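(* Let $\pi:E\to B$ be a $U(1)$-principal bundle in orbispaces and let $f:G\to E$ be a topological gerbe with band $U(1)$ and Dixmier-Douady class $d\in H^3(E;\mathbb Z)$. Let $h:LB\to U(1)^\delta$ be the function associated to the principal bundle $E\to B$, let $LB_1:=h^{-1}(1)\subseteq LB$, and let $g:LB_1\to U(1)^\delta$ be the function given by the holonomy of the $U(1)^\delta$-principal bundle $\tilde G^\delta\to LE$ along the fibres of the induced $U(1)$-principal bundle $L\pi:LE\to LB_1$. Let $\pi_!:H^3(E;\mathbb Z)\to H^2(B;\mathbb Z)$ be the integration map and $\overline{\pi_!(d)}:LB\to U(1)^\delta$ the function associated to the class $\pi_!(d)\in H^2(B;\mathbb Z)$. Then $$g=\overline{\pi_!(d)}_{|LB_1}.$$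
   Context: **Stacks.** A stack in topological spaces is a stack of groupoids on the site of topological spaces with open coverings; spaces are stacks via Yoneda and fibre products are $2$-categorical. An atlas of a stack $X$ is a representable, surjective map $A\to X$ from a space which admits local sections; $X$ is a topological stack if it has an atlas. A topological groupoid $A^1\rightrightarrows A^0$ (source $s$, range $r$) is separated if its identity map $A^0\to A^1$ is a closed map; proper if $(s,r):A^1\to A^0\times A^0$ is proper; étale if $s,r$ are étale; a proper étale groupoid is very proper if there is a continuous $\chi:A^0\to[0,1]$ with $r:\mathrm{supp}(s^*\chi)\to A^0$ proper and $\sum_{y\in r^{-1}(x)}\chi(s(y))=1$ for all $x\in A^0$. An orbispace is a topological stack having an atlas $A\to X$ (an orbispace atlas) such that $A\times_XA\rightrightarrows A$ is very proper, étale and separated. Its cohomology is $H^*(X;\mathbb Z):=H^*(|A^\cdot|;\mathbb Z)$, where $|A^\cdot|$ is the realization of the simplicial space $A^n=A\times_X\cdots\times_XA$ ($n+1$ factors). **Loop stack.** $LX$ has as objects over $T$ the pairs $(u,\phi)$, $u\in X(T)$, $\phi\in\mathrm{Aut}(u)$, and as morphisms $(u,\phi)\to(u',\phi')$ the morphisms $k:u\to u'$ with $\phi'k=k\phi$. Loops of an orbispace form an orbispace. **Principal bundles and $h$.** $\mathcal BU(1)=[*/U(1)]$. A $U(1)$-principal bundle over $B$ is a map $p:B\to\mathcal BU(1)$, with underlying map $E=B\times_{\mathcal BU(1)}*\to B$. Given $(u,\phi)\in LB(T)$, $p(\phi)$ is an automorphism of the principal $U(1)$-bundle $p(u)$ on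 $T$, hence multiplication by a function $T\to U(1)$; this defines $h:LB\to U(1)$. As $B$ is an orbispace, $h$ factors over the discrete group $U(1)^\delta$. The map $L\pi:LE\to LB$ factors over $LB_1=h^{-1}(1)$, and $LE\to LB_1$ is a $U(1)$-principal bundle. **Gerbes and $\tilde G^\delta$.** A topological gerbe with band $U(1)$ over $E$ is a map of topological stacks $G\to E$ such that objects of $E$ locally lift to $G$, two lifts are locally isomorphic, and automorphisms in $G$ over the identity in $E$ of an object over $T$ are canonically identified with $C(T,U(1))$; for an atlas $A\to E$ lifting to an atlas $A\to G$, the groupoid $\mathcal G^1=A\times_GA\rightrightarrows A$ is a $U(1)$-central extension of $\mathcal E^1=A\times_EA\rightrightarrows A$. Such gerbes are classified by the Dixmier-Douady class in $H^3(E;\mathbb Z)$. Let $(L\mathcal E)^0\subseteq\mathcal E^1$ be the space of morphisms with equal source and range; with the conjugation action of $\mathcal E^1$ it presents $LE$. The restriction of the $U(1)$-bundle $\mathcal G^1\to\mathcal E^1$ to $(L\mathcal E)^0$ carries an $\mathcal E^1$-action by conjugation with arbitrary lifts in $\mathcal G^1$ and descends to a $U(1)$-principal bundle $\tilde G\to LE$, which is a group over $E$ and a central extension of $LE$ by $E\times U(1)$. It has a natural reduction $\tilde G^\delta\to LE$ to $U(1)^\delta$: local sections $t$ of $(L\mathcal E)^0$ (for an orbispace atlas) satisfy locally $t^n=1$ for some $n\ge1$, and a local lift $\sigma$ of $t$ belongs to $\tilde G^\delta$ iff locally $\sigma^n$ is a constant $U(1)$-translate of the identity section. **The function $g$.**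 Let $T$ be a space and $T\to LB_1$ a map; let $S:=T\times_{LB_1}LE\to T$ (a $U(1)$-bundle) and $W:=S\times_{LE}\tilde G^\delta\to S$ (a $U(1)^\delta$-bundle). For a sufficiently fine open covering $(T_\alpha)$ of $T$ choose sections $s_\alpha:T_\alpha\to S$ and lifts $w_\alpha:T_\alpha\times\mathbb R\to W$ of the maps $T_\alpha\times\mathbb R\to S$, $(t,x)\mapsto s_\alpha(t)x$, where $\mathbb R$ acts through the covering $\mathbb R\to\mathbb R/\mathbb Z\cong U(1)$. Then $g$ on $T_\alpha$ is defined by $w_\alpha(t,0)=w_\alpha(t,1)g_{T_\alpha}(t)$. This is independent of choices, and functoriality in $T$ gives $g:LB_1\to U(1)^\delta$. **The function $\bar\chi$.** For a finite group $\Gamma$, the Bockstein boundary for $0\to\mathbb Z\to\mathbb R^\delta\to U(1)^\delta\to0$ gives $\hat\Gamma:=\mathrm{Hom}(\Gamma,U(1))=H^1(\Gamma;U(1)^\delta)\cong H^2(\Gamma;\mathbb Z)\cong H^2([*/\Gamma];\mathbb Z)$; a character $\chi\in\hat\Gamma$ defines $\bar\chi:L[*/\Gamma]\cong[\Gamma/\Gamma]\to U(1)^\delta$, $\gamma\mapsto\chi(\gamma)$. For an orbispace $B$ and $\chi\in H^2(B;\mathbb Z)$, the function $\bar\chi:LB\to U(1)^\delta$ is defined at a point $u:*\to LB$, given by a point $p_u$ of $B$ and $\gamma_u\in\mathrm{Aut}(p_u)$, as $\bar\chi(u):=\overline{\tilde u^*\chi}(\gamma_u)$, where $\Gamma_u$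 is the finite cyclic group generated by $\gamma_u$ and $\tilde u:[*/\Gamma_u]\to B$ the induced map. **Integration.** $\pi_!$ is integration over the fibres of the oriented fibre bundle $\pi$ with fibre $U(1)$. *)

theory Defs
  imports "HOL-Analysis.Analysis" "HOL-Homology.Homology" "HOL-Algebra.Generated_Groups" "HOL-Library.Equipollence"
begin

section \<open>Stacks on the site of topological spaces\<close>

text \<open>
  The site consists of all topologies on subsets of one type \<open>'u\<close>, with open coverings.  The main
  statement assumes that \<open>'u\<close> has at least the cardinality of the reals, so that, up to
  homeomorphism, this class of spaces is closed under finite products, under products with the real
  line and with \<open>U(1)\<close>, under subspaces, and under disjoint unions indexed by \<open>'u\<close>.

  A stack is presented by its total category \<open>X\<close> over spaces.  By the Yoneda lemma a map from a space
  \<open>T\<close> to \<open>X\<close> is an object of \<open>X\<close> over \<open>T\<close>, and this is how such maps are represented throughout.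
  Functions that are components of arrows are normalised to be extensional.
\<close>

record ('o, 'm, 'u) fibcat =
  Ob :: "'o set"
  Ar :: "'m set"
  src :: "'m \<Rightarrow> 'o"
  tgt :: "'m \<Rightarrow> 'o"
  ident :: "'o \<Rightarrow> 'm"
  cmp :: "'m \<Rightarrow> 'm \<Rightarrow> 'm"  \<comment> \<open>\<open>cmp X n m\<close> is \<open>n\<close> after \<open>m\<close>\<close>
  base :: "'o \<Rightarrow> 'u topology"
  bmap :: "'m \<Rightarrow> 'u \<Rightarrow> 'u"

definition arr :: "('o, 'm, 'u) fibcat \<Rightarrow> 'o \<Rightarrow> 'o \<Rightarrow> 'm set" where
  "arr X u v = {m \<in> Ar X. src X m = u \<and> tgt X m = v}"

definition category_over_spaces :: "('o, 'm, 'u) fibcat \<Rightarrow> bool" where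
  "category_over_spaces X \<longleftrightarrow>
     (\<forall>m\<in>Ar X. src X m \<in> Ob X \<and> tgt X m \<in> Ob X \<and>
        continuous_map (base X (src X m)) (base X (tgt X m)) (bmap X m) \<and>
        bmap X m \<in> extensional (topspace (base X (src X m)))) \<and>
     (\<forall>u\<in>Ob X. ident X u \<in> arr X u u \<and>
        (\<forall>x\<in>topspace (base X u). bmap X (ident X u) x = x)) \<and>
     (\<forall>u v w. \<forall>m\<in>arr X u v. \<forall>n\<in>arr X v w. cmp X n m \<in> arr X u w \<and>
        (\<forall>x\<in>topspace (base X u). bmap X (cmp X n m) x = bmap X n (bmap X m x))) \<and>
     (\<forall>u v. \<forall>m\<in>arr X u v. cmp X m (ident X u) = m \<and> cmp X (ident X v) m = m) \<and>
     (\<forall>u v w z. \<forall>m\<in>arr X u v. \<forall>n\<in>arr X v w. \<forall>k\<in>arr X w z.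
        cmp X k (cmp X n m) = cmp X (cmp X k n) m)"

definition fibred_in_groupoids :: "('o, 'm, 'u) fibcat \<Rightarrow> bool" where
  "fibred_in_groupoids X \<longleftrightarrow> category_over_spaces X \<and>
     (\<forall>v\<in>Ob X. \<forall>S f. continuous_map S (base X v) f \<longrightarrow>
        (\<exists>m\<in>Ar X. tgt X m = v \<and> base X (src X m) = S \<and> (\<forall>x\<in>topspace S. bmap X m x = f x))) \<and>
     (\<forall>m\<in>Ar X. \<forall>n\<in>Ar X. \<forall>f. tgt X m = tgt X n \<longrightarrow>
        continuous_map (base X (src X n)) (base X (src X m)) f \<longrightarrow>
        (\<forall>x\<in>topspace (base X (src X n)). bmap X m (f x) = bmap X n x) \<longrightarrow>
        (\<exists>!k. k \<in> arr X (src X n) (src X m) \<and>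
           (\<forall>x\<in>topspace (base X (src X n)). bmap X k x = f x) \<and> cmp X m k = n))"

definition open_cover :: "'u topology \<Rightarrow> 'u set set \<Rightarrow> bool" where
  "open_cover T C \<longleftrightarrow> (\<forall>U\<in>C. openin T U) \<and> \<Union>C = topspace T"

text \<open>\<open>m\<close> exhibits its source as a restriction of the object \<open>v\<close> to the subset \<open>U\<close> of its base.\<close>

definition restriction_arrow :: "('o, 'm, 'u) fibcat \<Rightarrow> 'm \<Rightarrow> 'u set \<Rightarrow> 'o \<Rightarrow> bool" where
  "restriction_arrow X m U v \<longleftrightarrow> m \<in> Ar X \<and> tgt X m = v \<and>
     base X (src X m) = subtopology (base X v) U \<and> (\<forall>x\<in>topspace (base X (src X m)). bmap X m x = x)"

text \<open>
  Descent for morphisms: isomorphisms from \<open>u\<close> to \<open>v\<close> over the identity form a sheaf.  A local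
  isomorphism over \<open>U\<close> is written as an arrow \<open>k U\<close> into \<open>v\<close> over the inclusion of \<open>U\<close>, starting at
  the restriction of \<open>u\<close> given by \<open>r U\<close>.
\<close>

definition arrows_glue :: "('o, 'm, 'u) fibcat \<Rightarrow> bool" where
  "arrows_glue X \<longleftrightarrow> (\<forall>u\<in>Ob X. \<forall>v\<in>Ob X. \<forall>C r k. base X u = base X v \<longrightarrow>
     open_cover (base X u) C \<longrightarrow>
     (\<forall>U\<in>C. restriction_arrow X (r U) U u \<and> restriction_arrow X (k U) U v \<and>
        src X (r U) = src X (k U)) \<longrightarrow>
     (\<forall>U\<in>C. \<forall>V\<in>C. \<forall>a\<in>Ar X. \<forall>b\<in>Ar X. src X a = src X b \<longrightarrow>
        tgt X a = src X (r U) \<longrightarrow> tgt X b = src X (r V) \<longrightarrow> cmp X (r U) a = cmp X (r V) b \<longrightarrow>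
        cmp X (k U) a = cmp X (k V) b) \<longrightarrow>
     (\<exists>!m. m \<in> arr X u v \<and> (\<forall>x\<in>topspace (base X u). bmap X m x = x) \<and>
        (\<forall>U\<in>C. cmp X m (r U) = k U)))"

text \<open>
  Descent for objects: the gluing isomorphism from \<open>obj U\<close> to \<open>obj V\<close> over the intersection of \<open>U\<close>
  and \<open>V\<close> is given as a pair of restriction arrows \<open>p U V\<close>, \<open>q U V\<close> with a common source.
\<close>

definition objects_glue :: "('o, 'm, 'u) fibcat \<Rightarrow> bool" where
  "objects_glue X \<longleftrightarrow> (\<forall>T C obj p q. open_cover T C \<longrightarrow>
     (\<forall>U\<in>C. obj U \<in> Ob X \<and> base X (obj U) = subtopology T U) \<longrightarrow>
     (\<forall>U\<in>C. \<forall>V\<in>C. restriction_arrow X (p U V) V (obj U) \<and> restriction_arrow X (q U V) U (obj V) \<and>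
        src X (p U V) = src X (q U V)) \<longrightarrow>
     (\<forall>U\<in>C. \<forall>V\<in>C. \<forall>W\<in>C. \<forall>a\<in>Ar X. \<forall>b\<in>Ar X. \<forall>c\<in>Ar X.
        src X a = src X b \<longrightarrow> src X b = src X c \<longrightarrow>
        tgt X a = src X (p U V) \<longrightarrow> tgt X b = src X (p V W) \<longrightarrow> tgt X c = src X (p U W) \<longrightarrow>
        cmp X (q U V) a = cmp X (p V W) b \<longrightarrow> cmp X (p U V) a = cmp X (p U W) c \<longrightarrow>
        cmp X (q V W) b = cmp X (q U W) c) \<longrightarrow>
     (\<exists>u\<in>Ob X. base X u = T \<and> (\<exists>m.
        (\<forall>U\<in>C. restriction_arrow X (m U) U u \<and> src X (m U) = obj U) \<and>
        (\<forall>U\<in>C. \<forall>V\<in>C. cmp X (m U) (p U V) = cmp X (m V) (q U V)))))"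

definition stack :: "('o, 'm, 'u) fibcat \<Rightarrow> bool" where
  "stack X \<longleftrightarrow> fibred_in_groupoids X \<and> arrows_glue X \<and> objects_glue X"

record ('o, 'm, 'p, 'n) smap =
  onob :: "'o \<Rightarrow> 'p"
  onar :: "'m \<Rightarrow> 'n"

definition stack_map ::
  "('o, 'm, 'u) fibcat \<Rightarrow> ('p, 'n, 'u) fibcat \<Rightarrow> ('o, 'm, 'p, 'n) smap \<Rightarrow> bool" where
  "stack_map X Y F \<longleftrightarrow>
     (\<forall>u\<in>Ob X. onob F u \<in> Ob Y \<and> base Y (onob F u) = base X u \<and>
        onar F (ident X u) = ident Y (onob F u)) \<and>
     (\<forall>u v. \<forall>m\<in>arr X u v. onar F m \<in> arr Y (onob F u) (onob F v) \<and>
        (\<forall>x\<in>topspace (base X u). bmap Y (onar F m) x = bmap X m x)) \<and>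
     (\<forall>u v w. \<forall>m\<in>arr X u v. \<forall>n\<in>arr X v w. onar F (cmp X n m) = cmp Y (onar F n) (onar F m))"

text \<open>Automorphisms of \<open>u\<close> in the fibre over its base.\<close>

definition autos :: "('o, 'm, 'u) fibcat \<Rightarrow> 'o \<Rightarrow> 'm set" where
  "autos X u = {k \<in> arr X u u. \<forall>x\<in>topspace (base X u). bmap X k x = x}"

definition aut_group :: "('o, 'm, 'u) fibcat \<Rightarrow> 'o \<Rightarrow> 'm monoid" where
  "aut_group X u = \<lparr>carrier = autos X u, monoid.mult = cmp X, one = ident X u\<rparr>"


section \<open>Atlases and orbispaces\<close>

text \<open>
  Let \<open>u\<close> and \<open>a\<close> be objects over \<open>T\<close> and \<open>A\<close>.  Maps from a space \<open>S\<close> to the 2-categorical fibre product of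
  \<open>T\<close> and \<open>A\<close> over \<open>X\<close> are, up to unique isomorphism, pairs of arrows from one object over \<open>S\<close> to \<open>u\<close>
  and to \<open>a\<close>.  Hence this fibre product is representable by a space iff \<open>u\<close> and \<open>a\<close> have a product
  in the total category, and it is then the base of that product.
\<close>

definition is_product ::
  "('o, 'm, 'u) fibcat \<Rightarrow> 'o \<Rightarrow> 'o \<Rightarrow> 'o \<Rightarrow> 'm \<Rightarrow> 'm \<Rightarrow> bool" where
  "is_product X u a w m n \<longleftrightarrow> w \<in> Ob X \<and> m \<in> arr X w u \<and> n \<in> arr X w a \<and>
     (\<forall>x\<in>Ob X. \<forall>k\<in>arr X x u. \<forall>l\<in>arr X x a. \<exists>!j. j \<in> arr X x w \<and> cmp X m j = k \<and> cmp X n j = l)"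

definition atlas :: "('o, 'm, 'u) fibcat \<Rightarrow> 'o \<Rightarrow> bool" where
  "atlas X a \<longleftrightarrow> a \<in> Ob X \<and> (\<forall>u\<in>Ob X. \<exists>w m n. is_product X u a w m n \<and>
     bmap X m ` topspace (base X w) = topspace (base X u) \<and>
     (\<forall>t\<in>topspace (base X u). \<exists>U s. openin (base X u) U \<and> t \<in> U \<and>
        continuous_map (subtopology (base X u) U) (base X w) s \<and> (\<forall>x\<in>U. bmap X m (s x) = x)))"

definition topological_stack :: "('o, 'm, 'u) fibcat \<Rightarrow> bool" where
  "topological_stack X \<longleftrightarrow> stack X \<and> (\<exists>a. atlas X a)"

text \<open>
  The \<open>(n+1)\<close>-fold fibre product of an atlas \<open>a\<close> with itself over \<open>X\<close> is the base of the product of \<open>n + 1\<close> copies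
  of \<open>a\<close> in the total category.
\<close>

definition is_power :: "('o, 'm, 'u) fibcat \<Rightarrow> 'o \<Rightarrow> nat \<Rightarrow> 'o \<Rightarrow> (nat \<Rightarrow> 'm) \<Rightarrow> bool" where
  "is_power X a n w p \<longleftrightarrow> w \<in> Ob X \<and> (\<forall>i\<le>n. p i \<in> arr X w a) \<and>
     (\<forall>x\<in>Ob X. \<forall>k. (\<forall>i\<le>n. k i \<in> arr X x a) \<longrightarrow>
        (\<exists>!j. j \<in> arr X x w \<and> (\<forall>i\<le>n. cmp X (p i) j = k i)))"

definition pow :: "('o, 'm, 'u) fibcat \<Rightarrow> 'o \<Rightarrow> nat \<Rightarrow> 'o" where
  "pow X a n = fst (SOME (w, p). is_power X a n w p)"

definition prj :: "('o, 'm, 'u) fibcat \<Rightarrow> 'o \<Rightarrow> nat \<Rightarrow> nat \<Rightarrow> 'm" where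
  "prj X a n = snd (SOME (w, p). is_power X a n w p)"

definition tuple :: "('o, 'm, 'u) fibcat \<Rightarrow> 'o \<Rightarrow> nat \<Rightarrow> 'o \<Rightarrow> (nat \<Rightarrow> 'm) \<Rightarrow> 'm" where
  "tuple X a n x k = (THE j. j \<in> arr X x (pow X a n) \<and> (\<forall>i\<le>n. cmp X (prj X a n i) j = k i))"

definition nerve :: "('o, 'm, 'u) fibcat \<Rightarrow> 'o \<Rightarrow> nat \<Rightarrow> 'u topology" where
  "nerve X a n = base X (pow X a n)"

definition source_map :: "('o, 'm, 'u) fibcat \<Rightarrow> 'o \<Rightarrow> 'u \<Rightarrow> 'u" where
  "source_map X a = bmap X (prj X a 1 0)"

definition range_map :: "('o, 'm, 'u) fibcat \<Rightarrow> 'o \<Rightarrow> 'u \<Rightarrow> 'u" where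
  "range_map X a = bmap X (prj X a 1 1)"

definition identity_map :: "('o, 'm, 'u) fibcat \<Rightarrow> 'o \<Rightarrow> 'u \<Rightarrow> 'u" where
  "identity_map X a = bmap X (tuple X a 1 a (\<lambda>i. ident X a))"

definition etale_map :: "'a topology \<Rightarrow> 'b topology \<Rightarrow> ('a \<Rightarrow> 'b) \<Rightarrow> bool" where
  "etale_map S T f \<longleftrightarrow> (\<forall>x\<in>topspace S. \<exists>U. openin S U \<and> x \<in> U \<and> openin T (f ` U) \<and>
     homeomorphic_map (subtopology S U) (subtopology T (f ` U)) f)"

definition etale_separated_atlas :: "('o, 'm, 'u) fibcat \<Rightarrow> 'o \<Rightarrow> bool" where
  "etale_separated_atlas X a \<longleftrightarrow> atlas X a \<and>
     etale_map (nerve X a 1) (base X a) (source_map X a) \<and>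
     etale_map (nerve X a 1) (base X a) (range_map X a) \<and>
     closed_map (base X a) (nerve X a 1) (identity_map X a)"

definition orbispace_atlas :: "('o, 'm, 'u) fibcat \<Rightarrow> 'o \<Rightarrow> bool" where
  "orbispace_atlas X a \<longleftrightarrow> etale_separated_atlas X a \<and>
     proper_map (nerve X a 1) (prod_topology (base X a) (base X a))
       (\<lambda>y. (source_map X a y, range_map X a y)) \<and>
     (\<exists>chi. continuous_map (base X a) (top_of_set {0..1::real}) chi \<and>
        proper_map
          (subtopology (nerve X a 1)
             (nerve X a 1 closure_of {y \<in> topspace (nerve X a 1). chi (source_map X a y) \<noteq> 0}))
          (base X a) (range_map X a) \<and>
        (\<forall>x\<in>topspace (base X a).
           ((\<lambda>y. chi (source_map X a y)) has_sum 1)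
             {y \<in> topspace (nerve X a 1). range_map X a y = x}))"

definition orbispace :: "('o, 'm, 'u) fibcat \<Rightarrow> bool" where
  "orbispace X \<longleftrightarrow> topological_stack X \<and> (\<exists>a. orbispace_atlas X a)"


section \<open>Realization of the simplicial space of an atlas\<close>

definition simplex_space :: "nat \<Rightarrow> (nat \<Rightarrow> real) topology" where
  "simplex_space n = subtopology (powertop_real UNIV) (standard_simplex n)"

definition simplex_push :: "nat \<Rightarrow> (nat \<Rightarrow> nat) \<Rightarrow> (nat \<Rightarrow> real) \<Rightarrow> (nat \<Rightarrow> real)" where
  "simplex_push m \<theta> t = (\<lambda>j. \<Sum>i | i \<le> m \<and> \<theta> i = j. t i)"

type_synonym 'u rpoint = "(nat \<times> 'u \<times> (nat \<Rightarrow> real)) set"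

definition prerealization ::
    "('o, 'm, 'u) fibcat \<Rightarrow> 'o \<Rightarrow> (nat \<times> 'u \<times> (nat \<Rightarrow> real)) topology" where
  "prerealization X a = sum_topology (\<lambda>n. prod_topology (nerve X a n) (simplex_space n)) UNIV"

definition realization_rel ::
  "('o, 'm, 'u) fibcat \<Rightarrow> 'o \<Rightarrow> ((nat \<times> 'u \<times> (nat \<Rightarrow> real)) \<times> (nat \<times> 'u \<times> (nat \<Rightarrow> real))) set" where
  "realization_rel X a =
     {((n, x, simplex_push m \<theta> t),
       (m, bmap X (tuple X a m (pow X a n) (\<lambda>i. prj X a n (\<theta> i))) x, t)) | m n \<theta> x t.
       mono_on {..m} \<theta> \<and> \<theta> ` {..m} \<subseteq> {..n} \<and> x \<in> topspace (nerve X a n) \<and> t \<in> standard_simplex m}"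

definition rpt :: "('o, 'm, 'u) fibcat \<Rightarrow> 'o \<Rightarrow> nat \<Rightarrow> 'u \<Rightarrow> (nat \<Rightarrow> real) \<Rightarrow> 'u rpoint" where
  "rpt X a n x t = {y. ((n, x, t), y) \<in> (realization_rel X a \<union> (realization_rel X a)\<inverse>)\<^sup>*}"

definition quotient_topology :: "'a topology \<Rightarrow> ('a \<Rightarrow> 'b) \<Rightarrow> 'b topology" where
  "quotient_topology S f =
     topology (\<lambda>W. W \<subseteq> f ` topspace S \<and> openin S {x \<in> topspace S. f x \<in> W})"

lemma quotient_map_quotient_topology: "quotient_map S (quotient_topology S f) f"
proof -
  let ?L = "\<lambda>W. W \<subseteq> f ` topspace S \<and> openin S {x \<in> topspace S. f x \<in> W}"
  have "istopology ?L"
    unfolding istopology_def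
  proof (intro conjI allI impI)
    fix V W assume "?L V" "?L W"
    moreover have "{x \<in> topspace S. f x \<in> V \<inter> W}
        = {x \<in> topspace S. f x \<in> V} \<inter> {x \<in> topspace S. f x \<in> W}" by auto
    ultimately show "V \<inter> W \<subseteq> f ` topspace S" "openin S {x \<in> topspace S. f x \<in> V \<inter> W}"
      by auto
  next
    fix K assume K: "\<forall>W\<in>K. ?L W"
    have "{x \<in> topspace S. f x \<in> \<Union>K} = (\<Union>W\<in>K. {x \<in> topspace S. f x \<in> W})" by auto
    then show "\<Union>K \<subseteq> f ` topspace S" "openin S {x \<in> topspace S. f x \<in> \<Union>K}"
      using K by auto
  qed
  then have op: "openin (quotient_topology S f) = ?L"
    by (simp add: quotient_topology_def topology_inverse')
  have "{x \<in> topspace S. f x \<in> f ` topspace S} = topspace S" by auto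
  then have "openin (quotient_topology S f) (f ` topspace S)"
    unfolding op by simp
  then have "topspace (quotient_topology S f) = f ` topspace S"
    by (metis (mono_tags, lifting) op openin_subset openin_topspace subset_antisym)
  then show ?thesis
    by (auto simp: quotient_map_def op)
qed

definition realization :: "('o, 'm, 'u) fibcat \<Rightarrow> 'o \<Rightarrow> 'u rpoint topology" where
  "realization X a = quotient_topology (prerealization X a) (\<lambda>(n, x, t). rpt X a n x t)"

text \<open>The map of realizations induced by a stack map \<open>F\<close> and an arrow \<open>k\<close> from \<open>F a\<close> to \<open>b\<close>.\<close>

definition realization_map ::
  "('o, 'm, 'u) fibcat \<Rightarrow> 'o \<Rightarrow> ('p, 'n, 'u) fibcat \<Rightarrow> 'p \<Rightarrow> ('o, 'm, 'p, 'n) smap \<Rightarrow> 'n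
     \<Rightarrow> 'u rpoint \<Rightarrow> 'u rpoint" where
  "realization_map X a Y b F k \<xi> = (case (SOME y. y \<in> \<xi>) of (n, x, t) \<Rightarrow>
     rpt Y b n
       (bmap Y (tuple Y b n (onob F (pow X a n)) (\<lambda>i. cmp Y k (onar F (prj X a n i)))) x) t)"

text \<open>The vertex given by a point \<open>x\<close> of the base of \<open>a\<close>, and the edge given by an automorphism of \<open>a\<close>.\<close>

definition vertex :: "('o, 'm, 'u) fibcat \<Rightarrow> 'o \<Rightarrow> 'u \<Rightarrow> 'u rpoint" where
  "vertex X a x = rpt X a 0 (bmap X (tuple X a 0 a (\<lambda>i. ident X a)) x) (\<lambda>i. if i = 0 then 1 else 0)"

definition edge_point ::
    "('o, 'm, 'u) fibcat \<Rightarrow> 'o \<Rightarrow> 'm \<Rightarrow> 'u \<Rightarrow> real \<Rightarrow> real \<Rightarrow> 'u rpoint" where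
  "edge_point X a \<gamma> x r s =
     rpt X a 1 (bmap X (tuple X a 1 a (\<lambda>i. if i = 0 then ident X a else \<gamma>)) x)
       (\<lambda>i. if i = 0 then r else if i = 1 then s else 0)"


section \<open>Singular cohomology\<close>

text \<open>
  A cochain is given by its values on singular simplices; values on functions that are not singular
  simplices are irrelevant.  A cohomology class is the set of its representing cocycles.
\<close>

type_synonym ('a, 'r) cochain = "((nat \<Rightarrow> real) \<Rightarrow> 'a) \<Rightarrow> 'r"

definition coboundary :: "nat \<Rightarrow> ('a, 'r::comm_ring_1) cochain \<Rightarrow> ('a, 'r) cochain" where
  "coboundary n c \<sigma> = (\<Sum>k\<le>Suc n. (-1) ^ k * c (singular_face (Suc n) k \<sigma>))"

definition cocycle :: "nat \<Rightarrow> 'a topology \<Rightarrow> ('a, 'r::comm_ring_1) cochain \<Rightarrow> bool" where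
  "cocycle n S c \<longleftrightarrow> (\<forall>\<sigma>. singular_simplex (Suc n) S \<sigma> \<longrightarrow> coboundary n c \<sigma> = 0)"

definition cohomologous ::
    "nat \<Rightarrow> 'a topology \<Rightarrow> ('a, 'r::comm_ring_1) cochain \<Rightarrow> ('a, 'r) cochain \<Rightarrow> bool" where
  "cohomologous n S c c' \<longleftrightarrow>
     (if n = 0 then \<forall>\<sigma>. singular_simplex 0 S \<sigma> \<longrightarrow> c \<sigma> = c' \<sigma>
      else \<exists>l. \<forall>\<sigma>. singular_simplex n S \<sigma> \<longrightarrow> c \<sigma> - c' \<sigma> = coboundary (n - 1) l \<sigma>)"

definition cohomology :: "nat \<Rightarrow> 'a topology \<Rightarrow> ('a, int) cochain set set" where
  "cohomology n S = {{c'. cocycle n S c' \<and> cohomologous n S c' c} | c. cocycle n S c}"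

definition cochain_pullback ::
    "nat \<Rightarrow> ('a \<Rightarrow> 'b) \<Rightarrow> ('b, 'r::comm_ring_1) cochain \<Rightarrow> ('a, 'r) cochain" where
  "cochain_pullback n f c \<sigma> = c (simplex_map n f \<sigma>)"

definition cohomology_pullback ::
    "nat \<Rightarrow> 'a topology \<Rightarrow> ('a \<Rightarrow> 'b) \<Rightarrow> ('b, int) cochain set \<Rightarrow> ('a, int) cochain set" where
  "cohomology_pullback n S f K =
     {c. cocycle n S c \<and> (\<exists>\<kappa>\<in>K. cohomologous n S c (cochain_pullback n f \<kappa>))}"

text \<open>The cup product of a \<open>p\<close>-cochain with a \<open>q\<close>-cochain (front face times back face).\<close>

definition cup ::
    "nat \<Rightarrow> nat \<Rightarrow> ('a, 'r::comm_ring_1) cochain \<Rightarrow> ('a, 'r) cochain \<Rightarrow> ('a, 'r) cochain" where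
  "cup p q c c' \<sigma> = c (restrict \<sigma> (standard_simplex p)) *
     c' (restrict (\<lambda>t. \<sigma> (\<lambda>i. if i < p then 0 else t (i - p))) (standard_simplex q))"

definition constant_simplex :: "nat \<Rightarrow> 'a \<Rightarrow> (nat \<Rightarrow> real) \<Rightarrow> 'a" where
  "constant_simplex n x = restrict (\<lambda>t. x) (standard_simplex n)"


section \<open>Principal bundles and classifying stacks\<close>

definition U1 :: "complex monoid" where
  "U1 = \<lparr>carrier = sphere 0 1, monoid.mult = (*), one = 1\<rparr>"

definition U1_space :: "complex topology" where
  "U1_space = top_of_set (sphere 0 1)"

record ('u, 'g) pbundle =
  bbase :: "'u topology"
  tot :: "'u topology"
  proj :: "'u \<Rightarrow> 'u"
  act :: "'u \<Rightarrow> 'g \<Rightarrow> 'u"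

definition principal_bundle :: "'g monoid \<Rightarrow> 'g topology \<Rightarrow> ('u, 'g) pbundle \<Rightarrow> bool" where
  "principal_bundle H Ht P \<longleftrightarrow>
     continuous_map (tot P) (bbase P) (proj P) \<and>
     (\<forall>y\<in>topspace (tot P). act P y \<one>\<^bsub>H\<^esub> = y \<and>
        (\<forall>g\<in>carrier H. act P y g \<in> topspace (tot P) \<and> proj P (act P y g) = proj P y \<and>
           (\<forall>h\<in>carrier H. act P (act P y g) h = act P y (g \<otimes>\<^bsub>H\<^esub> h)))) \<and>
     (\<forall>t\<in>topspace (bbase P). \<exists>U s. openin (bbase P) U \<and> t \<in> U \<and>
        (\<forall>x\<in>U. s x \<in> topspace (tot P) \<and> proj P (s x) = x) \<and>
        homeomorphic_map (prod_topology (subtopology (bbase P) U) Ht)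
          (subtopology (tot P) {y \<in> topspace (tot P). proj P y \<in> U}) (\<lambda>(x, g). act P (s x) g))"

record ('u, 'g) bundle_arrow =
  bsrc :: "('u, 'g) pbundle"
  btgt :: "('u, 'g) pbundle"
  bfun :: "'u \<Rightarrow> 'u"
  tfun :: "'u \<Rightarrow> 'u"

definition bundle_arrows :: "'g monoid \<Rightarrow> 'g topology \<Rightarrow> ('u, 'g) bundle_arrow set" where
  "bundle_arrows H Ht = {m. principal_bundle H Ht (bsrc m) \<and> principal_bundle H Ht (btgt m) \<and>
     continuous_map (bbase (bsrc m)) (bbase (btgt m)) (bfun m) \<and>
     bfun m \<in> extensional (topspace (bbase (bsrc m))) \<and>
     continuous_map (tot (bsrc m)) (tot (btgt m)) (tfun m) \<and>
     tfun m \<in> extensional (topspace (tot (bsrc m))) \<and>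
     (\<forall>y\<in>topspace (tot (bsrc m)). proj (btgt m) (tfun m y) = bfun m (proj (bsrc m) y) \<and>
        (\<forall>g\<in>carrier H. tfun m (act (bsrc m) y g) = act (btgt m) (tfun m y) g))}"

text \<open>The stack \<open>[*/H]\<close> of principal \<open>H\<close>-bundles, for a topological group \<open>H\<close> with topology \<open>Ht\<close>.\<close>

definition classifying_stack ::
  "'g monoid \<Rightarrow> 'g topology \<Rightarrow> (('u, 'g) pbundle, ('u, 'g) bundle_arrow, 'u) fibcat" where
  "classifying_stack H Ht = \<lparr>
     Ob = {P. principal_bundle H Ht P},
     Ar = bundle_arrows H Ht,
     src = bsrc,
     tgt = btgt,
     ident = (\<lambda>P. \<lparr>bsrc = P, btgt = P, bfun = restrict id (topspace (bbase P)),
                   tfun = restrict id (topspace (tot P))\<rparr>),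
     cmp = (\<lambda>n m. \<lparr>bsrc = bsrc m, btgt = btgt n,
                   bfun = compose (topspace (bbase (bsrc m))) (bfun n) (bfun m),
                   tfun = compose (topspace (tot (bsrc m))) (tfun n) (tfun m)\<rparr>),
     base = bbase,
     bmap = bfun\<rparr>"

text \<open>
  The underlying map \<open>E \<rightarrow> B\<close> of a \<open>U(1)\<close>-bundle \<open>p : B \<rightarrow> [*/U(1)]\<close>, where \<open>E\<close> is the 2-categorical
  fibre product of \<open>B\<close> with the point over \<open>[*/U(1)]\<close>.  Its objects over \<open>T\<close> are objects \<open>b\<close> of \<open>B\<close> over \<open>T\<close> with an isomorphism from the
  trivial bundle to \<open>p b\<close>, written here as the corresponding section of \<open>p b\<close>.
\<close>

type_synonym ('o, 'm, 'u) ub_map =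
  "('o, 'm, ('u, complex) pbundle, ('u, complex) bundle_arrow) smap"

type_synonym ('o, 'u) eob = "'o \<times> ('u \<Rightarrow> 'u)"
type_synonym ('o, 'm, 'u) ear = "('o, 'u) eob \<times> 'm \<times> ('o, 'u) eob"

definition bundle_sections :: "('u, 'g) pbundle \<Rightarrow> ('u \<Rightarrow> 'u) set" where
  "bundle_sections P = {\<sigma>. continuous_map (bbase P) (tot P) \<sigma> \<and> \<sigma> \<in> extensional (topspace (bbase P)) \<and>
     (\<forall>x\<in>topspace (bbase P). proj P (\<sigma> x) = x)}"

definition total_stack ::
  "('o, 'm, 'u) fibcat \<Rightarrow> ('o, 'm, 'u) ub_map \<Rightarrow> (('o, 'u) eob, ('o, 'm, 'u) ear, 'u) fibcat" where
  "total_stack B p = \<lparr>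
     Ob = {(b, \<sigma>). b \<in> Ob B \<and> \<sigma> \<in> bundle_sections (onob p b)},
     Ar = {((b, \<sigma>), m, (b', \<sigma>')). m \<in> arr B b b' \<and>
             \<sigma> \<in> bundle_sections (onob p b) \<and> \<sigma>' \<in> bundle_sections (onob p b') \<and>
             (\<forall>x\<in>topspace (base B b). tfun (onar p m) (\<sigma> x) = \<sigma>' (bmap B m x))},
     src = fst,
     tgt = (\<lambda>(e, m, e'). e'),
     ident = (\<lambda>e. (e, ident B (fst e), e)),
     cmp = (\<lambda>(e', n, e'') (e, m, _). (e, cmp B n m, e'')),
     base = (\<lambda>e. base B (fst e)),
     bmap = (\<lambda>(e, m, e'). bmap B m)\<rparr>"

definition total_proj :: "(('o, 'u) eob, ('o, 'm, 'u) ear, 'o, 'm) smap" where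
  "total_proj = \<lparr>onob = fst, onar = (\<lambda>(e, m, e'). m)\<rparr>"


section \<open>The loop stack and the function \<open>h\<close>\<close>

definition loop_stack ::
  "('o, 'm, 'u) fibcat \<Rightarrow> ('o \<times> 'm, ('o \<times> 'm) \<times> 'm \<times> ('o \<times> 'm), 'u) fibcat" where
  "loop_stack X = \<lparr>
     Ob = {(u, \<phi>). u \<in> Ob X \<and> \<phi> \<in> autos X u},
     Ar = {((u, \<phi>), k, (u', \<phi>')). k \<in> arr X u u' \<and> \<phi> \<in> autos X u \<and> \<phi>' \<in> autos X u' \<and>
             cmp X \<phi>' k = cmp X k \<phi>},
     src = fst,
     tgt = (\<lambda>(w, k, w'). w'),
     ident = (\<lambda>w. (w, ident X (fst w), w)),
     cmp = (\<lambda>(w', l, w'') (w, k, _). (w, cmp X l k, w'')),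
     base = (\<lambda>w. base X (fst w)),
     bmap = (\<lambda>(w, k, w'). bmap X k)\<rparr>"

definition h_fun :: "('o, 'm, 'u) ub_map \<Rightarrow> 'o \<times> 'm \<Rightarrow> 'u \<Rightarrow> complex" where
  "h_fun p w t = (THE z. z \<in> carrier U1 \<and>
     (\<forall>y\<in>topspace (tot (onob p (fst w))). proj (onob p (fst w)) y = t \<longrightarrow>
        tfun (onar p (snd w)) y = act (onob p (fst w)) y z))"

definition loop_stack_1 ::
  "('o, 'm, 'u) fibcat \<Rightarrow> ('o, 'm, 'u) ub_map
     \<Rightarrow> ('o \<times> 'm, ('o \<times> 'm) \<times> 'm \<times> ('o \<times> 'm), 'u) fibcat" where
  "loop_stack_1 B p = (let W = {w \<in> Ob (loop_stack B). \<forall>t\<in>topspace (base B (fst w)). h_fun p w t = 1}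
     in (loop_stack B)\<lparr>Ob := W, Ar := {m \<in> Ar (loop_stack B). fst m \<in> W \<and> snd (snd m) \<in> W}\<rparr>)"


section \<open>Gerbes, and the bundle over the loop stack\<close>

text \<open>
  A topological gerbe \<open>f : G \<rightarrow> E\<close> with band \<open>U(1)\<close>; \<open>sc x c\<close> is the automorphism of \<open>x\<close> given by the
  \<open>U(1)\<close>-valued function \<open>c\<close>.
\<close>

definition U1_gerbe ::
  "('go, 'gm, 'u) fibcat \<Rightarrow> ('eo, 'em, 'u) fibcat \<Rightarrow> ('go, 'gm, 'eo, 'em) smap
     \<Rightarrow> ('go \<Rightarrow> ('u \<Rightarrow> complex) \<Rightarrow> 'gm) \<Rightarrow> bool" where
  "U1_gerbe G E f sc \<longleftrightarrow> topological_stack G \<and> topological_stack E \<and> stack_map G E f \<and>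
     (\<forall>e\<in>Ob E. \<forall>t\<in>topspace (base E e). \<exists>x\<in>Ob G. \<exists>k V. openin (base E e) V \<and> t \<in> V \<and>
        restriction_arrow E k V e \<and> src E k = onob f x) \<and>
     (\<forall>x\<in>Ob G. \<forall>x'\<in>Ob G. \<forall>k\<in>arr E (onob f x) (onob f x'). base G x = base G x' \<longrightarrow>
        (\<forall>t\<in>topspace (base G x). bmap E k t = t) \<longrightarrow>
        (\<forall>t\<in>topspace (base G x). \<exists>V r n. openin (base G x) V \<and> t \<in> V \<and>
           restriction_arrow G r V x \<and> n \<in> arr G (src G r) x' \<and> onar f n = cmp E k (onar f r))) \<and>
     (\<forall>x\<in>Ob G.
        (\<forall>c. continuous_map (base G x) U1_space c \<longrightarrow>
           sc x c \<in> autos G x \<and> onar f (sc x c) = ident E (onob f x)) \<and>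
        (\<forall>\<phi>\<in>autos G x. onar f \<phi> = ident E (onob f x) \<longrightarrow>
           (\<exists>c. continuous_map (base G x) U1_space c \<and> sc x c = \<phi>)) \<and>
        (\<forall>c c'. continuous_map (base G x) U1_space c \<longrightarrow> continuous_map (base G x) U1_space c' \<longrightarrow>
           (sc x c = sc x c' \<longleftrightarrow> (\<forall>t\<in>topspace (base G x). c t = c' t)) \<and>
           cmp G (sc x c) (sc x c') = sc x (\<lambda>t. c t * c' t))) \<and>
     (\<forall>x x'. \<forall>m\<in>arr G x' x. \<forall>c. continuous_map (base G x) U1_space c \<longrightarrow>
        cmp G (sc x c) m = cmp G m (sc x' (\<lambda>t. c (bmap G m t))))"

text \<open>
  A section, over the base of \<open>(e, \<psi>)\<close>, of the pullback along \<open>(e, \<psi>)\<close> of the \<open>U(1)\<close>-bundle over the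
  loop stack of \<open>E\<close> defined by the gerbe.  Whenever \<open>x\<close> is a lift to \<open>G\<close> of a pullback of \<open>e\<close>, the
  bundle is identified with the bundle of lifts of \<open>\<psi>\<close> to automorphisms of \<open>x\<close>, and these
  identifications are related by conjugation with arrows of \<open>G\<close>; so a section is a conjugation
  invariant family \<open>\<omega>\<close> of such lifts.
\<close>

definition gerbe_section ::
  "('go, 'gm, 'u) fibcat \<Rightarrow> ('eo, 'em, 'u) fibcat \<Rightarrow> ('go, 'gm, 'eo, 'em) smap
     \<Rightarrow> 'eo \<times> 'em \<Rightarrow> ('go \<Rightarrow> 'em \<Rightarrow> 'gm) \<Rightarrow> bool" where
  "gerbe_section G E f w \<omega> \<longleftrightarrow>
     (\<forall>x\<in>Ob G. \<forall>k\<in>arr E (onob f x) (fst w).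
        \<omega> x k \<in> autos G x \<and> cmp E k (onar f (\<omega> x k)) = cmp E (snd w) k \<and>
        (\<forall>x'. \<forall>m\<in>arr G x' x. cmp G (\<omega> x k) m = cmp G m (\<omega> x' (cmp E k (onar f m)))))"

text \<open>Sections of the reduction to the discrete group: locally some power is a constant multiple of the unit.\<close>

definition flat_section ::
  "('go, 'gm, 'u) fibcat \<Rightarrow> ('eo, 'em, 'u) fibcat \<Rightarrow> ('go, 'gm, 'eo, 'em) smap
     \<Rightarrow> ('go \<Rightarrow> ('u \<Rightarrow> complex) \<Rightarrow> 'gm) \<Rightarrow> 'eo \<times> 'em \<Rightarrow> ('go \<Rightarrow> 'em \<Rightarrow> 'gm) \<Rightarrow> bool" where
  "flat_section G E f sc w \<omega> \<longleftrightarrow> gerbe_section G E f w \<omega> \<and>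
     (\<forall>t\<in>topspace (base E (fst w)). \<exists>V n z. openin (base E (fst w)) V \<and> t \<in> V \<and> 1 \<le> n \<and>
        z \<in> carrier U1 \<and>
        (\<forall>x\<in>Ob G. \<forall>k\<in>arr E (onob f x) (fst w). bmap E k ` topspace (base G x) \<subseteq> V \<longrightarrow>
           ((cmp G (\<omega> x k)) ^^ n) (ident G x) = sc x (\<lambda>t. z)))"


section \<open>The holonomy function \<open>g\<close>\<close>

text \<open>
  Let \<open>w = (u, \<phi>)\<close> be an object of \<open>LB\<^sub>1\<close> over \<open>T\<close>.  The fibre product \<open>S\<close> of \<open>T\<close> with \<open>LE\<close> over \<open>LB\<^sub>1\<close> is
  the total space of the principal bundle \<open>p u\<close>, because \<open>p \<phi>\<close> is the identity.  Over an open set \<open>U\<close>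
  in \<open>T\<close> choose a section \<open>s\<close> of \<open>S\<close>.  The product \<open>U \<times> \<real>\<close> is realised by a space of the site, namely
  the base of an object \<open>v\<close>, through its projections \<open>bmap B m\<close> to \<open>U\<close> and \<open>\<rho>\<close> to the reals; here \<open>m\<close>
  exhibits \<open>v\<close> as the pullback of \<open>u\<close>.  The map \<open>(t, x) \<mapsto> s(t) x\<close> from \<open>U \<times> \<real>\<close> to \<open>S\<close>, composed with the map from
  \<open>S\<close> to \<open>LE\<close>, is the object \<open>((v, \<tau>), \<psi>)\<close> of \<open>LE\<close>, and \<open>\<omega>\<close> is its lift \<open>w\<^sub>\<alpha>\<close>.  The last clause
  compares the values of the lift at \<open>(t, 0)\<close> and \<open>(t, 1)\<close>, which lie in the same fibre: \<open>k0\<close> and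
  \<open>k1\<close> identify a lift \<open>x\<close> of one point of \<open>E\<close> with the pullbacks of \<open>(v, \<tau>)\<close> to these two points.
\<close>

definition is_fibre_holonomy ::
  "('o, 'm, 'u) fibcat \<Rightarrow> ('o, 'm, 'u) ub_map
     \<Rightarrow> ('go, 'gm, 'u) fibcat \<Rightarrow> ('go, 'gm, ('o, 'u) eob, ('o, 'm, 'u) ear) smap
     \<Rightarrow> ('go \<Rightarrow> ('u \<Rightarrow> complex) \<Rightarrow> 'gm) \<Rightarrow> 'o \<times> 'm \<Rightarrow> ('u \<Rightarrow> complex) \<Rightarrow> bool" where
  "is_fibre_holonomy B p G f sc w g \<longleftrightarrow> (\<exists>C. open_cover (base B (fst w)) C \<and> (\<forall>U\<in>C.
     \<exists>s v m \<rho> \<tau> \<psi> \<omega>.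
       continuous_map (subtopology (base B (fst w)) U) (tot (onob p (fst w))) s \<and>
       (\<forall>t\<in>U. proj (onob p (fst w)) (s t) = t) \<and>
       m \<in> arr B v (fst w) \<and>
       homeomorphic_map (base B v) (prod_topology (subtopology (base B (fst w)) U) euclideanreal)
         (\<lambda>y. (bmap B m y, \<rho> y)) \<and>
       (v, \<tau>) \<in> Ob (total_stack B p) \<and>
       (\<forall>y\<in>topspace (base B v).
          tfun (onar p m) (\<tau> y) = act (onob p (fst w)) (s (bmap B m y)) (cis (2 * pi * \<rho> y))) \<and>
       \<psi> \<in> autos B v \<and> cmp B m \<psi> = cmp B (snd w) m \<and>
       flat_section G (total_stack B p) f sc ((v, \<tau>), ((v, \<tau>), \<psi>, (v, \<tau>))) \<omega> \<and>
       (\<forall>t\<in>U. g t \<in> carrier U1 \<and>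
          (\<forall>x\<in>Ob G. \<forall>k0\<in>arr (total_stack B p) (onob f x) (v, \<tau>).
             \<forall>k1\<in>arr (total_stack B p) (onob f x) (v, \<tau>). \<forall>pt y0 y1.
             topspace (base G x) = {pt} \<longrightarrow>
             bmap (total_stack B p) k0 pt = y0 \<longrightarrow> bmap B m y0 = t \<longrightarrow> \<rho> y0 = 0 \<longrightarrow>
             bmap (total_stack B p) k1 pt = y1 \<longrightarrow> bmap B m y1 = t \<longrightarrow> \<rho> y1 = 1 \<longrightarrow>
             cmp B m (onar total_proj k0) = cmp B m (onar total_proj k1) \<longrightarrow>
             \<omega> x k0 = cmp G (\<omega> x k1) (sc x (\<lambda>_. g t))))))"

definition is_holonomy_function ::
  "('o, 'm, 'u) fibcat \<Rightarrow> ('o, 'm, 'u) ub_map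
     \<Rightarrow> ('go, 'gm, 'u) fibcat \<Rightarrow> ('go, 'gm, ('o, 'u) eob, ('o, 'm, 'u) ear) smap
     \<Rightarrow> ('go \<Rightarrow> ('u \<Rightarrow> complex) \<Rightarrow> 'gm) \<Rightarrow> ('o \<times> 'm \<Rightarrow> 'u \<Rightarrow> complex) \<Rightarrow> bool" where
  "is_holonomy_function B p G f sc g \<longleftrightarrow>
     (\<forall>w\<in>Ob (loop_stack_1 B p). is_fibre_holonomy B p G f sc w (g w))"


section \<open>The Dixmier-Douady class\<close>

text \<open>
  Let \<open>e\<close> be an atlas of \<open>E\<close> and \<open>a\<close> an atlas of \<open>G\<close> with an arrow from \<open>f a\<close> to \<open>e\<close>.  The induced map
  \<open>|a| \<rightarrow> |e|\<close> of realizations is, up to homotopy, a fibration with fibre \<open>BU(1) = K(\<int>,2)\<close>, and the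
  Dixmier-Douady class is the transgression of the fundamental class of the fibre: a representative
  \<open>\<kappa>\<close> becomes on \<open>|a|\<close> the coboundary of a cochain \<open>l\<close> that restricts to the fundamental class on the
  fibre over each vertex.  That restriction is determined by its value on the sphere generating
  \<open>\<pi>\<^sub>2(BU(1)) = \<pi>\<^sub>1(U(1)) = \<int>\<close>, which is the simplex \<open>gerbe_sphere\<close>: its boundary is collapsed to the
  vertex, the edge coordinate is \<open>t 2\<close>, and the loop in \<open>U(1)\<close> is parametrised by
  \<open>t 1 / (t 0 + t 1)\<close>.  Subtracting the value on the constant simplex makes this a cycle.  The
  orientation of \<open>gerbe_sphere\<close> fixes the sign of the class.
\<close>

definition gerbe_sphere ::
  "('go, 'gm, 'u) fibcat \<Rightarrow> ('go \<Rightarrow> ('u \<Rightarrow> complex) \<Rightarrow> 'gm) \<Rightarrow> 'go \<Rightarrow> 'u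
     \<Rightarrow> (nat \<Rightarrow> real) \<Rightarrow> 'u rpoint" where
  "gerbe_sphere G sc a x = restrict
     (\<lambda>t. edge_point G a (sc a (\<lambda>_. cis (2 * pi * (t 1 / (t 0 + t 1))))) x (t 0 + t 1) (t 2))
     (standard_simplex 2)"

definition is_DD_class ::
  "('go, 'gm, 'u) fibcat \<Rightarrow> ('eo, 'em, 'u) fibcat \<Rightarrow> ('go, 'gm, 'eo, 'em) smap
     \<Rightarrow> ('go \<Rightarrow> ('u \<Rightarrow> complex) \<Rightarrow> 'gm) \<Rightarrow> 'eo \<Rightarrow> ('u rpoint, int) cochain set \<Rightarrow> bool" where
  "is_DD_class G E f sc e d \<longleftrightarrow> d \<in> cohomology 3 (realization E e) \<and>
     (\<exists>a k \<kappa> l. atlas G a \<and> etale_separated_atlas E (onob f a) \<and> k \<in> arr E (onob f a) e \<and> \<kappa> \<in> d \<and>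
        (\<forall>\<sigma>. singular_simplex 3 (realization G a) \<sigma> \<longrightarrow>
           coboundary 2 l \<sigma> = cochain_pullback 3 (realization_map G a E e f k) \<kappa> \<sigma>) \<and>
        (\<forall>x\<in>topspace (base G a).
           l (gerbe_sphere G sc a x) - l (constant_simplex 2 (vertex G a x)) = 1))"


section \<open>Integration over the fibre\<close>

text \<open>
  The atlas of \<open>E\<close> induced by an atlas \<open>b\<close> of \<open>B\<close>: its space is the total space of \<open>p b\<close>, and \<open>e\<close>
  consists of the pullback of \<open>b\<close> along the bundle projection, given by \<open>m\<close>, with its tautological section.
\<close>

definition induced_atlas ::
  "('o, 'm, 'u) fibcat \<Rightarrow> ('o, 'm, 'u) ub_map \<Rightarrow> 'o \<Rightarrow> ('o, 'u) eob \<Rightarrow> 'm \<Rightarrow> bool" where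
  "induced_atlas B p b e m \<longleftrightarrow> e \<in> Ob (total_stack B p) \<and> m \<in> arr B (fst e) b \<and>
     base B (fst e) = tot (onob p b) \<and>
     (\<forall>y\<in>topspace (tot (onob p b)). bmap B m y = proj (onob p b) y \<and>
        tfun (onar p m) (snd e y) = y)"

definition fibre_loop ::
  "('o, 'm, 'u) fibcat \<Rightarrow> ('o, 'm, 'u) ub_map \<Rightarrow> 'o \<Rightarrow> ('o, 'u) eob \<Rightarrow> 'u
     \<Rightarrow> (nat \<Rightarrow> real) \<Rightarrow> 'u rpoint" where
  "fibre_loop B p b e y = restrict
     (\<lambda>t. vertex (total_stack B p) e (act (onob p b) y (cis (2 * pi * t 1)))) (standard_simplex 1)"

text \<open>
  Integration over the fibre of the \<open>U(1)\<close>-bundle \<open>\<pi> : |e| \<rightarrow> |b|\<close> is the composition of the boundary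
  \<open>H\<^sup>n\<^sup>+\<^sup>1(|e|) \<rightarrow> H\<^sup>n\<^sup>+\<^sup>2(\<pi>)\<close> with the inverse of the Thom isomorphism
  \<open>H\<^sup>n(|b|) \<rightarrow> H\<^sup>n\<^sup>+\<^sup>2(\<pi>)\<close>, where \<open>H(\<pi>)\<close> is the relative cohomology of \<open>\<pi>\<close>, computed by the mapping cone of the
  pullback of cochains along \<open>\<pi>\<close>.  The Thom class is \<open>(\<epsilon>, \<eta>)\<close>: an Euler cocycle \<open>\<epsilon>\<close> on \<open>|b|\<close> and a global angular cochain \<open>\<eta>\<close>
  on \<open>|e|\<close> with \<open>\<delta>\<eta> = \<pi>\<^sup>*\<epsilon>\<close> and value one on the oriented fibres.  In terms of cochains: the integral of
  the class of \<open>\<eta> \<union> \<pi>\<^sup>*\<beta> + \<pi>\<^sup>*\<mu>\<close> is the class of the cocycle \<open>\<beta>\<close>.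
\<close>

definition is_fibre_integral ::
  "('o, 'm, 'u) fibcat \<Rightarrow> ('o, 'm, 'u) ub_map \<Rightarrow> 'o \<Rightarrow> ('o, 'u) eob \<Rightarrow> 'm \<Rightarrow> nat
     \<Rightarrow> ('u rpoint, int) cochain set \<Rightarrow> ('u rpoint, int) cochain set \<Rightarrow> bool" where
  "is_fibre_integral B p b e m n d c \<longleftrightarrow>
     (let E = total_stack B p; Y = realization E e; X = realization B b;
          \<pi> = realization_map E e B b total_proj m
      in d \<in> cohomology (Suc n) Y \<and> c \<in> cohomology n X \<and>
         (\<exists>\<epsilon> \<eta> \<beta> \<mu>. cocycle 2 X \<epsilon> \<and>
            (\<forall>\<sigma>. singular_simplex 2 Y \<sigma> \<longrightarrow> coboundary 1 \<eta> \<sigma> = cochain_pullback 2 \<pi> \<epsilon> \<sigma>) \<and>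
            (\<forall>y\<in>topspace (tot (onob p b)).
               \<eta> (fibre_loop B p b e y) - \<eta> (constant_simplex 1 (vertex E e y)) = 1) \<and>
            \<beta> \<in> c \<and>
            (\<forall>\<sigma>. singular_simplex (n + 2) X \<sigma> \<longrightarrow> coboundary (n + 1) \<mu> \<sigma> + cup 2 n \<epsilon> \<beta> \<sigma> = 0) \<and>
            (\<lambda>\<sigma>. cup 1 n \<eta> (cochain_pullback n \<pi> \<beta>) \<sigma> + cochain_pullback (n + 1) \<pi> \<mu> \<sigma>) \<in> d))"


section \<open>The function on the loop stack associated to a class of degree two\<close>

text \<open>
  For a principal bundle \<open>P\<close> of a discrete group \<open>\<Gamma>\<close> over a point and \<open>y \<in> P\<close>: the automorphism of \<open>P\<close> that
  corresponds to left translation by \<open>\<gamma>\<close> under the trivialisation defined by \<open>y\<close>.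
\<close>

definition torsor_auto :: "'g monoid \<Rightarrow> ('u, 'g) pbundle \<Rightarrow> 'u \<Rightarrow> 'g \<Rightarrow> ('u, 'g) bundle_arrow" where
  "torsor_auto \<Gamma> P y \<gamma> = \<lparr>bsrc = P, btgt = P, bfun = restrict id (topspace (bbase P)),
     tfun = restrict (\<lambda>x. act P y (\<gamma> \<otimes>\<^bsub>\<Gamma>\<^esub> (THE \<delta>. \<delta> \<in> carrier \<Gamma> \<and> act P y \<delta> = x))) (topspace (tot P))\<rparr>"

text \<open>
  \<open>P\<close> is an atlas of \<open>[*/\<Gamma>]\<close> with realization \<open>B\<Gamma>\<close>.  A character of \<open>\<Gamma>\<close>, viewed in \<open>H\<^sup>1(B\<Gamma>; U(1)\<^sup>\<delta>)\<close>
  through its values on the edges of \<open>B\<Gamma>\<close>, is lifted to a real cochain whose coboundary is integral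
  and represents its Bockstein.
\<close>

definition is_bockstein ::
  "'g monoid \<Rightarrow> ('u, 'g) pbundle \<Rightarrow> 'u \<Rightarrow> ('g \<Rightarrow> complex) \<Rightarrow> ('u rpoint, int) cochain set \<Rightarrow> bool" where
  "is_bockstein \<Gamma> P y chi c \<longleftrightarrow>
     (let S = classifying_stack \<Gamma> (discrete_topology (carrier \<Gamma>))
      in c \<in> cohomology 2 (realization S P) \<and>
         (\<exists>l :: ('u rpoint, real) cochain. \<exists>\<kappa>\<in>c.
            (\<forall>\<gamma>\<in>carrier \<Gamma>. \<forall>pt\<in>topspace (bbase P).
               cis (2 * pi * l (restrict (\<lambda>t. edge_point S P (torsor_auto \<Gamma> P y \<gamma>) pt (t 0) (t 1))
                                  (standard_simplex 1))) = chi \<gamma>) \<and>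
            (\<forall>\<sigma>. singular_simplex 2 (realization S P) \<sigma> \<longrightarrow> coboundary 1 l \<sigma> = of_int (\<kappa> \<sigma>))))"

text \<open>
  The value at \<open>(q, \<gamma>)\<close>, an object of the loop stack over a point, of the function associated to
  \<open>c \<in> H\<^sup>2(|b|; \<int>)\<close>.  \<open>F\<close> is the map \<open>[*/\<Gamma>] \<rightarrow> B\<close> induced by \<open>(q, \<gamma>)\<close>, for \<open>\<Gamma>\<close> generated by \<open>\<gamma>\<close>; it is determined
  by the isomorphism \<open>j\<close> from the image of the torsor \<open>P\<close> to \<open>q\<close>, compatible with the actions of \<open>\<Gamma>\<close>.
\<close>

definition is_associated_value ::
  "('o, 'm, 'u) fibcat \<Rightarrow> 'o \<Rightarrow> ('u rpoint, int) cochain set \<Rightarrow> 'o \<times> 'm \<Rightarrow> complex \<Rightarrow> bool" where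
  "is_associated_value B b c w z \<longleftrightarrow>
     (let q = fst w; \<gamma> = snd w;
          \<Gamma> = (aut_group B q)\<lparr>carrier := generate (aut_group B q) {\<gamma>}\<rparr>;
          S = classifying_stack \<Gamma> (discrete_topology (carrier \<Gamma>))
      in \<exists>(F :: (('u, 'm) pbundle, ('u, 'm) bundle_arrow, 'o, 'm) smap) P y j k chi.
           stack_map S B F \<and> P \<in> Ob S \<and> bbase P = base B q \<and> y \<in> topspace (tot P) \<and>
           j \<in> arr B (onob F P) q \<and> (\<forall>t\<in>topspace (base B q). bmap B j t = t) \<and>
           (\<forall>\<delta>\<in>carrier \<Gamma>. cmp B j (onar F (torsor_auto \<Gamma> P y \<delta>)) = cmp B \<delta> j) \<and>
           k \<in> arr B q b \<and>
           chi \<in> hom \<Gamma> U1 \<and>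
           is_bockstein \<Gamma> P y chi
             (cohomology_pullback 2 (realization S P) (realization_map S P B b F (cmp B k j)) c) \<and>
           z = chi \<gamma>)"

text \<open>On an object of the loop stack over a general space, the function is determined by restriction to points.\<close>

definition is_associated_function ::
  "('o, 'm, 'u) fibcat \<Rightarrow> 'o \<Rightarrow> ('u rpoint, int) cochain set \<Rightarrow> ('o \<times> 'm \<Rightarrow> 'u \<Rightarrow> complex) \<Rightarrow> bool" where
  "is_associated_function B b c chi \<longleftrightarrow>
     (\<forall>w\<in>Ob (loop_stack B). \<forall>w'\<in>Ob (loop_stack B). \<forall>k\<in>arr (loop_stack B) w' w. \<forall>pt.
        topspace (base B (fst w')) = {pt} \<longrightarrow>
        is_associated_value B b c w' (chi w (bmap (loop_stack B) k pt)))"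

end

theory Submission
  imports Defs "HOL-Number_Theory.Cong"
begin

text \<open>
  Both sides are computed at a point \<open>(q, \<gamma>)\<close> of \<open>LB\<^sub>1\<close> by explicit singular simplices.  Flatness of the
  lift gives \<open>\<gamma>\<^sup>n = 1\<close>, and the Bockstein turns the value of a class \<open>\<beta>\<close> into
  \<open>cis (2 \<pi> N / n)\<close>, where \<open>N\<close> is the sum of \<open>\<beta>\<close> over the triangles \<open>(1, \<gamma>\<^sup>i, \<gamma>\<^sup>i\<^sup>+\<^sup>1)\<close>, \<open>i < n\<close>.
  Over the fibre of \<open>E\<close> through \<open>q\<close> these triangles sweep out prisms.  If \<open>\<kappa>\<close> represents \<open>d\<close>, then
  modulo \<open>n\<close> the sum of \<open>\<kappa>\<close> over the prisms is the sum of \<open>\<pi>\<^sub>! \<kappa>\<close> over the triangles, because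
  \<open>\<kappa>\<close> is cohomologous to \<open>\<eta> \<union> \<pi>\<^sup>*\<beta> + \<pi>\<^sup>*\<mu>\<close> with an angular cochain \<open>\<eta>\<close>.  On the other hand \<open>\<kappa>\<close> becomes a coboundary
  \<open>\<delta>l\<close> on the gerbe, so the same sum is the difference of the sums of \<open>l\<close> over the triangles of the lifts of \<open>\<gamma>\<close>
  at the two ends of the path.  These lifts are scaled to have order \<open>n\<close> and differ by the holonomy
  \<open>cis (2 \<pi> k / n)\<close>, and rotating a lift by this amount changes the sum of \<open>l\<close> by \<open>k\<close>, as \<open>l\<close>
  restricts to the fundamental class of the fibre \<open>BU(1)\<close>.
\<close>

section \<open>Cochains on lists of vertices\<close>

text \<open>The chain of triangles is a cycle only modulo \<open>n\<close>, so every comparison is a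
  congruence; this loses nothing, as its value enters only through
  \<open>cis (2 * pi * N / n)\<close>. The number \<open>n\<close> is an exponent supplied by
  flatness at one end of the path and need not be the order of \<gamma>. Two obstacles shape the
  argument. Objects over the path lift to the gerbe only locally, so \<open>l\<close> cannot be
  summed along the whole path at once. \<open>height\<close> is therefore a potential attached to
  lifts of single points: it corrects the sum of \<open>l\<close> by a prism from the chart of the
  path to a chart of the gerbe, which makes it independent of the lift and of the chart modulo
  \<open>n\<close>, and an interval induction glues the local comparisons. Secondly,
  \<open>l\<close> is normalised only on \<open>gerbe_sphere\<close>, while rotating a lift produces
  other triangles. Rotations by arbitrary real angles are therefore realised by singular simplices;
  the difference of \<open>l\<close> on rotated and unrotated simplices is a cocycle in exponents
  and angles, and divisibility of the reals makes its commutators vanish, which reduces the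
  computation to full turns.\<close>

definition shift_vertices :: "(nat \<times> 'p) list \<Rightarrow> (nat \<times> 'p) list" where
  "shift_vertices = map (\<lambda>(i, x). (Suc i, x))"

text \<open>A vertex \<open>(i, x)\<close> stands for the i-th power of an automorphism whose n-th
  power is the identity, hence exponents count modulo \<open>n\<close>; \<open>x\<close> records the
  position of the vertex.\<close>

definition congruent_vertices :: "nat \<Rightarrow> (nat \<times> 'p) list \<Rightarrow> (nat \<times> 'p) list \<Rightarrow> bool" where
  "congruent_vertices n = list_all2 (\<lambda>(i, x) (j, y). i mod n = j mod n \<and> x = y)"

text \<open>Homogeneous notation: in the applications, translating all exponents is precomposition
  with the automorphism, which changes no point of the realization.\<close>

definition cyclic_cochain :: "nat \<Rightarrow> ((nat \<times> 'p) list \<Rightarrow> 'r) \<Rightarrow> bool" where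
  "cyclic_cochain n c \<longleftrightarrow> (\<forall>vs. c (shift_vertices vs) = c vs) \<and>
     (\<forall>vs ws. congruent_vertices n vs ws \<longrightarrow> c vs = c ws)"

definition list_coboundary :: "((nat \<times> 'p) list \<Rightarrow> 'r::comm_ring_1) \<Rightarrow> (nat \<times> 'p) list \<Rightarrow> 'r" where
  "list_coboundary c vs = (\<Sum>k<length vs. (-1) ^ k * c (take k vs @ drop (Suc k) vs))"

text \<open>The standard 2-chain of a cyclic group of order \<open>n\<close>: its boundary is
  \<open>n\<close> times the edge from 0 to 1, so it is a cycle modulo \<open>n\<close>.\<close>

definition cyclic_sum :: "nat \<Rightarrow> ((nat \<times> 'p) list \<Rightarrow> 'r::comm_ring_1) \<Rightarrow> 'p \<Rightarrow> 'r" where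
  "cyclic_sum n c x = (\<Sum>i<n. c [(0, x), (i, x), (Suc i, x)])"

text \<open>Each triangle times the edge from \<open>x\<close> to \<open>y\<close> is cut into its
  three shuffle tetrahedra, with the usual signs.\<close>

definition prism_sum :: "nat \<Rightarrow> ((nat \<times> 'p) list \<Rightarrow> 'r::comm_ring_1) \<Rightarrow> 'p \<Rightarrow> 'p \<Rightarrow> 'r" where
  "prism_sum n c x y = (\<Sum>i<n. c [(0, x), (0, y), (i, y), (Suc i, y)]
     - c [(0, x), (i, x), (i, y), (Suc i, y)] + c [(0, x), (i, x), (Suc i, x), (Suc i, y)])"

lemma list_coboundary_simps:
  "list_coboundary c [a, b] = c [b] - c [a]"
  "list_coboundary c [a, b, d] = c [b, d] - c [a, d] + c [a, b]"
  "list_coboundary c [a, b, d, e] = c [b, d, e] - c [a, d, e] + c [a, b, e] - c [a, b, d]"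
  "list_coboundary c [a, b, d, e, f] =
     c [b, d, e, f] - c [a, d, e, f] + c [a, b, e, f] - c [a, b, d, f] + c [a, b, d, e]"
  by (simp_all add: list_coboundary_def eval_nat_numeral)

lemma cyclic_cochain_add:
  assumes "cyclic_cochain n c"
  shows "c (map (\<lambda>(i, x). (i + k, x)) vs) = c vs"
proof (induction k)
  case (Suc k)
  have "map (\<lambda>(i, x). (i + Suc k, x)) vs = shift_vertices (map (\<lambda>(i, x). (i + k, x)) vs)"
    by (auto simp: shift_vertices_def)
  then show ?case
    using assms Suc by (simp add: cyclic_cochain_def)
qed (simp add: case_prod_beta)

lemma cyclic_cochain_cong:
  assumes "cyclic_cochain n c" "congruent_vertices n vs ws"
  shows "c vs = c ws"
  using assms by (simp add: cyclic_cochain_def)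

lemma sum_const_minus_telescope:
  fixes f :: "nat \<Rightarrow> 'r::comm_ring_1"
  shows "(\<Sum>i<n. a - (f (Suc i) - f i)) = of_nat n * a - (f n - f 0)"
  by (induction n) (simp_all add: algebra_simps)

text \<open>Translation turns each edge \<open>(i, i + 1)\<close> into the edge
  \<open>(0, 1)\<close>; the edges issuing from 0 telescope, and the last of them closes up because
  exponents count modulo \<open>n\<close>.\<close>

lemma cyclic_sum_coboundary:
  fixes c :: "(nat \<times> 'p) list \<Rightarrow> 'r::comm_ring_1"
  assumes c: "cyclic_cochain n c"
  shows "cyclic_sum n (list_coboundary c) x = of_nat n * c [(0, x), (1, x)]"
proof -
  have e: "list_coboundary c [(0, x), (i, x), (Suc i, x)]
      = c [(0, x), (1, x)] - (c [(0, x), (Suc i, x)] - c [(0, x), (i, x)])" for i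
    using cyclic_cochain_add[OF c, of i "[(0, x), (1, x)]"] by (simp add: list_coboundary_simps)
  have "cyclic_sum n (list_coboundary c) x
      = of_nat n * c [(0, x), (1, x)] - (c [(0, x), (n, x)] - c [(0, x), (0, x)])"
    unfolding cyclic_sum_def e by (rule sum_const_minus_telescope)
  also have "c [(0, x), (n, x)] = c [(0, x), (0, x)]"
    by (rule cyclic_cochain_cong[OF c]) (simp add: congruent_vertices_def)
  finally show ?thesis by simp
qed

text \<open>Boundary of a prism: top minus bottom minus sides. The sides over the edges
  \<open>(i, i + 1)\<close> are \<open>n\<close> translates of one square, and those over the edges
  from 0 telescope.\<close>

lemma prism_sum_coboundary:
  fixes c l :: "(nat \<times> 'p) list \<Rightarrow> int"
  assumes l: "cyclic_cochain n l"
    and c: "\<And>i j k m u v w z. {u, v, w, z} \<subseteq> {x, y} \<Longrightarrow>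
      c [(i, u), (j, v), (k, w), (m, z)] = list_coboundary l [(i, u), (j, v), (k, w), (m, z)]"
  shows "[prism_sum n c x y = cyclic_sum n l y - cyclic_sum n l x] (mod int n)"
proof -
  \<comment> \<open>\<open>P i j\<close> is the value on the square over the edge from
    \<open>i\<close> to \<open>j\<close>, cut along its diagonal.\<close>
  define P where "P i j = l [(i, x), (i, y), (j, y)] - l [(i, x), (j, x), (j, y)]" for i j
  have t: "c [(0, x), (0, y), (i, y), (Suc i, y)]
     - c [(0, x), (i, x), (i, y), (Suc i, y)] + c [(0, x), (i, x), (Suc i, x), (Suc i, y)]
     = l [(0, y), (i, y), (Suc i, y)] - l [(0, x), (i, x), (Suc i, x)]
       - (P i (Suc i) - (P 0 (Suc i) - P 0 i))" for i
    by (simp add: c list_coboundary_simps P_def)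
  have s: "P i (Suc i) = P 0 1" for i
    using cyclic_cochain_add[OF l, of i "[(0, x), (0, y), (1, y)]"]
      cyclic_cochain_add[OF l, of i "[(0, x), (1, x), (1, y)]"] by (simp add: P_def)
  have z: "P 0 n = P 0 0"
    unfolding P_def by (intro arg_cong2[of _ _ _ _ "(-)"] cyclic_cochain_cong[OF l])
      (simp_all add: congruent_vertices_def)
  have "prism_sum n c x y = cyclic_sum n l y - cyclic_sum n l x
      - (\<Sum>i<n. P 0 1 - (P 0 (Suc i) - P 0 i))"
    unfolding prism_sum_def t cyclic_sum_def s by (simp only: sum_subtractf)
  also note sum_const_minus_telescope
  finally have "prism_sum n c x y = cyclic_sum n l y - cyclic_sum n l x - int n * P 0 1 + (P 0 n - P 0 0)"
    by simp
  then have "prism_sum n c x y = cyclic_sum n l y - cyclic_sum n l x - int n * P 0 1"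
    using z by simp
  then show ?thesis
    by (simp add: cong_iff_lin)
qed

text \<open>Stacking two prisms: the triangle \<open>0, i, i + 1\<close> times the triangle
  \<open>x, y, t\<close> fills the gap between them and the long prism, and the faces left over lie
  above the edges of the first triangle, where they telescope or repeat as for a coboundary.\<close>

lemma prism_sum_add:
  fixes c :: "(nat \<times> 'p) list \<Rightarrow> int"
  assumes inv: "cyclic_cochain n c"
    and coc: "\<And>i j k m r u v w z s. {u, v, w, z, s} \<subseteq> {x, y, t} \<Longrightarrow>
      list_coboundary c [(i, u), (j, v), (k, w), (m, z), (r, s)] = 0"
  shows "[prism_sum n c x y + prism_sum n c y t = prism_sum n c x t] (mod int n)"
proof -
  \<comment> \<open>\<open>E i j\<close> is the value on the edge from \<open>i\<close> to
    \<open>j\<close> times the triangle \<open>x, y, t\<close>.\<close>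
  define E where "E i j = c [(i, x), (j, x), (j, y), (j, t)] - c [(i, x), (i, y), (j, y), (j, t)]
      + c [(i, x), (i, y), (i, t), (j, t)]" for i j
  define Q where "Q u v i = c [(0, u), (0, v), (i, v), (Suc i, v)]
     - c [(0, u), (i, u), (i, v), (Suc i, v)] + c [(0, u), (i, u), (Suc i, u), (Suc i, v)]" for u v i
  have coc': "c [(j, v), (k, w), (m, z), (r, s)] - c [(i, u), (k, w), (m, z), (r, s)]
       + c [(i, u), (j, v), (m, z), (r, s)] - c [(i, u), (j, v), (k, w), (r, s)]
       + c [(i, u), (j, v), (k, w), (m, z)] = 0" if "{u, v, w, z, s} \<subseteq> {x, y, t}" for i j k m r u v w z s
    using coc[OF that] by (simp add: list_coboundary_simps)
  have t: "Q x y i + Q y t i - Q x t i = - (E i (Suc i) - (E 0 (Suc i) - E 0 i))" for i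
    unfolding Q_def E_def
    \<comment> \<open>The six shuffles of two triangles. In these instances the exponent of the
      first vertex is the last argument.\<close>
    using coc'[of x x x y t i "Suc i" "Suc i" "Suc i" 0] coc'[of x x y y t i i "Suc i" "Suc i" 0]
      coc'[of x x y t t i i i "Suc i" 0] coc'[of x y y y t 0 i "Suc i" "Suc i" 0]
      coc'[of x y y t t 0 i i "Suc i" 0] coc'[of x y t t t 0 0 i "Suc i" 0]
    by simp
  have s: "E i (Suc i) = E 0 1" for i
    using cyclic_cochain_add[OF inv, of i "[(0, x), (1, x), (1, y), (1, t)]"]
      cyclic_cochain_add[OF inv, of i "[(0, x), (0, y), (1, y), (1, t)]"]
      cyclic_cochain_add[OF inv, of i "[(0, x), (0, y), (0, t), (1, t)]"] by (simp add: E_def)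
  have z: "E 0 n = E 0 0"
    unfolding E_def by (intro arg_cong2[of _ _ _ _ "(-)"] arg_cong2[of _ _ _ _ "(+)"]
        cyclic_cochain_cong[OF inv]) (simp_all add: congruent_vertices_def)
  have "prism_sum n c x y + prism_sum n c y t - prism_sum n c x t = (\<Sum>i<n. Q x y i + Q y t i - Q x t i)"
    by (simp add: prism_sum_def Q_def sum.distrib sum_subtractf)
  also have "\<dots> = - (int n * E 0 1) + (E 0 n - E 0 0)"
    unfolding t s sum_negf sum_const_minus_telescope by simp
  finally have "prism_sum n c x y + prism_sum n c y t = prism_sum n c x t - int n * E 0 1"
    using z by simp
  then show ?thesis
    by (simp add: cong_iff_lin)
qed

text \<open>A prism over a constant edge is idempotent under stacking.\<close>

lemma prism_sum_refl:
  fixes c :: "(nat \<times> 'p) list \<Rightarrow> int"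
  assumes "cyclic_cochain n c"
    and "\<And>i j k m r. list_coboundary c [(i, x), (j, x), (k, x), (m, x), (r, x)] = 0"
  shows "[prism_sum n c x x = 0] (mod int n)"
proof -
  have "[prism_sum n c x x + prism_sum n c x x = prism_sum n c x x] (mod int n)"
    using assms by (intro prism_sum_add) auto
  then show ?thesis
    by (metis add.right_neutral cong_add_lcancel)
qed

text \<open>
  For \<open>c = \<eta> \<union> \<pi>\<^sup>*\<beta> + \<pi>\<^sup>*\<mu>\<close>: of the three summands of the prism, only the one starting with the edge
  along the fibre contributes, as \<open>\<beta>\<close> takes the same value on all degenerate simplices that occur.
\<close>

lemma prism_sum_cup:
  fixes c e :: "(nat \<times> 'p) list \<Rightarrow> int" and b u :: "(nat \<times> unit) list \<Rightarrow> int"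
  assumes b: "cyclic_cochain n b"
    and coc: "\<And>i j k m. list_coboundary b [(i, ()), (j, ()), (k, ()), (m, ())] = 0"
    and c: "\<And>i j k m v w z s. {v, w, z, s} \<subseteq> {x, y} \<Longrightarrow> c [(i, v), (j, w), (k, z), (m, s)] =
       e [(i, v), (j, w)] * b [(j, ()), (k, ()), (m, ())] + u [(i, ()), (j, ()), (k, ()), (m, ())]"
  shows "prism_sum n c x y - prism_sum n c x x
    = (e [(0, x), (0, y)] - e [(0, x), (0, x)]) * cyclic_sum n b ()"
proof -
  \<comment> \<open>Cocycle condition on degenerate tetrahedra: \<open>b\<close> may be nonzero on a
    degenerate triangle, but its value there is one constant.\<close>
  have l: "b [(i, ()), (i, ()), (j, ())] = b [(i, ()), (i, ()), (i, ())]" for i j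
    using coc[of i i i j] by (simp add: list_coboundary_simps)
  have r: "b [(i, ()), (j, ()), (j, ())] = b [(j, ()), (j, ()), (j, ())]" for i j
    using coc[of i j j j] by (simp add: list_coboundary_simps)
  have s: "b [(i, ()), (i, ()), (i, ())] = b [(0, ()), (0, ()), (0, ())]" for i
    using cyclic_cochain_add[OF b, of i "[(0, ()), (0, ()), (0, ())]"] by simp
  have d: "b [(i, ()), (i, ()), (Suc i, ())] = b [(i, ()), (Suc i, ()), (Suc i, ())]" for i
    using l[of i "Suc i"] r[of i "Suc i"] s[of i] s[of "Suc i"] by metis
  show ?thesis
    by (simp add: prism_sum_def cyclic_sum_def c d sum_distrib_left left_diff_distrib
        flip: sum_subtractf)
qed

section \<open>Additivity in the real direction\<close>

text \<open>Divisibility of the reals: the value is a multiple of every positive integer, in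
  particular of one that exceeds it in absolute value.\<close>

lemma additive_real_int_zero:
  fixes f :: "real \<Rightarrow> int"
  assumes add: "\<And>x y. f (x + y) = f x + f y"
  shows "f x = 0"
proof (rule ccontr)
  assume nz: "f x \<noteq> 0"
  have mult: "f (of_nat k * y) = int k * f y" for k y
  proof (induction k)
    case 0
    show ?case using add[of 0 0] by simp
  next
    case (Suc k)
    then show ?case using add[of "of_nat k * y" y] by (simp add: algebra_simps)
  qed
  define k where "k = Suc (nat \<bar>f x\<bar>)"
  have "f x = int k * f (x / of_nat k)"
    using mult[of k "x / of_nat k"] by (simp add: k_def)
  moreover have "f (x / of_nat k) \<noteq> 0" using nz calculation by auto
  ultimately have "\<bar>f x\<bar> \<ge> int k"
    by (metis abs_mult abs_of_nat dvd_imp_le_int dvd_triv_left nz)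
  then show False by (simp add: k_def)
qed

text \<open>
  \<open>m\<close> is a homogeneous cocycle on the abelian monoid \<open>\<nat> \<times> \<real>\<close>; in the corresponding central
  extension the elements of \<open>\<real>\<close> are central, because \<open>\<real>\<close> is divisible.  The claim compares the
  \<open>n\<close>th powers of the lifts of \<open>(1, 0)\<close> and \<open>(1, \<phi>)\<close>.
\<close>

lemma cyclic_sum_twisted:
  fixes m :: "nat \<times> real \<Rightarrow> nat \<times> real \<Rightarrow> nat \<times> real \<Rightarrow> int"
  assumes coc: "\<And>v0 v1 v2 v3. m v1 v2 v3 - m v0 v2 v3 + m v0 v1 v3 - m v0 v1 v2 = 0"
    and shift: "\<And>i t i0 t0 i1 t1 i2 t2.
       m (i0 + i, t0 + t) (i1 + i, t1 + t) (i2 + i, t2 + t) = m (i0, t0) (i1, t1) (i2, t2)"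
    and zero: "\<And>i j k. m (i, 0) (j, 0) (k, 0) = 0"
    and single: "\<And>r s t. m (0, r) (0, s) (0, t) = 0"
    and int_shift: "\<And>r s i t. i > 0 \<Longrightarrow> m (0, r) (0, s) (i, t - 1) = m (0, r) (0, s) (i, t)"
    and n: "n > 0"
  shows "(\<Sum>i<n. m (0, 0) (i, - (real i * real k / real n)) (Suc i, - (real (Suc i) * real k / real n)))
     - int k * m (0, 0) (0, -1) (n, -1)
     = - int n * m (0, 0) (0, - (real k / real n)) (1, - (real k / real n))"
proof -
  define \<phi> where "\<phi> = - (real k / real n)"
  \<comment> \<open>Inhomogeneous form: \<open>q i t j s\<close> is the factor set of the central
    extension at the pair \<open>(i, t)\<close>, \<open>(j, s)\<close>.\<close>
  define q where "q i t j s = m (0, 0) (i, t) (i + j, t + s)" for i t j s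
  have q: "m (i, t) (i + j, t + s) (i + j + k, t + s + r) = q j s k r" for i t j s k r
    using shift[of 0 i 0 t j s "j + k" "s + r"] by (simp add: q_def algebra_simps)
  have coc': "q j s k r - q (i + j) (t + s) k r + q i t (j + k) (s + r) - q i t j s = 0" for i t j s k r
    using coc[of "(i, t)" "(i + j, t + s)" "(i + j + k, t + s + r)" "(0, 0)"] q[of i t j s k r]
    by (simp add: q_def algebra_simps)
  \<comment> \<open>The commutator of \<open>(i, t)\<close> with \<open>(0, s)\<close> is additive
    in \<open>s\<close> by three instances of the cocycle identity, hence zero.\<close>
  have comm: "q i t 0 s = q 0 s i t" for i t s
  proof -
    have "q i t 0 (s + s') - q 0 (s + s') i t
        = (q i t 0 s - q 0 s i t) + (q i t 0 s' - q 0 s' i t)" for s s'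
      using coc'[of 0 s 0 s' i t] coc'[of i t 0 s' 0 s] coc'[of 0 s' i t 0 s]
      by (simp add: algebra_simps)
    then have "q i t 0 s - q 0 s i t = 0"
      by (rule additive_real_int_zero[of "\<lambda>s. q i t 0 s - q 0 s i t"])
    then show ?thesis by simp
  qed
  \<comment> \<open>\<open>S i\<close> compares the lift of \<open>(i, i * \<phi>)\<close> with the
    product of the lifts of \<open>(0, i * \<phi>)\<close> and \<open>(i, 0)\<close>. The factor set
    is trivial on both axes, so on the multiples of \<open>(1, \<phi>)\<close> it is the coboundary
    of \<open>S\<close>.\<close>
  define S where "S i = q 0 (real i * \<phi>) i 0" for i
  have aa: "q i 0 j 0 = 0" for i j using zero by (simp add: q_def)
  have cc: "q 0 t 0 s = 0" for t s using single by (simp add: q_def)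
  have step: "q i (real i * \<phi>) 1 \<phi> = S (Suc i) - S i - S 1" for i
    using coc'[of i 0 1 \<phi> 0 "real i * \<phi>"] coc'[of 0 \<phi> 1 0 i 0] comm[of i 0 \<phi>]
      coc'[of i 0 1 0 0 \<phi>] coc'[of 0 \<phi> "Suc i" 0 0 "real i * \<phi>"]
      aa[of i 1] cc[of "real i * \<phi>" \<phi>]
    by (simp add: S_def distrib_right add.commute)
  have "(\<Sum>i<n. q i (real i * \<phi>) 1 \<phi>) = S n - S 0 - int n * S 1"
    unfolding step by (induction n) (simp_all add: algebra_simps)
  moreover have "S 0 = 0" using aa by (simp add: S_def)
  \<comment> \<open>As \<open>n * \<phi> = - k\<close>, this term is a rotation by \<open>k\<close>
    full turns, each of which contributes the same amount.\<close>
  moreover have "S n = int k * m (0, 0) (0, -1) (n, -1)"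
  proof -
    have "m (0, 0) (0, - real j) (n, - real j) = int j * m (0, 0) (0, -1) (n, -1)" for j
    proof (induction j)
      case 0
      show ?case using zero by simp
    next
      case (Suc j)
      have per: "m (0, 0) (0, -1) (n, - real j) = m (0, 0) (0, -1) (n, 0)" for j
      proof (induction j)
        case (Suc j)
        have "- real (Suc j) = - real j - 1" by simp
        then show ?case using int_shift[OF n, of 0 "-1" "- real j"] Suc by metis
      qed simp
      have "m (0, 0) (0, -1) (n, - real (Suc j)) = m (0, 0) (0, -1) (n, -1)"
        using per[of 1] per[of "Suc j"] by simp
      then show ?case
        using coc[of "(0, -1)" "(0, - real (Suc j))" "(n, - real (Suc j))" "(0, 0)"] single Suc
          shift[of 0 0 0 "-1" 0 "- real j" n "- real j"]
        by (simp add: algebra_simps)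
    qed
    then show ?thesis using n by (simp add: S_def q_def \<phi>_def)
  qed
  moreover have "S 1 = m (0, 0) (0, \<phi>) (1, \<phi>)" by (simp add: S_def q_def)
  moreover have "q i (real i * \<phi>) 1 \<phi> = m (0, 0) (i, real i * \<phi>) (Suc i, real (Suc i) * \<phi>)" for i
    by (simp add: q_def algebra_simps)
  ultimately show ?thesis
    by (simp add: \<phi>_def)
qed

section \<open>Categories over spaces\<close>

locale spaces_category =
  fixes X :: "('o, 'm, 'u) fibcat"
  assumes cat: "category_over_spaces X"
begin

lemma arr_Ob: "m \<in> arr X u v \<Longrightarrow> u \<in> Ob X" "m \<in> arr X u v \<Longrightarrow> v \<in> Ob X"
  using cat by (auto simp: category_over_spaces_def arr_def)

lemma continuous_bmap: "m \<in> arr X u v \<Longrightarrow> continuous_map (base X u) (base X v) (bmap X m)"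
  using cat by (auto simp: category_over_spaces_def arr_def)

lemma bmap_in: "m \<in> arr X u v \<Longrightarrow> t \<in> topspace (base X u) \<Longrightarrow> bmap X m t \<in> topspace (base X v)"
  using continuous_bmap by (auto simp: continuous_map_def)

lemma ident_arr: "u \<in> Ob X \<Longrightarrow> ident X u \<in> arr X u u"
  using cat by (auto simp: category_over_spaces_def)

lemma bmap_ident: "u \<in> Ob X \<Longrightarrow> t \<in> topspace (base X u) \<Longrightarrow> bmap X (ident X u) t = t"
  using cat by (auto simp: category_over_spaces_def)

lemma cmp_arr: "n \<in> arr X v w \<Longrightarrow> m \<in> arr X u v \<Longrightarrow> cmp X n m \<in> arr X u w"
  using cat by (auto simp: category_over_spaces_def)

lemma bmap_cmp: "n \<in> arr X v w \<Longrightarrow> m \<in> arr X u v \<Longrightarrow> t \<in> topspace (base X u) \<Longrightarrow>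
    bmap X (cmp X n m) t = bmap X n (bmap X m t)"
  using cat by (auto simp: category_over_spaces_def)

lemma cmp_ident: "m \<in> arr X u v \<Longrightarrow> cmp X m (ident X u) = m" "m \<in> arr X u v \<Longrightarrow> cmp X (ident X v) m = m"
  using cat by (auto simp: category_over_spaces_def)

lemma cmp_assoc: "k \<in> arr X w z \<Longrightarrow> n \<in> arr X v w \<Longrightarrow> m \<in> arr X u v \<Longrightarrow>
    cmp X (cmp X k n) m = cmp X k (cmp X n m)"
  using cat by (fastforce simp: category_over_spaces_def)

lemma autos_arr: "k \<in> autos X u \<Longrightarrow> k \<in> arr X u u"
  by (simp add: autos_def)

lemma bmap_autos: "k \<in> autos X u \<Longrightarrow> t \<in> topspace (base X u) \<Longrightarrow> bmap X k t = t"
  by (simp add: autos_def)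

lemma ident_autos: "u \<in> Ob X \<Longrightarrow> ident X u \<in> autos X u"
  by (simp add: autos_def ident_arr bmap_ident)

lemma cmp_autos: "k \<in> autos X u \<Longrightarrow> l \<in> autos X u \<Longrightarrow> cmp X k l \<in> autos X u"
  by (auto simp: autos_def cmp_arr bmap_cmp)

end

text \<open>The same iterate as in \<open>flat_section\<close>, so that flatness can be read as a
  statement about powers of automorphisms.\<close>

definition auto_pow :: "('o, 'm, 'u) fibcat \<Rightarrow> 'o \<Rightarrow> 'm \<Rightarrow> nat \<Rightarrow> 'm" where
  "auto_pow X u \<psi> i = (cmp X \<psi> ^^ i) (ident X u)"

lemma auto_pow_0: "auto_pow X u \<psi> 0 = ident X u"
  and auto_pow_Suc: "auto_pow X u \<psi> (Suc i) = cmp X \<psi> (auto_pow X u \<psi> i)"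
  by (simp_all add: auto_pow_def)

context spaces_category
begin

lemma auto_pow_autos: "u \<in> Ob X \<Longrightarrow> \<psi> \<in> autos X u \<Longrightarrow> auto_pow X u \<psi> i \<in> autos X u"
  by (induction i) (simp_all add: auto_pow_0 auto_pow_Suc ident_autos cmp_autos)

lemma auto_pow_1: "\<psi> \<in> autos X u \<Longrightarrow> auto_pow X u \<psi> 1 = \<psi>"
  using auto_pow_Suc[of X u \<psi> 0] cmp_ident(1)[OF autos_arr] by (simp add: auto_pow_0)

lemma auto_pow_add:
  assumes "u \<in> Ob X" "\<psi> \<in> autos X u"
  shows "auto_pow X u \<psi> (i + j) = cmp X (auto_pow X u \<psi> i) (auto_pow X u \<psi> j)"
proof (induction i)
  case 0
  show ?case using cmp_ident(2)[OF autos_arr[OF auto_pow_autos[OF assms, of j]]] by (simp add: auto_pow_0)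
next
  case (Suc i)
  then show ?case using auto_pow_autos[OF assms] assms
    by (simp add: auto_pow_Suc cmp_assoc[of _ u u _ u _ u] autos_arr)
qed

lemma auto_pow_Suc_right:
  "u \<in> Ob X \<Longrightarrow> \<psi> \<in> autos X u \<Longrightarrow> auto_pow X u \<psi> (Suc i) = cmp X (auto_pow X u \<psi> i) \<psi>"
  using auto_pow_add[of u \<psi> i 1] auto_pow_1 by simp

lemma auto_pow_commute:
  assumes m: "m \<in> arr X u v" and \<phi>: "\<phi> \<in> autos X u" and \<psi>: "\<psi> \<in> autos X v"
    and eq: "cmp X \<psi> m = cmp X m \<phi>"
  shows "cmp X (auto_pow X v \<psi> i) m = cmp X m (auto_pow X u \<phi> i)"
proof (induction i)
  case 0
  show ?case using m by (simp add: auto_pow_0 cmp_ident)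
next
  case (Suc i)
  have p: "auto_pow X v \<psi> i \<in> arr X v v" "auto_pow X u \<phi> i \<in> arr X u u" "\<psi> \<in> arr X v v" "\<phi> \<in> arr X u u"
    using auto_pow_autos arr_Ob[OF m] \<phi> \<psi> autos_arr by blast+
  have "cmp X (auto_pow X v \<psi> (Suc i)) m = cmp X \<psi> (cmp X m (auto_pow X u \<phi> i))"
    using Suc p m by (simp add: auto_pow_Suc cmp_assoc)
  also have "\<dots> = cmp X m (auto_pow X u \<phi> (Suc i))"
    using cmp_assoc[OF p(3) m p(2)] cmp_assoc[OF m p(4,2)] eq by (simp add: auto_pow_Suc)
  finally show ?case .
qed

lemma auto_pow_commuting_product:
  assumes u: "u \<in> Ob X" and \<phi>: "\<phi> \<in> autos X u" and \<psi>: "\<psi> \<in> autos X u"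
    and c: "cmp X \<phi> \<psi> = cmp X \<psi> \<phi>"
  shows "auto_pow X u (cmp X \<phi> \<psi>) i = cmp X (auto_pow X u \<phi> i) (auto_pow X u \<psi> i)"
proof (induction i)
  case 0
  show ?case using cmp_ident(2)[OF ident_arr[OF u]] by (simp add: auto_pow_0)
next
  case (Suc i)
  have p: "auto_pow X u \<phi> i \<in> arr X u u" "auto_pow X u \<psi> i \<in> arr X u u" "\<psi> \<in> arr X u u" "\<phi> \<in> arr X u u"
    using auto_pow_autos u \<phi> \<psi> autos_arr by blast+
  have c': "cmp X (auto_pow X u \<phi> i) \<psi> = cmp X \<psi> (auto_pow X u \<phi> i)"
    using auto_pow_commute[OF autos_arr[OF \<psi>] \<phi> \<phi> c] .
  have "auto_pow X u (cmp X \<phi> \<psi>) (Suc i) = cmp X \<phi> (cmp X (cmp X \<psi> (auto_pow X u \<phi> i)) (auto_pow X u \<psi> i))"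
    using Suc cmp_assoc[OF p(4,3) cmp_arr[OF p(1,2)]] cmp_assoc[OF p(3,1,2)] by (simp add: auto_pow_Suc)
  also have "\<dots> = cmp X (auto_pow X u \<phi> (Suc i)) (auto_pow X u \<psi> (Suc i))"
    using cmp_assoc[OF p(4) p(1) cmp_arr[OF p(3,2)]] cmp_assoc[OF p(1,3,2)] by (simp add: auto_pow_Suc flip: c')
  finally show ?case .
qed

end

section \<open>Stack maps as functors\<close>

locale stack_morphism = X: spaces_category X + Y: spaces_category Y
  for X :: "('o, 'm, 'u) fibcat" and Y :: "('p, 'n, 'u) fibcat" +
  fixes F :: "('o, 'm, 'p, 'n) smap"
  assumes F: "stack_map X Y F"
begin

lemma onob_Ob: "u \<in> Ob X \<Longrightarrow> onob F u \<in> Ob Y"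
  and base_onob: "u \<in> Ob X \<Longrightarrow> base Y (onob F u) = base X u"
  and onar_ident: "u \<in> Ob X \<Longrightarrow> onar F (ident X u) = ident Y (onob F u)"
  using F by (auto simp: stack_map_def)

lemma onar_arr: "m \<in> arr X u v \<Longrightarrow> onar F m \<in> arr Y (onob F u) (onob F v)"
  and bmap_onar: "m \<in> arr X u v \<Longrightarrow> t \<in> topspace (base X u) \<Longrightarrow> bmap Y (onar F m) t = bmap X m t"
  and onar_cmp: "n \<in> arr X v w \<Longrightarrow> m \<in> arr X u v \<Longrightarrow> onar F (cmp X n m) = cmp Y (onar F n) (onar F m)"
  using F by (auto simp: stack_map_def)

lemma onar_autos: "u \<in> Ob X \<Longrightarrow> k \<in> autos X u \<Longrightarrow> onar F k \<in> autos Y (onob F u)"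
  by (auto simp: autos_def onar_arr bmap_onar base_onob)

lemma onar_auto_pow:
  assumes "u \<in> Ob X" "\<psi> \<in> autos X u"
  shows "onar F (auto_pow X u \<psi> i) = auto_pow Y (onob F u) (onar F \<psi>) i"
proof (induction i)
  case (Suc i)
  then show ?case
    using assms X.auto_pow_autos[OF assms, of i] by (simp add: auto_pow_Suc onar_cmp[of _ u u _ u] X.autos_arr)
qed (simp add: auto_pow_0 onar_ident assms)

end

section \<open>Powers of an object and points of the realization\<close>

text \<open>Existence makes the choices behind \<open>pow\<close> and \<open>prj\<close> genuine
  powers; it is obtained later from products, for atlases as well as for torsors.\<close>

locale powers = spaces_category +
  fixes a :: 'b
  assumes ex_power: "\<And>n. \<exists>w p. is_power X a n w p"
begin

lemma is_power_pow: "is_power X a n (pow X a n) (prj X a n)"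
proof -
  have "\<exists>z. case z of (w, p) \<Rightarrow> is_power X a n w p" using ex_power by simp
  then have "case (SOME z. case z of (w, p) \<Rightarrow> is_power X a n w p) of (w, p) \<Rightarrow> is_power X a n w p"
    by (rule someI_ex)
  then show ?thesis unfolding pow_def prj_def by (metis (no_types, lifting) case_prod_beta)
qed

lemma pow_Ob: "pow X a n \<in> Ob X"
  and prj_arr: "i \<le> n \<Longrightarrow> prj X a n i \<in> arr X (pow X a n) a"
  using is_power_pow by (auto simp: is_power_def)

lemma a_Ob: "a \<in> Ob X"
  using arr_Ob(2)[OF prj_arr[of 0 0]] by simp

lemma tuple_unique:
  assumes "x \<in> Ob X" "j \<in> arr X x (pow X a n)" "\<And>i. i \<le> n \<Longrightarrow> cmp X (prj X a n i) j = \<kappa> i"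
  shows "tuple X a n x \<kappa> = j"
proof -
  have "\<forall>i\<le>n. \<kappa> i \<in> arr X x a" using assms cmp_arr prj_arr by metis
  then have "\<exists>!j. j \<in> arr X x (pow X a n) \<and> (\<forall>i\<le>n. cmp X (prj X a n i) j = \<kappa> i)"
    using is_power_pow[of n] assms(1) by (simp add: is_power_def)
  then show ?thesis unfolding tuple_def using assms by (intro the1_equality) auto
qed

lemma tuple_props:
  assumes "x \<in> Ob X" "\<forall>i\<le>n. \<kappa> i \<in> arr X x a"
  shows tuple_arr: "tuple X a n x \<kappa> \<in> arr X x (pow X a n)"
    and prj_tuple: "i \<le> n \<Longrightarrow> cmp X (prj X a n i) (tuple X a n x \<kappa>) = \<kappa> i"
proof -
  have "\<exists>!j. j \<in> arr X x (pow X a n) \<and> (\<forall>i\<le>n. cmp X (prj X a n i) j = \<kappa> i)"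
    using is_power_pow[of n] assms by (simp add: is_power_def)
  then have "tuple X a n x \<kappa> \<in> arr X x (pow X a n) \<and>
      (\<forall>i\<le>n. cmp X (prj X a n i) (tuple X a n x \<kappa>) = \<kappa> i)"
    unfolding tuple_def by (rule theI')
  then show "tuple X a n x \<kappa> \<in> arr X x (pow X a n)"
    "i \<le> n \<Longrightarrow> cmp X (prj X a n i) (tuple X a n x \<kappa>) = \<kappa> i" by auto
qed

lemma tuple_cong: "(\<And>i. i \<le> n \<Longrightarrow> \<kappa> i = \<kappa>' i) \<Longrightarrow> tuple X a n x \<kappa> = tuple X a n x \<kappa>'"
  unfolding tuple_def by (rule arg_cong[of _ _ The]) (auto simp: fun_eq_iff)

lemma tuple_cmp:
  assumes m: "m \<in> arr X x' x" and \<kappa>: "\<forall>i\<le>n. \<kappa> i \<in> arr X x a"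
  shows "tuple X a n x' (\<lambda>i. cmp X (\<kappa> i) m) = cmp X (tuple X a n x \<kappa>) m"
proof (rule tuple_unique)
  have x: "x \<in> Ob X" using arr_Ob m by blast
  show "x' \<in> Ob X" using arr_Ob m by blast
  show "cmp X (tuple X a n x \<kappa>) m \<in> arr X x' (pow X a n)" using tuple_arr[OF x \<kappa>] m cmp_arr by blast
  show "cmp X (prj X a n i) (cmp X (tuple X a n x \<kappa>) m) = cmp X (\<kappa> i) m" if "i \<le> n" for i
    using cmp_assoc[OF prj_arr[OF that] tuple_arr[OF x \<kappa>] m] prj_tuple[OF x \<kappa> that] by simp
qed

lemma tuple_reindex:
  assumes x: "x \<in> Ob X" and \<kappa>: "\<forall>i\<le>n. \<kappa> i \<in> arr X x a" and \<theta>: "\<And>i. i \<le> m \<Longrightarrow> \<theta> i \<le> n"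
  shows "cmp X (tuple X a m (pow X a n) (\<lambda>i. prj X a n (\<theta> i))) (tuple X a n x \<kappa>)
    = tuple X a m x (\<lambda>i. \<kappa> (\<theta> i))"
proof -
  have "cmp X (tuple X a m (pow X a n) (\<lambda>i. prj X a n (\<theta> i))) (tuple X a n x \<kappa>)
      = tuple X a m x (\<lambda>i. cmp X (prj X a n (\<theta> i)) (tuple X a n x \<kappa>))"
    using tuple_cmp[OF tuple_arr[OF x \<kappa>], of m "\<lambda>i. prj X a n (\<theta> i)"] \<theta> prj_arr by simp
  also have "\<dots> = tuple X a m x (\<lambda>i. \<kappa> (\<theta> i))"
    using \<theta> prj_tuple[OF x \<kappa>] by (intro tuple_cong) auto
  finally show ?thesis .
qed

end

text \<open>Points of the realization are addressed by an object \<open>x\<close> with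
  \<open>n + 1\<close> arrows to the atlas and a point of its base, so that computations take place
  with arrows instead of points of the nerve.\<close>

definition tuple_point ::
  "('o, 'm, 'u) fibcat \<Rightarrow> 'o \<Rightarrow> nat \<Rightarrow> 'o \<Rightarrow> (nat \<Rightarrow> 'm) \<Rightarrow> 'u \<Rightarrow> (nat \<Rightarrow> real) \<Rightarrow> 'u rpoint" where
  "tuple_point X a n x \<kappa> z t = rpt X a n (bmap X (tuple X a n x \<kappa>) z) t"

lemma rpt_eqI:
  assumes "((n, x, t), (m, y, s)) \<in> realization_rel X a"
  shows "rpt X a n x t = rpt X a m y s"
proof -
  let ?S = "realization_rel X a \<union> (realization_rel X a)\<inverse>"
  have "((n, x, t), (m, y, s)) \<in> ?S\<^sup>*" "((m, y, s), (n, x, t)) \<in> ?S\<^sup>*" using assms by blast+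
  then show ?thesis unfolding rpt_def by (auto intro: rtrancl_trans)
qed

context powers
begin

text \<open>The defining relation of the realization, transported from the universal tuple on the
  power to an arbitrary tuple.\<close>

lemma tuple_point_push:
  assumes \<theta>: "mono_on {..m} \<theta>" "\<theta> ` {..m} \<subseteq> {..n}"
    and x: "x \<in> Ob X" and \<kappa>: "\<forall>i\<le>n. \<kappa> i \<in> arr X x a"
    and z: "z \<in> topspace (base X x)" and t: "t \<in> standard_simplex m"
  shows "tuple_point X a n x \<kappa> z (simplex_push m \<theta> t) = tuple_point X a m x (\<lambda>i. \<kappa> (\<theta> i)) z t"
proof -
  have \<theta>': "\<theta> i \<le> n" if "i \<le> m" for i using \<theta> that by auto
  let ?y = "bmap X (tuple X a n x \<kappa>) z"
  have "?y \<in> topspace (nerve X a n)"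
    using bmap_in[OF tuple_arr[OF x \<kappa>] z] by (simp add: nerve_def)
  then have "rpt X a n ?y (simplex_push m \<theta> t)
      = rpt X a m (bmap X (tuple X a m (pow X a n) (\<lambda>i. prj X a n (\<theta> i))) ?y) t"
    using \<theta> t by (intro rpt_eqI) (auto simp: realization_rel_def)
  also have "bmap X (tuple X a m (pow X a n) (\<lambda>i. prj X a n (\<theta> i))) ?y = bmap X (tuple X a m x (\<lambda>i. \<kappa> (\<theta> i))) z"
    using bmap_cmp[OF tuple_arr[OF pow_Ob] tuple_arr[OF x \<kappa>] z, of m "\<lambda>i. prj X a n (\<theta> i)"]
      tuple_reindex[OF x \<kappa>, of m \<theta>] prj_arr \<theta>' by simp
  finally show ?thesis by (simp add: tuple_point_def)
qed

text \<open>Applied to an automorphism of \<open>x\<close>, which fixes all points of the base, this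
  is the invariance that makes the vertex notation homogeneous.\<close>

lemma tuple_point_cmp:
  assumes "m \<in> arr X x' x" "\<forall>i\<le>n. \<kappa> i \<in> arr X x a" "z \<in> topspace (base X x')"
  shows "tuple_point X a n x' (\<lambda>i. cmp X (\<kappa> i) m) z t = tuple_point X a n x \<kappa> (bmap X m z) t"
  using tuple_cmp[OF assms(1,2)] bmap_cmp[OF tuple_arr[OF arr_Ob(2)[OF assms(1)]] assms(1,3), of n \<kappa>] assms(2)
  by (simp add: tuple_point_def)

lemma tuple_point_cong:
  "(\<And>i. i \<le> n \<Longrightarrow> \<kappa> i = \<kappa>' i) \<Longrightarrow> tuple_point X a n x \<kappa> z t = tuple_point X a n x \<kappa>' z t"
  by (simp add: tuple_point_def tuple_cong[of n \<kappa> \<kappa>' x])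

lemma tuple_point_face:
  assumes "k \<le> Suc n" and x: "x \<in> Ob X" and \<kappa>: "\<forall>i\<le>Suc n. \<kappa> i \<in> arr X x a"
    and z: "z \<in> topspace (base X x)" and t: "t \<in> standard_simplex n"
  shows "tuple_point X a (Suc n) x \<kappa> z (simplical_face k t)
    = tuple_point X a n x (\<lambda>i. \<kappa> (if i < k then i else Suc i)) z t"
proof -
  have "simplical_face k t = simplex_push n (\<lambda>i. if i < k then i else Suc i) t"
  proof
    fix j
    have "{i. i \<le> n \<and> (if i < k then i else Suc i) = j} =
        (if j < k then (if j \<le> n then {j} else {}) else if j = k then {}
         else if j - 1 \<le> n then {j - 1} else {})"
      by (auto split: if_splits)
    then show "simplical_face k t j = simplex_push n (\<lambda>i. if i < k then i else Suc i) t j"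
      using t assms(1) by (auto simp: simplex_push_def simplical_face_def standard_simplex_def)
  qed
  moreover have "mono_on {..n} (\<lambda>i. if i < k then i else Suc i)" by (auto simp: mono_on_def)
  moreover have "(\<lambda>i. if i < k then i else Suc i) ` {..n} \<subseteq> {..Suc n}" by auto
  ultimately show ?thesis
    using tuple_point_push[of n "\<lambda>i. if i < k then i else Suc i" "Suc n" x \<kappa> z t] x \<kappa> z t by simp
qed

text \<open>Vertices of weight zero do not matter: restrict to the face spanned by the other ones.\<close>

lemma tuple_point_support:
  assumes x: "x \<in> Ob X" and \<kappa>: "\<forall>i\<le>n. \<kappa> i \<in> arr X x a" "\<forall>i\<le>n. \<kappa>' i \<in> arr X x a"
    and z: "z \<in> topspace (base X x)" and t: "t \<in> standard_simplex n"
    and eq: "\<And>i. i \<le> n \<Longrightarrow> t i \<noteq> 0 \<Longrightarrow> \<kappa> i = \<kappa>' i"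
  shows "tuple_point X a n x \<kappa> z t = tuple_point X a n x \<kappa>' z t"
proof -
  define S where "S = {i. i \<le> n \<and> t i \<noteq> 0}"
  define L where "L = sorted_list_of_set S"
  have fin: "finite S" by (simp add: S_def)
  have sumt: "(\<Sum>i\<le>n. t i) = 1" using t by (simp add: standard_simplex_def)
  have "S \<noteq> {}" using sumt sum.neutral[of "{..n}" t] by (force simp: S_def)
  then have len: "length L = card S" "card S > 0" using fin by (auto simp: L_def card_gt_0_iff)
  define m where "m = card S - 1"
  define \<theta> where "\<theta> = (!) L"
  define s where "s i = (if i \<le> m then t (\<theta> i) else 0)" for i
  have L: "set L = S" "sorted L" "distinct L" using fin by (auto simp: L_def)
  have bij: "bij_betw \<theta> {..m} S"
    unfolding \<theta>_def by (rule bij_betw_nth[OF L(3)]) (use len L(1) in \<open>auto simp: m_def\<close>)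
  have \<theta>S: "\<theta> i \<in> S" if "i \<le> m" for i using bij that by (auto simp: bij_betw_def)
  have mono: "mono_on {..m} \<theta>"
    using L(2) len by (auto simp: mono_on_def \<theta>_def m_def intro!: sorted_nth_mono)
  have "(\<Sum>i\<le>m. s i) = (\<Sum>i\<le>m. t (\<theta> i))" by (simp add: s_def)
  also have "\<dots> = sum t S" using sum.reindex_bij_betw[OF bij] .
  also have "\<dots> = 1" unfolding sumt[symmetric] by (rule sum.mono_neutral_left) (auto simp: S_def)
  finally have "s \<in> standard_simplex m" using t by (auto simp: s_def standard_simplex_def)
  have push: "simplex_push m \<theta> s = t"
  proof
    fix j
    show "simplex_push m \<theta> s j = t j"
    proof (cases "j \<in> S")
      case True
      then obtain i where i: "i \<le> m" "\<theta> i = j" using bij by (auto simp: bij_betw_def)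
      then have "{i. i \<le> m \<and> \<theta> i = j} = {i}" using bij by (auto simp: bij_betw_def inj_on_def)
      then show ?thesis using i by (simp add: simplex_push_def s_def)
    next
      case False
      then have "{i. i \<le> m \<and> \<theta> i = j} = {}" using \<theta>S by auto
      then have "simplex_push m \<theta> s j = 0" unfolding simplex_push_def by (simp only: sum.empty)
      then show ?thesis using False t by (auto simp: S_def standard_simplex_def) 
    qed
  qed
  have sub: "\<theta> ` {..m} \<subseteq> {..n}" using \<theta>S by (auto simp: S_def)
  have "tuple_point X a m x (\<lambda>i. \<kappa> (\<theta> i)) z s = tuple_point X a m x (\<lambda>i. \<kappa>' (\<theta> i)) z s"
    using eq \<theta>S by (intro tuple_point_cong) (auto simp: S_def)
  then show ?thesis
    using tuple_point_push[OF mono sub x \<kappa>(1) z \<open>s \<in> _\<close>] tuple_point_push[OF mono sub x \<kappa>(2) z \<open>s \<in> _\<close>]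
    by (simp add: push)
qed

lemma continuous_rpt:
  assumes f: "continuous_map S (nerve X a n) f" and g: "continuous_map S (simplex_space n) g"
  shows "continuous_map S (realization X a) (\<lambda>s. rpt X a n (f s) (g s))"
proof -
  have "continuous_map S (prerealization X a) (\<lambda>s. (n, f s, g s))"
  proof -
    have "continuous_map (prod_topology (nerve X a n) (simplex_space n)) (prerealization X a) (\<lambda>y. (n, y))"
      unfolding prerealization_def by (rule continuous_map_component_injection) simp
    from continuous_map_compose[OF _ this, of S "\<lambda>s. (f s, g s)"] f g show ?thesis
      by (simp add: continuous_map_pairwise o_def)
  qed
  from continuous_map_compose[OF this, of "realization X a" "\<lambda>(n, x, t). rpt X a n x t"]
  show ?thesis
    using quotient_imp_continuous_map[OF quotient_map_quotient_topology[of "prerealization X a"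
          "\<lambda>(n, x, t). rpt X a n x t"]]
    by (simp add: realization_def o_def)
qed

lemma continuous_tuple_point:
  assumes "x \<in> Ob X" "\<forall>i\<le>n. \<kappa> i \<in> arr X x a"
    "continuous_map S (base X x) f" "continuous_map S (simplex_space n) g"
  shows "continuous_map S (realization X a) (\<lambda>s. tuple_point X a n x \<kappa> (f s) (g s))"
  unfolding tuple_point_def
  by (rule continuous_rpt[OF continuous_map_compose[OF assms(3), unfolded o_def] assms(4)])
    (simp add: nerve_def continuous_bmap tuple_arr assms)

lemma singular_simplex_tuple_point:
  assumes "x \<in> Ob X" "\<forall>i\<le>n. \<kappa> i \<in> arr X x a" "continuous_map (simplex_space n) (base X x) f"
  shows "singular_simplex n (realization X a)
    (restrict (\<lambda>t. tuple_point X a n x \<kappa> (f t) t) (standard_simplex n))"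
proof -
  have "continuous_map (simplex_space n) (realization X a) (\<lambda>t. tuple_point X a n x \<kappa> (f t) t)"
    using assms by (intro continuous_tuple_point) (auto simp: continuous_map_id[unfolded id_def])
  then show ?thesis
    unfolding singular_simplex_def simplex_space_def
    by (auto intro: continuous_map_eq)
qed

end

section \<open>Maps of realizations induced by stack maps\<close>

locale realization_morphism = stack_morphism + X: powers X a + Y: powers Y b for a b +
  fixes k
  assumes k: "k \<in> arr Y (onob F a) b"
begin

text \<open>\<open>realization_map\<close> evaluates a formula at an arbitrary representative. The
  formula respects the relation that generates the equivalence, so the given tuple may serve as the
  representative.\<close>

lemma realization_map_tuple_point:
  assumes x: "x \<in> Ob X" and \<kappa>: "\<forall>i\<le>n. \<kappa> i \<in> arr X x a" and z: "z \<in> topspace (base X x)"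
  shows "realization_map X a Y b F k (tuple_point X a n x \<kappa> z t)
    = tuple_point Y b n (onob F x) (\<lambda>i. cmp Y k (onar F (\<kappa> i))) z t"
proof -
  define g where "g = (\<lambda>(n, x, t). tuple_point Y b n (onob F (pow X a n)) (\<lambda>i. cmp Y k (onar F (prj X a n i))) x t)"
  have kprj: "cmp Y k (onar F (prj X a n i)) \<in> arr Y (onob F (pow X a n)) b" if "i \<le> n" for n i
    using that X.prj_arr onar_arr k Y.cmp_arr by blast
  then have kprj': "\<forall>i\<le>n. cmp Y k (onar F (prj X a n i)) \<in> arr Y (onob F (pow X a n)) b" for n by simp
  have g: "g p = g q" if "(p, q) \<in> realization_rel X a" for p q
  proof -
    from that obtain m n \<theta> x t where p: "p = (n, x, simplex_push m \<theta> t)"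
      "q = (m, bmap X (tuple X a m (pow X a n) (\<lambda>i. prj X a n (\<theta> i))) x, t)"
      and \<theta>: "mono_on {..m} \<theta>" "\<theta> ` {..m} \<subseteq> {..n}" and x: "x \<in> topspace (base X (pow X a n))"
      and t: "t \<in> standard_simplex m"
      by (auto simp: realization_rel_def nerve_def)
    let ?\<tau> = "tuple X a m (pow X a n) (\<lambda>i. prj X a n (\<theta> i))"
    have \<tau>: "?\<tau> \<in> arr X (pow X a n) (pow X a m)"
      using \<theta> X.prj_arr by (intro X.tuple_arr X.pow_Ob) auto
    have x': "x \<in> topspace (base Y (onob F (pow X a n)))" using x by (simp add: base_onob X.pow_Ob)
    have "g p = tuple_point Y b m (onob F (pow X a n)) (\<lambda>i. cmp Y k (onar F (prj X a n (\<theta> i)))) x t"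
      unfolding p g_def prod.case
      by (rule Y.tuple_point_push[OF \<theta> onob_Ob[OF X.pow_Ob] kprj' x' t])
    also have "\<dots> = tuple_point Y b m (onob F (pow X a n))
        (\<lambda>i. cmp Y (cmp Y k (onar F (prj X a m i))) (onar F ?\<tau>)) x t"
    proof (rule Y.tuple_point_cong)
      fix i assume i: "i \<le> m"
      have "cmp X (prj X a m i) ?\<tau> = prj X a n (\<theta> i)"
        using \<theta> i X.prj_arr by (intro X.prj_tuple X.pow_Ob) auto
      then show "cmp Y k (onar F (prj X a n (\<theta> i))) = cmp Y (cmp Y k (onar F (prj X a m i))) (onar F ?\<tau>)"
        using onar_cmp[OF X.prj_arr[OF i] \<tau>] Y.cmp_assoc[OF k onar_arr[OF X.prj_arr[OF i]] onar_arr[OF \<tau>]]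
        by simp
    qed
    also have "\<dots> = tuple_point Y b m (onob F (pow X a m)) (\<lambda>i. cmp Y k (onar F (prj X a m i)))
        (bmap Y (onar F ?\<tau>) x) t"
      by (rule Y.tuple_point_cmp[OF onar_arr[OF \<tau>] kprj' x'])
    also have "\<dots> = g q"
      unfolding p g_def prod.case using bmap_onar[OF \<tau> x] by simp
    finally show ?thesis .
  qed
  have g': "g p = g q" if "(p, q) \<in> (realization_rel X a \<union> (realization_rel X a)\<inverse>)\<^sup>*" for p q
    using that by (induction rule: rtrancl_induct) (use g in force)+
  let ?p = "(n, bmap X (tuple X a n x \<kappa>) z, t)"
  let ?\<xi> = "tuple_point X a n x \<kappa> z t"
  have "?p \<in> ?\<xi>" by (simp add: tuple_point_def rpt_def)
  then have "(SOME y. y \<in> ?\<xi>) \<in> ?\<xi>" by (rule someI)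
  then have "g (SOME y. y \<in> ?\<xi>) = g ?p" using g'[of ?p] by (simp add: tuple_point_def rpt_def)
  moreover have "realization_map X a Y b F k ?\<xi> = g (SOME y. y \<in> ?\<xi>)"
    by (simp add: realization_map_def g_def tuple_point_def)
  moreover have "g ?p = tuple_point Y b n (onob F x) (\<lambda>i. cmp Y k (onar F (\<kappa> i))) z t"
  proof -
    let ?\<tau> = "tuple X a n x \<kappa>"
    have \<tau>: "?\<tau> \<in> arr X x (pow X a n)" using x \<kappa> by (rule X.tuple_arr)
    have "g ?p = tuple_point Y b n (onob F (pow X a n)) (\<lambda>i. cmp Y k (onar F (prj X a n i))) (bmap Y (onar F ?\<tau>) z) t"
      using bmap_onar[OF \<tau> z] by (simp add: g_def)
    also have "\<dots> = tuple_point Y b n (onob F x)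
        (\<lambda>i. cmp Y (cmp Y k (onar F (prj X a n i))) (onar F ?\<tau>)) z t"
      using z by (intro Y.tuple_point_cmp[OF onar_arr[OF \<tau>] kprj', symmetric]) (auto simp: base_onob x)
    also have "\<dots> = tuple_point Y b n (onob F x) (\<lambda>i. cmp Y k (onar F (\<kappa> i))) z t"
    proof (rule Y.tuple_point_cong)
      fix i assume i: "i \<le> n"
      then show "cmp Y (cmp Y k (onar F (prj X a n i))) (onar F ?\<tau>) = cmp Y k (onar F (\<kappa> i))"
        using onar_cmp[OF X.prj_arr[OF i] \<tau>] Y.cmp_assoc[OF k onar_arr[OF X.prj_arr[OF i]] onar_arr[OF \<tau>]]
          X.prj_tuple[OF x \<kappa> i] by simp
    qed
    finally show ?thesis .
  qed
  ultimately show ?thesis by simp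
qed

end

section \<open>Simplices spanned by lists of vertices\<close>

text \<open>A vertex consists of an exponent, a chart and a real parameter; the parameter enters
  through the position \<open>y\<close> in \<open>vertex_simplex\<close>.\<close>

definition vertex_arrow :: "('o, 'm, 'u) fibcat \<Rightarrow> 'o \<Rightarrow> ('c \<Rightarrow> 'm) \<Rightarrow> 'm \<Rightarrow> nat \<times> 'c \<times> real \<Rightarrow> 'm" where
  "vertex_arrow X x \<kappa> \<psi> = (\<lambda>(i, c, r). cmp X (\<kappa> c) (auto_pow X x \<psi> i))"

text \<open>
  The simplex with vertices \<open>(i, c, r)\<close>: its point with barycentric coordinates \<open>t\<close> lies over the point \<open>y (\<Sum> t r)\<close>
  of the base of \<open>x\<close>, and the vertices are given by the arrows \<open>\<kappa> c \<circ> \<psi>\<^sup>i\<close> to the atlas.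
\<close>

definition vertex_simplex ::
  "('o, 'm, 'u) fibcat \<Rightarrow> 'o \<Rightarrow> 'o \<Rightarrow> ('c \<Rightarrow> 'm) \<Rightarrow> 'm \<Rightarrow> (real \<Rightarrow> 'u) \<Rightarrow> (nat \<times> 'c \<times> real) list
     \<Rightarrow> (nat \<Rightarrow> real) \<Rightarrow> 'u rpoint" where
  "vertex_simplex X a x \<kappa> \<psi> y vs = restrict
     (\<lambda>t. tuple_point X a (length vs - 1) x (\<lambda>j. vertex_arrow X x \<kappa> \<psi> (vs ! j))
        (y (\<Sum>j<length vs. t j * snd (snd (vs ! j)))) t)
     (standard_simplex (length vs - 1))"

lemma sum_simplical_face:
  fixes t f :: "nat \<Rightarrow> real"
  assumes "k \<le> m"
  shows "(\<Sum>j<Suc m. simplical_face k t j * f j) = (\<Sum>j<m. t j * f (if j < k then j else Suc j))"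
  using assms
proof (induction m)
  case 0
  then show ?case by (simp add: simplical_face_def)
next
  case (Suc m)
  show ?case
  proof (cases "k = Suc m")
    case True
    then show ?thesis by (simp add: simplical_face_def)
  next
    case False
    then have "k \<le> m" using Suc by simp
    then show ?thesis
      using Suc.IH by (simp add: simplical_face_def)
  qed
qed

lemma continuous_map_simplex_sum:
  "continuous_map (simplex_space n) euclideanreal (\<lambda>t. \<Sum>j\<in>A. t j * f j)" if "finite A"
proof -
  have "continuous_map (simplex_space n) euclideanreal (\<lambda>t. t j)" for j
    unfolding simplex_space_def
    by (intro continuous_map_from_subtopology continuous_map_product_projection) simp
  then show ?thesis using that
    by (intro continuous_map_sum continuous_map_real_mult) auto
qed

locale vertex_family = powers X a for X :: "('o, 'm, 'u) fibcat" and a +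
  fixes x and \<kappa> :: "'c \<Rightarrow> 'm" and \<psi> y
  assumes \<psi>: "\<psi> \<in> autos X x"
    and \<kappa>: "\<kappa> c \<in> arr X x a"
    and y: "continuous_map euclideanreal (base X x) y"
begin

abbreviation vsimp where "vsimp \<equiv> vertex_simplex X a x \<kappa> \<psi> y"

lemma x: "x \<in> Ob X"
  using \<kappa> arr_Ob by blast

lemma vertex_arrow_arr: "vertex_arrow X x \<kappa> \<psi> v \<in> arr X x a"
  using \<kappa> auto_pow_autos[OF x \<psi>] by (auto simp: vertex_arrow_def intro: cmp_arr autos_arr split: prod.split)

lemma y_in: "y r \<in> topspace (base X x)"
  using y by (auto simp: continuous_map_def)

lemma singular_vsimp:
  "singular_simplex (length vs - 1) (realization X a) (vsimp vs)"
  unfolding vertex_simplex_def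
  using x vertex_arrow_arr continuous_map_compose[OF continuous_map_simplex_sum y]
  by (intro singular_simplex_tuple_point) (auto simp: o_def)

text \<open>The parameter of the base point is linear in the barycentric coordinates, so passing to
  a face merely deletes a vertex from the list.\<close>

lemma face_vsimp:
  assumes len: "length vs = Suc (Suc n)" and k: "k \<le> Suc n"
  shows "singular_face (Suc n) k (vsimp vs) = vsimp (take k vs @ drop (Suc k) vs)"
proof
  fix t
  let ?ws = "take k vs @ drop (Suc k) vs"
  have nth: "?ws ! j = vs ! (if j < k then j else Suc j)" if "j \<le> n" for j
    using that len k by (auto simp: nth_append min_def)
  have lenw: "length ?ws = Suc n" using len k by simp
  show "singular_face (Suc n) k (vsimp vs) t = vsimp ?ws t"
  proof (cases "t \<in> standard_simplex n")
    case True
    have "simplical_face k t \<in> standard_simplex (Suc n)"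
      using simplical_face_in_standard_simplex[of "Suc n" k t] True k by simp
    then have "singular_face (Suc n) k (vsimp vs) t
        = tuple_point X a (Suc n) x (\<lambda>j. vertex_arrow X x \<kappa> \<psi> (vs ! j))
            (y (\<Sum>j<Suc (Suc n). simplical_face k t j * snd (snd (vs ! j)))) (simplical_face k t)"
      using True by (simp add: singular_face_def vertex_simplex_def len)
    also have "\<dots> = tuple_point X a n x (\<lambda>j. vertex_arrow X x \<kappa> \<psi> (vs ! (if j < k then j else Suc j)))
            (y (\<Sum>j<Suc n. t j * snd (snd (vs ! (if j < k then j else Suc j))))) t"
      unfolding sum_simplical_face[OF k]
      using x vertex_arrow_arr y_in True k by (intro tuple_point_face) auto
    also have "\<dots> = tuple_point X a n x (\<lambda>j. vertex_arrow X x \<kappa> \<psi> (?ws ! j))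
            (y (\<Sum>j<Suc n. t j * snd (snd (?ws ! j)))) t"
    proof -
      have "(\<Sum>j<Suc n. t j * snd (snd (vs ! (if j < k then j else Suc j)))) = (\<Sum>j<Suc n. t j * snd (snd (?ws ! j)))"
        by (intro sum.cong refl) (simp only: nth lessThan_iff less_Suc_eq_le)
      then show ?thesis by (simp only:) (rule tuple_point_cong, simp only: nth)
    qed
    finally show ?thesis using True lenw by (simp add: vertex_simplex_def)
  next
    case False
    then show ?thesis using lenw by (simp add: singular_face_def vertex_simplex_def)
  qed
qed

lemma coboundary_vsimp:
  assumes "length vs = Suc (Suc n)"
  shows "coboundary n c (vsimp vs) = list_coboundary (\<lambda>ws. c (vsimp ws)) vs"
  unfolding coboundary_def list_coboundary_def assms
  by (intro sum.cong) (auto simp: face_vsimp[OF assms])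

text \<open>Raising every exponent precomposes all arrows with \<open>\<psi>\<close>, and
  \<open>\<psi>\<close> fixes the points of the base.\<close>

lemma vsimp_shift: "vsimp (shift_vertices vs) = vsimp vs"
proof (cases "vs = []")
  case False
  then have nth: "shift_vertices vs ! j = (case vs ! j of (i, p) \<Rightarrow> (Suc i, p))" if "j \<le> length vs - 1" for j
    using that nth_map[of j vs] by (cases vs) (auto simp: shift_vertices_def simp del: list.map nth_Cons_Suc)
  have len: "length (shift_vertices vs) = length vs" by (simp add: shift_vertices_def)
  have s: "(\<Sum>j<length vs. t j * snd (snd (shift_vertices vs ! j))) = (\<Sum>j<length vs. t j * snd (snd (vs ! j)))"
    for t :: "nat \<Rightarrow> real"
    by (intro sum.cong) (auto simp: nth split: prod.split)
  have a: "vertex_arrow X x \<kappa> \<psi> (shift_vertices vs ! j) = cmp X (vertex_arrow X x \<kappa> \<psi> (vs ! j)) \<psi>"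
    if "j \<le> length vs - 1" for j
    unfolding nth[OF that] vertex_arrow_def
    using cmp_assoc[OF \<kappa> autos_arr[OF auto_pow_autos[OF x \<psi>]] autos_arr[OF \<psi>]]
    by (simp add: auto_pow_Suc_right x \<psi> split: prod.split)
  have t: "tuple_point X a (length vs - 1) x (\<lambda>j. vertex_arrow X x \<kappa> \<psi> (shift_vertices vs ! j)) (y r) t
      = tuple_point X a (length vs - 1) x (\<lambda>j. vertex_arrow X x \<kappa> \<psi> (vs ! j)) (y r) t" for r t
    using tuple_point_cong[OF a] tuple_point_cmp[OF autos_arr[OF \<psi>], of "length vs - 1"
        "\<lambda>j. vertex_arrow X x \<kappa> \<psi> (vs ! j)" "y r" t]
    by (simp add: vertex_arrow_arr y_in bmap_autos[OF \<psi>])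
  show ?thesis unfolding vertex_simplex_def len s t ..
qed (simp add: shift_vertices_def)

lemma vsimp_congruent:
  assumes n: "auto_pow X x \<psi> n = ident X x" and c: "congruent_vertices n vs ws"
  shows "vsimp vs = vsimp ws"
proof -
  have mult: "auto_pow X x \<psi> (n * k) = ident X x" for k
    by (induction k) (simp_all add: auto_pow_0 auto_pow_add x \<psi> n cmp_ident(1)[OF ident_arr])
  have p: "auto_pow X x \<psi> i = auto_pow X x \<psi> (i mod n)" for i
    using auto_pow_add[OF x \<psi>, of "n * (i div n)" "i mod n"]
      cmp_ident(2)[OF autos_arr[OF auto_pow_autos[OF x \<psi>]]] by (simp add: mult)
  have len: "length vs = length ws"
    using c by (auto simp: congruent_vertices_def list_all2_lengthD)
  have nth: "fst (vs ! j) mod n = fst (ws ! j) mod n \<and> snd (vs ! j) = snd (ws ! j)" if "j < length vs" for j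
    using list_all2_nthD[OF c[unfolded congruent_vertices_def] that] by (auto split: prod.splits)
  show ?thesis
  proof (cases "vs = []")
    case False
    have "vertex_arrow X x \<kappa> \<psi> (vs ! j) = vertex_arrow X x \<kappa> \<psi> (ws ! j)" if "j \<le> length vs - 1" for j
    proof -
      have "j < length vs" using that False by (cases vs) auto
      then show ?thesis
        using nth[of j] p[of "fst (vs ! j)"] p[of "fst (ws ! j)"]
        by (simp add: vertex_arrow_def case_prod_beta)
    qed
    then have "tuple_point X a (length vs - 1) x (\<lambda>j. vertex_arrow X x \<kappa> \<psi> (vs ! j)) z t
        = tuple_point X a (length vs - 1) x (\<lambda>j. vertex_arrow X x \<kappa> \<psi> (ws ! j)) z t" for z t
      by (rule tuple_point_cong)
    moreover have "(\<Sum>j<length vs. t j * snd (snd (vs ! j))) = (\<Sum>j<length vs. t j * snd (snd (ws ! j)))"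
      for t :: "nat \<Rightarrow> real"
      using nth by (intro sum.cong) auto
    ultimately show ?thesis
      unfolding vertex_simplex_def len[symmetric] by simp
  qed (use len in auto)
qed

lemma cyclic_cochain_vsimp:
  "auto_pow X x \<psi> n = ident X x \<Longrightarrow> cyclic_cochain n (\<lambda>vs. c (vsimp vs))"
  unfolding cyclic_cochain_def by (auto simp: vsimp_shift intro!: arg_cong[of _ _ c] vsimp_congruent)

text \<open>The powers of \<open>\<psi>\<close> pull back along \<open>m\<close> to the powers of
  \<open>\<psi>'\<close>, so a simplex may be computed over any object that maps compatibly to
  \<open>x\<close>.\<close>

lemma vsimp_pullback:
  assumes m: "m \<in> arr X x' x" and \<psi>': "\<psi>' \<in> autos X x'" and eq: "cmp X \<psi> m = cmp X m \<psi>'"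
    and y': "\<And>r. y' r \<in> topspace (base X x')" "\<And>r. bmap X m (y' r) = y r"
    and \<kappa>': "\<And>c. \<kappa>' c = cmp X (\<kappa> c) m"
  shows "vertex_simplex X a x' \<kappa>' \<psi>' y' vs = vsimp vs"
proof -
  have "vertex_arrow X x' \<kappa>' \<psi>' v = cmp X (vertex_arrow X x \<kappa> \<psi> v) m" for v
  proof -
    obtain i c r where v: "v = (i, c, r)" by (cases v)
    have x': "x' \<in> Ob X" using m arr_Ob by blast
    have "cmp X (cmp X (\<kappa> c) m) (auto_pow X x' \<psi>' i) = cmp X (\<kappa> c) (cmp X (auto_pow X x \<psi> i) m)"
      using cmp_assoc[OF \<kappa> m autos_arr[OF auto_pow_autos[OF x' \<psi>']]] auto_pow_commute[OF m \<psi>' \<psi> eq] by simp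
    also have "\<dots> = cmp X (cmp X (\<kappa> c) (auto_pow X x \<psi> i)) m"
      using cmp_assoc[OF \<kappa> autos_arr[OF auto_pow_autos[OF x \<psi>]] m] by simp
    finally show ?thesis by (simp add: vertex_arrow_def v \<kappa>')
  qed
  then show ?thesis
    unfolding vertex_simplex_def using tuple_point_cmp[OF m] vertex_arrow_arr y' by simp
qed

text \<open>Both vertices have the same arrow, so the edge is degenerate in the nerve direction and
  only the base point moves; this is the form of \<open>fibre_loop\<close>.\<close>

lemma vsimp_fibre_edge:
  assumes "t \<in> standard_simplex 1"
  shows "vsimp [(0, c, r), (0, c, s)] t = vertex X a (bmap X (\<kappa> c) (y (t 0 * r + t 1 * s)))"
proof -
  let ?z = "y (t 0 * r + t 1 * s)"
  have *: "vertex_arrow X x \<kappa> \<psi> ([(0, c, r), (0, c, s)] ! j) = \<kappa> c" if "j \<le> 1" for j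
    using that cmp_ident(1)[OF \<kappa>] by (auto simp: vertex_arrow_def auto_pow_0 le_Suc_eq)
  have push: "simplex_push 1 (\<lambda>_. 0) t = (\<lambda>i. if i = 0 then 1 else 0)"
    using assms by (auto simp: simplex_push_def standard_simplex_def atMost_def[symmetric])
  have im: "(\<lambda>_. 0) ` {..1::nat} \<subseteq> {..0::nat}" by auto
  have "vsimp [(0, c, r), (0, c, s)] t = tuple_point X a 1 x (\<lambda>j. \<kappa> c) ?z t"
    using tuple_point_cong[of 1, OF *] assms by (simp add: vertex_simplex_def)
  also have "\<dots> = tuple_point X a 0 x (\<lambda>j. \<kappa> c) ?z (\<lambda>i. if i = 0 then 1 else 0)"
    using tuple_point_push[OF _ im x _ y_in assms, of "\<lambda>_. \<kappa> c"] \<kappa> unfolding push by (simp add: mono_on_def)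
  also have "\<dots> = tuple_point X a 0 x (\<lambda>j. cmp X (ident X a) (\<kappa> c)) ?z (\<lambda>i. if i = 0 then 1 else 0)"
    using cmp_ident(2)[OF \<kappa>] by simp
  also have "\<dots> = tuple_point X a 0 a (\<lambda>j. ident X a) (bmap X (\<kappa> c) ?z) (\<lambda>i. if i = 0 then 1 else 0)"
    using \<kappa> y_in ident_arr[OF a_Ob] by (intro tuple_point_cmp) auto
  finally show ?thesis by (simp add: vertex_def tuple_point_def)
qed

end

context realization_morphism
begin

lemma simplex_map_vertex_simplex:
  assumes "vertex_family X a x \<kappa> \<psi> y"
  shows "simplex_map (length vs - 1) (realization_map X a Y b F k) (vertex_simplex X a x \<kappa> \<psi> y vs)
    = vertex_simplex Y b (onob F x) (\<lambda>c. cmp Y k (onar F (\<kappa> c))) (onar F \<psi>) y vs"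
proof -
  interpret vertex_family X a x \<kappa> \<psi> y by fact
  have "cmp Y k (onar F (vertex_arrow X x \<kappa> \<psi> v))
      = vertex_arrow Y (onob F x) (\<lambda>c. cmp Y k (onar F (\<kappa> c))) (onar F \<psi>) v" for v
  proof -
    obtain i c r where v: "v = (i, c, r)" by (cases v)
    have p: "auto_pow X x \<psi> i \<in> arr X x x" using X.auto_pow_autos[OF x \<psi>] X.autos_arr by blast
    show ?thesis
      using onar_cmp[OF \<kappa>[of c] p] Y.cmp_assoc[OF k onar_arr[OF \<kappa>[of c]] onar_arr[OF p]]
      by (simp add: vertex_arrow_def v onar_auto_pow x \<psi>)
  qed
  then show ?thesis
    unfolding simplex_map_def vertex_simplex_def
    by (intro restrict_ext) (simp add: realization_map_tuple_point x vertex_arrow_arr y_in)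
qed

lemma vertex_family_image:
  assumes "vertex_family X a x \<kappa> \<psi> y"
  shows "vertex_family Y b (onob F x) (\<lambda>c. cmp Y k (onar F (\<kappa> c))) (onar F \<psi>) y"
proof -
  interpret vertex_family X a x \<kappa> \<psi> y by fact
  show ?thesis
    using x \<kappa> \<psi> y by unfold_locales (auto simp: onar_autos base_onob intro: Y.cmp_arr k onar_arr)
qed

end

section \<open>Rotated simplices\<close>

definition group_weight :: "(nat \<times> real) list \<Rightarrow> (nat \<Rightarrow> real) \<Rightarrow> nat \<Rightarrow> real" where
  "group_weight vs t i = (\<Sum>j<length vs. t j * (if fst (vs ! j) = i then 1 else 0))"

definition group_moment :: "(nat \<times> real) list \<Rightarrow> (nat \<Rightarrow> real) \<Rightarrow> nat \<Rightarrow> real" where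
  "group_moment vs t i = (\<Sum>j<length vs. t j * (if fst (vs ! j) = i then snd (vs ! j) else 0))"

text \<open>Vertices with equal exponent share one rotation angle, the mean of their angles. Moving
  the weight from one of them to another sweeps through the angles in between, which is how a
  simplex can wind around the circle. A group without weight defaults to the angle of the vertex
  itself.\<close>

definition group_mean :: "(nat \<times> real) list \<Rightarrow> (nat \<Rightarrow> real) \<Rightarrow> nat \<times> real \<Rightarrow> real" where
  "group_mean vs t v = (if group_weight vs t (fst v) = 0 then snd v
     else group_moment vs t (fst v) / group_weight vs t (fst v))"

lemma group_weight_nonneg: "t \<in> standard_simplex n \<Longrightarrow> 0 \<le> group_weight vs t i"
  unfolding group_weight_def by (intro sum_nonneg) (auto simp: standard_simplex_def)

lemma group_weight_pos:
  assumes "t \<in> standard_simplex n" "j < length vs" "t j \<noteq> 0"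
  shows "group_weight vs t (fst (vs ! j)) > 0"
proof -
  have "0 < t j * (if fst (vs ! j) = fst (vs ! j) then 1 else 0)"
    using assms by (auto simp: standard_simplex_def less_le)
  also have "\<dots> \<le> group_weight vs t (fst (vs ! j))"
    unfolding group_weight_def
    by (rule member_le_sum[of j "{..<length vs}" "\<lambda>k. t k * (if fst (vs ! k) = fst (vs ! j) then 1 else 0)"])
      (use assms in \<open>auto simp: standard_simplex_def\<close>)
  finally show ?thesis .
qed

lemma group_mean_const:
  assumes "\<And>w. w \<in> set vs \<Longrightarrow> fst w = fst v \<Longrightarrow> snd w = snd v"
  shows "group_mean vs t v = snd v"
proof -
  have "group_moment vs t (fst v) = snd v * group_weight vs t (fst v)"
    unfolding group_moment_def group_weight_def sum_distrib_left
    by (intro sum.cong) (auto simp: assms)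
  then show ?thesis by (simp add: group_mean_def)
qed

lemma group_mean_bounded:
  assumes t: "t \<in> standard_simplex n" and M: "\<And>w. w \<in> set vs \<Longrightarrow> \<bar>snd w\<bar> \<le> M" and v: "v \<in> set vs"
  shows "\<bar>group_mean vs t v\<bar> \<le> M"
proof (cases "group_weight vs t (fst v) = 0")
  case False
  then have pos: "group_weight vs t (fst v) > 0" using group_weight_nonneg[OF t, of vs "fst v"] by simp
  have "\<bar>group_moment vs t (fst v)\<bar> \<le> (\<Sum>j<length vs. M * (t j * (if fst (vs ! j) = fst v then 1 else 0)))"
    unfolding group_moment_def
  proof (rule order_trans[OF sum_abs sum_mono])
    fix j assume j: "j \<in> {..<length vs}"
    have "0 \<le> t j" using t by (simp add: standard_simplex_def)
    moreover have "\<bar>snd (vs ! j)\<bar> \<le> M" using M j by auto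
    ultimately show "\<bar>t j * (if fst (vs ! j) = fst v then snd (vs ! j) else 0)\<bar>
        \<le> M * (t j * (if fst (vs ! j) = fst v then 1 else 0))"
      using mult_left_mono[of "\<bar>snd (vs ! j)\<bar>" M "t j"] by (auto simp: abs_mult mult.commute)
  qed
  also have "\<dots> = M * group_weight vs t (fst v)" by (simp add: group_weight_def sum_distrib_left)
  finally show ?thesis using pos by (simp add: group_mean_def field_simps)
qed (use M v in \<open>simp add: group_mean_def\<close>)

lemma group_mean_face:
  assumes len: "length vs = Suc (Suc n)" and k: "k \<le> Suc n"
  shows "group_mean vs (simplical_face k t) v = group_mean (take k vs @ drop (Suc k) vs) t v"
proof -
  let ?ws = "take k vs @ drop (Suc k) vs"
  have nth: "?ws ! j = vs ! (if j < k then j else Suc j)" if "j \<le> n" for j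
    using that len k by (auto simp: nth_append min_def)
  have lenw: "length ?ws = Suc n" using len k by simp
  have w: "group_weight vs (simplical_face k t) i = group_weight ?ws t i" for i
    unfolding group_weight_def len lenw sum_simplical_face[OF k]
    by (intro sum.cong refl) (simp only: nth lessThan_iff less_Suc_eq_le)
  have m: "group_moment vs (simplical_face k t) i = group_moment ?ws t i" for i
    unfolding group_moment_def len lenw sum_simplical_face[OF k]
    by (intro sum.cong refl) (simp only: nth lessThan_iff less_Suc_eq_le)
  show ?thesis by (simp add: group_mean_def w m)
qed

lemma group_mean_shift:
  "group_mean (map (\<lambda>(i, s). (i + k, s + r)) vs) t (i + k, s + r) = group_mean vs t (i, s) + r"
proof -
  have w: "group_weight (map (\<lambda>(i, s). (i + k, s + r)) vs) t (i + k) = group_weight vs t i"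
    unfolding group_weight_def length_map by (intro sum.cong) (auto simp: case_prod_beta)
  have m: "group_moment (map (\<lambda>(i, s). (i + k, s + r)) vs) t (i + k)
      = group_moment vs t i + r * group_weight vs t i"
    unfolding group_moment_def group_weight_def length_map sum_distrib_left sum.distrib[symmetric]
    by (intro sum.cong) (auto simp: case_prod_beta algebra_simps)
  show ?thesis by (simp add: group_mean_def w m add_divide_distrib)
qed

text \<open>
  Where the weight of a group vanishes, its mean jumps, but the corresponding vertices do not matter.
  So continuity is shown on the closure of the graph of the means, which is compact over the simplex.
\<close>

lemma continuous_map_group_mean:
  fixes f :: "(nat \<Rightarrow> real) \<Rightarrow> (nat \<Rightarrow> real) \<Rightarrow> 'y"
  assumes len: "length vs = Suc n"
    and cont: "continuous_map (prod_topology (simplex_space n) (powertop_real UNIV)) Y (\<lambda>(t, \<Theta>). f t \<Theta>)"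
    and supp: "\<And>t \<Theta> \<Theta>'. t \<in> standard_simplex n \<Longrightarrow> (\<And>j. j \<le> n \<Longrightarrow> t j \<noteq> 0 \<Longrightarrow> \<Theta> j = \<Theta>' j) \<Longrightarrow> f t \<Theta> = f t \<Theta>'"
  shows "continuous_map (simplex_space n) Y (\<lambda>t. f t (\<lambda>j. group_mean vs t (vs ! j)))"
proof -
  define M where "M = Max ((\<lambda>v. \<bar>snd v\<bar>) ` set vs)"
  have M: "\<bar>snd w\<bar> \<le> M" if "w \<in> set vs" for w unfolding M_def using that by (intro Max_ge) auto
  have M0: "M \<ge> 0" using M[of "vs ! 0"] len by (metis abs_ge_zero order_trans nth_mem zero_less_Suc)
  define K :: "(nat \<Rightarrow> real) topology" where "K = subtopology (powertop_real UNIV) (UNIV \<rightarrow>\<^sub>E {-M..M})"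
  \<comment> \<open>The equation of the mean, cleared of its denominator: it is a closed condition
    and leaves the angles of a weightless group free.\<close>
  define R where "R = {p \<in> topspace (prod_topology (simplex_space n) K).
     \<forall>j\<le>n. snd p j * group_weight vs (fst p) (fst (vs ! j)) = group_moment vs (fst p) (fst (vs ! j))}"
  have K: "compact_space K" unfolding K_def
    by (intro compact_space_subtopology) (simp add: compactin_PiE)
  have cw: "continuous_map (simplex_space n) euclideanreal (\<lambda>t. group_weight vs t i)"
    "continuous_map (simplex_space n) euclideanreal (\<lambda>t. group_moment vs t i)" for i
    unfolding group_weight_def group_moment_def by (intro continuous_map_simplex_sum; simp)+
  have pK: "continuous_map K euclideanreal (\<lambda>\<Theta>. \<Theta> j)" for j
    unfolding K_def by (intro continuous_map_from_subtopology continuous_map_product_projection) simp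
  have "closedin (prod_topology (simplex_space n) K) R"
  proof -
    let ?P = "prod_topology (simplex_space n) K"
    have "closedin ?P {p \<in> topspace ?P. snd p j * group_weight vs (fst p) (fst (vs ! j)) - group_moment vs (fst p) (fst (vs ! j)) \<in> {0}}" for j
      by (intro closedin_continuous_map_preimage[where Y = euclideanreal] continuous_map_diff continuous_map_real_mult
          continuous_map_compose[OF continuous_map_snd pK, unfolded o_def]
          continuous_map_compose[OF continuous_map_fst cw(1), unfolded o_def]
          continuous_map_compose[OF continuous_map_fst cw(2), unfolded o_def]) auto
    then have "closedin ?P (\<Inter>j\<in>{..n}. {p \<in> topspace ?P. snd p j * group_weight vs (fst p) (fst (vs ! j)) - group_moment vs (fst p) (fst (vs ! j)) \<in> {0}})"
      by (intro closedin_INT) auto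
    moreover have "R = (\<Inter>j\<in>{..n}. {p \<in> topspace ?P. snd p j * group_weight vs (fst p) (fst (vs ! j)) - group_moment vs (fst p) (fst (vs ! j)) \<in> {0}})"
      by (auto simp: R_def)
    ultimately show ?thesis by simp
  qed
  then have closed: "closed_map (subtopology (prod_topology (simplex_space n) K) R) (simplex_space n) fst"
    using Abstract_Topological_Spaces.closed_map_fst[OF K] unfolding closed_map_def
    by (blast intro: closedin_trans_full)
  \<comment> \<open>Indices beyond \<open>n\<close> receive 0 in order to stay inside the cube
    \<open>K\<close>.\<close>
  have mem: "(t, (\<lambda>j. if j \<le> n then group_mean vs t (vs ! j) else 0)) \<in> R" if "t \<in> standard_simplex n" for t
  proof -
    have "\<bar>group_mean vs t (vs ! j)\<bar> \<le> M" if "j \<le> n" for j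
      using group_mean_bounded[OF \<open>t \<in> _\<close>, of vs M "vs ! j"] M len that by simp
    then have "(\<lambda>j. if j \<le> n then group_mean vs t (vs ! j) else 0) \<in> UNIV \<rightarrow>\<^sub>E {-M..M}"
      using M0 by (auto simp: abs_le_iff minus_le_iff)
    moreover have "group_mean vs t (vs ! j) * group_weight vs t (fst (vs ! j)) = group_moment vs t (fst (vs ! j))"
      if "j \<le> n" for j
    proof (cases "group_weight vs t (fst (vs ! j)) = 0")
      case True
      have "t k * (if fst (vs ! k) = fst (vs ! j) then snd (vs ! k) else 0) = 0" if "k < length vs" for k
        using group_weight_pos[OF \<open>t \<in> _\<close> that] True by (cases "t k = 0 \<or> fst (vs ! k) \<noteq> fst (vs ! j)") auto
      then have "group_moment vs t (fst (vs ! j)) = 0" unfolding group_moment_def by (intro sum.neutral) auto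
      then show ?thesis using True by simp
    qed (simp add: group_mean_def)
    ultimately show ?thesis using that by (simp add: R_def simplex_space_def K_def)
  qed
  have cfst: "continuous_map (subtopology (prod_topology (simplex_space n) K) R) (simplex_space n) fst"
    by (intro continuous_map_from_subtopology continuous_map_fst)
  have Rtop: "topspace (subtopology (prod_topology (simplex_space n) K) R) = R"
    by (auto simp: R_def)
  \<comment> \<open>Projection along the compact factor \<open>K\<close> is closed, hence a quotient
    map onto the simplex.\<close>
  have quot: "quotient_map (subtopology (prod_topology (simplex_space n) K) R) (simplex_space n) fst"
  proof (rule continuous_closed_imp_quotient_map[OF cfst closed])
    show "fst ` topspace (subtopology (prod_topology (simplex_space n) K) R) = topspace (simplex_space n)"
      unfolding Rtop using mem by (force simp: R_def simplex_space_def)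
  qed
  have "continuous_map (subtopology (prod_topology (simplex_space n) K) R) Y (\<lambda>(t, \<Theta>). f t \<Theta>)"
  proof -
    have "subtopology (prod_topology (simplex_space n) K) R
        = subtopology (prod_topology (simplex_space n) (powertop_real UNIV)) (topspace (simplex_space n) \<times> (UNIV \<rightarrow>\<^sub>E {-M..M}) \<inter> R)"
      unfolding K_def prod_topology_subtopology subtopology_subtopology by simp
    then show ?thesis by (simp only:) (rule continuous_map_from_subtopology[OF cont])
  qed
  then have "continuous_map (subtopology (prod_topology (simplex_space n) K) R) Y
      ((\<lambda>t. f t (\<lambda>j. group_mean vs t (vs ! j))) \<circ> fst)"
  proof (rule continuous_map_eq)
    fix p assume "p \<in> topspace (subtopology (prod_topology (simplex_space n) K) R)"
    then obtain t \<Theta> where p: "p = (t, \<Theta>)" "(t, \<Theta>) \<in> R" unfolding Rtop by (cases p) auto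
    have t: "t \<in> standard_simplex n" using p by (simp add: R_def simplex_space_def)
    \<comment> \<open>Where a vertex has positive weight the relation determines its angle; by
      \<open>supp\<close> the other angles do not affect \<open>f\<close>.\<close>
    have "f t \<Theta> = f t (\<lambda>j. group_mean vs t (vs ! j))"
    proof (rule supp[OF t])
      fix j assume "j \<le> n" "t j \<noteq> 0"
      then show "\<Theta> j = group_mean vs t (vs ! j)"
        using p group_weight_pos[OF t, of j vs] len by (auto simp: R_def group_mean_def field_simps)
    qed
    then show "(case p of (t, \<Theta>) \<Rightarrow> f t \<Theta>) = ((\<lambda>t. f t (\<lambda>j. group_mean vs t (vs ! j))) \<circ> fst) p"
      by (simp add: p)
  qed
  then show ?thesis using continuous_compose_quotient_map[OF quot] by blast
qed

text \<open>\<open>\<sigma>\<close> is a one-parameter group of automorphisms of period 1, in the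
  application the scalars \<open>cis (2 * pi * r)\<close>. Continuity is required on tuples of four
  arrows, since tetrahedra are the simplices on which the coboundary of \<open>l\<close> is
  known.\<close>

locale rotations = powers X a for X :: "('o, 'm, 'u) fibcat" and a +
  fixes x \<kappa> \<omega> z and \<sigma> :: "real \<Rightarrow> 'm"
  assumes \<kappa>: "\<kappa> \<in> arr X x a" and \<omega>: "\<omega> \<in> autos X x" and z: "z \<in> topspace (base X x)"
    and \<sigma>: "\<sigma> r \<in> autos X x" and \<sigma>_add: "\<sigma> (r + s) = cmp X (\<sigma> r) (\<sigma> s)" and \<sigma>_1: "\<sigma> 1 = ident X x"
    and commute: "cmp X \<omega> (\<sigma> r) = cmp X (\<sigma> r) \<omega>"
    and continuous_\<sigma>: "\<forall>j\<le>3. \<alpha> j \<in> arr X x a \<Longrightarrow> continuous_map (powertop_real UNIV) (nerve X a 3)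
       (\<lambda>\<Theta>. bmap X (tuple X a 3 x (\<lambda>j. cmp X (\<alpha> j) (\<sigma> (\<Theta> j)))) z)"
begin

definition rarrow :: "nat \<Rightarrow> real \<Rightarrow> 'm" where
  "rarrow i r = cmp X (cmp X \<kappa> (auto_pow X x \<omega> i)) (\<sigma> r)"

definition rsimp :: "(nat \<times> real) list \<Rightarrow> (nat \<Rightarrow> real) \<Rightarrow> 'u rpoint" where
  "rsimp vs = restrict
     (\<lambda>t. tuple_point X a (length vs - 1) x (\<lambda>j. rarrow (fst (vs ! j)) (group_mean vs t (vs ! j))) z t)
     (standard_simplex (length vs - 1))"

lemma x: "x \<in> Ob X"
  using \<kappa> arr_Ob by blast

lemma \<kappa>_pow: "cmp X \<kappa> (auto_pow X x \<omega> i) \<in> arr X x a"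
  using \<kappa> autos_arr[OF auto_pow_autos[OF x \<omega>]] cmp_arr by blast

lemma rarrow_arr: "rarrow i r \<in> arr X x a"
  unfolding rarrow_def using \<kappa>_pow autos_arr[OF \<sigma>] cmp_arr by blast

lemma \<sigma>_0: "\<sigma> 0 = ident X x"
  using \<sigma>_add[of 1 0] cmp_ident(2)[OF autos_arr[OF \<sigma>[of 0]]] by (simp add: \<sigma>_1)

text \<open>As \<open>\<sigma>\<close> commutes with \<open>\<omega>\<close>, adding to exponent and
  angle is precomposition with an automorphism that is the same for all vertices.\<close>

lemma rarrow_add: "rarrow (i + j) (r + s) = cmp X (rarrow i r) (cmp X (auto_pow X x \<omega> j) (\<sigma> s))"
proof -
  note \<omega>' = autos_arr[OF auto_pow_autos[OF x \<omega>]] and \<sigma>' = autos_arr[OF \<sigma>]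
  have c: "cmp X (auto_pow X x \<omega> j) (\<sigma> r) = cmp X (\<sigma> r) (auto_pow X x \<omega> j)"
    using auto_pow_commute[OF \<sigma>' \<omega> \<omega> commute] .
  have "rarrow (i + j) (r + s) = cmp X (cmp X (cmp X \<kappa> (auto_pow X x \<omega> i)) (auto_pow X x \<omega> j)) (cmp X (\<sigma> r) (\<sigma> s))"
    unfolding rarrow_def auto_pow_add[OF x \<omega>] \<sigma>_add using cmp_assoc[OF \<kappa> \<omega>' \<omega>'] by simp
  also have "\<dots> = cmp X (cmp X (cmp X \<kappa> (auto_pow X x \<omega> i)) (cmp X (auto_pow X x \<omega> j) (\<sigma> r))) (\<sigma> s)"
    using cmp_assoc[OF cmp_arr[OF \<kappa>_pow \<omega>'] \<sigma>' \<sigma>'] cmp_assoc[OF \<kappa>_pow \<omega>' \<sigma>'] by simp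
  also have "\<dots> = cmp X (cmp X (rarrow i r) (auto_pow X x \<omega> j)) (\<sigma> s)"
    unfolding c rarrow_def using cmp_assoc[OF \<kappa>_pow \<sigma>' \<omega>'] by simp
  also have "\<dots> = cmp X (rarrow i r) (cmp X (auto_pow X x \<omega> j) (\<sigma> s))"
    using cmp_assoc[OF rarrow_arr \<omega>' \<sigma>'] by simp
  finally show ?thesis .
qed

text \<open>The means may jump where a weight vanishes, but by \<open>tuple_point_support\<close>
  the vertices concerned do not affect the point.\<close>

lemma singular_rsimp:
  assumes len: "length vs = 4"
  shows "singular_simplex 3 (realization X a) (rsimp vs)"
proof -
  define f where "f t \<Theta> = tuple_point X a 3 x (\<lambda>j. rarrow (fst (vs ! j)) (\<Theta> j)) z t" for t and \<Theta> :: "nat \<Rightarrow> real"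
  have "continuous_map (simplex_space 3) (realization X a) (\<lambda>t. f t (\<lambda>j. group_mean vs t (vs ! j)))"
  proof (rule continuous_map_group_mean)
    show "length vs = Suc 3" using len by simp
    have "continuous_map (prod_topology (simplex_space 3) (powertop_real UNIV)) (nerve X a 3)
      (\<lambda>p. bmap X (tuple X a 3 x (\<lambda>j. rarrow (fst (vs ! j)) (snd p j))) z)"
      unfolding rarrow_def
      by (rule continuous_map_compose[OF continuous_map_snd continuous_\<sigma>, unfolded o_def]) (simp add: \<kappa>_pow)
    then show "continuous_map (prod_topology (simplex_space 3) (powertop_real UNIV)) (realization X a) (\<lambda>(t, \<Theta>). f t \<Theta>)"
      unfolding f_def tuple_point_def case_prod_beta by (rule continuous_rpt) (rule continuous_map_fst)
    show "f t \<Theta> = f t \<Theta>'" if "t \<in> standard_simplex 3" "\<And>j. j \<le> 3 \<Longrightarrow> t j \<noteq> 0 \<Longrightarrow> \<Theta> j = \<Theta>' j" for t \<Theta> \<Theta>'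
      unfolding f_def using that z x rarrow_arr by (intro tuple_point_support) auto
  qed
  moreover have "rsimp vs = restrict (\<lambda>t. f t (\<lambda>j. group_mean vs t (vs ! j))) (standard_simplex 3)"
    by (simp add: rsimp_def f_def len)
  ultimately show ?thesis
    unfolding singular_simplex_def by (simp add: simplex_space_def continuous_map_eq)
qed

lemma face_rsimp:
  assumes len: "length vs = Suc (Suc n)" and k: "k \<le> Suc n"
  shows "singular_face (Suc n) k (rsimp vs) = rsimp (take k vs @ drop (Suc k) vs)"
proof
  fix t
  let ?ws = "take k vs @ drop (Suc k) vs"
  have nth: "?ws ! j = vs ! (if j < k then j else Suc j)" if "j \<le> n" for j
    using that len k by (auto simp: nth_append min_def)
  have lenw: "length ?ws = Suc n" using len k by simp
  show "singular_face (Suc n) k (rsimp vs) t = rsimp ?ws t"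
  proof (cases "t \<in> standard_simplex n")
    case True
    have "simplical_face k t \<in> standard_simplex (Suc n)"
      using simplical_face_in_standard_simplex[of "Suc n" k t] True k by simp
    then have "singular_face (Suc n) k (rsimp vs) t
        = tuple_point X a (Suc n) x (\<lambda>j. rarrow (fst (vs ! j)) (group_mean ?ws t (vs ! j))) z (simplical_face k t)"
      using True by (simp add: singular_face_def rsimp_def len group_mean_face[OF len k])
    also have "\<dots> = tuple_point X a n x (\<lambda>j. rarrow (fst (vs ! (if j < k then j else Suc j)))
          (group_mean ?ws t (vs ! (if j < k then j else Suc j)))) z t"
      using x rarrow_arr z True k by (intro tuple_point_face) auto
    also have "\<dots> = tuple_point X a n x (\<lambda>j. rarrow (fst (?ws ! j)) (group_mean ?ws t (?ws ! j))) z t"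
      by (rule tuple_point_cong) (simp only: nth)
    finally show ?thesis using True lenw by (simp add: rsimp_def)
  next
    case False
    then show ?thesis using lenw by (simp add: singular_face_def rsimp_def)
  qed
qed

lemma coboundary_rsimp:
  assumes "length vs = Suc (Suc n)"
  shows "coboundary n c (rsimp vs) = list_coboundary (\<lambda>ws. c (rsimp ws)) vs"
  unfolding coboundary_def list_coboundary_def assms
  by (intro sum.cong) (auto simp: face_rsimp[OF assms])

text \<open>Simultaneous translation of all vertices is precomposition with an automorphism of \<open>x\<close>.\<close>

lemma rsimp_eqI:
  assumes "length vs = length ws" "vs \<noteq> []"
    and "\<And>t. t \<in> standard_simplex (length vs - 1) \<Longrightarrow> \<exists>i r. \<forall>j<length vs.
      rarrow (fst (vs ! j)) (group_mean vs t (vs ! j))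
      = cmp X (rarrow (fst (ws ! j)) (group_mean ws t (ws ! j))) (cmp X (auto_pow X x \<omega> i) (\<sigma> r))"
  shows "rsimp vs = rsimp ws"
  unfolding rsimp_def assms(1)[symmetric]
proof (rule restrict_ext)
  fix t assume t: "t \<in> standard_simplex (length vs - 1)"
  then obtain i r where *: "\<forall>j<length vs. rarrow (fst (vs ! j)) (group_mean vs t (vs ! j))
      = cmp X (rarrow (fst (ws ! j)) (group_mean ws t (ws ! j))) (cmp X (auto_pow X x \<omega> i) (\<sigma> r))"
    using assms(3) by blast
  \<comment> \<open>The automorphism may depend on \<open>t\<close>, as points are compared one at a
    time.\<close>
  have u: "cmp X (auto_pow X x \<omega> i) (\<sigma> r) \<in> autos X x"
    using cmp_autos[OF auto_pow_autos[OF x \<omega>] \<sigma>] .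
  have "tuple_point X a (length vs - 1) x (\<lambda>j. rarrow (fst (vs ! j)) (group_mean vs t (vs ! j))) z t
      = tuple_point X a (length vs - 1) x (\<lambda>j. cmp X (rarrow (fst (ws ! j)) (group_mean ws t (ws ! j)))
          (cmp X (auto_pow X x \<omega> i) (\<sigma> r))) z t"
  proof (rule tuple_point_cong)
    fix j assume "j \<le> length vs - 1"
    then have "j < length vs" using assms(2) by (cases vs) auto
    then show "rarrow (fst (vs ! j)) (group_mean vs t (vs ! j))
        = cmp X (rarrow (fst (ws ! j)) (group_mean ws t (ws ! j))) (cmp X (auto_pow X x \<omega> i) (\<sigma> r))"
      using * by blast
  qed
  also have "\<dots> = tuple_point X a (length vs - 1) x (\<lambda>j. rarrow (fst (ws ! j)) (group_mean ws t (ws ! j))) z t"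
    using tuple_point_cmp[OF autos_arr[OF u]] rarrow_arr z bmap_autos[OF u z] by simp
  finally show "tuple_point X a (length vs - 1) x (\<lambda>j. rarrow (fst (vs ! j)) (group_mean vs t (vs ! j))) z t
      = tuple_point X a (length vs - 1) x (\<lambda>j. rarrow (fst (ws ! j)) (group_mean ws t (ws ! j))) z t" .
qed

lemma rsimp_shift: "rsimp (map (\<lambda>(i, s). (i + k, s + r)) vs) = rsimp vs" if "vs \<noteq> []"
proof (rule rsimp_eqI)
  fix t
  have "rarrow (fst (map (\<lambda>(i, s). (i + k, s + r)) vs ! j))
       (group_mean (map (\<lambda>(i, s). (i + k, s + r)) vs) t (map (\<lambda>(i, s). (i + k, s + r)) vs ! j))
      = cmp X (rarrow (fst (vs ! j)) (group_mean vs t (vs ! j))) (cmp X (auto_pow X x \<omega> k) (\<sigma> r))"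
    if "j < length vs" for j
    using that by (cases "vs ! j") (simp add: group_mean_shift rarrow_add)
  then show "\<exists>i r'. \<forall>j<length (map (\<lambda>(i, s). (i + k, s + r)) vs).
      rarrow (fst (map (\<lambda>(i, s). (i + k, s + r)) vs ! j))
       (group_mean (map (\<lambda>(i, s). (i + k, s + r)) vs) t (map (\<lambda>(i, s). (i + k, s + r)) vs ! j))
      = cmp X (rarrow (fst (vs ! j)) (group_mean vs t (vs ! j))) (cmp X (auto_pow X x \<omega> i) (\<sigma> r'))"
    by auto
qed (use that in auto)

lemma rsimp_congI:
  assumes "length vs = length ws" "vs \<noteq> []"
    and "\<And>t j. t \<in> standard_simplex (length vs - 1) \<Longrightarrow> j < length vs \<Longrightarrow>
      rarrow (fst (vs ! j)) (group_mean vs t (vs ! j)) = rarrow (fst (ws ! j)) (group_mean ws t (ws ! j))"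
  shows "rsimp vs = rsimp ws"
  using assms(1,2)
proof (rule rsimp_eqI)
  have "cmp X (rarrow i r) (cmp X (auto_pow X x \<omega> 0) (\<sigma> 0)) = rarrow i r" for i r
    using cmp_ident(1)[OF rarrow_arr] cmp_ident(1)[OF ident_arr[OF x]] by (simp add: auto_pow_0 \<sigma>_0)
  then show "\<exists>i r. \<forall>j<length vs. rarrow (fst (vs ! j)) (group_mean vs t (vs ! j))
      = cmp X (rarrow (fst (ws ! j)) (group_mean ws t (ws ! j))) (cmp X (auto_pow X x \<omega> i) (\<sigma> r))"
    if "t \<in> standard_simplex (length vs - 1)" for t
    using assms(3)[OF that] by metis
qed

lemma \<sigma>_of_int: "\<sigma> (of_int k) = ident X x"
proof -
  have nat: "\<sigma> (of_nat k) = ident X x" for k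
    by (induction k) (simp_all add: \<sigma>_0 \<sigma>_add \<sigma>_1 cmp_ident(1)[OF ident_arr[OF x]])
  moreover have "\<sigma> (- of_nat k) = ident X x" for k
    using \<sigma>_add[of "of_nat k" "- of_nat k"] cmp_ident(2)[OF autos_arr[OF \<sigma>[of "- of_nat k"]]]
    by (simp add: nat \<sigma>_0)
  ultimately show ?thesis by (cases k rule: int_cases2) simp_all
qed

lemma rarrow_add_int: "rarrow i (r + of_int k) = rarrow i r"
  using rarrow_add[of i 0 r "of_int k"] cmp_ident(1)[OF rarrow_arr[of i r]] cmp_ident(1)[OF ident_arr[OF x]]
  by (simp add: \<sigma>_of_int auto_pow_0)

text \<open>In a power of the product of \<open>\<omega>\<close> and \<open>\<sigma> \<phi>\<close>
  the two commuting factors separate, and the angles add up to \<open>i * \<phi>\<close>.\<close>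

lemma rarrow_rotated:
  "vertex_arrow X x (\<lambda>c. \<kappa>) (cmp X \<omega> (\<sigma> \<phi>)) (i, c) = rarrow i (real i * \<phi>)"
proof -
  have "auto_pow X x (\<sigma> \<phi>) i = \<sigma> (real i * \<phi>)" for i
    by (induction i) (simp_all add: auto_pow_0 auto_pow_Suc \<sigma>_0 algebra_simps flip: \<sigma>_add)
  then show ?thesis
    unfolding rarrow_def vertex_arrow_def
    using auto_pow_commuting_product[OF x \<omega> \<sigma> commute, of \<phi> i]
      cmp_assoc[OF \<kappa> autos_arr[OF auto_pow_autos[OF x \<omega>]] autos_arr[OF \<sigma>]]
    by (cases c) simp
qed

text \<open>Vertices of one exponent carry equal angles here, so averaging changes nothing, and the
  simplices of the rotated automorphism are a special case.\<close>

lemma rsimp_rotated: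
  assumes "vs \<noteq> []"
  shows "rsimp (map (\<lambda>(i, c). (i, real i * \<phi>)) vs) = vertex_simplex X a x (\<lambda>c. \<kappa>) (cmp X \<omega> (\<sigma> \<phi>)) (\<lambda>r. z) vs"
proof -
  have "tuple_point X a (length vs - 1) x (\<lambda>j. rarrow (fst (map (\<lambda>(i, c). (i, real i * \<phi>)) vs ! j))
        (group_mean (map (\<lambda>(i, c). (i, real i * \<phi>)) vs) t (map (\<lambda>(i, c). (i, real i * \<phi>)) vs ! j))) z t
      = tuple_point X a (length vs - 1) x (\<lambda>j. vertex_arrow X x (\<lambda>c. \<kappa>) (cmp X \<omega> (\<sigma> \<phi>)) (vs ! j)) z t" for t
  proof (rule tuple_point_cong)
    fix j assume "j \<le> length vs - 1"
    then have j: "j < length vs" using assms by (cases vs) auto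
    have "group_mean (map (\<lambda>(i, c). (i, real i * \<phi>)) vs) t (i, real i * \<phi>) = snd (i, real i * \<phi>)" for i
      by (rule group_mean_const) auto
    then show "rarrow (fst (map (\<lambda>(i, c). (i, real i * \<phi>)) vs ! j))
        (group_mean (map (\<lambda>(i, c). (i, real i * \<phi>)) vs) t (map (\<lambda>(i, c). (i, real i * \<phi>)) vs ! j))
        = vertex_arrow X x (\<lambda>c. \<kappa>) (cmp X \<omega> (\<sigma> \<phi>)) (vs ! j)"
      using j by (cases "vs ! j") (simp add: rarrow_rotated)
  qed
  then show ?thesis by (simp add: rsimp_def vertex_simplex_def)
qed

text \<open>By hypothesis the coboundary of \<open>l\<close> sees the exponents only. Hence the
  change \<open>m\<close> of \<open>l\<close> under rotation is a cocycle, and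
  \<open>cyclic_sum_twisted\<close> reduces its sum to full turns. With the angle
  \<open>- (k / n)\<close>, exactly \<open>k\<close> full turns are made in \<open>n\<close>
  steps.\<close>

lemma cyclic_sum_rotated:
  fixes l :: "('u rpoint, int) cochain"
  assumes n: "n > 0"
    and l: "\<And>vs ws. length vs = 4 \<Longrightarrow> map fst vs = map fst ws \<Longrightarrow>
       coboundary 2 l (rsimp vs) = coboundary 2 l (rsimp ws)"
  shows "[cyclic_sum n (\<lambda>vs. l (vertex_simplex X a x (\<lambda>c. \<kappa>) (cmp X \<omega> (\<sigma> (- (real k / real n)))) (\<lambda>r. z) vs)) p
     - cyclic_sum n (\<lambda>vs. l (vertex_simplex X a x (\<lambda>c. \<kappa>) \<omega> (\<lambda>r. z) vs)) p
     = int k * (l (rsimp [(0, 0), (0, -1), (n, -1)]) - l (rsimp [(0, 0), (0, 0), (n, 0)]))] (mod int n)"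
proof -
  define \<phi> where "\<phi> = - (real k / real n)"
  define m where "m u v w = l (rsimp [u, v, w]) - l (rsimp [(fst u, 0), (fst v, 0), (fst w, 0)])" for u v w
  have coc: "m v1 v2 v3 - m v0 v2 v3 + m v0 v1 v3 - m v0 v1 v2 = 0" for v0 v1 v2 v3
    using l[of "[v0, v1, v2, v3]" "[(fst v0, 0), (fst v1, 0), (fst v2, 0), (fst v3, 0)]"]
    by (simp add: coboundary_rsimp[of _ 2, simplified] list_coboundary_simps m_def)
  have shift: "m (i0 + i, t0 + t) (i1 + i, t1 + t) (i2 + i, t2 + t) = m (i0, t0) (i1, t1) (i2, t2)"
    for i0 i t0 t i1 t1 i2 t2
    using rsimp_shift[of "[(i0, t0), (i1, t1), (i2, t2)]" i t] rsimp_shift[of "[(i0, 0), (i1, 0), (i2, 0)]" i 0]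
    by (simp add: m_def)
  \<comment> \<open>All vertices form a single group, so at each point the simplex is rotated by one
    common angle, that is, by an automorphism of \<open>x\<close>.\<close>
  have single: "m (0, r) (0, s) (0, t) = 0" for r s t
  proof -
    have "rsimp [(0, r), (0, s), (0, t)] = rsimp [(0, 0), (0, 0), (0, 0)]"
    proof (rule rsimp_eqI)
      fix c :: "nat \<Rightarrow> real" assume "c \<in> standard_simplex (length [(0, r), (0, s), (0, t)] - 1)"
      then have c: "c 0 + c 1 + c 2 = 1" by (simp add: standard_simplex_def eval_nat_numeral)
      let ?\<theta> = "c 0 * r + c 1 * s + c 2 * t"
      have *: "group_mean [(0, r), (0, s), (0, t)] c (0, u) = ?\<theta>" for u
        using c by (simp add: group_mean_def group_weight_def group_moment_def eval_nat_numeral)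
      have "group_mean [(0, 0), (0, 0), (0, 0)] c (0, 0) = 0"
        using group_mean_const[of "[(0, 0), (0, 0), (0, 0)]" "(0, 0)" c] by auto
      then have "rarrow (fst ([(0, r), (0, s), (0, t)] ! j)) (group_mean [(0, r), (0, s), (0, t)] c ([(0, r), (0, s), (0, t)] ! j))
        = cmp X (rarrow (fst ([(0, 0), (0, 0), (0, 0)] ! j)) (group_mean [(0, 0), (0, 0), (0, 0)] c ([(0, 0), (0, 0), (0, 0)] ! j)))
          (cmp X (auto_pow X x \<omega> 0) (\<sigma> ?\<theta>))" if "j < length [(0, r), (0, s), (0, t)]" for j
        using that rarrow_add[of 0 0 0 ?\<theta>] by (auto simp: * less_Suc_eq eval_nat_numeral)
      then show "\<exists>i ra. \<forall>j<length [(0, r), (0, s), (0, t)].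
        rarrow (fst ([(0, r), (0, s), (0, t)] ! j)) (group_mean [(0, r), (0, s), (0, t)] c ([(0, r), (0, s), (0, t)] ! j))
        = cmp X (rarrow (fst ([(0, 0), (0, 0), (0, 0)] ! j)) (group_mean [(0, 0), (0, 0), (0, 0)] c ([(0, 0), (0, 0), (0, 0)] ! j)))
          (cmp X (auto_pow X x \<omega> i) (\<sigma> ra))" by blast
    qed auto
    then show ?thesis by (simp add: m_def)
  qed
  \<comment> \<open>The last vertex is alone in its group, so its angle counts only modulo
    1.\<close>
  have int_shift: "m (0, r) (0, s) (i, t - 1) = m (0, r) (0, s) (i, t)" if "i > 0" for r s i t
  proof -
    have "rsimp [(0, r), (0, s), (i, t - 1)] = rsimp [(0, r), (0, s), (i, t)]"
    proof (rule rsimp_congI)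
      fix c :: "nat \<Rightarrow> real" and j
      have "group_mean [(0, r), (0, s), (i, t)] c (i, t) = t" for t
        using group_mean_const[of "[(0, r), (0, s), (i, t)]" "(i, t)" c] that by auto
      moreover have "group_mean [(0, r), (0, s), (i, t - 1)] c (0, u) = group_mean [(0, r), (0, s), (i, t)] c (0, u)" for u
        using that by (simp add: group_mean_def group_weight_def group_moment_def eval_nat_numeral)
      moreover assume "j < length [(0, r), (0, s), (i, t - 1)]"
      ultimately show "rarrow (fst ([(0, r), (0, s), (i, t - 1)] ! j)) (group_mean [(0, r), (0, s), (i, t - 1)] c ([(0, r), (0, s), (i, t - 1)] ! j))
        = rarrow (fst ([(0, r), (0, s), (i, t)] ! j)) (group_mean [(0, r), (0, s), (i, t)] c ([(0, r), (0, s), (i, t)] ! j))"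
        using rarrow_add_int[of i t "-1"] by (auto simp: less_Suc_eq)
    qed auto
    then show ?thesis by (simp add: m_def)
  qed
  have twisted: "l (rsimp [(0, 0), (i, real i * \<phi>), (Suc i, real (Suc i) * \<phi>)])
      = l (vertex_simplex X a x (\<lambda>c. \<kappa>) (cmp X \<omega> (\<sigma> \<phi>)) (\<lambda>r. z) [(0, p), (i, p), (Suc i, p)])" for i \<phi>
    using rsimp_rotated[of "[(0, p), (i, p), (Suc i, p)]" \<phi>] by simp
  have \<omega>': "cmp X \<omega> (\<sigma> 0) = \<omega>" using cmp_ident(1)[OF autos_arr[OF \<omega>]] by (simp add: \<sigma>_0)
  have "cyclic_sum n (\<lambda>vs. l (vertex_simplex X a x (\<lambda>c. \<kappa>) (cmp X \<omega> (\<sigma> \<phi>)) (\<lambda>r. z) vs)) p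
     - cyclic_sum n (\<lambda>vs. l (vertex_simplex X a x (\<lambda>c. \<kappa>) \<omega> (\<lambda>r. z) vs)) p
     = (\<Sum>i<n. m (0, 0) (i, real i * \<phi>) (Suc i, real (Suc i) * \<phi>))"
    unfolding cyclic_sum_def m_def sum_subtractf fst_conv twisted using twisted[of _ 0] by (simp add: \<omega>')
  moreover have "(\<Sum>i<n. m (0, 0) (i, real i * \<phi>) (Suc i, real (Suc i) * \<phi>))
     - int k * m (0, 0) (0, -1) (n, -1)
     = - int n * m (0, 0) (0, - (real k / real n)) (1, - (real k / real n))"
    using cyclic_sum_twisted[of m n k, OF coc shift _ single int_shift n] by (simp add: \<phi>_def m_def)
  ultimately show ?thesis
    unfolding \<phi>_def[symmetric] by (simp add: m_def cong_iff_dvd_diff)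
qed

text \<open>The mean over the first group is \<open>- t\<^sub>1 / (t\<^sub>0 + t\<^sub>1)\<close>; rotating back, it moves to the last vertex.\<close>

lemma rsimp_sphere:
  assumes \<omega>n: "auto_pow X x \<omega> n = ident X x" and n: "n > 0" and t: "t \<in> standard_simplex 2"
  shows "rsimp [(0, 0), (0, -1), (n, -1)] t = tuple_point X a 1 x
      (\<lambda>j. if j = 0 then \<kappa> else cmp X \<kappa> (\<sigma> (t 1 / (t 0 + t 1)))) z
      (\<lambda>i. if i = 0 then t 0 + t 1 else if i = 1 then t 2 else 0)"
    and "rsimp [(0, 0), (0, 0), (n, 0)] t = vertex X a (bmap X \<kappa> z)"
proof -
  let ?u = "t 1 / (t 0 + t 1)"
  have t2: "t j = 0" if "j > 2" for j using t that by (simp add: standard_simplex_def)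
  have \<kappa>0: "rarrow 0 r = cmp X \<kappa> (\<sigma> r)" for r
    using cmp_ident(1)[OF \<kappa>] by (simp add: rarrow_def auto_pow_0)
  have \<kappa>n: "rarrow n r = cmp X \<kappa> (\<sigma> r)" for r
    using cmp_ident(1)[OF \<kappa>] by (simp add: rarrow_def \<omega>n)
  have \<kappa>00: "rarrow 0 0 = \<kappa>" using \<kappa>0[of 0] cmp_ident(1)[OF \<kappa>] by (simp add: \<sigma>_0)
  \<comment> \<open>\<open>\<theta>\<close> merges the vertices 0 and 1, whose arrows will turn out
    to be equal.\<close>
  define \<theta> where "\<theta> i = (if i \<le> 1 then 0 else 1 :: nat)" for i :: nat
  have "simplex_push 2 \<theta> t j = (\<Sum>i\<le>2. if \<theta> i = j then t i else 0)" for j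
    using sum.inter_filter[of "{..2}" t "\<lambda>i. \<theta> i = j"] by (simp add: simplex_push_def)
  then have push: "simplex_push 2 \<theta> t = (\<lambda>i. if i = 0 then t 0 + t 1 else if i = 1 then t 2 else 0)"
    by (auto simp: numeral_2_eq_2 \<theta>_def)
  have \<theta>: "mono_on {..2} \<theta>" "\<theta> ` {..2} \<subseteq> {..1}" by (auto simp: mono_on_def \<theta>_def)
  define s where "s = group_mean [(0, 0), (0, -1), (n, -1)] t (0, 0)"
  \<comment> \<open>If \<open>t 0 + t 1 = 0\<close>, the means default to the angles 0 and -1, which
    agree by periodicity, and \<open>?u = 0\<close> since division by zero gives 0.\<close>
  have s: "rarrow i s = rarrow i (- ?u)" "rarrow i (group_mean [(0, 0), (0, -1), (n, -1)] t (0, -1)) = rarrow i s" for i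
    using n rarrow_add_int[of i 0 "-1"]
    by (auto simp: s_def group_mean_def group_weight_def group_moment_def eval_nat_numeral)
  have e: "group_mean [(0, 0), (0, -1), (n, -1)] t (n, -1) = -1"
    using group_mean_const[of "[(0, 0), (0, -1), (n, -1)]" "(n, -1)" t] n by auto
  have "rsimp [(0, 0), (0, -1), (n, -1)] t
     = tuple_point X a 2 x (\<lambda>j. if j \<le> 1 then rarrow 0 (- ?u) else rarrow n (-1)) z t"
    unfolding rsimp_def using t
    by (simp add: numeral_2_eq_2[symmetric], intro tuple_point_cong)
       (auto simp: le_Suc_eq numeral_2_eq_2 s e s_def[symmetric])
  \<comment> \<open>The common rotation by \<open>- ?u\<close> is split off. The last vertex has
    angle -1, which is 0 modulo 1, and so it retains \<open>?u\<close>.\<close>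
  also have "\<dots> = tuple_point X a 2 x (\<lambda>j. cmp X (if j \<le> 1 then \<kappa> else cmp X \<kappa> (\<sigma> ?u)) (\<sigma> (- ?u))) z t"
  proof (rule tuple_point_cong)
    have "cmp X (cmp X \<kappa> (\<sigma> ?u)) (\<sigma> (- ?u)) = rarrow n (-1)"
      using cmp_assoc[OF \<kappa> autos_arr[OF \<sigma>[of ?u]] autos_arr[OF \<sigma>[of "- ?u"]]] \<sigma>_of_int[of "-1"] \<sigma>_add[of ?u "- ?u"]
      by (simp add: \<kappa>n \<sigma>_0)
    then show "(if j \<le> 1 then rarrow 0 (- ?u) else rarrow n (-1)) = cmp X (if j \<le> 1 then \<kappa> else cmp X \<kappa> (\<sigma> ?u)) (\<sigma> (- ?u))" for j :: nat
      by (simp add: \<kappa>0)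
  qed
  also have "\<dots> = tuple_point X a 2 x (\<lambda>j. if j \<le> 1 then \<kappa> else cmp X \<kappa> (\<sigma> ?u)) z t"
    using tuple_point_cmp[OF autos_arr[OF \<sigma>[of "- ?u"]] _ z, of 2 "\<lambda>j. if j \<le> 1 then \<kappa> else cmp X \<kappa> (\<sigma> ?u)" t]
      \<kappa> cmp_arr[OF \<kappa> autos_arr[OF \<sigma>]] bmap_autos[OF \<sigma> z] by simp
  also have "\<dots> = tuple_point X a 2 x (\<lambda>j. if \<theta> j = 0 then \<kappa> else cmp X \<kappa> (\<sigma> ?u)) z t"
    by (intro tuple_point_cong) (auto simp: \<theta>_def)
  also have "\<dots> = tuple_point X a 1 x (\<lambda>j. if j = 0 then \<kappa> else cmp X \<kappa> (\<sigma> ?u)) z (simplex_push 2 \<theta> t)"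
    using \<kappa> cmp_arr[OF \<kappa> autos_arr[OF \<sigma>]] by (intro tuple_point_push[OF \<theta> x _ z t, symmetric]) auto
  finally show "rsimp [(0, 0), (0, -1), (n, -1)] t = tuple_point X a 1 x
      (\<lambda>j. if j = 0 then \<kappa> else cmp X \<kappa> (\<sigma> ?u)) z
      (\<lambda>i. if i = 0 then t 0 + t 1 else if i = 1 then t 2 else 0)"
    by (simp add: push)
  have "group_mean [(0, 0), (0, 0), (n, 0)] t (i, 0) = snd (i, 0 :: real)" for i
    by (rule group_mean_const) auto
  then have z0: "group_mean [(0, 0), (0, 0), (n, 0)] t (i, 0) = 0" for i by simp
  have push0: "simplex_push 2 (\<lambda>_. 0) t = (\<lambda>i. if i = 0 then 1 else 0)"
    using t by (auto simp: simplex_push_def standard_simplex_def atMost_def[symmetric])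
  have im0: "(\<lambda>_. 0) ` {..2::nat} \<subseteq> {..0::nat}" by auto
  have "rsimp [(0, 0), (0, 0), (n, 0)] t = tuple_point X a 2 x (\<lambda>j. \<kappa>) z t"
    unfolding rsimp_def using t
    by (simp add: numeral_2_eq_2[symmetric], intro tuple_point_cong)
       (auto simp: le_Suc_eq numeral_2_eq_2 z0 \<kappa>00 \<kappa>n \<sigma>_0 cmp_ident(1)[OF \<kappa>])
  also have "\<dots> = tuple_point X a 0 x (\<lambda>j. \<kappa>) z (\<lambda>i. if i = 0 then 1 else 0)"
    using tuple_point_push[OF _ im0 x _ z t, of "\<lambda>_. \<kappa>"] \<kappa> unfolding push0 by (simp add: mono_on_def)
  also have "\<dots> = tuple_point X a 0 x (\<lambda>j. cmp X (ident X a) \<kappa>) z (\<lambda>i. if i = 0 then 1 else 0)"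
    using cmp_ident(2)[OF \<kappa>] by simp
  also have "\<dots> = tuple_point X a 0 a (\<lambda>j. ident X a) (bmap X \<kappa> z) (\<lambda>i. if i = 0 then 1 else 0)"
    using \<kappa> z ident_arr[OF a_Ob] by (intro tuple_point_cmp) auto
  finally show "rsimp [(0, 0), (0, 0), (n, 0)] t = vertex X a (bmap X \<kappa> z)"
    by (simp add: vertex_def tuple_point_def)
qed

end

section \<open>Products and powers\<close>

text \<open>The product of one power of \<open>a\<close> with a further copy of \<open>a\<close> is
  the next power.\<close>

lemma (in spaces_category) powers_if_products:
  assumes a: "a \<in> Ob X" and prod: "\<And>u. u \<in> Ob X \<Longrightarrow> \<exists>w m n. is_product X u a w m n"
  shows "powers X a"
proof
  show "\<exists>w p. is_power X a n w p" for n
  proof (induction n)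
    case 0
    have "is_power X a 0 a (\<lambda>_. ident X a)"
      using a by (auto simp: is_power_def ident_arr cmp_ident)
    then show ?case by blast
  next
    case (Suc n)
    then obtain w p where w: "is_power X a n w p" by blast
    then have "w \<in> Ob X" by (simp add: is_power_def)
    from prod[OF this] obtain w' m q where w': "is_product X w a w' m q" by blast
    let ?p = "\<lambda>i. if i \<le> n then cmp X (p i) m else q"
    have m: "m \<in> arr X w' w" and q: "q \<in> arr X w' a" using w' by (auto simp: is_product_def)
    have p: "p i \<in> arr X w a" if "i \<le> n" for i using w that by (auto simp: is_power_def)
    have "\<exists>!j. j \<in> arr X x w' \<and> (\<forall>i\<le>Suc n. cmp X (?p i) j = k i)"
      if x: "x \<in> Ob X" and k: "\<forall>i\<le>Suc n. k i \<in> arr X x a" for x k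
    proof -
      obtain j0 where j0: "j0 \<in> arr X x w" "\<forall>i\<le>n. cmp X (p i) j0 = k i"
        and j0u: "\<And>j. j \<in> arr X x w \<Longrightarrow> \<forall>i\<le>n. cmp X (p i) j = k i \<Longrightarrow> j = j0"
      proof -
        have "\<exists>!j. j \<in> arr X x w \<and> (\<forall>i\<le>n. cmp X (p i) j = k i)"
          using w x k by (simp add: is_power_def)
        then show ?thesis using that by blast
      qed
      have "\<exists>!j. j \<in> arr X x w' \<and> cmp X m j = j0 \<and> cmp X q j = k (Suc n)"
        using w' x k j0(1) by (simp add: is_product_def)
      moreover have "(\<forall>i\<le>Suc n. cmp X (?p i) j = k i) \<longleftrightarrow> cmp X m j = j0 \<and> cmp X q j = k (Suc n)"
        if j: "j \<in> arr X x w'" for j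
      proof -
        have e: "cmp X (?p i) j = cmp X (p i) (cmp X m j)" if "i \<le> n" for i
          using cmp_assoc[OF p[OF that] m j] that by simp
        have "(\<forall>i\<le>Suc n. cmp X (?p i) j = k i)
            \<longleftrightarrow> (\<forall>i\<le>n. cmp X (p i) (cmp X m j) = k i) \<and> cmp X q j = k (Suc n)"
          using e by (auto simp: le_Suc_eq)
        also have "(\<forall>i\<le>n. cmp X (p i) (cmp X m j) = k i) \<longleftrightarrow> cmp X m j = j0"
          using j0u[OF cmp_arr[OF m j]] j0(2) by auto
        finally show ?thesis .
      qed
      ultimately show ?thesis by metis
    qed
      moreover have "?p i \<in> arr X w' a" for i using cmp_arr[OF p m] q by auto
    ultimately have "is_power X a (Suc n) w' ?p"
      using w' by (auto simp: is_power_def is_product_def)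
    then show ?case by blast
  qed
qed

section \<open>Cartesian arrows in categories fibred in groupoids\<close>

locale fibred_groupoids = spaces_category +
  assumes fib: "fibred_in_groupoids X"
begin

lemma pullback:
  assumes "v \<in> Ob X" "continuous_map S (base X v) f"
  obtains x m where "m \<in> arr X x v" "base X x = S" "\<And>t. t \<in> topspace S \<Longrightarrow> bmap X m t = f t"
proof -
  note * = fib[unfolded fibred_in_groupoids_def, THEN conjunct2, THEN conjunct1, rule_format]
  obtain m where "m \<in> Ar X" "tgt X m = v" "base X (src X m) = S" "\<forall>x\<in>topspace S. bmap X m x = f x"
    using *[OF assms] by blast
  then show ?thesis using that[of m "src X m"] by (auto simp: arr_def)
qed

lemma factor_ex1:
  assumes "m \<in> arr X x v" "n \<in> arr X y v" "continuous_map (base X y) (base X x) f"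
    "\<And>t. t \<in> topspace (base X y) \<Longrightarrow> bmap X m (f t) = bmap X n t"
  shows "\<exists>!k. k \<in> arr X y x \<and> (\<forall>t\<in>topspace (base X y). bmap X k t = f t) \<and> cmp X m k = n"
proof -
  note * = fib[unfolded fibred_in_groupoids_def, THEN conjunct2, THEN conjunct2, rule_format]
  have "m \<in> Ar X" "src X m = x" "tgt X m = v" "n \<in> Ar X" "src X n = y" "tgt X n = v"
    using assms(1,2) by (auto simp: arr_def)
  then show ?thesis using *[of m n f] assms(3,4) by simp
qed

lemma factor:
  assumes "m \<in> arr X x v" "n \<in> arr X y v" "continuous_map (base X y) (base X x) f"
    "\<And>t. t \<in> topspace (base X y) \<Longrightarrow> bmap X m (f t) = bmap X n t"
  obtains k where "k \<in> arr X y x" "\<And>t. t \<in> topspace (base X y) \<Longrightarrow> bmap X k t = f t" "cmp X m k = n"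
proof -
  have "\<exists>k. k \<in> arr X y x \<and> (\<forall>t\<in>topspace (base X y). bmap X k t = f t) \<and> cmp X m k = n"
    by (rule ex1_implies_ex[OF factor_ex1[OF assms(1-3)]]) (rule assms(4))
  then show ?thesis using that by blast
qed

text \<open>Every arrow is cartesian: a factorisation through it is unique once its base map is
  fixed.\<close>

lemma cancel:
  assumes m: "m \<in> arr X x v" and k: "k \<in> arr X y x" "k' \<in> arr X y x"
    and eq: "cmp X m k = cmp X m k'" "\<And>t. t \<in> topspace (base X y) \<Longrightarrow> bmap X k t = bmap X k' t"
  shows "k = k'"
proof -
  have *: "\<exists>!j. j \<in> arr X y x \<and> (\<forall>t\<in>topspace (base X y). bmap X j t = bmap X k t) \<and> cmp X m j = cmp X m k"
    by (rule factor_ex1[OF m cmp_arr[OF m k(1)] continuous_bmap[OF k(1)]]) (simp add: bmap_cmp[OF m k(1)])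
  show ?thesis using the1_equality[OF *, of k] the1_equality[OF *, of k'] k eq by simp
qed

lemma pullback_auto:
  assumes m: "m \<in> arr X x v" and \<phi>: "\<phi> \<in> autos X v"
  obtains \<psi> where "\<psi> \<in> autos X x" "cmp X m \<psi> = cmp X \<phi> m"
proof -
  obtain k where "k \<in> arr X x x" "\<And>t. t \<in> topspace (base X x) \<Longrightarrow> bmap X k t = id t" "cmp X m k = cmp X \<phi> m"
  proof (rule factor[OF m cmp_arr[OF autos_arr[OF \<phi>] m], of id])
    show "bmap X m (id t) = bmap X (cmp X \<phi> m) t" if "t \<in> topspace (base X x)" for t
      using that bmap_cmp[OF autos_arr[OF \<phi>] m] bmap_autos[OF \<phi>] bmap_in[OF m] by simp
  qed auto
  then show ?thesis by (intro that[of k]) (auto simp: autos_def)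
qed

lemma cancel_autos:
  assumes "m \<in> arr X x v" "k \<in> autos X x" "k' \<in> autos X x" "cmp X m k = cmp X m k'"
  shows "k = k'"
  by (rule cancel[OF assms(1) autos_arr[OF assms(2)] autos_arr[OF assms(3)] assms(4)])
    (simp add: bmap_autos[OF assms(2)] bmap_autos[OF assms(3)])

end

lemma fibred_groupoidsI: "stack X \<Longrightarrow> fibred_groupoids X"
  by unfold_locales (auto simp: stack_def fibred_in_groupoids_def)

lemma atlas_powers:
  assumes "stack X" "atlas X a"
  shows "powers X a"
proof -
  interpret fibred_groupoids X by (rule fibred_groupoidsI) fact
  show ?thesis
  proof (rule powers_if_products)
    show "a \<in> Ob X" using assms(2) by (simp add: atlas_def)
    show "\<exists>w m n. is_product X u a w m n" if "u \<in> Ob X" for u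
      using assms(2) that unfolding atlas_def by meson
  qed
qed

section \<open>Principal bundles\<close>

lemma principal_bundle_act:
  assumes "principal_bundle H Ht P" "y \<in> topspace (tot P)"
  shows "act P y \<one>\<^bsub>H\<^esub> = y"
    and "g \<in> carrier H \<Longrightarrow> act P y g \<in> topspace (tot P)"
    and "g \<in> carrier H \<Longrightarrow> proj P (act P y g) = proj P y"
    and "g \<in> carrier H \<Longrightarrow> h \<in> carrier H \<Longrightarrow> act P (act P y g) h = act P y (g \<otimes>\<^bsub>H\<^esub> h)"
    and "proj P y \<in> topspace (bbase P)"
  using assms by (auto simp: principal_bundle_def continuous_map_def)

lemma principal_bundle_local:
  assumes "principal_bundle H Ht P" "t \<in> topspace (bbase P)"
  shows "\<exists>U s. openin (bbase P) U \<and> t \<in> U \<and>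
        (\<forall>x\<in>U. s x \<in> topspace (tot P) \<and> proj P (s x) = x) \<and>
        homeomorphic_map (prod_topology (subtopology (bbase P) U) Ht)
          (subtopology (tot P) {y \<in> topspace (tot P). proj P y \<in> U}) (\<lambda>(x, g). act P (s x) g)"
  using assms unfolding principal_bundle_def by blast

text \<open>In a local trivialisation all points of a fibre are translates of the section point,
  which gives existence; injectivity of the trivialisation gives uniqueness.\<close>

lemma principal_bundle_torsor:
  assumes P: "principal_bundle H Ht P" and H: "group H" "topspace Ht = carrier H"
    and y: "y \<in> topspace (tot P)" "y' \<in> topspace (tot P)" "proj P y = proj P y'"
  shows "\<exists>!g. g \<in> carrier H \<and> act P y g = y'"
proof -
  interpret group H by fact
  have "proj P y \<in> topspace (bbase P)" using principal_bundle_act(5)[OF P y(1)] .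
  from principal_bundle_local[OF P this] obtain U s where U: "openin (bbase P) U" "proj P y \<in> U"
    and s': "\<forall>x\<in>U. s x \<in> topspace (tot P) \<and> proj P (s x) = x"
    and hm: "homeomorphic_map (prod_topology (subtopology (bbase P) U) Ht)
          (subtopology (tot P) {y \<in> topspace (tot P). proj P y \<in> U}) (\<lambda>(x, g). act P (s x) g)"
    by blast
  have s: "\<And>x. x \<in> U \<Longrightarrow> s x \<in> topspace (tot P)" "\<And>x. x \<in> U \<Longrightarrow> proj P (s x) = x" using s' by auto
  have tU: "topspace (subtopology (bbase P) U) = U" using openin_subset[OF U(1)] by auto
  note im = homeomorphic_imp_surjective_map[OF hm] and inj = homeomorphic_imp_injective_map[OF hm]
  have ex: "\<exists>g\<in>carrier H. act P (s (proj P y)) g = z" if "z \<in> topspace (tot P)" "proj P z = proj P y" for z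
  proof -
    have "z \<in> topspace (subtopology (tot P) {y \<in> topspace (tot P). proj P y \<in> U})" using that U by simp
    then obtain x g where xg: "x \<in> U" "g \<in> carrier H" "z = act P (s x) g"
      unfolding im[symmetric] using tU H(2) by auto
    then have "x = proj P y" using that(2) principal_bundle_act(3)[OF P s(1)] s(2) by simp
    then show ?thesis using xg by blast
  qed
  let ?s = "s (proj P y)"
  have s': "?s \<in> topspace (tot P)" using s U by blast
  from ex[OF y(1)] obtain a where a: "a \<in> carrier H" "act P ?s a = y" by auto
  from ex[OF y(2)] y(3) obtain b where b: "b \<in> carrier H" "act P ?s b = y'" by auto
  have act: "act P y g = act P ?s (a \<otimes>\<^bsub>H\<^esub> g)" if "g \<in> carrier H" for g
    using principal_bundle_act(4)[OF P s' a(1) that] a(2) by simp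
  show ?thesis
  proof (rule ex1I)
    show "inv\<^bsub>H\<^esub> a \<otimes>\<^bsub>H\<^esub> b \<in> carrier H \<and> act P y (inv\<^bsub>H\<^esub> a \<otimes>\<^bsub>H\<^esub> b) = y'"
      using a b act by (simp add: m_assoc[symmetric])
  next
    fix g assume g: "g \<in> carrier H \<and> act P y g = y'"
    then have "act P ?s (a \<otimes>\<^bsub>H\<^esub> g) = act P ?s b" using act[of g] b by metis
    then have "a \<otimes>\<^bsub>H\<^esub> g = b"
      using inj_onD[OF inj, of "(proj P y, a \<otimes>\<^bsub>H\<^esub> g)" "(proj P y, b)"] a b g U(2) tU H(2)
        principal_bundle_act(5)[OF P y(1)] by simp
    then show "g = inv\<^bsub>H\<^esub> a \<otimes>\<^bsub>H\<^esub> b" using a g by (auto simp: m_assoc[symmetric])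
  qed
qed

text \<open>The group element that carries one point to the other fixes their common image, so it is
  the unit.\<close>

lemma bundle_arrow_inj:
  assumes m: "m \<in> bundle_arrows H Ht" and H: "group H" "topspace Ht = carrier H"
    and y: "y \<in> topspace (tot (bsrc m))" "y' \<in> topspace (tot (bsrc m))"
      "proj (bsrc m) y = proj (bsrc m) y'" and eq: "tfun m y = tfun m y'"
  shows "y = y'"
proof -
  interpret group H by fact
  have P: "principal_bundle H Ht (bsrc m)" "principal_bundle H Ht (btgt m)"
    using m by (auto simp: bundle_arrows_def)
  obtain g where g: "g \<in> carrier H" "act (bsrc m) y g = y'"
    using principal_bundle_torsor[OF P(1) H y] by blast
  have t: "tfun m y \<in> topspace (tot (btgt m))" using m y by (auto simp: bundle_arrows_def continuous_map_def)
  have "act (btgt m) (tfun m y) g = tfun m y" using m y g eq by (auto simp: bundle_arrows_def)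
  moreover have "act (btgt m) (tfun m y) \<one>\<^bsub>H\<^esub> = tfun m y" using principal_bundle_act(1)[OF P(2) t] .
  ultimately have "g = \<one>\<^bsub>H\<^esub>" using principal_bundle_torsor[OF P(2) H t t] g by auto
  then show ?thesis using g principal_bundle_act(1)[OF P(1) y(1)] by simp
qed

lemma group_U1: "group U1"
proof (rule groupI)
  show "\<exists>y\<in>carrier U1. y \<otimes>\<^bsub>U1\<^esub> x = \<one>\<^bsub>U1\<^esub>" if "x \<in> carrier U1" for x
  proof -
    have "x \<noteq> 0" using that by (auto simp: U1_def)
    then show ?thesis using that by (intro bexI[of _ "inverse x"]) (auto simp: U1_def norm_inverse)
  qed
qed (auto simp: U1_def norm_mult)

lemma topspace_U1_space: "topspace U1_space = carrier U1"
  by (simp add: U1_space_def U1_def)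

lemma cis_U1: "cis r \<in> carrier U1"
  by (simp add: U1_def)

section \<open>The total stack of a circle bundle\<close>

locale circle_bundle = B: fibred_groupoids B + E: fibred_groupoids "total_stack B p"
  for B :: "('o, 'm, 'u) fibcat" and p :: "('o, 'm, 'u) ub_map" +
  assumes p: "stack_map B (classifying_stack U1 U1_space) p"
begin

abbreviation E where "E \<equiv> total_stack B p"

lemma principal: "u \<in> Ob B \<Longrightarrow> principal_bundle U1 U1_space (onob p u)"
  and bbase: "u \<in> Ob B \<Longrightarrow> bbase (onob p u) = base B u"
  using p by (auto simp: stack_map_def classifying_stack_def)

lemma barrow:
  assumes "m \<in> arr B u v"
  shows "onar p m \<in> bundle_arrows U1 U1_space" "bsrc (onar p m) = onob p u" "btgt (onar p m) = onob p v"
    "t \<in> topspace (base B u) \<Longrightarrow> bfun (onar p m) t = bmap B m t"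
proof -
  have "onar p m \<in> arr (classifying_stack U1 U1_space) (onob p u) (onob p v) \<and>
        (\<forall>x\<in>topspace (base B u). bmap (classifying_stack U1 U1_space) (onar p m) x = bmap B m x)"
    using p assms unfolding stack_map_def by blast
  then show "onar p m \<in> bundle_arrows U1 U1_space" "bsrc (onar p m) = onob p u" "btgt (onar p m) = onob p v"
    "t \<in> topspace (base B u) \<Longrightarrow> bfun (onar p m) t = bmap B m t"
    by (auto simp: classifying_stack_def arr_def)
qed

lemma tfun_cont: "m \<in> arr B u v \<Longrightarrow> continuous_map (tot (onob p u)) (tot (onob p v)) (tfun (onar p m))"
  using barrow[of m u v] by (auto simp: bundle_arrows_def)

lemma tfun_in: "m \<in> arr B u v \<Longrightarrow> y \<in> topspace (tot (onob p u)) \<Longrightarrow> tfun (onar p m) y \<in> topspace (tot (onob p v))"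
  using tfun_cont by (auto simp: continuous_map_def)

lemma proj_in: "u \<in> Ob B \<Longrightarrow> y \<in> topspace (tot (onob p u)) \<Longrightarrow> proj (onob p u) y \<in> topspace (base B u)"
  using principal_bundle_act(5)[OF principal] bbase by metis

lemma proj_tfun:
  assumes "m \<in> arr B u v" "y \<in> topspace (tot (onob p u))"
  shows "proj (onob p v) (tfun (onar p m) y) = bmap B m (proj (onob p u) y)"
proof -
  have "proj (onob p v) (tfun (onar p m) y) = bfun (onar p m) (proj (onob p u) y)"
    using barrow[OF assms(1)] assms(2) by (auto simp: bundle_arrows_def)
  then show ?thesis using barrow(4)[OF assms(1) proj_in[OF B.arr_Ob(1)[OF assms(1)] assms(2)]] by simp
qed

lemma tfun_act:
  assumes "m \<in> arr B u v" "y \<in> topspace (tot (onob p u))" "g \<in> carrier U1"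
  shows "tfun (onar p m) (act (onob p u) y g) = act (onob p v) (tfun (onar p m) y) g"
  using barrow[OF assms(1)] assms by (auto simp: bundle_arrows_def)

lemma tfun_inj:
  assumes "m \<in> arr B u v" "y \<in> topspace (tot (onob p u))" "y' \<in> topspace (tot (onob p u))"
    "proj (onob p u) y = proj (onob p u) y'" "tfun (onar p m) y = tfun (onar p m) y'"
  shows "y = y'"
  using bundle_arrow_inj[OF barrow(1)[OF assms(1)] group_U1 topspace_U1_space] assms barrow[OF assms(1)] by metis

lemma tfun_cmp:
  assumes "n \<in> arr B v w" "m \<in> arr B u v" "y \<in> topspace (tot (onob p u))"
  shows "tfun (onar p (cmp B n m)) y = tfun (onar p n) (tfun (onar p m) y)"
proof -
  have "onar p (cmp B n m) = cmp (classifying_stack U1 U1_space) (onar p n) (onar p m)"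
    using p assms unfolding stack_map_def by blast
  then show ?thesis using assms barrow(2)[OF assms(2)] by (simp add: classifying_stack_def compose_def)
qed

lemma E_Ob: "(u, \<xi>) \<in> Ob E \<longleftrightarrow> u \<in> Ob B \<and> \<xi> \<in> bundle_sections (onob p u)"
  and E_base: "base E (u, \<xi>) = base B u"
  and E_bmap: "bmap E (e1, m, e2) = bmap B m"
  and E_cmp: "cmp E (e2', n, e3) (e1, m, e2) = (e1, cmp B n m, e3)"
  and E_arr: "L \<in> arr E (u, \<xi>) (v, \<zeta>) \<longleftrightarrow> (\<exists>m. L = ((u, \<xi>), m, (v, \<zeta>)) \<and> m \<in> arr B u v \<and>
      \<xi> \<in> bundle_sections (onob p u) \<and> \<zeta> \<in> bundle_sections (onob p v) \<and>
      (\<forall>t\<in>topspace (base B u). tfun (onar p m) (\<xi> t) = \<zeta> (bmap B m t)))"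
  by (auto simp: total_stack_def arr_def)

lemma section_props:
  assumes "(u, \<xi>) \<in> Ob E"
  shows "continuous_map (base B u) (tot (onob p u)) \<xi>"
    "t \<in> topspace (base B u) \<Longrightarrow> \<xi> t \<in> topspace (tot (onob p u))"
    "t \<in> topspace (base B u) \<Longrightarrow> proj (onob p u) (\<xi> t) = t"
  using assms by (auto simp: E_Ob bundle_sections_def bbase continuous_map_def)

lemma total_proj_map: "stack_map E B total_proj"
  unfolding stack_map_def
proof (intro conjI ballI allI)
  fix e assume "e \<in> Ob E"
  then show "onob total_proj e \<in> Ob B" "base B (onob total_proj e) = base E e"
    "onar total_proj (ident E e) = ident B (onob total_proj e)"
    by (auto simp: total_proj_def total_stack_def)
next
  fix e e' M assume M: "M \<in> arr E e e'"
  obtain u \<xi> v \<zeta> where "e = (u, \<xi>)" "e' = (v, \<zeta>)" by (cases e, cases e')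
  with M show "onar total_proj M \<in> arr B (onob total_proj e) (onob total_proj e')"
    "bmap B (onar total_proj M) t = bmap E M t" for t
    by (auto simp: total_proj_def E_arr E_bmap)
next
  fix e e' e'' M N assume "M \<in> arr E e e'" "N \<in> arr E e' e''"
  moreover obtain u \<xi> v \<zeta> w \<theta> where "e = (u, \<xi>)" "e' = (v, \<zeta>)" "e'' = (w, \<theta>)" by (cases e, cases e', cases e'')
  ultimately show "onar total_proj (cmp E N M) = cmp B (onar total_proj N) (onar total_proj M)"
    by (auto simp: total_proj_def E_arr E_cmp)
qed

sublocale total_proj: stack_morphism E B total_proj
  by unfold_locales (rule total_proj_map)

end

section \<open>The atlas of the total stack induced by an atlas of the base\<close>

locale circle_bundle_atlas = circle_bundle +
  fixes b e m
  assumes ind: "induced_atlas B p b e m"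
begin

lemma e_Ob: "e \<in> Ob E" and m: "m \<in> arr B (fst e) b" and base_e: "base B (fst e) = tot (onob p b)"
  and bmap_m: "y \<in> topspace (tot (onob p b)) \<Longrightarrow> bmap B m y = proj (onob p b) y"
  and tfun_m: "y \<in> topspace (tot (onob p b)) \<Longrightarrow> tfun (onar p m) (snd e y) = y"
  using ind by (auto simp: induced_atlas_def)

lemma e_pair: "(fst e, snd e) \<in> Ob E" using e_Ob by simp

text \<open>Arrows in \<open>E\<close> to the induced atlas are arrows in \<open>B\<close> to \<open>b\<close>: the section determines the point of the total space.\<close>

lemma arrow_to_e:
  assumes x: "(x, \<xi>) \<in> Ob E" and l: "l \<in> arr B x b"
  shows "\<exists>!L. L \<in> arr E (x, \<xi>) e \<and> cmp B m (onar total_proj L) = l"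
    and "L \<in> arr E (x, \<xi>) e \<Longrightarrow> cmp B m (onar total_proj L) = l \<Longrightarrow> t \<in> topspace (base B x) \<Longrightarrow>
      bmap E L t = tfun (onar p l) (\<xi> t)"
proof -
  define f where "f t = tfun (onar p l) (\<xi> t)" for t
  note s = section_props[OF x] and se = section_props[OF e_pair]
  have f: "continuous_map (base B x) (base B (fst e)) f"
    unfolding f_def base_e using continuous_map_compose[OF s(1) tfun_cont[OF l]] by (simp add: o_def)
  have f_in: "f t \<in> topspace (tot (onob p b))" if "t \<in> topspace (base B x)" for t
    using f that by (auto simp: base_e continuous_map_def)
  have mf: "bmap B m (f t) = bmap B l t" if "t \<in> topspace (base B x)" for t
    using bmap_m[OF f_in[OF that]] proj_tfun[OF l s(2)[OF that]] s(3)[OF that] by (simp add: f_def)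
  obtain k where k: "k \<in> arr B x (fst e)" "\<And>t. t \<in> topspace (base B x) \<Longrightarrow> bmap B k t = f t" "cmp B m k = l"
    using B.factor[OF m l f mf] by blast
  \<comment> \<open>Both sides agree after applying the bundle map of \<open>m\<close>, which is
    injective on fibres.\<close>
  have tk: "tfun (onar p k) (\<xi> t) = snd e (bmap B k t)" if t: "t \<in> topspace (base B x)" for t
  proof (rule tfun_inj[OF m tfun_in[OF k(1) s(2)[OF t]]])
    have e': "bmap B k t \<in> topspace (base B (fst e))" using f_in[OF t] k(2)[OF t] by (simp add: base_e)
    show "snd e (bmap B k t) \<in> topspace (tot (onob p (fst e)))" using se(2)[OF e'] .
    show "proj (onob p (fst e)) (tfun (onar p k) (\<xi> t)) = proj (onob p (fst e)) (snd e (bmap B k t))"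
      using se(3)[OF e'] proj_tfun[OF k(1) s(2)[OF t]] s(3)[OF t] by simp
    show "tfun (onar p m) (tfun (onar p k) (\<xi> t)) = tfun (onar p m) (snd e (bmap B k t))"
      using tfun_cmp[OF m k(1) s(2)[OF t]] k tfun_m[OF f_in[OF t]] t by (simp add: f_def)
  qed
  have L: "((x, \<xi>), k, e) \<in> arr E (x, \<xi>) e"
    using x e_pair k(1) tk by (cases e) (auto simp: E_arr E_Ob)
  \<comment> \<open>The bundle map of \<open>m\<close> sends the tautological section at a point to
    that very point, which forces the base map.\<close>
  have val: "bmap E L t = f t" if L: "L \<in> arr E (x, \<xi>) e" "cmp B m (onar total_proj L) = l" and t: "t \<in> topspace (base B x)"
    for L t
  proof -
    obtain k' where k': "L = ((x, \<xi>), k', e)" "k' \<in> arr B x (fst e)" "tfun (onar p k') (\<xi> t) = snd e (bmap B k' t)"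
      using L(1) t by (cases e) (auto simp: E_arr)
    have "bmap B k' t = tfun (onar p m) (snd e (bmap B k' t))"
      using tfun_m B.bmap_in[OF k'(2) t] by (simp add: base_e)
    also have "\<dots> = f t"
      using k' tfun_cmp[OF m k'(2) s(2)[OF t]] L(2) by (simp add: f_def total_proj_def)
    finally show ?thesis by (simp add: k' E_bmap)
  qed
  then show "L \<in> arr E (x, \<xi>) e \<Longrightarrow> cmp B m (onar total_proj L) = l \<Longrightarrow> t \<in> topspace (base B x) \<Longrightarrow>
      bmap E L t = tfun (onar p l) (\<xi> t)" by (simp add: f_def)
  show "\<exists>!L. L \<in> arr E (x, \<xi>) e \<and> cmp B m (onar total_proj L) = l"
  proof (rule ex1I)
    show "((x, \<xi>), k, e) \<in> arr E (x, \<xi>) e \<and> cmp B m (onar total_proj ((x, \<xi>), k, e)) = l"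
      using L k by (simp add: total_proj_def)
  next
    fix L assume L: "L \<in> arr E (x, \<xi>) e \<and> cmp B m (onar total_proj L) = l"
    obtain k' where k': "L = ((x, \<xi>), k', e)" "k' \<in> arr B x (fst e)"
      using L by (cases e) (auto simp: E_arr)
    have "k' = k"
    proof (rule B.cancel[OF m k'(2) k(1)])
      show "cmp B m k' = cmp B m k" using L k' k by (simp add: total_proj_def)
      show "bmap B k' t = bmap B k t" if "t \<in> topspace (base B x)" for t
        using val[of L t] L that k' k by (simp add: E_bmap)
    qed
    then show "L = ((x, \<xi>), k, e)" using k' by simp
  qed
qed

text \<open>An arrow to \<open>e\<close> amounts to an arrow to \<open>b\<close>. So the product
  with \<open>e\<close> lies over the product of \<open>u\<close> with \<open>b\<close>, and carries
  the section pulled back from \<open>\<zeta>\<close>.\<close>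

lemma product_in_E:
  assumes prod: "is_product B u b w0 m0 n0" and u: "(u, \<zeta>) \<in> Ob E"
  shows "\<exists>w M N. is_product E (u, \<zeta>) e w M N"
proof -
  have m0: "m0 \<in> arr B w0 u" and n0: "n0 \<in> arr B w0 b" using prod by (auto simp: is_product_def)
  have "continuous_map (base B w0) (base E (u, \<zeta>)) (bmap B m0)"
    using B.continuous_bmap[OF m0] by (simp add: E_base)
  from E.pullback[OF u this] obtain W M where M: "M \<in> arr E W (u, \<zeta>)" "base E W = base B w0"
    "\<And>t. t \<in> topspace (base B w0) \<Longrightarrow> bmap E M t = bmap B m0 t" by metis
  obtain w \<theta> where W: "W = (w, \<theta>)" by (cases W)
  have WOb: "(w, \<theta>) \<in> Ob E" using E.arr_Ob(1)[OF M(1)] W by simp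
  note s = section_props[OF WOb]
  obtain m1 where m1: "M = ((w, \<theta>), m1, (u, \<zeta>))" "m1 \<in> arr B w u"
    "\<And>t. t \<in> topspace (base B w) \<Longrightarrow> tfun (onar p m1) (\<theta> t) = \<zeta> (bmap B m1 t)"
    using M(1) by (auto simp: W E_arr)
  have bw: "base B w = base B w0" using M(2) by (simp add: W E_base)
  have "continuous_map (base B w) (base B w0) id" using bw by simp
  \<comment> \<open>\<open>i\<close> identifies the chosen pullback \<open>w\<close> with the given
    product \<open>w0\<close>.\<close>
  then obtain i where i: "i \<in> arr B w w0" "\<And>t. t \<in> topspace (base B w) \<Longrightarrow> bmap B i t = t" "cmp B m0 i = m1"
    using B.factor[OF m0 m1(2), of id] M(3) bw by (auto simp: m1(1) E_bmap)
  define n1 where "n1 = cmp B n0 i"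
  have n1: "n1 \<in> arr B w b" unfolding n1_def using B.cmp_arr n0 i by blast
  obtain N where N: "N \<in> arr E (w, \<theta>) e" "cmp B m (onar total_proj N) = n1"
    using arrow_to_e(1)[OF WOb n1] by blast
  have "\<exists>!J. J \<in> arr E X (w, \<theta>) \<and> cmp E M J = K \<and> cmp E N J = L"
    if X: "X \<in> Ob E" and K: "K \<in> arr E X (u, \<zeta>)" and L: "L \<in> arr E X e" for X K L
  proof -
    obtain x \<xi> where X': "X = (x, \<xi>)" by (cases X)
    have xOb: "(x, \<xi>) \<in> Ob E" using X X' by simp
    note sx = section_props[OF xOb]
    obtain k where k: "K = ((x, \<xi>), k, (u, \<zeta>))" "k \<in> arr B x u"
      "\<And>t. t \<in> topspace (base B x) \<Longrightarrow> tfun (onar p k) (\<xi> t) = \<zeta> (bmap B k t)"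
      using K by (auto simp: X' E_arr)
    define l where "l = cmp B m (onar total_proj L)"
    have "onar total_proj L \<in> arr B x (fst e)"
      using total_proj.onar_arr[OF L] by (simp add: X' total_proj_def)
    then have l: "l \<in> arr B x b" unfolding l_def using m B.cmp_arr by blast
    have xB: "x \<in> Ob B" using xOb by (simp add: E_Ob)
    obtain j0 where j0: "j0 \<in> arr B x w0" "cmp B m0 j0 = k" "cmp B n0 j0 = l"
      and j0u: "\<And>j. j \<in> arr B x w0 \<Longrightarrow> cmp B m0 j = k \<Longrightarrow> cmp B n0 j = l \<Longrightarrow> j = j0"
    proof -
      have "\<exists>!j. j \<in> arr B x w0 \<and> cmp B m0 j = k \<and> cmp B n0 j = l"
        using prod xB k(2) l by (simp add: is_product_def)
      then show ?thesis using that by blast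
    qed
    obtain j where j: "j \<in> arr B x w" "\<And>t. t \<in> topspace (base B x) \<Longrightarrow> bmap B j t = bmap B j0 t" "cmp B i j = j0"
    proof (rule B.factor[OF i(1) j0(1), of "bmap B j0"])
      show "continuous_map (base B x) (base B w) (bmap B j0)" using B.continuous_bmap[OF j0(1)] by (simp add: bw)
      then show "bmap B i (bmap B j0 t) = bmap B j0 t" if "t \<in> topspace (base B x)" for t
        using that i(2) by (auto simp: continuous_map_def)
    qed blast
    have mj: "cmp B m1 j = k" and nj: "cmp B n1 j = l"
      using B.cmp_assoc[OF m0 i(1) j(1)] B.cmp_assoc[OF n0 i(1) j(1)] by (simp_all add: i(3) j(3) j0 n1_def)
    have "tfun (onar p j) (\<xi> t) = \<theta> (bmap B j t)" if t: "t \<in> topspace (base B x)" for t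
    proof (rule tfun_inj[OF m1(2) tfun_in[OF j(1) sx(2)[OF t]]])
      note wt = B.bmap_in[OF j(1) t]
      show "\<theta> (bmap B j t) \<in> topspace (tot (onob p w))" using s(2)[OF wt] .
      show "proj (onob p w) (tfun (onar p j) (\<xi> t)) = proj (onob p w) (\<theta> (bmap B j t))"
        using s(3)[OF wt] proj_tfun[OF j(1) sx(2)[OF t]] sx(3)[OF t] by simp
      show "tfun (onar p m1) (tfun (onar p j) (\<xi> t)) = tfun (onar p m1) (\<theta> (bmap B j t))"
        using tfun_cmp[OF m1(2) j(1) sx(2)[OF t]] k(3)[OF t] m1(3)[OF wt] B.bmap_cmp[OF m1(2) j(1) t] by (simp add: mj)
    qed
    then have J: "(X, j, (w, \<theta>)) \<in> arr E X (w, \<theta>)"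
      using xOb WOb j(1) by (auto simp: X' E_arr E_Ob)
    have NJ: "cmp E N J = L \<longleftrightarrow> cmp B n1 (onar total_proj J) = l" if J: "J \<in> arr E X (w, \<theta>)" for J
    proof -
      have "cmp B m (onar total_proj (cmp E N J)) = cmp B n1 (onar total_proj J)"
        unfolding total_proj.onar_cmp[OF N(1) J] N(2)[symmetric]
        using B.cmp_assoc[OF m, of "onar total_proj N" w "onar total_proj J" x]
          total_proj.onar_arr[OF N(1)] total_proj.onar_arr[OF J] by (simp add: total_proj_def X')
      moreover have "cmp E N J \<in> arr E (x, \<xi>) e" using E.cmp_arr[OF N(1) J] by (simp add: X')
      ultimately show ?thesis using arrow_to_e(1)[OF xOb l] L unfolding X' l_def by metis
    qed
    show ?thesis
    proof (rule ex1I)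
      show "(X, j, (w, \<theta>)) \<in> arr E X (w, \<theta>) \<and> cmp E M (X, j, (w, \<theta>)) = K \<and> cmp E N (X, j, (w, \<theta>)) = L"
        using J NJ[OF J] mj nj by (simp add: m1(1) k(1) E_cmp X' total_proj_def)
    next
      fix J assume J': "J \<in> arr E X (w, \<theta>) \<and> cmp E M J = K \<and> cmp E N J = L"
      then obtain j' where j': "J = (X, j', (w, \<theta>))" "j' \<in> arr B x w" by (auto simp: X' E_arr)
      have a: "cmp B m1 j' = k" "cmp B n1 j' = l"
        using J' NJ[of J] by (auto simp: j' m1(1) k(1) E_cmp X' total_proj_def)
      have "cmp B i j' = j0"
        using B.cmp_assoc[OF m0 i(1) j'(2)] B.cmp_assoc[OF n0 i(1) j'(2)] a
        by (intro j0u B.cmp_arr[OF i(1) j'(2)]) (simp_all add: i(3) n1_def)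
      then have "j' = j"
        using B.bmap_cmp[OF i(1) j'(2)] i(2) B.bmap_in[OF j'(2)] j(2,3)
        by (intro B.cancel[OF i(1) j'(2) j(1)]) auto
      then show "J = (X, j, (w, \<theta>))" using j' by simp
    qed
  qed
  then have "is_product E (u, \<zeta>) e (w, \<theta>) M N"
    using WOb M(1) N(1) W by (simp add: is_product_def)
  then show ?thesis by blast
qed

lemma powers_e:
  assumes "\<And>u. u \<in> Ob B \<Longrightarrow> \<exists>w m n. is_product B u b w m n"
  shows "powers E e"
proof (rule E.powers_if_products[OF e_Ob])
  fix \<epsilon> assume "\<epsilon> \<in> Ob E"
  then show "\<exists>w M N. is_product E \<epsilon> e w M N"
    using assms product_in_E by (cases \<epsilon>) (metis E_Ob)
qed

end

section \<open>Classifying stacks of discrete groups\<close>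

lemma bundle_arrowD:
  assumes "m \<in> bundle_arrows H Ht"
  shows "principal_bundle H Ht (bsrc m)" "principal_bundle H Ht (btgt m)"
    "continuous_map (bbase (bsrc m)) (bbase (btgt m)) (bfun m)"
    "continuous_map (tot (bsrc m)) (tot (btgt m)) (tfun m)"
    "bfun m \<in> extensional (topspace (bbase (bsrc m)))" "tfun m \<in> extensional (topspace (tot (bsrc m)))"
    "y \<in> topspace (tot (bsrc m)) \<Longrightarrow> tfun m y \<in> topspace (tot (btgt m))"
    "t \<in> topspace (bbase (bsrc m)) \<Longrightarrow> bfun m t \<in> topspace (bbase (btgt m))"
    "y \<in> topspace (tot (bsrc m)) \<Longrightarrow> proj (btgt m) (tfun m y) = bfun m (proj (bsrc m) y)"
    "y \<in> topspace (tot (bsrc m)) \<Longrightarrow> g \<in> carrier H \<Longrightarrow>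
       tfun m (act (bsrc m) y g) = act (btgt m) (tfun m y) g"
  using assms by (auto simp: bundle_arrows_def continuous_map_def)

lemma continuous_map_restrict:
  "continuous_map X Y f \<Longrightarrow> continuous_map X Y (restrict f (topspace X))"
  by (rule continuous_map_eq) auto

lemma ident_bundle_arrow:
  fixes P :: "('u, 'g) pbundle"
  assumes "principal_bundle H Ht P"
  shows "\<lparr>bsrc = P, btgt = P, bfun = restrict id (topspace (bbase P)), tfun = restrict id (topspace (tot P))\<rparr>
    \<in> bundle_arrows H Ht"
proof -
  have "continuous_map X X (restrict id (topspace X))" for X :: "'u topology"
    by (rule continuous_map_restrict) simp
  then show ?thesis
    using assms principal_bundle_act(2,3,5)[OF assms] by (simp add: bundle_arrows_def)
qed

lemma cmp_bundle_arrow: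
  assumes m: "m \<in> bundle_arrows H Ht" and n: "n \<in> bundle_arrows H Ht" and mn: "btgt m = bsrc n"
  shows "\<lparr>bsrc = bsrc m, btgt = btgt n, bfun = compose (topspace (bbase (bsrc m))) (bfun n) (bfun m),
     tfun = compose (topspace (tot (bsrc m))) (tfun n) (tfun m)\<rparr> \<in> bundle_arrows H Ht"
proof -
  note D = bundle_arrowD[OF m] and D' = bundle_arrowD[OF n, folded mn]
  have "continuous_map (bbase (bsrc m)) (bbase (btgt n)) (compose (topspace (bbase (bsrc m))) (bfun n) (bfun m))"
    using continuous_map_restrict[OF continuous_map_compose[OF D(3) D'(3)]] by (simp add: compose_def restrict_def o_def)
  moreover have "continuous_map (tot (bsrc m)) (tot (btgt n)) (compose (topspace (tot (bsrc m))) (tfun n) (tfun m))"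
    using continuous_map_restrict[OF continuous_map_compose[OF D(4) D'(4)]] by (simp add: compose_def restrict_def o_def)
  ultimately show ?thesis
    using D D' principal_bundle_act[OF D(1)]
    by (auto simp: bundle_arrows_def compose_def)
qed

text \<open>The identity laws hold as equalities because the components of bundle arrows are
  extensional.\<close>

lemma category_classifying_stack:
  "category_over_spaces (classifying_stack H Ht :: (('u, 'g) pbundle, ('u, 'g) bundle_arrow, 'u) fibcat)"
proof -
  let ?S = "classifying_stack H Ht :: (('u, 'g) pbundle, ('u, 'g) bundle_arrow, 'u) fibcat"
  have arr: "m \<in> arr ?S P Q \<longleftrightarrow> m \<in> bundle_arrows H Ht \<and> bsrc m = P \<and> btgt m = Q" for m P Q
    by (simp add: classifying_stack_def arr_def)
  have 1: "src ?S m \<in> Ob ?S \<and> tgt ?S m \<in> Ob ?S \<and> continuous_map (base ?S (src ?S m)) (base ?S (tgt ?S m)) (bmap ?S m) \<and>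
        bmap ?S m \<in> extensional (topspace (base ?S (src ?S m)))" if "m \<in> Ar ?S" for m
    using that bundle_arrowD[of m H Ht] by (simp add: classifying_stack_def)
  have 2: "ident ?S u \<in> arr ?S u u \<and> (\<forall>x\<in>topspace (base ?S u). bmap ?S (ident ?S u) x = x)" if "u \<in> Ob ?S" for u
    using that ident_bundle_arrow[of H Ht u] unfolding arr by (simp add: classifying_stack_def)
  have 3: "cmp ?S n m \<in> arr ?S u w \<and> (\<forall>x\<in>topspace (base ?S u). bmap ?S (cmp ?S n m) x = bmap ?S n (bmap ?S m x))"
    if "m \<in> arr ?S u v" "n \<in> arr ?S v w" for u v w m n
    using that cmp_bundle_arrow[of m H Ht n] unfolding arr by (auto simp: classifying_stack_def compose_def)
  have 4: "cmp ?S m (ident ?S u) = m \<and> cmp ?S (ident ?S v) m = m" if "m \<in> arr ?S u v" for u v m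
  proof -
    note m = that[unfolded arr] and D = bundle_arrowD[of m H Ht]
    have "compose (topspace (bbase u)) (bfun m) (restrict id (topspace (bbase u))) = bfun m"
      "compose (topspace (tot u)) (tfun m) (restrict id (topspace (tot u))) = tfun m"
      "compose (topspace (bbase u)) (restrict id (topspace (bbase v))) (bfun m) = bfun m"
      "compose (topspace (tot u)) (restrict id (topspace (tot v))) (tfun m) = tfun m"
      using D m by (auto simp: compose_def restrict_def extensional_def fun_eq_iff)
    then show ?thesis using m by (auto simp: classifying_stack_def)
  qed
  have 5: "cmp ?S k (cmp ?S n m) = cmp ?S (cmp ?S k n) m"
    if "m \<in> arr ?S u v" "n \<in> arr ?S v w" "k \<in> arr ?S w z" for u v w z m n k
    using that[unfolded arr] bundle_arrowD(7,8)[of m H Ht]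
    by (auto simp: classifying_stack_def compose_def restrict_def fun_eq_iff)
  show ?thesis
    unfolding category_over_spaces_def
    using 1 2 3 4 5 by (intro conjI ballI allI) blast+
qed

lemma local_section_continuous:
  assumes P: "principal_bundle H Ht P" and H: "group H" "topspace Ht = carrier H" and U: "openin (bbase P) U"
    and s: "\<forall>x\<in>U. s x \<in> topspace (tot P) \<and> proj P (s x) = x"
    and hm: "homeomorphic_map (prod_topology (subtopology (bbase P) U) Ht)
          (subtopology (tot P) {y \<in> topspace (tot P). proj P y \<in> U}) (\<lambda>(x, g). act P (s x) g)"
  shows "continuous_map (subtopology (bbase P) U) (tot P) s"
proof -
  interpret group H by fact
  have tU: "topspace (subtopology (bbase P) U) = U" using openin_subset[OF U] by auto
  have "continuous_map (subtopology (bbase P) U) (prod_topology (subtopology (bbase P) U) Ht) (\<lambda>x. (x, \<one>\<^bsub>H\<^esub>))"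
    using H(2) by (simp add: continuous_map_pairwise o_def)
  from continuous_map_compose[OF this homeomorphic_imp_continuous_map[OF hm]]
  have "continuous_map (subtopology (bbase P) U) (tot P) (\<lambda>x. act P (s x) \<one>\<^bsub>H\<^esub>)"
    by (simp add: o_def continuous_map_in_subtopology)
  then show ?thesis
    by (rule continuous_map_eq) (use s principal_bundle_act(1)[OF P] tU in auto)
qed

lemma continuous_map_prod_discrete:
  assumes "\<And>d. d \<in> D \<Longrightarrow> continuous_map X Z (\<lambda>q. f (q, d))"
  shows "continuous_map (prod_topology X (discrete_topology D)) Z f"
proof (rule pasting_lemma[where I = D and T = "\<lambda>d. topspace X \<times> {d}" and f = "\<lambda>d p. f (fst p, d)"])
  show "openin (prod_topology X (discrete_topology D)) (topspace X \<times> {d})" if "d \<in> D" for d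
    using that by (simp add: openin_prod_Times_iff)
  show "continuous_map (subtopology (prod_topology X (discrete_topology D)) (topspace X \<times> {d})) Z (\<lambda>p. f (fst p, d))"
    if "d \<in> D" for d
    by (rule continuous_map_from_subtopology[OF continuous_map_compose[OF continuous_map_fst assms[OF that], unfolded o_def]])
  show "f (fst p, d) = f (fst p, d')"
    if "d \<in> D" "d' \<in> D" "p \<in> topspace (prod_topology X (discrete_topology D)) \<inter> topspace X \<times> {d} \<inter> topspace X \<times> {d'}" for d d' p
    using that by auto
  show "\<exists>d. d \<in> D \<and> p \<in> topspace X \<times> {d} \<and> f p = f (fst p, d)"
    if "p \<in> topspace (prod_topology X (discrete_topology D))" for p
    using that by (intro exI[of _ "snd p"]) auto
qed

text \<open>In a local trivialisation the action is right multiplication on the discrete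
  factor.\<close>

lemma continuous_act_discrete:
  assumes P: "principal_bundle H (discrete_topology (carrier H)) P" and H: "group H" and g: "g \<in> carrier H"
  shows "continuous_map (tot P) (tot P) (\<lambda>y. act P y g)"
proof -
  interpret group H by fact
  let ?D = "discrete_topology (carrier H)"
  have "\<exists>V. openin (tot P) V \<and> y \<in> V \<and> continuous_map (subtopology (tot P) V) (tot P) (\<lambda>y. act P y g)"
    if y: "y \<in> topspace (tot P)" for y
  proof -
    obtain U s where U: "openin (bbase P) U" "proj P y \<in> U"
      and s: "\<forall>x\<in>U. s x \<in> topspace (tot P) \<and> proj P (s x) = x"
      and hm: "homeomorphic_map (prod_topology (subtopology (bbase P) U) ?D)
          (subtopology (tot P) {y \<in> topspace (tot P). proj P y \<in> U}) (\<lambda>(x, g). act P (s x) g)"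
      using principal_bundle_local[OF P principal_bundle_act(5)[OF P y]] by blast
    have tU: "topspace (subtopology (bbase P) U) = U" using openin_subset[OF U(1)] by auto
    let ?V = "{y \<in> topspace (tot P). proj P y \<in> U}" and ?h = "\<lambda>(x, g). act P (s x) g"
    have cp: "continuous_map (tot P) (bbase P) (proj P)" using P by (simp add: principal_bundle_def)
    have op: "openin (tot P) ?V" using openin_continuous_map_preimage[OF cp U(1)] .
    let ?X = "prod_topology (subtopology (bbase P) U) ?D"
    have "continuous_map ?X ?X (\<lambda>(x, a). (x, a \<otimes>\<^bsub>H\<^esub> g))"
    proof (rule continuous_map_prod_discrete)
      show "continuous_map (subtopology (bbase P) U) ?X (\<lambda>q. case (q, d) of (x, a) \<Rightarrow> (x, a \<otimes>\<^bsub>H\<^esub> g))"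
        if "d \<in> carrier H" for d
        using that g by (simp add: continuous_map_pairwise o_def)
    qed
    from continuous_map_compose[OF this homeomorphic_imp_continuous_map[OF hm]]
    have "continuous_map ?X (tot P) (\<lambda>p. act P (s (fst p)) (snd p \<otimes>\<^bsub>H\<^esub> g))"
      by (simp add: o_def case_prod_beta continuous_map_in_subtopology)
    then have "continuous_map ?X (tot P) ((\<lambda>y. act P y g) \<circ> ?h)"
    proof (rule continuous_map_eq)
      fix p assume "p \<in> topspace ?X"
      then show "act P (s (fst p)) (snd p \<otimes>\<^bsub>H\<^esub> g) = ((\<lambda>y. act P y g) \<circ> ?h) p"
        using tU s principal_bundle_act(4)[OF P, of "s (fst p)" "snd p" g] g by (auto simp: case_prod_beta)
    qed
    then have "continuous_map (subtopology (tot P) ?V) (tot P) (\<lambda>y. act P y g)"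
      by (rule continuous_compose_quotient_map[OF hm[unfolded homeomorphic_map_def, THEN conjunct1]])
    then show ?thesis using op y U(2) by blast
  qed
  then obtain V where V: "\<And>y. y \<in> topspace (tot P) \<Longrightarrow> openin (tot P) (V y) \<and> y \<in> V y \<and>
      continuous_map (subtopology (tot P) (V y)) (tot P) (\<lambda>y. act P y g)" by metis
  show ?thesis
  proof (rule pasting_lemma[where I = "topspace (tot P)" and T = V and f = "\<lambda>_ y. act P y g"])
    show "openin (tot P) (V y)" "continuous_map (subtopology (tot P) (V y)) (tot P) (\<lambda>y. act P y g)"
      if "y \<in> topspace (tot P)" for y using V[OF that] by blast+
    show "\<exists>j. j \<in> topspace (tot P) \<and> y \<in> V j \<and> act P y g = act P y g"
      if "y \<in> topspace (tot P)" for y using V[OF that] that by blast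
  qed (rule refl)
qed

text \<open>Makes room inside the fixed type of points for the total space of a trivial bundle with
  finite fibre.\<close>

lemma infinite_prod_embedding:
  assumes inf: "infinite (UNIV :: 'u set)" and C: "finite (C :: 'g set)"
  obtains enc :: "'u \<times> 'g \<Rightarrow> 'u" where "inj_on enc (UNIV \<times> C)"
proof -
  have "|(UNIV :: 'u set) \<times> (UNIV :: 'u set)| =o |UNIV :: 'u set|"
    using card_of_Times_same_infinite[OF inf] .
  then obtain h where h: "bij_betw h ((UNIV :: 'u set) \<times> (UNIV :: 'u set)) (UNIV :: 'u set)"
    using card_of_ordIso by blast
  obtain k :: "'g \<Rightarrow> 'u" where k: "inj_on k C"
  proof -
    obtain A :: "'u set" where "finite A" "card A = card C" using infinite_arbitrarily_large[OF inf] by blast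
    then obtain k :: "'g \<Rightarrow> 'u" where "bij_betw k C A" using finite_same_card_bij[OF C] by metis
    then show ?thesis using that by (auto simp: bij_betw_def)
  qed
  have "inj_on (\<lambda>(u, g). h (u, k g)) (UNIV \<times> C)"
  proof (rule inj_onI, clarify)
    fix u g u' g' assume g: "g \<in> C" "g' \<in> C" and eq: "h (u, k g) = h (u', k g')"
    have "(u, k g) = (u', k g')" using inj_onD[OF bij_betw_imp_inj_on[OF h] eq] by simp
    then show "u = u' \<and> g = g'" using inj_onD[OF k _ g] by simp
  qed
  then show ?thesis by (rule that)
qed

lemma image_Collect_mem: "A \<subseteq> f ` X \<Longrightarrow> f ` {x \<in> X. f x \<in> A} = A"
  by auto

text \<open>
  For a torsor \<open>P\<close> over a point, the product of a bundle \<open>Q\<close> with \<open>P\<close> in \<open>[*/\<Gamma>]\<close> is the pullback of \<open>Q\<close> to its own total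
  space: a point of \<open>Q\<close> is the same as an isomorphism of its fibre with \<open>P\<close>.
\<close>

locale point_torsor =
  fixes \<Gamma> :: "'g monoid" and P :: "('u, 'g) pbundle" and y0 pt
  assumes \<Gamma>: "group \<Gamma>" "finite (carrier \<Gamma>)"
    and P: "principal_bundle \<Gamma> (discrete_topology (carrier \<Gamma>)) P"
    and y0: "y0 \<in> topspace (tot P)" and pt: "topspace (bbase P) = {pt}"
    and inf: "infinite (UNIV :: 'u set)"
begin

interpretation G: group \<Gamma> by (rule \<Gamma>)

abbreviation D where "D \<equiv> discrete_topology (carrier \<Gamma>)"

abbreviation S :: "(('u, 'g) pbundle, ('u, 'g) bundle_arrow, 'u) fibcat" where "S \<equiv> classifying_stack \<Gamma> D"

sublocale S: spaces_category S
  by unfold_locales (rule category_classifying_stack)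

definition quot :: "'u \<Rightarrow> 'g" where
  "quot z = (THE g. g \<in> carrier \<Gamma> \<and> act P y0 g = z)"

lemma proj_P: "z \<in> topspace (tot P) \<Longrightarrow> proj P z = pt"
  using principal_bundle_act(5)[OF P] pt by auto

lemma quot:
  assumes "z \<in> topspace (tot P)"
  shows "quot z \<in> carrier \<Gamma>" "act P y0 (quot z) = z" "g \<in> carrier \<Gamma> \<Longrightarrow> act P y0 g = z \<Longrightarrow> quot z = g"
proof -
  have *: "\<exists>!g. g \<in> carrier \<Gamma> \<and> act P y0 g = z"
    by (rule principal_bundle_torsor[OF P \<Gamma>(1)]) (use assms y0 proj_P in auto)
  show "quot z \<in> carrier \<Gamma>" "act P y0 (quot z) = z" unfolding quot_def using theI'[OF *] by auto
  show "g \<in> carrier \<Gamma> \<Longrightarrow> act P y0 g = z \<Longrightarrow> quot z = g" unfolding quot_def using the1_equality[OF *] by auto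
qed

lemma quot_act: "z \<in> topspace (tot P) \<Longrightarrow> g \<in> carrier \<Gamma> \<Longrightarrow> quot (act P z g) = quot z \<otimes>\<^bsub>\<Gamma>\<^esub> g"
proof -
  assume z: "z \<in> topspace (tot P)" and g: "g \<in> carrier \<Gamma>"
  show "quot (act P z g) = quot z \<otimes>\<^bsub>\<Gamma>\<^esub> g"
  proof (rule quot(3)[OF principal_bundle_act(2)[OF P z g] G.m_closed[OF quot(1)[OF z] g]])
    show "act P y0 (quot z \<otimes>\<^bsub>\<Gamma>\<^esub> g) = act P z g"
      using principal_bundle_act(4)[OF P y0 quot(1)[OF z] g] quot(2)[OF z] by simp
  qed
qed

text \<open>Over one point, a single trivialisation identifies the total space with the discrete
  group.\<close>

lemma open_in_tot_P: "A \<subseteq> topspace (tot P) \<Longrightarrow> openin (tot P) A"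
proof -
  assume A: "A \<subseteq> topspace (tot P)"
  obtain U s where U: "openin (bbase P) U" "pt \<in> U"
    and hm: "homeomorphic_map (prod_topology (subtopology (bbase P) U) D)
          (subtopology (tot P) {y \<in> topspace (tot P). proj P y \<in> U}) (\<lambda>(x, g). act P (s x) g)"
    using principal_bundle_local[OF P, of pt] pt by blast
  have U': "U = {pt}" using openin_subset[OF U(1)] U(2) pt by auto
  have tot: "subtopology (tot P) {y \<in> topspace (tot P). proj P y \<in> U} = tot P"
    using proj_P U' by (subst subtopology_superset) auto
  let ?X = "prod_topology (subtopology (bbase P) U) D"
  have hm': "homeomorphic_map ?X (tot P) (\<lambda>(x, g). act P (s x) g)" using hm tot by simp
  have op: "openin ?X B" if "B \<subseteq> topspace ?X" for B
  proof -
    have "B = {pt} \<times> (snd ` B)" using that U' pt by force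
    moreover have "openin ?X ({pt} \<times> (snd ` B))"
      using that pt U(1) U' by (auto simp: openin_prod_Times_iff openin_subtopology_refl intro: openin_topspace)
    ultimately show ?thesis by simp
  qed
  define B where "B = {p \<in> topspace ?X. (\<lambda>(x, g). act P (s x) g) p \<in> A}"
  have "(\<lambda>(x, g). act P (s x) g) ` B = A"
    unfolding B_def by (rule image_Collect_mem) (use homeomorphic_imp_surjective_map[OF hm'] A in simp)
  moreover have "openin (tot P) ((\<lambda>(x, g). act P (s x) g) ` B)"
    using homeomorphic_map_openness[OF hm', of B] op[of B] by (auto simp: B_def)
  ultimately show ?thesis by simp
qed

lemma continuous_from_tot_P: "f ` topspace (tot P) \<subseteq> topspace Z \<Longrightarrow> continuous_map (tot P) Z f"
  unfolding continuous_map_def by (auto intro!: open_in_tot_P)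

lemma product:
  assumes Q: "principal_bundle \<Gamma> D Q"
  shows "\<exists>w m n. is_product S Q P w m n"
proof -
  obtain enc :: "'u \<times> 'g \<Rightarrow> 'u" where enc: "inj_on enc (UNIV \<times> carrier \<Gamma>)"
    using infinite_prod_embedding[OF inf \<Gamma>(2)] by blast
  define dec where "dec = inv_into (UNIV \<times> carrier \<Gamma>) enc"
  have dec: "dec (enc (q, g)) = (q, g)" if "g \<in> carrier \<Gamma>" for q g
    unfolding dec_def using that by (intro inv_into_f_f[OF enc]) auto
  define X where "X = prod_topology (tot Q) D"
  define T where "T = quotient_topology X enc"
  have tX: "topspace X = topspace (tot Q) \<times> carrier \<Gamma>" by (simp add: X_def)
  have q: "quotient_map X T enc" unfolding T_def by (rule quotient_map_quotient_topology)
  have hm: "homeomorphic_map X T enc"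
    unfolding homeomorphic_map_def using q by (auto simp: tX intro: inj_on_subset[OF enc])
  have tT: "topspace T = enc ` (topspace (tot Q) \<times> carrier \<Gamma>)"
    using quotient_imp_surjective_map[OF q] tX by simp
  have contT: "continuous_map T Z f" if "\<And>d. d \<in> carrier \<Gamma> \<Longrightarrow> continuous_map (tot Q) Z (\<lambda>q. f (enc (q, d)))" for Z f
  proof (rule continuous_compose_quotient_map[OF q])
    show "continuous_map X Z (f \<circ> enc)" unfolding X_def by (rule continuous_map_prod_discrete) (simp add: that)
  qed
  note actQ = principal_bundle_act[OF Q] and actP = principal_bundle_act[OF P]
  \<comment> \<open>The bundle \<open>Q\<close> pulled back to its own total space, in the
    tautological trivialisation and encoded in the type of points.\<close>
  define W where "W = \<lparr>bbase = tot Q, tot = T, proj = (\<lambda>z. fst (dec z)),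
      act = (\<lambda>z g. enc (fst (dec z), snd (dec z) \<otimes>\<^bsub>\<Gamma>\<^esub> g))\<rparr>"
  have W: "principal_bundle \<Gamma> D W"
    unfolding principal_bundle_def
  proof (intro conjI ballI)
    show "continuous_map (tot W) (bbase W) (proj W)"
      unfolding W_def pbundle.simps by (rule contT) (simp add: dec continuous_map_id[unfolded id_def])
  next
    fix y assume "y \<in> topspace (tot W)"
    then obtain q d where y: "y = enc (q, d)" "q \<in> topspace (tot Q)" "d \<in> carrier \<Gamma>" by (auto simp: W_def tT)
    show "act W y \<one>\<^bsub>\<Gamma>\<^esub> = y" using y by (simp add: W_def dec)
    fix g assume g: "g \<in> carrier \<Gamma>"
    show "act W y g \<in> topspace (tot W)" using y g by (simp add: W_def dec tT)
    show "proj W (act W y g) = proj W y" using y g by (simp add: W_def dec)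
    fix h assume "h \<in> carrier \<Gamma>"
    then show "act W (act W y g) h = act W y (g \<otimes>\<^bsub>\<Gamma>\<^esub> h)" using y g by (simp add: W_def dec G.m_assoc)
  next
    fix t assume t: "t \<in> topspace (bbase W)"
    have "subtopology (tot W) {y \<in> topspace (tot W). proj W y \<in> topspace (bbase W)} = tot W"
      by (subst subtopology_superset) (auto simp: W_def tT dec)
    moreover have "homeomorphic_map (prod_topology (subtopology (bbase W) (topspace (bbase W))) D) (tot W)
        (\<lambda>(x, g). act W (enc (x, \<one>\<^bsub>\<Gamma>\<^esub>)) g)"
      using homeomorphic_map_eq[OF hm, of "\<lambda>(x, g). act W (enc (x, \<one>\<^bsub>\<Gamma>\<^esub>)) g"]
      by (auto simp: W_def X_def dec)
    ultimately show "\<exists>U s. openin (bbase W) U \<and> t \<in> U \<and>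
        (\<forall>x\<in>U. s x \<in> topspace (tot W) \<and> proj W (s x) = x) \<and>
        homeomorphic_map (prod_topology (subtopology (bbase W) U) D)
          (subtopology (tot W) {y \<in> topspace (tot W). proj W y \<in> U}) (\<lambda>(x, g). act W (s x) g)"
      using t by (intro exI[of _ "topspace (bbase W)"] exI[of _ "\<lambda>x. enc (x, \<one>\<^bsub>\<Gamma>\<^esub>)"]) (auto simp: W_def tT dec)
  qed
  \<comment> \<open>The pair \<open>(q, g)\<close> goes to \<open>q g\<close> in \<open>Q\<close> by
    \<open>m\<close> and to \<open>y0 g\<close> in \<open>P\<close> by \<open>n\<close>: the point
    \<open>q\<close> gives the isomorphism of its fibre with \<open>P\<close> that takes
    \<open>q\<close> to \<open>y0\<close>.\<close>
  define m where "m = \<lparr>bsrc = W, btgt = Q, bfun = restrict (proj Q) (topspace (tot Q)),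
      tfun = restrict (\<lambda>z. act Q (fst (dec z)) (snd (dec z))) (topspace T)\<rparr>"
  define n where "n = \<lparr>bsrc = W, btgt = P, bfun = restrict (\<lambda>_. pt) (topspace (tot Q)),
      tfun = restrict (\<lambda>z. act P y0 (snd (dec z))) (topspace T)\<rparr>"
  have m: "m \<in> bundle_arrows \<Gamma> D"
  proof -
    have "continuous_map T (tot Q) (\<lambda>z. act Q (fst (dec z)) (snd (dec z)))"
      by (rule contT) (simp add: dec continuous_act_discrete[OF Q \<Gamma>(1)])
    moreover have "continuous_map (tot Q) (bbase Q) (proj Q)" using Q by (simp add: principal_bundle_def)
    ultimately show ?thesis
      using W Q actQ by (auto simp: bundle_arrows_def m_def W_def tT dec intro!: continuous_map_restrict[of T, unfolded tT] continuous_map_restrict)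
  qed
  have n: "n \<in> bundle_arrows \<Gamma> D"
  proof -
    have "continuous_map T (tot P) (\<lambda>z. act P y0 (snd (dec z)))"
      by (rule contT) (simp add: dec actP y0)
    moreover have "continuous_map (tot Q) (bbase P) (\<lambda>_. pt)" using pt by simp
    ultimately show ?thesis
      using W P actP y0 proj_P by (auto simp: bundle_arrows_def n_def W_def tT dec intro!: continuous_map_restrict[of T, unfolded tT] continuous_map_restrict)
  qed
  have "\<exists>!j. j \<in> arr S R W \<and> cmp S m j = k \<and> cmp S n j = l"
    if R: "R \<in> Ob S" and k: "k \<in> arr S R Q" and l: "l \<in> arr S R P" for R k l
  proof -
    have R: "principal_bundle \<Gamma> D R" using R by (simp add: classifying_stack_def)
    have k: "k \<in> bundle_arrows \<Gamma> D" "bsrc k = R" "btgt k = Q" and l: "l \<in> bundle_arrows \<Gamma> D" "bsrc l = R" "btgt l = P"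
      using k l by (auto simp: classifying_stack_def arr_def)
    note Dk = bundle_arrowD[OF k(1), unfolded k(2,3)] and Dl = bundle_arrowD[OF l(1), unfolded l(2,3)]
    note actR = principal_bundle_act[OF R]
    \<comment> \<open>The point of \<open>Q\<close> that corresponds to \<open>y0\<close> under the
      two given maps. It is constant along the fibres of \<open>R\<close> and so descends to the
      base.\<close>
    define v where "v \<xi> = act Q (tfun k \<xi>) (inv\<^bsub>\<Gamma>\<^esub> (quot (tfun l \<xi>)))" for \<xi>
    define sel where "sel t = (SOME \<xi>. \<xi> \<in> topspace (tot R) \<and> proj R \<xi> = t)" for t
    have loc: "\<exists>U s. openin (bbase R) U \<and> t \<in> U \<and> (\<forall>x\<in>U. s x \<in> topspace (tot R) \<and> proj R (s x) = x) \<and>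
        continuous_map (subtopology (bbase R) U) (tot R) s" if "t \<in> topspace (bbase R)" for t
    proof -
      obtain U s where U: "openin (bbase R) U" "t \<in> U"
        and s: "\<forall>x\<in>U. s x \<in> topspace (tot R) \<and> proj R (s x) = x"
        and hm: "homeomorphic_map (prod_topology (subtopology (bbase R) U) D)
          (subtopology (tot R) {y \<in> topspace (tot R). proj R y \<in> U}) (\<lambda>(x, g). act R (s x) g)"
        using principal_bundle_local[OF R \<open>t \<in> _\<close>] by blast
      show ?thesis using U s local_section_continuous[OF R \<Gamma>(1) _ U(1) s hm] by auto
    qed
    have sel: "sel t \<in> topspace (tot R)" "proj R (sel t) = t" if t: "t \<in> topspace (bbase R)" for t
    proof -
      have "\<exists>\<xi>. \<xi> \<in> topspace (tot R) \<and> proj R \<xi> = t" using loc[OF t] by blast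
      then show "sel t \<in> topspace (tot R)" "proj R (sel t) = t" unfolding sel_def using someI_ex[of "\<lambda>\<xi>. \<xi> \<in> topspace (tot R) \<and> proj R \<xi> = t"] by auto
    qed
    have ql: "quot (tfun l \<xi>) \<in> carrier \<Gamma>" if "\<xi> \<in> topspace (tot R)" for \<xi> using quot(1) Dl(7) that by blast
    have v_in: "v \<xi> \<in> topspace (tot Q)" if "\<xi> \<in> topspace (tot R)" for \<xi>
      unfolding v_def using actQ(2) Dk(7) ql that by blast
    have v_act: "v (act R \<xi> g) = v \<xi>" if "\<xi> \<in> topspace (tot R)" "g \<in> carrier \<Gamma>" for \<xi> g
    proof -
      have "v (act R \<xi> g) = act Q (act Q (tfun k \<xi>) g) (inv\<^bsub>\<Gamma>\<^esub> (quot (tfun l \<xi>) \<otimes>\<^bsub>\<Gamma>\<^esub> g))"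
        using that Dk(10) Dl(10) Dl(7) quot_act by (simp add: v_def)
      also have "\<dots> = v \<xi>"
        using that ql[OF that(1)] Dk(7)[OF that(1)] by (simp add: v_def actQ(4) G.inv_mult_group G.m_assoc[symmetric])
      finally show ?thesis .
    qed
    have v_sel: "v (sel (proj R \<xi>)) = v \<xi>" if \<xi>: "\<xi> \<in> topspace (tot R)" for \<xi>
    proof -
      note s = sel[OF actR(5)[OF \<xi>]]
      obtain g where "g \<in> carrier \<Gamma>" "act R \<xi> g = sel (proj R \<xi>)"
        using principal_bundle_torsor[OF R \<Gamma>(1) _ \<xi> s(1)] s(2) by auto
      then show ?thesis using v_act[OF \<xi>] by metis
    qed
    have cql: "continuous_map (tot R) D (\<lambda>\<xi>. quot (tfun l \<xi>))"
      using continuous_map_compose[OF Dl(4) continuous_from_tot_P[of quot D]] quot(1) by (auto simp: o_def)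
    have cv: "continuous_map (tot R) (tot Q) v"
    proof -
      have 1: "continuous_map (prod_topology (tot Q) D) (tot Q) (\<lambda>p. act Q (fst p) (inv\<^bsub>\<Gamma>\<^esub> (snd p)))"
        by (rule continuous_map_prod_discrete) (simp add: continuous_act_discrete[OF Q \<Gamma>(1)])
      have 2: "continuous_map (tot R) (prod_topology (tot Q) D) (\<lambda>\<xi>. (tfun k \<xi>, quot (tfun l \<xi>)))"
        using Dk(4) cql by (simp add: continuous_map_pairwise o_def)
      show ?thesis using continuous_map_compose[OF 2 1] by (simp add: o_def v_def[abs_def])
    qed
    \<comment> \<open>The choice \<open>sel\<close> need not be continuous, but \<open>v\<close> is
      constant on fibres, so continuous local sections may take its place.\<close>
    have cb: "continuous_map (bbase R) (tot Q) (\<lambda>t. v (sel t))"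
    proof -
      obtain U s where Us: "\<And>t. t \<in> topspace (bbase R) \<Longrightarrow> openin (bbase R) (U t) \<and> t \<in> U t \<and>
          (\<forall>x\<in>U t. s t x \<in> topspace (tot R) \<and> proj R (s t x) = x) \<and> continuous_map (subtopology (bbase R) (U t)) (tot R) (s t)"
        using loc by metis
      show ?thesis
      proof (rule pasting_lemma[where I = "topspace (bbase R)" and T = U and f = "\<lambda>t x. v (s t x)"])
        show "continuous_map (subtopology (bbase R) (U t)) (tot Q) (\<lambda>x. v (s t x))" if "t \<in> topspace (bbase R)" for t
          using continuous_map_compose[of _ _ "s t", OF _ cv] Us[OF that] by (simp add: o_def)
        show "v (s t x) = v (s t' x)" if "t \<in> topspace (bbase R)" "t' \<in> topspace (bbase R)" "x \<in> topspace (bbase R) \<inter> U t \<inter> U t'" for t t' x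
          using v_sel[of "s t x"] v_sel[of "s t' x"] Us[OF that(1)] Us[OF that(2)] that(3) by auto
        show "\<exists>j. j \<in> topspace (bbase R) \<and> t \<in> U j \<and> v (sel t) = v (s j t)" if "t \<in> topspace (bbase R)" for t
          using v_sel[of "s t t"] Us[OF that] that by auto
      qed (use Us in auto)
    qed
    define j where "j = \<lparr>bsrc = R, btgt = W, bfun = restrict (\<lambda>t. v (sel t)) (topspace (bbase R)),
        tfun = restrict (\<lambda>\<xi>. enc (v \<xi>, quot (tfun l \<xi>))) (topspace (tot R))\<rparr>"
    have j: "j \<in> bundle_arrows \<Gamma> D"
    proof -
      have "continuous_map (tot R) X (\<lambda>\<xi>. (v \<xi>, quot (tfun l \<xi>)))"
        unfolding X_def using cv cql by (simp add: continuous_map_pairwise o_def)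
      from continuous_map_compose[OF this quotient_imp_continuous_map[OF q]]
      have "continuous_map (tot R) T (\<lambda>\<xi>. enc (v \<xi>, quot (tfun l \<xi>)))" by (simp add: o_def)
      then have "continuous_map (tot R) T (tfun j)" "continuous_map (bbase R) (tot Q) (bfun j)"
        using cb by (auto simp: j_def intro!: continuous_map_restrict)
      then show ?thesis
        using R W actR v_act v_sel ql Dl quot_act by (auto simp: bundle_arrows_def j_def W_def dec)
    qed
    have mj: "cmp S m j = k"
    proof -
      have b: "compose (topspace (bbase R)) (bfun m) (bfun j) = bfun k"
      proof
        fix t
        show "compose (topspace (bbase R)) (bfun m) (bfun j) t = bfun k t"
        proof (cases "t \<in> topspace (bbase R)")
          case True
          note s = sel[OF True]
          have "proj Q (v (sel t)) = bfun k t"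
            using Dk(9)[OF s(1)] actQ(3)[OF Dk(7)[OF s(1)] G.inv_closed[OF ql[OF s(1)]]] s(2) by (simp add: v_def)
          then show ?thesis using True v_in[OF s(1)] by (simp add: compose_def m_def j_def)
        next
          case False
          then show ?thesis using Dk(5) by (simp add: compose_def extensional_def)
        qed
      qed
      have t: "compose (topspace (tot R)) (tfun m) (tfun j) = tfun k"
      proof
        fix \<xi>
        show "compose (topspace (tot R)) (tfun m) (tfun j) \<xi> = tfun k \<xi>"
        proof (cases "\<xi> \<in> topspace (tot R)")
          case True
          have "act Q (v \<xi>) (quot (tfun l \<xi>)) = tfun k \<xi>"
            using actQ(4)[OF Dk(7)[OF True] G.inv_closed[OF ql[OF True]] ql[OF True]] actQ(1)[OF Dk(7)[OF True]] ql[OF True]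
            by (simp add: v_def)
          then show ?thesis using True v_in[OF True] ql[OF True] by (simp add: compose_def m_def j_def dec tT)
        next
          case False
          then show ?thesis using Dk(6) by (simp add: compose_def extensional_def)
        qed
      qed
      show ?thesis
        using b t k by (simp add: classifying_stack_def) (simp add: m_def j_def)
    qed
    have nj: "cmp S n j = l"
    proof -
      have b: "compose (topspace (bbase R)) (bfun n) (bfun j) = bfun l"
      proof
        fix t
        show "compose (topspace (bbase R)) (bfun n) (bfun j) t = bfun l t"
        proof (cases "t \<in> topspace (bbase R)")
          case True
          then have "bfun l t = pt" using Dl(8)[OF True] pt by simp
          then show ?thesis using True v_in[OF sel(1)[OF True]] by (simp add: compose_def n_def j_def)
        next
          case False
          then show ?thesis using Dl(5) by (simp add: compose_def extensional_def)
        qed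
      qed
      have t: "compose (topspace (tot R)) (tfun n) (tfun j) = tfun l"
      proof
        fix \<xi>
        show "compose (topspace (tot R)) (tfun n) (tfun j) \<xi> = tfun l \<xi>"
        proof (cases "\<xi> \<in> topspace (tot R)")
          case True
          then show ?thesis using v_in[OF True] ql[OF True] quot(2)[OF Dl(7)[OF True]]
            by (simp add: compose_def n_def j_def dec tT)
        next
          case False
          then show ?thesis using Dl(6) by (simp add: compose_def extensional_def)
        qed
      qed
      show ?thesis
        using b t l by (simp add: classifying_stack_def) (simp add: n_def j_def)
    qed
    show ?thesis
    proof (rule ex1I)
      show "j \<in> arr S R W \<and> cmp S m j = k \<and> cmp S n j = l"
        using j mj nj by (simp add: classifying_stack_def arr_def j_def)
    next
      fix j' assume j': "j' \<in> arr S R W \<and> cmp S m j' = k \<and> cmp S n j' = l"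
      have J: "j' \<in> bundle_arrows \<Gamma> D" "bsrc j' = R" "btgt j' = W" using j' by (auto simp: classifying_stack_def arr_def)
      note DJ = bundle_arrowD[OF J(1), unfolded J(2,3)]
      have kk: "tfun k = compose (topspace (tot R)) (tfun m) (tfun j')" and ll: "tfun l = compose (topspace (tot R)) (tfun n) (tfun j')"
        using j' J by (auto simp: classifying_stack_def)
      have tf: "tfun j' \<xi> = tfun j \<xi>" for \<xi>
      proof (cases "\<xi> \<in> topspace (tot R)")
        case True
        have "tfun j' \<xi> \<in> topspace T" using DJ(7)[OF True] by (simp add: W_def)
        then obtain z d where z: "tfun j' \<xi> = enc (z, d)" "z \<in> topspace (tot Q)" "d \<in> carrier \<Gamma>" by (auto simp: tT)
        have 1: "tfun k \<xi> = act Q z d" and 2: "tfun l \<xi> = act P y0 d"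
          using True z by (auto simp: kk ll compose_def m_def n_def tT dec)
        have d: "quot (tfun l \<xi>) = d" using quot(3)[OF Dl(7)[OF True] z(3)] 2 by simp
        have "v \<xi> = z" using z by (simp add: v_def d 1 actQ(1,4))
        then show ?thesis using True by (simp add: j_def z d)
      next
        case False
        then show ?thesis using DJ(6) by (simp add: j_def extensional_def)
      qed
      have bf: "bfun j' t = bfun j t" for t
      proof (cases "t \<in> topspace (bbase R)")
        case True
        note s = sel[OF True]
        have "bfun j' t = proj W (tfun j' (sel t))" using DJ(9)[OF s(1)] s(2) by simp
        also have "\<dots> = bfun j t" using True s ql[OF s(1)] by (simp add: tf) (simp add: j_def W_def dec)
        finally show ?thesis .
      next
        case False
        then show ?thesis using DJ(5) by (simp add: j_def extensional_def)
      qed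
      have "tfun j' = tfun j" "bfun j' = bfun j" using tf bf by auto
      then show "j' = j" using J by (simp add: j_def)
    qed
  qed
  then have "is_product S Q P W m n"
    using W m n by (simp add: is_product_def) (simp add: classifying_stack_def arr_def m_def n_def)
  then show ?thesis by blast
qed

sublocale powers S P
proof -
  have "P \<in> Ob S" using P by (simp add: classifying_stack_def)
  moreover have "\<exists>w m n. is_product S u P w m n" if "u \<in> Ob S" for u
    using product that by (simp add: classifying_stack_def)
  ultimately show "powers S P" by (rule S.powers_if_products)
qed

end

section \<open>Gerbes\<close>

lemma (in powers) vertex_simplex_cong:
  assumes "length vs = length ws" "vs \<noteq> []"
    and "\<And>j. j < length vs \<Longrightarrow> vertex_arrow X x \<kappa> \<psi> (vs ! j) = vertex_arrow X x \<kappa>' \<psi>' (ws ! j)"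
    and "\<And>t. t \<in> standard_simplex (length vs - 1) \<Longrightarrow>
      y (\<Sum>j<length vs. t j * snd (snd (vs ! j))) = y' (\<Sum>j<length ws. t j * snd (snd (ws ! j)))"
  shows "vertex_simplex X a x \<kappa> \<psi> y vs = vertex_simplex X a x \<kappa>' \<psi>' y' ws"
proof -
  have "vertex_arrow X x \<kappa> \<psi> (vs ! j) = vertex_arrow X x \<kappa>' \<psi>' (ws ! j)" if "j \<le> length vs - 1" for j
    using that assms by (cases vs) auto
  then have "tuple_point X a (length vs - 1) x (\<lambda>j. vertex_arrow X x \<kappa> \<psi> (vs ! j)) z t
      = tuple_point X a (length vs - 1) x (\<lambda>j. vertex_arrow X x \<kappa>' \<psi>' (ws ! j)) z t" for z t
    by (rule tuple_point_cong)
  then show ?thesis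
    unfolding vertex_simplex_def assms(1)[symmetric]
    by (intro restrict_ext) (simp add: assms(4) assms(1)[symmetric])
qed

locale gerbe = G: fibred_groupoids G + E: fibred_groupoids E + f: stack_morphism G E f
  for G :: "('go, 'gm, 'u) fibcat" and E :: "('eo, 'em, 'u) fibcat" and f +
  fixes sc :: "'go \<Rightarrow> ('u \<Rightarrow> complex) \<Rightarrow> 'gm"
  assumes gerbe: "U1_gerbe G E f sc"
begin

lemma local_lift:
  assumes "e \<in> Ob E" "t \<in> topspace (base E e)"
  obtains x k V where "x \<in> Ob G" "openin (base E e) V" "t \<in> V" "restriction_arrow E k V e" "src E k = onob f x"
proof -
  have "\<forall>e\<in>Ob E. \<forall>t\<in>topspace (base E e). \<exists>x\<in>Ob G. \<exists>k V. openin (base E e) V \<and> t \<in> V \<and>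
        restriction_arrow E k V e \<and> src E k = onob f x"
    using gerbe unfolding U1_gerbe_def by (elim conjE)
  then show ?thesis using assms that by blast
qed

lemma local_iso:
  assumes "x \<in> Ob G" "x' \<in> Ob G" "k \<in> arr E (onob f x) (onob f x')" "base G x = base G x'"
    "\<And>t. t \<in> topspace (base G x) \<Longrightarrow> bmap E k t = t" "t \<in> topspace (base G x)"
  obtains V r n where "openin (base G x) V" "t \<in> V" "restriction_arrow G r V x" "n \<in> arr G (src G r) x'"
    "onar f n = cmp E k (onar f r)"
proof -
  have "\<forall>x\<in>Ob G. \<forall>x'\<in>Ob G. \<forall>k\<in>arr E (onob f x) (onob f x'). base G x = base G x' \<longrightarrow>
        (\<forall>t\<in>topspace (base G x). bmap E k t = t) \<longrightarrow>
        (\<forall>t\<in>topspace (base G x). \<exists>V r n. openin (base G x) V \<and> t \<in> V \<and>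
           restriction_arrow G r V x \<and> n \<in> arr G (src G r) x' \<and> onar f n = cmp E k (onar f r))"
    using gerbe unfolding U1_gerbe_def by (elim conjE)
  then have "\<exists>V r n. openin (base G x) V \<and> t \<in> V \<and>
           restriction_arrow G r V x \<and> n \<in> arr G (src G r) x' \<and> onar f n = cmp E k (onar f r)"
    using assms by simp
  then show ?thesis using that by blast
qed

lemma sc:
  assumes "x \<in> Ob G"
  shows sc_autos: "continuous_map (base G x) U1_space c \<Longrightarrow> sc x c \<in> autos G x"
    and onar_sc: "continuous_map (base G x) U1_space c \<Longrightarrow> onar f (sc x c) = ident E (onob f x)"
    and sc_ex: "\<phi> \<in> autos G x \<Longrightarrow> onar f \<phi> = ident E (onob f x) \<Longrightarrow>
      \<exists>c. continuous_map (base G x) U1_space c \<and> sc x c = \<phi>"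
    and sc_eq_iff: "continuous_map (base G x) U1_space c \<Longrightarrow> continuous_map (base G x) U1_space c' \<Longrightarrow>
      sc x c = sc x c' \<longleftrightarrow> (\<forall>t\<in>topspace (base G x). c t = c' t)"
    and sc_mult: "continuous_map (base G x) U1_space c \<Longrightarrow> continuous_map (base G x) U1_space c' \<Longrightarrow>
      cmp G (sc x c) (sc x c') = sc x (\<lambda>t. c t * c' t)"
proof -
  have "\<forall>x\<in>Ob G.
        (\<forall>c. continuous_map (base G x) U1_space c \<longrightarrow>
           sc x c \<in> autos G x \<and> onar f (sc x c) = ident E (onob f x)) \<and>
        (\<forall>\<phi>\<in>autos G x. onar f \<phi> = ident E (onob f x) \<longrightarrow>
           (\<exists>c. continuous_map (base G x) U1_space c \<and> sc x c = \<phi>)) \<and>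
        (\<forall>c c'. continuous_map (base G x) U1_space c \<longrightarrow> continuous_map (base G x) U1_space c' \<longrightarrow>
           (sc x c = sc x c' \<longleftrightarrow> (\<forall>t\<in>topspace (base G x). c t = c' t)) \<and>
           cmp G (sc x c) (sc x c') = sc x (\<lambda>t. c t * c' t))"
    using gerbe unfolding U1_gerbe_def by (elim conjE)
  then show "continuous_map (base G x) U1_space c \<Longrightarrow> sc x c \<in> autos G x"
    "continuous_map (base G x) U1_space c \<Longrightarrow> onar f (sc x c) = ident E (onob f x)"
    "\<phi> \<in> autos G x \<Longrightarrow> onar f \<phi> = ident E (onob f x) \<Longrightarrow>
      \<exists>c. continuous_map (base G x) U1_space c \<and> sc x c = \<phi>"
    "continuous_map (base G x) U1_space c \<Longrightarrow> continuous_map (base G x) U1_space c' \<Longrightarrow>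
      sc x c = sc x c' \<longleftrightarrow> (\<forall>t\<in>topspace (base G x). c t = c' t)"
    "continuous_map (base G x) U1_space c \<Longrightarrow> continuous_map (base G x) U1_space c' \<Longrightarrow>
      cmp G (sc x c) (sc x c') = sc x (\<lambda>t. c t * c' t)"
    using assms by simp_all
qed

lemma sc_natural:
  assumes "m \<in> arr G x' x" "continuous_map (base G x) U1_space c"
  shows "cmp G (sc x c) m = cmp G m (sc x' (\<lambda>t. c (bmap G m t)))"
proof -
  have "\<forall>x x'. \<forall>m\<in>arr G x' x. \<forall>c. continuous_map (base G x) U1_space c \<longrightarrow>
        cmp G (sc x c) m = cmp G m (sc x' (\<lambda>t. c (bmap G m t)))"
    using gerbe unfolding U1_gerbe_def by (elim conjE)
  then show ?thesis using assms by simp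
qed

lemma continuous_const_U1: "z \<in> carrier U1 \<Longrightarrow> continuous_map T U1_space (\<lambda>_. z)"
  by (simp add: topspace_U1_space)

text \<open>The identity equals \<open>sc x c\<close> for some \<open>c\<close>; since
  \<open>1 * c = c\<close>, composing it with the automorphism of the constant 1 changes
  nothing.\<close>

lemma sc_one:
  assumes x: "x \<in> Ob G"
  shows "sc x (\<lambda>_. 1) = ident G x"
proof -
  obtain c where c: "continuous_map (base G x) U1_space c" "sc x c = ident G x"
    using sc_ex[OF x G.ident_autos[OF x] f.onar_ident[OF x]] by blast
  have c1: "continuous_map (base G x) U1_space (\<lambda>_. 1)"
    by (rule continuous_const_U1) (simp add: U1_def)
  have "cmp G (sc x (\<lambda>_. 1)) (sc x c) = sc x (\<lambda>t. 1 * c t)" using sc_mult[OF x c1 c(1)] .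
  then show ?thesis
    using c(2) G.cmp_ident(1)[OF G.autos_arr[OF sc_autos[OF x c1]]] by simp
qed

text \<open>An automorphism fixes the points of the base, so naturality leaves the function
  \<open>c\<close> unchanged.\<close>

lemma sc_commute:
  assumes x: "x \<in> Ob G" and c: "continuous_map (base G x) U1_space c" and \<phi>: "\<phi> \<in> autos G x"
  shows "cmp G (sc x c) \<phi> = cmp G \<phi> (sc x c)"
proof -
  have m: "continuous_map (base G x) (base G x) (bmap G \<phi>)" using G.continuous_bmap[OF G.autos_arr[OF \<phi>]] .
  have c': "continuous_map (base G x) U1_space (\<lambda>t. c (bmap G \<phi> t))"
    using continuous_map_compose[OF m c] by (simp add: o_def)
  have "sc x (\<lambda>t. c (bmap G \<phi> t)) = sc x c"
    using sc_eq_iff[OF x c' c] G.bmap_autos[OF \<phi>] by simp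
  then show ?thesis using sc_natural[OF G.autos_arr[OF \<phi>] c] by simp
qed

lemma continuous_U1_power: "continuous_map T U1_space c \<Longrightarrow> continuous_map T U1_space (\<lambda>t. c t ^ i)"
proof -
  assume c: "continuous_map T U1_space c"
  have "continuous_map euclidean euclidean (\<lambda>w::complex. w ^ i)" by (simp add: continuous_intros)
  from continuous_map_compose[OF _ this, of T c] c show ?thesis
    by (auto simp: U1_space_def continuous_map_in_subtopology norm_power o_def Pi_iff)
qed

lemma auto_pow_sc:
  assumes x: "x \<in> Ob G" and c: "continuous_map (base G x) U1_space c"
  shows "auto_pow G x (sc x c) i = sc x (\<lambda>t. c t ^ i)"
proof (induction i)
  case 0
  show ?case by (simp add: auto_pow_0 sc_one x)
next
  case (Suc i)
  then show ?case using sc_mult[OF x c continuous_U1_power[OF c]] by (simp add: auto_pow_Suc)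
qed

text \<open>Rotations form a continuous family: realise \<open>\<real>\<^sup>4\<close> by a space of the site.\<close>

lemma continuous_rotation_tuple:
  assumes a: "powers G a" and x: "x \<in> Ob G" and z: "topspace (base G x) = {z}"
    and emb: "inj (j :: real \<times> real \<times> real \<times> real \<Rightarrow> 'u)" and \<alpha>: "\<forall>i\<le>3. \<alpha> i \<in> arr G x a"
  shows "continuous_map (powertop_real UNIV) (nerve G a 3)
    (\<lambda>\<Theta>. bmap G (tuple G a 3 x (\<lambda>i. cmp G (\<alpha> i) (sc x (\<lambda>_. cis (2 * pi * \<Theta> i))))) z)"
proof -
  interpret powers G a by fact
  \<comment> \<open>A copy of real 4-space among the topologies on the type of points;
    \<open>x\<close> is pulled back to it along the constant map.\<close>
  define N where "N = quotient_topology (euclidean :: (real \<times> real \<times> real \<times> real) topology) j"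
  have q: "quotient_map euclidean N j" unfolding N_def by (rule quotient_map_quotient_topology)
  have jN: "continuous_map euclidean N j" using quotient_imp_continuous_map[OF q] .
  have tN: "topspace N = range j" using quotient_imp_surjective_map[OF q] by simp
  have "continuous_map N (base G x) (\<lambda>_. z)" using z by simp
  from G.pullback[OF x this] obtain xN M where M: "M \<in> arr G xN x" "base G xN = N"
    "\<And>t. t \<in> topspace N \<Longrightarrow> bmap G M t = z" by metis
  have xN: "xN \<in> Ob G" using G.arr_Ob(1)[OF M(1)] .
  define pr :: "nat \<Rightarrow> real \<times> real \<times> real \<times> real \<Rightarrow> real" where
    "pr i v = (if i = 0 then fst v else if i = 1 then fst (snd v)
       else if i = 2 then fst (snd (snd v)) else snd (snd (snd v)))" for i v
  define \<theta> where "\<theta> i = pr i \<circ> inv_into UNIV j" for i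
  have \<theta>j: "\<theta> i (j v) = pr i v" for i v by (simp add: \<theta>_def inv_f_f[OF emb])
  have c\<theta>: "continuous_map N U1_space (\<lambda>t. cis (2 * pi * \<theta> i t))" for i
  proof (rule continuous_compose_quotient_map[OF q])
    have "continuous_on UNIV (pr i)"
      unfolding pr_def by (cases "i = 0"; cases "i = 1"; cases "i = 2")
        (simp_all add: continuous_on_fst continuous_on_snd)
    then have "continuous_on UNIV (\<lambda>v. cis (2 * pi * pr i v))" by (intro continuous_intros)
    then show "continuous_map euclidean U1_space ((\<lambda>t. cis (2 * pi * \<theta> i t)) \<circ> j)"
      by (simp add: U1_space_def continuous_map_in_subtopology o_def \<theta>j image_subset_iff)
  qed
  \<comment> \<open>The universal rotated tuple, in which the four angles are coordinate
    functions.\<close>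
  define \<beta> where "\<beta> i = cmp G (cmp G (\<alpha> i) M) (sc xN (\<lambda>t. cis (2 * pi * \<theta> i t)))" for i
  have scN: "sc xN (\<lambda>t. cis (2 * pi * \<theta> i t)) \<in> arr G xN xN" for i
    using G.autos_arr[OF sc_autos[OF xN]] c\<theta> M(2) by simp
  have \<beta>: "\<forall>i\<le>3. \<beta> i \<in> arr G xN a"
    unfolding \<beta>_def using \<alpha> M(1) scN G.cmp_arr by blast
  \<comment> \<open>Restricting the universal tuple to the point with the given angles recovers the
    rotated tuple over \<open>x\<close>.\<close>
  have point: "bmap G (tuple G a 3 x (\<lambda>i. cmp G (\<alpha> i) (sc x (\<lambda>_. cis (2 * pi * pr i v))))) z
      = bmap G (tuple G a 3 xN \<beta>) (j v)" for v
  proof -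
    have "continuous_map (base G x) (base G xN) (\<lambda>_. j v)" by (simp add: M(2) tN)
    then obtain i where i: "i \<in> arr G x xN" "\<And>t. t \<in> topspace (base G x) \<Longrightarrow> bmap G i t = j v" "cmp G M i = ident G x"
    proof (rule G.factor[OF M(1) G.ident_arr[OF x]])
      show "bmap G M (j v) = bmap G (ident G x) t" if "t \<in> topspace (base G x)" for t
        using that z M(3)[of "j v"] by (simp add: tN G.bmap_ident[OF x])
    qed blast
    have "cmp G (\<beta> k) i = cmp G (\<alpha> k) (sc x (\<lambda>_. cis (2 * pi * pr k v)))" if k: "k \<le> 3" for k
    proof -
      have cc: "continuous_map (base G xN) U1_space (\<lambda>t. cis (2 * pi * \<theta> k t))" using c\<theta> M(2) by simp
      have ci: "continuous_map (base G x) U1_space (\<lambda>t. cis (2 * pi * \<theta> k (bmap G i t)))"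
        using continuous_map_compose[OF G.continuous_bmap[OF i(1)] cc] by (simp add: o_def)
      have sc': "sc x (\<lambda>t. cis (2 * pi * \<theta> k (bmap G i t))) = sc x (\<lambda>_. cis (2 * pi * pr k v))"
        using i(2) by (subst sc_eq_iff[OF x ci continuous_const_U1[OF cis_U1]]) (simp add: \<theta>j)
      have \<alpha>k: "\<alpha> k \<in> arr G x a" using \<alpha> k by blast
      have sa: "sc x (\<lambda>_. cis (2 * pi * pr k v)) \<in> arr G x x"
        using G.autos_arr[OF sc_autos[OF x continuous_const_U1[OF cis_U1]]] .
      have "cmp G (\<beta> k) i = cmp G (cmp G (\<alpha> k) M) (cmp G i (sc x (\<lambda>_. cis (2 * pi * pr k v))))"
        unfolding \<beta>_def using G.cmp_assoc[OF G.cmp_arr[OF \<alpha>k M(1)] scN i(1)] sc_natural[OF i(1) cc] sc' by simp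
      also have "\<dots> = cmp G (cmp G (cmp G (\<alpha> k) M) i) (sc x (\<lambda>_. cis (2 * pi * pr k v)))"
        using G.cmp_assoc[OF G.cmp_arr[OF \<alpha>k M(1)] i(1) sa] by simp
      also have "cmp G (cmp G (\<alpha> k) M) i = \<alpha> k"
        using G.cmp_assoc[OF \<alpha>k M(1) i(1)] i(3) G.cmp_ident(1)[OF \<alpha>k] by simp
      finally show ?thesis .
    qed
    then have "tuple G a 3 x (\<lambda>i. cmp G (\<alpha> i) (sc x (\<lambda>_. cis (2 * pi * pr i v)))) = tuple G a 3 x (\<lambda>k. cmp G (\<beta> k) i)"
      by (intro tuple_cong) simp
    also have "\<dots> = cmp G (tuple G a 3 xN \<beta>) i" using tuple_cmp[OF i(1) \<beta>] .
    finally have "tuple G a 3 x (\<lambda>i. cmp G (\<alpha> i) (sc x (\<lambda>_. cis (2 * pi * pr i v)))) = cmp G (tuple G a 3 xN \<beta>) i" .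
    then show ?thesis
      using G.bmap_cmp[OF tuple_arr[OF xN \<beta>] i(1), of z] z i(2)[of z] by simp
  qed
  have "continuous_map (powertop_real UNIV) euclidean (\<lambda>\<Theta> :: nat \<Rightarrow> real. (\<Theta> 0, \<Theta> 1, \<Theta> 2, \<Theta> 3) :: real \<times> real \<times> real \<times> real)"
    by (simp add: euclidean_product_topology continuous_intros)
  from continuous_map_compose[OF continuous_map_compose[OF this jN], of "nerve G a 3" "bmap G (tuple G a 3 xN \<beta>)"]
  have "continuous_map (powertop_real UNIV) (nerve G a 3) (\<lambda>\<Theta> :: nat \<Rightarrow> real. bmap G (tuple G a 3 xN \<beta>) (j (\<Theta> 0, \<Theta> 1, \<Theta> 2, \<Theta> 3)))"
    using G.continuous_bmap[OF tuple_arr[OF xN \<beta>]] by (simp add: o_def M(2) nerve_def)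
  moreover have "tuple G a 3 x (\<lambda>i. cmp G (\<alpha> i) (sc x (\<lambda>_. cis (2 * pi * pr i (\<Theta> 0, \<Theta> 1, \<Theta> 2, \<Theta> 3)))))
      = tuple G a 3 x (\<lambda>i. cmp G (\<alpha> i) (sc x (\<lambda>_. cis (2 * pi * \<Theta> i))))" for \<Theta> :: "nat \<Rightarrow> real"
    by (rule tuple_cong) (auto simp: pr_def le_Suc_eq numeral_3_eq_3 numeral_2_eq_2)
  ultimately show ?thesis by (simp only: point[symmetric])
qed

lemma sc_rotations:
  assumes a: "powers G a" and \<kappa>: "\<kappa> \<in> arr G x a" and \<omega>: "\<omega> \<in> autos G x" and z: "topspace (base G x) = {z}"
    and emb: "inj (j :: real \<times> real \<times> real \<times> real \<Rightarrow> 'u)"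
  shows "rotations G a x \<kappa> \<omega> z (\<lambda>r. sc x (\<lambda>_. cis (2 * pi * r)))"
proof -
  interpret powers G a by fact
  have x: "x \<in> Ob G" using G.arr_Ob(1)[OF \<kappa>] .
  note c = continuous_const_U1[OF cis_U1]
  show ?thesis
  proof
    show "sc x (\<lambda>_. cis (2 * pi * r)) \<in> autos G x" for r by (rule sc_autos[OF x c])
    show "sc x (\<lambda>_. cis (2 * pi * (r + s))) = cmp G (sc x (\<lambda>_. cis (2 * pi * r))) (sc x (\<lambda>_. cis (2 * pi * s)))" for r s
      using sc_mult[OF x c c] by (simp add: cis_mult distrib_left)
    show "sc x (\<lambda>_. cis (2 * pi * 1)) = ident G x" using sc_one[OF x] by simp
    show "cmp G \<omega> (sc x (\<lambda>_. cis (2 * pi * r))) = cmp G (sc x (\<lambda>_. cis (2 * pi * r))) \<omega>" for r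
      using sc_commute[OF x c \<omega>] by simp
    show "continuous_map (powertop_real UNIV) (nerve G a 3)
       (\<lambda>\<Theta>. bmap G (tuple G a 3 x (\<lambda>j. cmp G (\<alpha> j) (sc x (\<lambda>_. cis (2 * pi * \<Theta> j))))) z)"
      if "\<forall>j\<le>3. \<alpha> j \<in> arr G x a" for \<alpha>
      by (rule continuous_rotation_tuple[OF a x z emb that])
  qed (use \<kappa> \<omega> z in auto)
qed

end

text \<open>\<open>c3\<close> represents the Dixmier-Douady class, and \<open>l\<close> is a
  primitive of its pullback to the gerbe, normalised on the fibre spheres.\<close>

locale gerbe_atlas = gerbe G E f sc + R: realization_morphism G E f a e k
  for G :: "('go, 'gm, 'u) fibcat" and E :: "('eo, 'em, 'u) fibcat" and f sc a e k +
  fixes c3 l :: "('u rpoint, int) cochain"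
  assumes coboundary_l: "singular_simplex 3 (realization G a) s \<Longrightarrow>
      coboundary 2 l s = cochain_pullback 3 (realization_map G a E e f k) c3 s"
    and l_sphere: "z \<in> topspace (base G a) \<Longrightarrow>
      l (gerbe_sphere G sc a z) - l (constant_simplex 2 (vertex G a z)) = 1"
    and cocycle_c3: "cocycle 3 (realization E e) c3"
begin

text \<open>Over one point, this number modulo \<open>n\<close> tells apart the lifts of one
  automorphism whose n-th power is the identity; \<open>lift_sum_rotated\<close> computes the
  differences.\<close>

definition lift_sum :: "nat \<Rightarrow> 'go \<Rightarrow> 'gm \<Rightarrow> 'gm \<Rightarrow> 'u \<Rightarrow> int" where
  "lift_sum n x \<kappa> \<omega> z = cyclic_sum n (\<lambda>vs. l (vertex_simplex G a x (\<lambda>_::unit. \<kappa>) \<omega> (\<lambda>_. z) vs)) ((), 0)"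

text \<open>Scalars map to identities in \<open>E\<close>, so the coboundary of \<open>l\<close>
  does not see the angles and \<open>cyclic_sum_rotated\<close> applies. Each remaining full turn is
  a fibre sphere, on which \<open>l\<close> is normalised to 1.\<close>

lemma lift_sum_rotated:
  assumes \<kappa>: "\<kappa> \<in> arr G x a" and \<omega>: "\<omega> \<in> autos G x" and z: "topspace (base G x) = {z}"
    and emb: "inj (j :: real \<times> real \<times> real \<times> real \<Rightarrow> 'u)"
    and n: "n > 0" and \<omega>n: "auto_pow G x \<omega> n = ident G x"
  shows "[lift_sum n x \<kappa> (cmp G \<omega> (sc x (\<lambda>_. cis (- (2 * pi * real i / real n))))) z - lift_sum n x \<kappa> \<omega> z = int i] (mod int n)"
proof -
  interpret r: rotations G a x \<kappa> \<omega> z "\<lambda>r. sc x (\<lambda>_. cis (2 * pi * r))"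
    by (rule sc_rotations[OF R.X.powers_axioms \<kappa> \<omega> z emb])
  note c = continuous_const_U1[OF cis_U1]
  have "coboundary 2 l (r.rsimp vs) = coboundary 2 l (r.rsimp ws)" if len: "length vs = 4" and eq: "map fst vs = map fst ws" for vs ws
  proof -
    have len': "length ws = 4" using arg_cong[OF eq, of length] len by simp
    have fr: "onar f (r.rarrow i s) = cmp E (onar f \<kappa>) (auto_pow E (onob f x) (onar f \<omega>) i)" for i s
    proof -
      have p: "auto_pow G x \<omega> i \<in> arr G x x" using G.autos_arr[OF G.auto_pow_autos[OF r.x \<omega>]] .
      have "onar f (r.rarrow i s) = cmp E (onar f (cmp G \<kappa> (auto_pow G x \<omega> i))) (ident E (onob f x))"
        unfolding r.rarrow_def
        using f.onar_cmp[OF r.\<kappa>_pow G.autos_arr[OF sc_autos[OF r.x c]]] onar_sc[OF r.x c] by simp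
      also have "\<dots> = onar f (cmp G \<kappa> (auto_pow G x \<omega> i))"
        using E.cmp_ident(1)[OF f.onar_arr[OF r.\<kappa>_pow]] .
      finally show ?thesis using f.onar_cmp[OF \<kappa> p] f.onar_auto_pow[OF r.x \<omega>] by simp
    qed
    have *: "fst (vs ! j) = fst (ws ! j)" if "j < 4" for j
      using arg_cong[OF eq, of "\<lambda>xs. xs ! j"] that len len' by simp
    have "simplex_map 3 (realization_map G a E e f k) (r.rsimp vs) = simplex_map 3 (realization_map G a E e f k) (r.rsimp ws)"
      unfolding simplex_map_def
    proof (rule restrict_ext)
      fix t assume t: "t \<in> standard_simplex 3"
      have 1: "realization_map G a E e f k (r.rsimp us t) = tuple_point E e 3 (onob f x)
          (\<lambda>j. cmp E k (cmp E (onar f \<kappa>) (auto_pow E (onob f x) (onar f \<omega>) (fst (us ! j))))) z t"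
        if "length us = 4" for us
        using t that R.realization_map_tuple_point[OF r.x, of 3 "\<lambda>j. r.rarrow (fst (us ! j)) (group_mean us t (us ! j))" z t]
          r.rarrow_arr r.z by (simp add: r.rsimp_def fr)
      have "tuple_point E e 3 (onob f x) (\<lambda>j. cmp E k (cmp E (onar f \<kappa>) (auto_pow E (onob f x) (onar f \<omega>) (fst (vs ! j))))) z t
        = tuple_point E e 3 (onob f x) (\<lambda>j. cmp E k (cmp E (onar f \<kappa>) (auto_pow E (onob f x) (onar f \<omega>) (fst (ws ! j))))) z t"
        by (rule R.Y.tuple_point_cong) (simp add: *)
      then show "(realization_map G a E e f k \<circ> r.rsimp vs) t = (realization_map G a E e f k \<circ> r.rsimp ws) t"
        by (simp add: 1 len len')
    qed
    then show ?thesis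
      using coboundary_l[OF r.singular_rsimp[OF len]] coboundary_l[OF r.singular_rsimp[OF len']]
      by (simp add: cochain_pullback_def)
  qed
  from r.cyclic_sum_rotated[OF n this, of i "((), 0)"]
  have "[lift_sum n x \<kappa> (cmp G \<omega> (sc x (\<lambda>_. cis (- (2 * pi * real i / real n))))) z - lift_sum n x \<kappa> \<omega> z
     = int i * (l (r.rsimp [(0, 0), (0, -1), (n, -1)]) - l (r.rsimp [(0, 0), (0, 0), (n, 0)]))] (mod int n)"
    by (simp add: lift_sum_def)
  moreover have "r.rsimp [(0, 0), (0, -1), (n, -1)] = gerbe_sphere G sc a (bmap G \<kappa> z)"
  proof
    fix t
    show "r.rsimp [(0, 0), (0, -1), (n, -1)] t = gerbe_sphere G sc a (bmap G \<kappa> z) t"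
    proof (cases "t \<in> standard_simplex 2")
      case True
      let ?u = "\<lambda>_::'u. cis (2 * pi * (t 1 / (t 0 + t 1)))"
      have nat: "cmp G (sc a ?u) \<kappa> = cmp G \<kappa> (sc x ?u)" using sc_natural[OF \<kappa> c] .
      have "gerbe_sphere G sc a (bmap G \<kappa> z) t = tuple_point G a 1 a (\<lambda>i. if i = 0 then ident G a else sc a ?u) (bmap G \<kappa> z)
          (\<lambda>i. if i = 0 then t 0 + t 1 else if i = 1 then t 2 else 0)"
        unfolding gerbe_sphere_def edge_point_def tuple_point_def using True by (rule restrict_apply')
      also have "\<dots> = tuple_point G a 1 x (\<lambda>i. cmp G (if i = 0 then ident G a else sc a ?u) \<kappa>) z
          (\<lambda>i. if i = 0 then t 0 + t 1 else if i = 1 then t 2 else 0)"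
        using r.z G.ident_arr[OF R.X.a_Ob] G.autos_arr[OF sc_autos[OF R.X.a_Ob c]]
        by (intro R.X.tuple_point_cmp[OF \<kappa>, symmetric]) auto
      also have "(\<lambda>i. cmp G (if i = 0 then ident G a else sc a ?u) \<kappa>) = (\<lambda>i. if i = (0::nat) then \<kappa> else cmp G \<kappa> (sc x ?u))"
        using G.cmp_ident(2)[OF \<kappa>] nat by auto
      finally show ?thesis using r.rsimp_sphere(1)[OF \<omega>n n True] by simp
    qed (simp add: r.rsimp_def gerbe_sphere_def eval_nat_numeral)
  qed
  moreover have "r.rsimp [(0, 0), (0, 0), (n, 0)] = constant_simplex 2 (vertex G a (bmap G \<kappa> z))"
  proof
    fix t show "r.rsimp [(0, 0), (0, 0), (n, 0)] t = constant_simplex 2 (vertex G a (bmap G \<kappa> z)) t"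
      using r.rsimp_sphere(2)[OF \<omega>n n, of t]
      by (cases "t \<in> standard_simplex 2") (simp_all add: constant_simplex_def r.rsimp_def eval_nat_numeral)
  qed
  ultimately show ?thesis using l_sphere[OF G.bmap_in[OF \<kappa> r.z]] by simp
qed

end

section \<open>Congruences between prisms, and simplices over a single point\<close>

lemma prism_sum_cong:
  assumes "\<And>i j k m p q. c [(i, x), (j, if p then x else y), (k, if q then x else y), (m, y)]
      = c' [(i, x'), (j, if p then x' else y'), (k, if q then x' else y'), (m, y')]"
  shows "prism_sum n c x y = prism_sum n c' x' y'"
proof -
  have "c [(i, x), (j, y), (k, y), (m, y)] = c' [(i, x'), (j, y'), (k, y'), (m, y')]"
    "c [(i, x), (j, x), (k, y), (m, y)] = c' [(i, x'), (j, x'), (k, y'), (m, y')]"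
    "c [(i, x), (j, x), (k, x), (m, y)] = c' [(i, x'), (j, x'), (k, x'), (m, y')]" for i j k m
    using assms[of i j False k False m] assms[of i j True k False m] assms[of i j True k True m] by simp_all
  then show ?thesis by (simp add: prism_sum_def)
qed

lemma cyclic_sum_cong:
  assumes "\<And>i j k. c [(i, x), (j, x), (k, x)] = c' [(i, x'), (j, x'), (k, x')]"
  shows "cyclic_sum n c x = cyclic_sum n c' x'"
  by (simp add: cyclic_sum_def assms)

text \<open>Two ways around a square: \<open>p + q\<close> and \<open>s + t\<close> both represent
  the diagonal \<open>r\<close>, and \<open>t\<close> is the difference of the sums \<open>u\<close>
  and \<open>v\<close>.\<close>

lemma cong_combine:
  fixes p :: int
  assumes "[t = u - v] (mod N)" "[p + q = r] (mod N)" "[s + t = r] (mod N)"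
  shows "[p = (u - q) - (v - s)] (mod N)"
proof -
  have "p - ((u - q) - (v - s)) = ((p + q) - r) - ((s + t) - r) + (t - (u - v))" by simp
  moreover have "N dvd ((p + q) - r) - ((s + t) - r) + (t - (u - v))"
    using assms unfolding cong_iff_dvd_diff by (metis dvd_add dvd_diff)
  ultimately show ?thesis unfolding cong_iff_dvd_diff by (simp only:)
qed

lemma simplex_average_bounds:
  assumes t: "t \<in> standard_simplex (n - 1)" and n: "n > 0" and r: "\<And>j. j < n \<Longrightarrow> p \<le> r j \<and> r j \<le> (q::real)"
  shows "p \<le> (\<Sum>j<n. t j * r j)" "(\<Sum>j<n. t j * r j) \<le> q"
proof -
  have "{..n - 1} = {..<n}" using n by auto
  then have s: "(\<Sum>j<n. t j) = 1" and nn: "\<And>j. 0 \<le> t j" using t by (auto simp: standard_simplex_def)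
  have "(\<Sum>j<n. t j * p) \<le> (\<Sum>j<n. t j * r j)" "(\<Sum>j<n. t j * r j) \<le> (\<Sum>j<n. t j * q)"
    using r nn by (auto intro!: sum_mono mult_left_mono)
  then show "p \<le> (\<Sum>j<n. t j * r j)" "(\<Sum>j<n. t j * r j) \<le> q"
    using s by (simp_all flip: sum_distrib_right)
qed

context vertex_family
begin

lemma vertex_family_const: "vertex_family X a x \<kappa> \<psi> (\<lambda>_. y s)"
  using \<psi> \<kappa> y_in by unfold_locales auto

text \<open>If all vertices have the same parameter \<open>s\<close>, the base point stays at
  \<open>y s\<close>, and the simplex can be computed over any object that maps to this
  point.\<close>

lemma vsimp_at_point:
  assumes m: "m \<in> arr X x' x" and \<psi>': "\<psi>' \<in> autos X x'" "cmp X \<psi> m = cmp X m \<psi>'"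
    and z: "z \<in> topspace (base X x')" "bmap X m z = y s"
    and len: "length ws = length vs" "vs \<noteq> []"
    and eq: "\<And>j. j < length vs \<Longrightarrow> fst (ws ! j) = fst (vs ! j) \<and>
      \<kappa>' (fst (snd (ws ! j))) = cmp X (\<kappa> (fst (snd (vs ! j)))) m \<and> snd (snd (vs ! j)) = s"
  shows "vertex_simplex X a x' \<kappa>' \<psi>' (\<lambda>_. z) ws = vsimp vs"
proof -
  interpret c: vertex_family X a x \<kappa> \<psi> "\<lambda>_. y s" by (rule vertex_family_const)
  have "vsimp vs = c.vsimp vs"
  proof (rule vertex_simplex_cong)
    fix t :: "nat \<Rightarrow> real" assume "t \<in> standard_simplex (length vs - 1)"
    then have "s \<le> (\<Sum>j<length vs. t j * snd (snd (vs ! j)))" "(\<Sum>j<length vs. t j * snd (snd (vs ! j))) \<le> s"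
      using simplex_average_bounds[of t "length vs" s "\<lambda>j. snd (snd (vs ! j))" s] len(2) eq by simp_all
    then show "y (\<Sum>j<length vs. t j * snd (snd (vs ! j))) = y s" by simp
  qed (use len in auto)
  also have "\<dots> = vertex_simplex X a x' (\<lambda>c. cmp X (\<kappa> c) m) \<psi>' (\<lambda>_. z) vs"
    by (rule c.vsimp_pullback[OF m \<psi>', symmetric]) (use z in auto)
  also have "\<dots> = vertex_simplex X a x' \<kappa>' \<psi>' (\<lambda>_. z) ws"
  proof (rule vertex_simplex_cong)
    fix j assume "j < length vs"
    then show "vertex_arrow X x' (\<lambda>c. cmp X (\<kappa> c) m) \<psi>' (vs ! j) = vertex_arrow X x' \<kappa>' \<psi>' (ws ! j)"
      using eq[of j] by (simp add: vertex_arrow_def case_prod_beta)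
  qed (use len in auto)
  finally show ?thesis by simp
qed

end

lemma (in spaces_category) auto_pow_mult:
  assumes "u \<in> Ob X" "\<psi> \<in> autos X u"
  shows "auto_pow X u (auto_pow X u \<psi> i) j = auto_pow X u \<psi> (j * i)"
  by (induction j) (simp_all add: auto_pow_0 auto_pow_Suc auto_pow_add[OF assms])

section \<open>Transport of lifts along a path\<close>

text \<open>\<open>yy\<close> is a path in the base of \<open>p\<close>, and \<open>\<Omega>\<close>
  a family of lifts to the gerbe of the automorphism \<open>\<Psi>\<close> of \<open>p\<close>.
  Flatness is asked for near each point of the path.\<close>

locale gerbe_path = gerbe_atlas G E f sc a e k c3 l
  for G :: "('go, 'gm, 'u) fibcat" and E :: "('eo, 'em, 'u) fibcat" and f sc a e k c3 l +
  fixes p \<Psi> K and yy :: "real \<Rightarrow> 'u" and \<Omega> n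
  assumes atlas_a: "atlas G a"
    and K: "K \<in> arr E p e" and \<Psi>: "\<Psi> \<in> autos E p" and yy: "continuous_map euclideanreal (base E p) yy"
    and gsection: "gerbe_section G E f (p, \<Psi>) \<Omega>" and n: "n > 0" and \<Psi>n: "auto_pow E p \<Psi> n = ident E p"
    and flat: "\<And>r. \<exists>V N z. openin (base E p) V \<and> yy r \<in> V \<and> 1 \<le> N \<and> z \<in> carrier U1 \<and>
        (\<forall>x\<in>Ob G. \<forall>h\<in>arr E (onob f x) p. bmap E h ` topspace (base G x) \<subseteq> V \<longrightarrow>
           auto_pow G x (\<Omega> x h) N = sc x (\<lambda>_. z))"
begin

lemma p_Ob: "p \<in> Ob E"
  using E.arr_Ob(1)[OF K] .

lemma \<Omega>:
  assumes "x \<in> Ob G" "h \<in> arr E (onob f x) p"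
  shows \<Omega>_autos: "\<Omega> x h \<in> autos G x" and \<Omega>_over: "cmp E h (onar f (\<Omega> x h)) = cmp E \<Psi> h"
    and \<Omega>_natural: "m \<in> arr G x' x \<Longrightarrow> cmp G (\<Omega> x h) m = cmp G m (\<Omega> x' (cmp E h (onar f m)))"
  using gsection assms by (auto simp: gerbe_section_def)

lemma onar_\<Omega>_autos: "x \<in> Ob G \<Longrightarrow> h \<in> arr E (onob f x) p \<Longrightarrow> onar f (\<Omega> x h) \<in> autos E (onob f x)"
  using f.onar_autos \<Omega>_autos by blast

text \<open>Along \<open>h\<close> the image of the lift lies over \<open>\<Psi>\<close>, whose n-th
  power is the identity, and \<open>h\<close> can be cancelled on the left.\<close>

lemma onar_\<Omega>_pow:
  assumes x: "x \<in> Ob G" and h: "h \<in> arr E (onob f x) p"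
  shows "auto_pow E (onob f x) (onar f (\<Omega> x h)) n = ident E (onob f x)"
proof (rule E.cancel_autos[OF h])
  note fx = f.onob_Ob[OF x]
  show "auto_pow E (onob f x) (onar f (\<Omega> x h)) n \<in> autos E (onob f x)"
    by (rule E.auto_pow_autos[OF fx onar_\<Omega>_autos[OF x h]])
  show "ident E (onob f x) \<in> autos E (onob f x)" by (rule E.ident_autos[OF fx])
  show "cmp E h (auto_pow E (onob f x) (onar f (\<Omega> x h)) n) = cmp E h (ident E (onob f x))"
    using E.auto_pow_commute[OF h onar_\<Omega>_autos[OF x h] \<Psi> \<Omega>_over[OF x h, symmetric], of n]
      E.cmp_ident(1)[OF h] E.cmp_ident(2)[OF h] by (simp add: \<Psi>n)
qed

lemma pull_h: "m \<in> arr G x' x \<Longrightarrow> h \<in> arr E (onob f x) p \<Longrightarrow> cmp E h (onar f m) \<in> arr E (onob f x') p"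
  using f.onar_arr E.cmp_arr by blast

lemma \<Omega>_pow_natural:
  assumes h: "h \<in> arr E (onob f x) p" and m: "m \<in> arr G x' x"
  shows "cmp G (auto_pow G x (\<Omega> x h) i) m = cmp G m (auto_pow G x' (\<Omega> x' (cmp E h (onar f m))) i)"
  by (rule G.auto_pow_commute[OF m \<Omega>_autos[OF G.arr_Ob(1)[OF m] pull_h[OF m h]]
        \<Omega>_autos[OF G.arr_Ob(2)[OF m] h] \<Omega>_natural[OF G.arr_Ob(2)[OF m] h m]])

lemma \<Omega>_pow_restrict:
  assumes h: "h \<in> arr E (onob f x) p" and m: "m \<in> arr G x' x"
    and one: "auto_pow G x (\<Omega> x h) n = ident G x"
  shows "auto_pow G x' (\<Omega> x' (cmp E h (onar f m))) n = ident G x'"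
proof (rule G.cancel_autos[OF m])
  note x' = G.arr_Ob(1)[OF m]
  show "auto_pow G x' (\<Omega> x' (cmp E h (onar f m))) n \<in> autos G x'"
    by (rule G.auto_pow_autos[OF x' \<Omega>_autos[OF x' pull_h[OF m h]]])
  show "ident G x' \<in> autos G x'" by (rule G.ident_autos[OF x'])
  show "cmp G m (auto_pow G x' (\<Omega> x' (cmp E h (onar f m))) n) = cmp G m (ident G x')"
    using \<Omega>_pow_natural[OF h m, of n] one G.cmp_ident(1)[OF m] G.cmp_ident(2)[OF m] by simp
qed

text \<open>Between objects over single points, \<open>m\<close> has a right inverse and can be
  cancelled on the right.\<close>

lemma \<Omega>_pow_extend:
  assumes h: "h \<in> arr E (onob f x) p" and m: "m \<in> arr G x' x"
    and pts: "topspace (base G x) = {z}" "topspace (base G x') = {z'}"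
    and one: "auto_pow G x' (\<Omega> x' (cmp E h (onar f m))) n = ident G x'"
  shows "auto_pow G x (\<Omega> x h) n = ident G x"
proof -
  note x = G.arr_Ob(2)[OF m]
  obtain i where i: "i \<in> arr G x x'" "cmp G m i = ident G x"
  proof (rule G.factor[OF m G.ident_arr[OF x], of "\<lambda>_. z'"])
    show "continuous_map (base G x) (base G x') (\<lambda>_. z')" using pts by simp
    show "bmap G m z' = bmap G (ident G x) t" if "t \<in> topspace (base G x)" for t
      using G.bmap_in[OF m, of z'] that pts G.bmap_ident[OF x] by simp
  qed blast
  have P: "auto_pow G x (\<Omega> x h) n \<in> arr G x x" using G.autos_arr[OF G.auto_pow_autos[OF x \<Omega>_autos[OF x h]]] .
  have "cmp G (auto_pow G x (\<Omega> x h) n) m = m" using \<Omega>_pow_natural[OF h m, of n] one G.cmp_ident(1)[OF m] by simp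
  then show ?thesis using G.cmp_assoc[OF P m i(1)] i(2) G.cmp_ident(1)[OF P] by simp
qed

text \<open>Over a lift \<open>x\<close>, the chart 0 is the given one of the path and the others come from charts of the gerbe.\<close>

definition lift_chart :: "'em \<Rightarrow> (nat \<Rightarrow> 'gm) \<Rightarrow> nat \<Rightarrow> 'em" where
  "lift_chart h c i = (case i of 0 \<Rightarrow> cmp E K h | Suc j \<Rightarrow> cmp E k (onar f (c j)))"

definition down :: "'go \<Rightarrow> 'em \<Rightarrow> (nat \<Rightarrow> 'gm) \<Rightarrow> (real \<Rightarrow> 'u) \<Rightarrow> (nat \<times> nat \<times> real) list \<Rightarrow> int" where
  "down x h c y vs = c3 (vertex_simplex E e (onob f x) (lift_chart h c) (onar f (\<Omega> x h)) y vs)"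

text \<open>The shift \<open>i - 1\<close> matches \<open>lift_chart\<close>, where chart
  \<open>Suc j\<close> is the image of the chart \<open>c j\<close> of the gerbe.\<close>

definition up :: "'go \<Rightarrow> 'em \<Rightarrow> (nat \<Rightarrow> 'gm) \<Rightarrow> (real \<Rightarrow> 'u) \<Rightarrow> (nat \<times> nat \<times> real) list \<Rightarrow> int" where
  "up x h c y vs = l (vertex_simplex G a x (\<lambda>i. c (i - 1)) (\<Omega> x h) y vs)"

definition path_prism :: "real \<Rightarrow> real \<Rightarrow> int" where
  "path_prism r s = prism_sum n (\<lambda>vs. c3 (vertex_simplex E e p (\<lambda>_::unit. K) \<Psi> yy vs)) ((), r) ((), s)"

text \<open>The sum of \<open>l\<close> lives in a chart of the gerbe, the path prisms live in the
  chart \<open>K\<close>. The subtracted prism leads from one to the other over a fixed point, so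
  that differences of this potential can measure path prisms modulo \<open>n\<close>.\<close>

definition height :: "'go \<Rightarrow> 'em \<Rightarrow> 'gm \<Rightarrow> 'u \<Rightarrow> int" where
  "height x h c z = cyclic_sum n (up x h (\<lambda>_. c) (\<lambda>_. z)) (1, 0)
     - prism_sum n (down x h (\<lambda>_. c) (\<lambda>_. z)) (0, 0) (1, 0)"

lemma family_path: "vertex_family E e p (\<lambda>_::unit. K) \<Psi> yy"
  using K \<Psi> yy by unfold_locales auto

lemma family_down:
  assumes "x \<in> Ob G" "h \<in> arr E (onob f x) p" "\<And>j. c j \<in> arr G x a" "continuous_map euclideanreal (base G x) y"
  shows "vertex_family E e (onob f x) (lift_chart h c) (onar f (\<Omega> x h)) y"
proof
  show "lift_chart h c i \<in> arr E (onob f x) e" for i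
    using E.cmp_arr[OF K assms(2)] E.cmp_arr[OF R.k f.onar_arr[OF assms(3)]]
    by (simp add: lift_chart_def split: nat.split)
qed (use onar_\<Omega>_autos assms in \<open>auto simp: f.base_onob\<close>)

lemma family_up:
  assumes "x \<in> Ob G" "h \<in> arr E (onob f x) p" "\<And>j. c j \<in> arr G x a" "continuous_map euclideanreal (base G x) y"
  shows "vertex_family G a x (\<lambda>i::nat. c (i - 1)) (\<Omega> x h) y"
  using \<Omega>_autos assms by unfold_locales auto

lemma cocycle_family:
  assumes "vertex_family E e x' \<kappa> \<psi> y" "length vs = 5"
  shows "list_coboundary (\<lambda>vs. c3 (vertex_simplex E e x' \<kappa> \<psi> y vs)) vs = 0"
proof -
  interpret vertex_family E e x' \<kappa> \<psi> y by fact
  have "coboundary 3 c3 (vsimp vs) = 0"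
    using cocycle_c3 singular_vsimp[of vs] assms(2) by (simp add: cocycle_def)
  then show ?thesis using coboundary_vsimp[of vs 3 c3] assms(2) by simp
qed

text \<open>A square of charts and parameters: the prism along the path in chart 0 is compared with
  the route through the charts of the gerbe, where \<open>c3\<close> becomes the coboundary of
  \<open>l\<close>.\<close>

lemma height_step:
  assumes x: "x \<in> Ob G" and h: "h \<in> arr E (onob f x) p" and c: "\<And>j. c j \<in> arr G x a"
    and y: "continuous_map euclideanreal (base G x) y" and one: "auto_pow G x (\<Omega> x h) n = ident G x"
  shows "[prism_sum n (down x h c y) (0, r) (0, s)
    = (cyclic_sum n (up x h c y) (Suc j, s) - prism_sum n (down x h c y) (0, s) (Suc j, s))
      - (cyclic_sum n (up x h c y) (Suc i, r) - prism_sum n (down x h c y) (0, r) (Suc i, r))] (mod int n)"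
proof -
  interpret d: vertex_family E e "onob f x" "lift_chart h c" "onar f (\<Omega> x h)" y
    by (rule family_down[OF x h c y])
  interpret u: vertex_family G a x "\<lambda>i::nat. c (i - 1)" "\<Omega> x h" y
    by (rule family_up[OF x h c y])
  have cyc: "cyclic_cochain n (down x h c y)"
    unfolding down_def using d.cyclic_cochain_vsimp[OF onar_\<Omega>_pow[OF x h]] .
  have cyu: "cyclic_cochain n (up x h c y)"
    unfolding up_def using u.cyclic_cochain_vsimp[OF one] .
  have coc: "list_coboundary (down x h c y) vs = 0" if "length vs = 5" for vs
    unfolding down_def using cocycle_family[OF d.vertex_family_axioms that] .
  have add: "[prism_sum n (down x h c y) q q' + prism_sum n (down x h c y) q' q''
      = prism_sum n (down x h c y) q q''] (mod int n)" for q q' q''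
    by (rule prism_sum_add[OF cyc coc]) simp
  have "[prism_sum n (down x h c y) (Suc i, r) (Suc j, s)
      = cyclic_sum n (up x h c y) (Suc j, s) - cyclic_sum n (up x h c y) (Suc i, r)] (mod int n)"
  proof (rule prism_sum_coboundary[OF cyu])
    fix i' j' k' m' :: nat and q1 q2 q3 q4 assume q: "{q1, q2, q3, q4} \<subseteq> {(Suc i, r), (Suc j, s)}"
    let ?vs = "[(i', q1), (j', q2), (k', q3), (m', q4)]"
    have "vertex_simplex E e (onob f x) (\<lambda>i. cmp E k (onar f (c (i - 1)))) (onar f (\<Omega> x h)) y ?vs = d.vsimp ?vs"
    proof (rule R.Y.vertex_simplex_cong)
      fix j0 assume "j0 < length ?vs"
      then have "fst (snd (?vs ! j0)) = Suc i \<or> fst (snd (?vs ! j0)) = Suc j"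
        using q by (auto simp: less_Suc_eq)
      then show "vertex_arrow E (onob f x) (\<lambda>i. cmp E k (onar f (c (i - 1)))) (onar f (\<Omega> x h)) (?vs ! j0)
          = vertex_arrow E (onob f x) (lift_chart h c) (onar f (\<Omega> x h)) (?vs ! j0)"
        by (cases "?vs ! j0") (auto simp: vertex_arrow_def lift_chart_def)
    qed auto
    moreover have "simplex_map 3 (realization_map G a E e f k) (u.vsimp ?vs)
        = vertex_simplex E e (onob f x) (\<lambda>i. cmp E k (onar f (c (i - 1)))) (onar f (\<Omega> x h)) y ?vs"
      using R.simplex_map_vertex_simplex[OF u.vertex_family_axioms, of ?vs] by (simp add: numeral_3_eq_3)
    ultimately have "down x h c y ?vs = cochain_pullback 3 (realization_map G a E e f k) c3 (u.vsimp ?vs)"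
      by (simp add: down_def cochain_pullback_def)
    also have "\<dots> = coboundary 2 l (u.vsimp ?vs)"
      using coboundary_l u.singular_vsimp[of ?vs] by (simp add: numeral_3_eq_3)
    also have "\<dots> = list_coboundary (up x h c y) ?vs"
      unfolding up_def by (rule u.coboundary_vsimp) simp
    finally show "down x h c y ?vs = list_coboundary (up x h c y) ?vs" .
  qed
  then show ?thesis
    using add[of "(0, r)" "(0, s)" "(Suc j, s)"] add[of "(0, r)" "(Suc i, r)" "(Suc j, s)"] by (rule cong_combine)
qed

text \<open>Expresses the end terms of \<open>height_step\<close>, which are formed over the piece
  \<open>x\<close> of the path, on an object over a single point.\<close>

lemma height_at_point:
  assumes x: "x \<in> Ob G" and h: "h \<in> arr E (onob f x) p" and c: "\<And>j. c j \<in> arr G x a"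
    and y: "continuous_map euclideanreal (base G x) y"
    and m: "m \<in> arr G x' x" and z: "z \<in> topspace (base G x')" "bmap G m z = y s"
  shows "height x' (cmp E h (onar f m)) (cmp G (c j) m) z
    = cyclic_sum n (up x h c y) (Suc j, s) - prism_sum n (down x h c y) (0, s) (Suc j, s)"
proof -
  interpret d: vertex_family E e "onob f x" "lift_chart h c" "onar f (\<Omega> x h)" y
    by (rule family_down[OF x h c y])
  interpret u: vertex_family G a x "\<lambda>i::nat. c (i - 1)" "\<Omega> x h" y
    by (rule family_up[OF x h c y])
  note x' = G.arr_Ob(1)[OF m] and h' = pull_h[OF m h]
  let ?h = "cmp E h (onar f m)" and ?c = "\<lambda>_::nat. cmp G (c j) m"
  have zE: "z \<in> topspace (base E (onob f x'))" "bmap E (onar f m) z = y s"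
    using z f.base_onob[OF x'] f.bmap_onar[OF m z(1)] by simp_all
  have nat: "cmp E (onar f (\<Omega> x h)) (onar f m) = cmp E (onar f m) (onar f (\<Omega> x' ?h))"
    using f.onar_cmp[OF G.autos_arr[OF \<Omega>_autos[OF x h]] m] f.onar_cmp[OF m G.autos_arr[OF \<Omega>_autos[OF x' h']]]
      \<Omega>_natural[OF x h m] by simp
  have ch: "lift_chart ?h ?c 0 = cmp E (lift_chart h c 0) (onar f m)"
    "lift_chart ?h ?c (Suc 0) = cmp E (lift_chart h c (Suc j)) (onar f m)"
    using E.cmp_assoc[OF K h f.onar_arr[OF m]] E.cmp_assoc[OF R.k f.onar_arr[OF c[of j]] f.onar_arr[OF m]]
      f.onar_cmp[OF c[of j] m] by (simp_all add: lift_chart_def)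
  have "cyclic_sum n (up x' ?h ?c (\<lambda>_. z)) (1, 0) = cyclic_sum n (up x h c y) (Suc j, s)"
  proof (rule cyclic_sum_cong)
    show "up x' ?h ?c (\<lambda>_. z) [(i1, 1, 0), (i2, 1, 0), (i3, 1, 0)] = up x h c y [(i1, Suc j, s), (i2, Suc j, s), (i3, Suc j, s)]"
      for i1 i2 i3
      unfolding up_def
      by (intro arg_cong[of _ _ l] u.vsimp_at_point[OF m \<Omega>_autos[OF x' h'] \<Omega>_natural[OF x h m] z])
        (auto simp: less_Suc_eq)
  qed
  moreover have "prism_sum n (down x' ?h ?c (\<lambda>_. z)) (0, 0) (1, 0) = prism_sum n (down x h c y) (0, s) (Suc j, s)"
  proof (rule prism_sum_cong)
    fix i1 i2 i3 i4 q1 q2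
    show "down x' ?h ?c (\<lambda>_. z) [(i1, 0, 0), (i2, if q1 then (0, 0) else (1, 0)), (i3, if q2 then (0, 0) else (1, 0)), (i4, 1, 0)]
      = down x h c y [(i1, 0, s), (i2, if q1 then (0, s) else (Suc j, s)), (i3, if q2 then (0, s) else (Suc j, s)), (i4, Suc j, s)]"
      unfolding down_def
      by (intro arg_cong[of _ _ c3] d.vsimp_at_point[OF f.onar_arr[OF m] onar_\<Omega>_autos[OF x' h'] nat zE])
        (auto simp: less_Suc_eq ch)
  qed
  ultimately show ?thesis by (simp add: height_def)
qed

section \<open>Lifts of single points, and independence of the potential from them\<close>

definition point_lift :: "real \<Rightarrow> 'go \<Rightarrow> 'em \<Rightarrow> 'gm \<Rightarrow> 'u \<Rightarrow> bool" where
  "point_lift r x h c z \<longleftrightarrow> x \<in> Ob G \<and> h \<in> arr E (onob f x) p \<and> c \<in> arr G x a \<and>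
     topspace (base G x) = {z} \<and> bmap E h z = yy r"

lemma point_lift_restrict:
  assumes x: "point_lift r x h c z" and m: "m \<in> arr G x' x" and z': "topspace (base G x') = {z'}"
  shows "point_lift r x' (cmp E h (onar f m)) (cmp G c m) z'"
    and "height x' (cmp E h (onar f m)) (cmp G c m) z' = height x h c z"
proof -
  have X: "x \<in> Ob G" "h \<in> arr E (onob f x) p" "c \<in> arr G x a" "topspace (base G x) = {z}" "bmap E h z = yy r"
    using x by (auto simp: point_lift_def)
  have mz: "bmap G m z' = z" using G.bmap_in[OF m, of z'] z' X(4) by simp
  have "z' \<in> topspace (base E (onob f x'))" using z' f.base_onob[OF G.arr_Ob(1)[OF m]] by simp
  then show "point_lift r x' (cmp E h (onar f m)) (cmp G c m) z'"
    using X G.arr_Ob(1)[OF m] pull_h[OF m X(2)] G.cmp_arr[OF X(3) m] z' mz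
      E.bmap_cmp[OF X(2) f.onar_arr[OF m]] f.bmap_onar[OF m, of z'] by (simp add: point_lift_def)
  have cont: "continuous_map euclideanreal (base G x) (\<lambda>_. z)" using X(4) by simp
  have i: "ident G x \<in> arr G x x" by (rule G.ident_arr[OF X(1)])
  have "height x' (cmp E h (onar f m)) (cmp G c m) z' = height x (cmp E h (onar f (ident G x))) (cmp G c (ident G x)) z"
    using height_at_point[where c = "\<lambda>_. c" and z = z' and s = 0 and j = 0, OF X(1,2) _ cont m]
      height_at_point[where c = "\<lambda>_. c" and z = z and s = 0 and j = 0, OF X(1,2) _ cont i]
      X(3,4) z' mz G.bmap_ident[OF X(1)] by simp
  then show "height x' (cmp E h (onar f m)) (cmp G c m) z' = height x h c z"
    using f.onar_ident[OF X(1)] E.cmp_ident(1)[OF X(2)] G.cmp_ident(1)[OF X(3)] by simp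
qed

text \<open>\<open>height_step\<close> for a constant path with two charts of the gerbe: the prism
  along the path is degenerate, hence zero modulo \<open>n\<close>.\<close>

lemma height_chart_independent:
  assumes x: "point_lift r x h c z" and x': "point_lift r x h c' z" and one: "auto_pow G x (\<Omega> x h) n = ident G x"
  shows "[height x h c z = height x h c' z] (mod int n)"
proof -
  have X: "x \<in> Ob G" "h \<in> arr E (onob f x) p" "c \<in> arr G x a" "c' \<in> arr G x a" "topspace (base G x) = {z}"
    using x x' by (auto simp: point_lift_def)
  define d where "d j = (if j = 0 then c else c')" for j :: nat
  have d: "d j \<in> arr G x a" for j using X by (simp add: d_def)
  have cont: "continuous_map euclideanreal (base G x) (\<lambda>_. z)" using X(5) by simp
  have i: "ident G x \<in> arr G x x" by (rule G.ident_arr[OF X(1)])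
  interpret d: vertex_family E e "onob f x" "lift_chart h d" "onar f (\<Omega> x h)" "\<lambda>_. z"
    by (rule family_down[OF X(1,2) d cont])
  have ev: "height x h (d j) z = cyclic_sum n (up x h d (\<lambda>_. z)) (Suc j, 0) - prism_sum n (down x h d (\<lambda>_. z)) (0, 0) (Suc j, 0)" for j
    using height_at_point[where c = d and z = z and s = 0 and j = j, OF X(1,2) d cont i] f.onar_ident[OF X(1)] E.cmp_ident(1)[OF X(2)]
      G.cmp_ident(1)[OF d[of j]] X(5) G.bmap_ident[OF X(1)] by simp
  have "[prism_sum n (down x h d (\<lambda>_. z)) (0, 0) (0, 0) = 0] (mod int n)"
    unfolding down_def using d.cyclic_cochain_vsimp[OF onar_\<Omega>_pow[OF X(1,2)]] cocycle_family[OF d.vertex_family_axioms]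
    by (intro prism_sum_refl) auto
  then have "[height x h (d 1) z - height x h (d 0) z = 0] (mod int n)"
    using height_step[where c = d and r = 0 and s = 0 and j = 1 and i = 0, OF X(1,2) d cont one] unfolding ev by (meson cong_sym cong_trans)
  then show ?thesis by (simp add: d_def cong_diff_iff_cong_0 cong_sym)
qed

text \<open>Two lifts of the same point become isomorphic after a further pullback, because \<open>G\<close> is a gerbe.\<close>

lemma height_lift_independent:
  assumes x: "point_lift r x h c z" and x1: "point_lift r x1 h1 c1 z1" and one: "auto_pow G x (\<Omega> x h) n = ident G x"
  shows "auto_pow G x1 (\<Omega> x1 h1) n = ident G x1" and "[height x h c z = height x1 h1 c1 z1] (mod int n)"
proof -
  have X: "x \<in> Ob G" "h \<in> arr E (onob f x) p" "topspace (base G x) = {z}" "bmap E h z = yy r"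
    using x by (auto simp: point_lift_def)
  have X1: "x1 \<in> Ob G" "h1 \<in> arr E (onob f x1) p" "topspace (base G x1) = {z1}" "bmap E h1 z1 = yy r"
    using x1 by (auto simp: point_lift_def)
  have "continuous_map (base G x) (base G x1) (\<lambda>_. z1)" using X1(3) by simp
  from G.pullback[OF X1(1) this] obtain x2 M where M: "M \<in> arr G x2 x1" "base G x2 = base G x"
    "\<And>t. t \<in> topspace (base G x) \<Longrightarrow> bmap G M t = z1" by metis
  note x2 = G.arr_Ob(1)[OF M(1)] and fM = f.onar_arr[OF M(1)] and h2 = pull_h[OF M(1) X1(2)]
  have bE: "base E (onob f x) = base G x" "base E (onob f x2) = base G x"
    using f.base_onob[OF X(1)] f.base_onob[OF x2] M(2) by auto
  \<comment> \<open>\<open>g\<close> compares the two images in \<open>E\<close>. It lifts to the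
    gerbe after shrinking, and over a point an open neighbourhood is everything.\<close>
  obtain g where g: "g \<in> arr E (onob f x) (onob f x2)" "\<And>t. t \<in> topspace (base G x) \<Longrightarrow> bmap E g t = id t"
    "cmp E (cmp E h1 (onar f M)) g = h"
  proof (rule E.factor[OF h2 X(2), of id])
    show "continuous_map (base E (onob f x)) (base E (onob f x2)) id" using bE by simp
    show "bmap E (cmp E h1 (onar f M)) (id t) = bmap E h t" if "t \<in> topspace (base E (onob f x))" for t
      using that X X1(4) bE E.bmap_cmp[OF X1(2) fM, of t] f.bmap_onar[OF M(1), of t] M(2,3) by simp
  qed (use bE in auto)
  obtain V q N where V: "openin (base G x) V" "z \<in> V" "restriction_arrow G q V x" "N \<in> arr G (src G q) x2"
    "onar f N = cmp E g (onar f q)"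
    using local_iso[OF X(1) x2 g(1) M(2)[symmetric], of z] g(2) X(3) by (metis id_apply insertI1)
  define x3 where "x3 = src G q"
  have q: "q \<in> arr G x3 x" and t3: "topspace (base G x3) = {z}"
    using V X(3) by (auto simp: restriction_arrow_def arr_def x3_def)
  have N: "N \<in> arr G x3 x2" using V(4) by (simp add: x3_def)
  have MN: "cmp G M N \<in> arr G x3 x1" using G.cmp_arr[OF M(1) N] .
  have h3: "cmp E h1 (onar f (cmp G M N)) = cmp E h (onar f q)"
  proof -
    have "cmp E h1 (onar f (cmp G M N)) = cmp E h1 (cmp E (onar f M) (cmp E g (onar f q)))"
      using f.onar_cmp[OF M(1) N] V(5) by simp
    also have "\<dots> = cmp E (cmp E (cmp E h1 (onar f M)) g) (onar f q)"
      using E.cmp_assoc[OF X1(2) fM E.cmp_arr[OF g(1) f.onar_arr[OF q]]] E.cmp_assoc[OF h2 g(1) f.onar_arr[OF q]] by simp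
    finally show ?thesis by (simp add: g(3))
  qed
  note A = point_lift_restrict[OF x q t3] and B = point_lift_restrict[OF x1 MN t3, unfolded h3]
  have one3: "auto_pow G x3 (\<Omega> x3 (cmp E h (onar f q))) n = ident G x3"
    by (rule \<Omega>_pow_restrict[OF X(2) q one])
  show "auto_pow G x1 (\<Omega> x1 h1) n = ident G x1"
    by (rule \<Omega>_pow_extend[OF X1(2) MN X1(3) t3]) (simp add: h3 one3)
  show "[height x h c z = height x1 h1 c1 z1] (mod int n)"
    using height_chart_independent[OF A(1) B(1) one3] by (simp add: A(2) B(2))
qed

text \<open>On a lift over a connected piece of the path, \<open>\<Omega>\<^sup>n\<close> is a continuous function with values in a finite set.\<close>

lemma local_structure:
  "\<exists>d x h c w. d > 0 \<and> x \<in> Ob G \<and> h \<in> arr E (onob f x) p \<and> c \<in> arr G x a \<and>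
    base G x = subtopology (base E p) (yy ` {r - d<..<r + d}) \<and>
    (\<forall>t\<in>topspace (base G x). bmap E h t = t) \<and>
    w \<in> carrier U1 \<and> auto_pow G x (\<Omega> x h) n = sc x (\<lambda>_. w)"
proof -
  have yy_in: "yy s \<in> topspace (base E p)" for s using yy by (auto simp: continuous_map_def)
  obtain x0 k0 V0 where x0: "x0 \<in> Ob G" and V0: "openin (base E p) V0" "yy r \<in> V0"
    and k0: "restriction_arrow E k0 V0 p" "src E k0 = onob f x0"
    using local_lift[OF p_Ob yy_in] by blast
  have k0': "k0 \<in> arr E (onob f x0) p" and bx0: "base G x0 = subtopology (base E p) V0"
    and k0t: "\<And>t. t \<in> topspace (base G x0) \<Longrightarrow> bmap E k0 t = t"
    using k0 f.base_onob[OF x0] by (auto simp: restriction_arrow_def arr_def)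
  have tx0: "yy r \<in> topspace (base G x0)" using V0 yy_in by (simp add: bx0)
  obtain V1 N z where V1: "openin (base E p) V1" "yy r \<in> V1" "1 \<le> N" "z \<in> carrier U1"
    and fl: "\<And>x h. x \<in> Ob G \<Longrightarrow> h \<in> arr E (onob f x) p \<Longrightarrow> bmap E h ` topspace (base G x) \<subseteq> V1 \<Longrightarrow>
           auto_pow G x (\<Omega> x h) N = sc x (\<lambda>_. z)"
    using flat[of r] by blast
  have "\<exists>w m n. is_product G x0 a w m n \<and>
     bmap G m ` topspace (base G w) = topspace (base G x0) \<and>
     (\<forall>t\<in>topspace (base G x0). \<exists>U s. openin (base G x0) U \<and> t \<in> U \<and>
        continuous_map (subtopology (base G x0) U) (base G w) s \<and> (\<forall>x\<in>U. bmap G m (s x) = x))"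
    using atlas_a x0 by (simp add: atlas_def)
  then obtain w m nn U s where prod: "is_product G x0 a w m nn" and U: "openin (base G x0) U" "yy r \<in> U"
    and s: "continuous_map (subtopology (base G x0) U) (base G w) s" "\<And>x. x \<in> U \<Longrightarrow> bmap G m (s x) = x"
    using tx0 by blast
  have m: "m \<in> arr G w x0" and nn: "nn \<in> arr G w a" using prod by (auto simp: is_product_def)
  have "openin (base E p) U" using U(1) openin_trans_full[OF _ V0(1)] by (simp add: bx0)
  then have "openin (base E p) (U \<inter> V1)" using V1 by blast
  from openin_continuous_map_preimage[OF yy this] have "open {s. yy s \<in> U \<inter> V1}" by simp
  \<comment> \<open>An interval that the path maps into a set on which a lift, a chart and the
    flatness condition are all available.\<close>
  then obtain d where d: "d > 0" "ball r d \<subseteq> {s. yy s \<in> U \<inter> V1}"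
    using U V1 open_contains_ball[of "{s. yy s \<in> U \<inter> V1}"] by auto
  define J where "J = yy ` {r - d<..<r + d}"
  have J: "J \<subseteq> U \<inter> V1" using d(2) by (auto simp: J_def ball_eq_greaterThanLessThan)
  have UV: "U \<subseteq> V0" using openin_subset[OF U(1)] by (auto simp: bx0)
  let ?S = "subtopology (base E p) J"
  have sub: "?S = subtopology (subtopology (base G x0) U) J"
    using J UV unfolding bx0 subtopology_subtopology by (metis Int_absorb1 Int_absorb2 le_infE order_trans inf.absorb_iff2)
  have "continuous_map ?S (base G x0) id"
    unfolding bx0 using J UV by (auto simp: continuous_map_in_subtopology continuous_map_from_subtopology)
  from G.pullback[OF x0 this] obtain x M where M0: "M \<in> arr G x x0" "base G x = ?S"
    "\<And>t. t \<in> topspace ?S \<Longrightarrow> bmap G M t = id t" by blast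
  note M = M0[unfolded id_apply]
  note x = G.arr_Ob(1)[OF M(1)]
  define h where "h = cmp E k0 (onar f M)"
  have h: "h \<in> arr E (onob f x) p" unfolding h_def using E.cmp_arr[OF k0' f.onar_arr[OF M(1)]] .
  have ht: "bmap E h t = t" if "t \<in> topspace (base G x)" for t
    unfolding h_def using E.bmap_cmp[OF k0' f.onar_arr[OF M(1)], of t] f.bmap_onar[OF M(1) that] M(2,3) that
      k0t[of t] G.bmap_in[OF M(1) that] f.base_onob[OF x] by simp
  obtain q where q: "q \<in> arr G x w"
  proof (rule G.factor[OF m M(1), of s])
    show "continuous_map (base G x) (base G w) s" unfolding M(2) sub using s(1) by (rule continuous_map_from_subtopology)
    show "bmap G m (s t) = bmap G M t" if "t \<in> topspace (base G x)" for t
      using that M(2,3) s(2) J by auto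
  qed blast
  define c where "c = cmp G nn q"
  have c: "c \<in> arr G x a" unfolding c_def using G.cmp_arr[OF nn q] .
  have flx: "auto_pow G x (\<Omega> x h) N = sc x (\<lambda>_. z)"
    using J ht M(2) by (intro fl[OF x h]) auto
  have \<Omega>x: "\<Omega> x h \<in> autos G x" by (rule \<Omega>_autos[OF x h])
  have "onar f (auto_pow G x (\<Omega> x h) n) = ident E (onob f x)"
    using f.onar_auto_pow[OF x \<Omega>x] onar_\<Omega>_pow[OF x h] by simp
  from sc_ex[OF x G.auto_pow_autos[OF x \<Omega>x] this] obtain C where C: "continuous_map (base G x) U1_space C"
    "sc x C = auto_pow G x (\<Omega> x h) n" by blast
  \<comment> \<open>The power with exponent \<open>N * n\<close> is computed in two ways, once
    through flatness.\<close>
  have "sc x (\<lambda>t. C t ^ N) = auto_pow G x (\<Omega> x h) (N * n)"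
    using auto_pow_sc[OF x C(1), of N] G.auto_pow_mult[OF x \<Omega>x, of n N] by (simp add: C(2))
  also have "\<dots> = sc x (\<lambda>t. z ^ n)"
    using auto_pow_sc[OF x continuous_const_U1[OF V1(4)], of n] G.auto_pow_mult[OF x \<Omega>x, of N n]
    by (simp add: flx mult.commute)
  finally have CN: "C t ^ N = z ^ n" if "t \<in> topspace (base G x)" for t
    using sc_eq_iff[OF x continuous_U1_power[OF C(1), of N] continuous_U1_power[OF continuous_const_U1[OF V1(4)], where i = n]] that
    by simp
  let ?I = "{r - d<..<r + d}"
  have yyI: "continuous_map (top_of_set ?I) (base G x) yy"
    unfolding M(2) J_def using continuous_map_from_subtopology[OF yy] by (auto simp: continuous_map_in_subtopology)
  have CI: "continuous_on ?I (C \<circ> yy)"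
    using continuous_map_compose[OF yyI C(1)] by (simp add: U1_space_def continuous_map_in_subtopology)
  have yI: "yy s \<in> topspace (base G x)" if "s \<in> ?I" for s using that yy_in by (auto simp: M(2) J_def)
  \<comment> \<open>All values of \<open>C\<close> are N-th roots of the one number
    \<open>z ^ n\<close>, and the interval is connected.\<close>
  have "finite ((C \<circ> yy) ` ?I)"
  proof (rule finite_subset)
    show "(C \<circ> yy) ` ?I \<subseteq> {u. u ^ N = z ^ n}" using CN yI by auto
    show "finite {u. u ^ N = z ^ n}" using V1(3) by (intro finite_nth_roots) simp
  qed
  from continuous_finite_range_constant[OF _ CI this] obtain u where u: "\<And>s. s \<in> ?I \<Longrightarrow> C (yy s) = u"
    by (auto simp: constant_on_def)
  have Cu: "C t = u" if "t \<in> topspace (base G x)" for t using that u by (auto simp: M(2) J_def)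
  have uU: "u \<in> carrier U1"
    using C(1) yI[of r] Cu[of "yy r"] d(1) by (auto simp: continuous_map_def topspace_U1_space)
  have "auto_pow G x (\<Omega> x h) n = sc x (\<lambda>_. u)"
    unfolding C(2)[symmetric] using sc_eq_iff[OF x C(1) continuous_const_U1[OF uU]] Cu by simp
  with d(1) x h c M(2) ht uU show ?thesis unfolding J_def
    by (intro exI[of _ d] exI[of _ x] exI[of _ h] exI[of _ c] exI[of _ u]) simp
qed

lemma restrict_to_point:
  assumes x: "x \<in> Ob G" "h \<in> arr E (onob f x) p" "c \<in> arr G x a" and t: "t \<in> topspace (base G x)" "bmap E h t = yy r"
  obtains x' m z where "m \<in> arr G x' x" "bmap G m z = t" "point_lift r x' (cmp E h (onar f m)) (cmp G c m) z"
proof -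
  have "continuous_map (subtopology (base G x) {t}) (base G x) id" by (simp add: continuous_map_from_subtopology)
  from G.pullback[OF x(1) this] obtain x' m where m0: "m \<in> arr G x' x" "base G x' = subtopology (base G x) {t}"
    "\<And>s. s \<in> topspace (subtopology (base G x) {t}) \<Longrightarrow> bmap G m s = id s" by blast
  note m = m0[unfolded id_apply]
  have tt: "topspace (base G x') = {t}" "bmap G m t = t" using m(2,3) t by auto
  have "point_lift r x' (cmp E h (onar f m)) (cmp G c m) t"
    using x m(1) tt t(2) G.arr_Ob(1)[OF m(1)] pull_h[OF m(1) x(2)] G.cmp_arr[OF x(3) m(1)]
      E.bmap_cmp[OF x(2) f.onar_arr[OF m(1)], of t] f.bmap_onar[OF m(1), of t] f.base_onob[OF G.arr_Ob(1)[OF m(1)]]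
    by (simp add: point_lift_def)
  then show ?thesis using m(1) tt(2) that by blast
qed

lemma ex_point_lift: obtains x h c z where "point_lift r x h c z"
proof -
  obtain d x h c w where d: "d > 0" and x: "x \<in> Ob G" "h \<in> arr E (onob f x) p" "c \<in> arr G x a"
    and b: "base G x = subtopology (base E p) (yy ` {r - d<..<r + d})"
    and ht': "\<forall>t\<in>topspace (base G x). bmap E h t = t"
    and w: "w \<in> carrier U1" "auto_pow G x (\<Omega> x h) n = sc x (\<lambda>_. w)"
    using local_structure[of r] by blast
  note ht = bspec[OF ht']
  have "yy r \<in> topspace (base G x)" using yy d by (auto simp: b continuous_map_def)
  from restrict_to_point[OF x this ht[OF this]] show ?thesis using that by blast
qed

text \<open>Both claims travel together: the congruence needs a lift whose n-th power is the
  identity, and this property has itself to be carried along the path.\<close>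

definition transported :: "real \<Rightarrow> real \<Rightarrow> bool" where
  "transported r s \<longleftrightarrow> (\<forall>x h c z x' h' c' z'. point_lift r x h c z \<longrightarrow> point_lift s x' h' c' z' \<longrightarrow>
     auto_pow G x (\<Omega> x h) n = ident G x \<longrightarrow>
     auto_pow G x' (\<Omega> x' h') n = ident G x' \<and>
     [path_prism r s = height x' h' c' z' - height x h c z] (mod int n))"

lemma path_prism_add: "[path_prism r s + path_prism s t = path_prism r t] (mod int n)"
proof -
  interpret q: vertex_family E e p "\<lambda>_::unit. K" \<Psi> yy by (rule family_path)
  show ?thesis
    unfolding path_prism_def using q.cyclic_cochain_vsimp[OF \<Psi>n] cocycle_family[OF q.vertex_family_axioms]
    by (intro prism_sum_add) auto
qed

lemma transported_trans:
  assumes "transported r s" "transported s t"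
  shows "transported r t"
  unfolding transported_def
proof (intro allI impI)
  fix x h c z x' h' c' z'
  assume x: "point_lift r x h c z" and x': "point_lift t x' h' c' z'" and one: "auto_pow G x (\<Omega> x h) n = ident G x"
  obtain x0 h0 c0 z0 where x0: "point_lift s x0 h0 c0 z0" by (rule ex_point_lift)
  have 1: "auto_pow G x0 (\<Omega> x0 h0) n = ident G x0" "[path_prism r s = height x0 h0 c0 z0 - height x h c z] (mod int n)"
    using assms(1) x x0 one unfolding transported_def by blast+
  have 2: "auto_pow G x' (\<Omega> x' h') n = ident G x'" "[path_prism s t = height x' h' c' z' - height x0 h0 c0 z0] (mod int n)"
    using assms(2) x0 x' 1(1) unfolding transported_def by blast+
  have "[path_prism r t = height x' h' c' z' - height x h c z] (mod int n)"
    using cong_trans[OF cong_sym[OF path_prism_add[of r s t]] cong_add[OF 1(2) 2(2)]] by simp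
  then show "auto_pow G x' (\<Omega> x' h') n = ident G x' \<and> [path_prism r t = height x' h' c' z' - height x h c z] (mod int n)"
    using 2 by simp
qed

text \<open>The local hypothesis of \<open>Bolzano\<close>: short intervals around \<open>u\<close>
  lie inside one piece provided by \<open>local_structure\<close>.\<close>

lemma transported_local: "\<exists>d>0. \<forall>r s. r \<le> u \<and> u \<le> s \<and> s - r < d \<longrightarrow> transported r s"
proof -
  obtain d x h c w where d: "d > 0" and x: "x \<in> Ob G" and h: "h \<in> arr E (onob f x) p" and c: "c \<in> arr G x a"
    and b: "base G x = subtopology (base E p) (yy ` {u - d<..<u + d})"
    and ht': "\<forall>t\<in>topspace (base G x). bmap E h t = t"
    and w: "w \<in> carrier U1" "auto_pow G x (\<Omega> x h) n = sc x (\<lambda>_. w)"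
    using local_structure[of u] by blast
  note ht = bspec[OF ht']
  have "transported r s" if rs: "r \<le> u" "u \<le> s" "s - r < d" for r s
    unfolding transported_def
  proof (intro allI impI)
    fix xr hr cr zr xs hs cs zs
    assume R: "point_lift r xr hr cr zr" and S: "point_lift s xs hs cs zs" and one: "auto_pow G xr (\<Omega> xr hr) n = ident G xr"
    \<comment> \<open>Clamping keeps the path inside the piece; simplices with parameters between
      \<open>r\<close> and \<open>s\<close> are unchanged, as averages stay between the two.\<close>
    define y where "y v = yy (max r (min s v))" for v
    have cl: "continuous_map euclideanreal euclideanreal (\<lambda>v. max r (min s v))"
      by (simp add: continuous_intros)
    have "max r (min s v) \<in> {u - d<..<u + d}" for v using rs by (auto simp: max_def min_def)
    then have y: "continuous_map euclideanreal (base G x) y"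
      using continuous_map_compose[OF cl yy] by (auto simp: b continuous_map_in_subtopology o_def y_def[abs_def])
    have yv: "y v = yy v" if "r \<le> v" "v \<le> s" for v using that by (simp add: y_def)
    have y_in: "y v \<in> topspace (base G x)" for v using y by (auto simp: continuous_map_def)
    have h_r: "bmap E h (y r) = yy r" and h_s: "bmap E h (y s) = yy s" using ht[OF y_in[of r]] ht[OF y_in[of s]] yv[of r] yv[of s] rs by auto
    obtain x1 m1 z1 where m1: "m1 \<in> arr G x1 x" "bmap G m1 z1 = y r" and L1: "point_lift r x1 (cmp E h (onar f m1)) (cmp G c m1) z1"
      using restrict_to_point[OF x h c y_in h_r] by blast
    obtain x2 m2 z2 where m2: "m2 \<in> arr G x2 x" "bmap G m2 z2 = y s" and L2: "point_lift s x2 (cmp E h (onar f m2)) (cmp G c m2) z2"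
      using restrict_to_point[OF x h c y_in h_s] by blast
    have z1: "z1 \<in> topspace (base G x1)" and z2: "z2 \<in> topspace (base G x2)" using L1 L2 by (auto simp: point_lift_def)
    note I1 = height_lift_independent[OF R L1 one]
    \<comment> \<open>On the piece the n-th power is a constant \<open>w\<close>; at one point it is
      the identity, so \<open>w = 1\<close>.\<close>
    have one': "auto_pow G x (\<Omega> x h) n = ident G x"
    proof -
      have "cmp G m1 (ident G x1) = cmp G (sc x (\<lambda>_. w)) m1"
        using \<Omega>_pow_natural[OF h m1(1), of n] I1(1) w(2) by simp
      also have "\<dots> = cmp G m1 (sc x1 (\<lambda>_. w))" by (rule sc_natural[OF m1(1) continuous_const_U1[OF w(1)]])
      finally have "ident G x1 = sc x1 (\<lambda>_. w)"
        by (rule G.cancel_autos[OF m1(1) G.ident_autos[OF G.arr_Ob(1)[OF m1(1)]]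
              sc_autos[OF G.arr_Ob(1)[OF m1(1)] continuous_const_U1[OF w(1)]]])
      then have "sc x1 (\<lambda>_. w) = sc x1 (\<lambda>_. 1)" using sc_one[OF G.arr_Ob(1)[OF m1(1)]] by simp
      then have "w = 1"
        using sc_eq_iff[OF G.arr_Ob(1)[OF m1(1)] continuous_const_U1[OF w(1)] continuous_const_U1[of 1]] z1 by (auto simp: U1_def)
      then show ?thesis using w(2) sc_one[OF x] by simp
    qed
    have one2: "auto_pow G x2 (\<Omega> x2 (cmp E h (onar f m2))) n = ident G x2"
      by (rule \<Omega>_pow_restrict[OF h m2(1) one'])
    note I2 = height_lift_independent[OF L2 S one2]
    have "path_prism r s = prism_sum n (down x h (\<lambda>_. c) y) (0, r) (0, s)"
      unfolding path_prism_def
    proof (rule prism_sum_cong)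
      fix i1 i2 i3 i4 :: nat and q1 q2
      let ?vs = "[(i1, (), r), (i2, if q1 then ((), r) else ((), s)), (i3, if q2 then ((), r) else ((), s)), (i4, (), s)]"
      let ?ws = "[(i1, 0, r), (i2, if q1 then (0, r) else (0, s)), (i3, if q2 then (0, r) else (0, s)), (i4, 0::nat, s)]"
      have cl: "continuous_map euclideanreal (base E p) y"
        unfolding y_def[abs_def] by (rule continuous_map_compose[OF _ yy, unfolded o_def]) (simp add: continuous_intros)
      interpret q: vertex_family E e p "\<lambda>_::unit. K" \<Psi> yy by (rule family_path)
      interpret q': vertex_family E e p "\<lambda>_::nat. K" \<Psi> y using K \<Psi> cl by unfold_locales auto
      have "q.vsimp ?vs = q'.vsimp ?ws"
      proof (rule R.Y.vertex_simplex_cong)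
        fix j assume j: "j < length ?vs"
        show "vertex_arrow E p (\<lambda>_. K) \<Psi> (?vs ! j) = vertex_arrow E p (\<lambda>_. K) \<Psi> (?ws ! j)"
          using j by (auto simp: less_Suc_eq vertex_arrow_def)
      next
        fix t :: "nat \<Rightarrow> real" assume t: "t \<in> standard_simplex (length ?vs - 1)"
        have e: "snd (snd (?vs ! j)) = snd (snd (?ws ! j))" "r \<le> snd (snd (?vs ! j)) \<and> snd (snd (?vs ! j)) \<le> s"
          if "j < length ?vs" for j using that rs by (auto simp: less_Suc_eq)
        have "(\<Sum>j<length ?vs. t j * snd (snd (?vs ! j))) = (\<Sum>j<length ?ws. t j * snd (snd (?ws ! j)))"
          using e(1) by (intro sum.cong) auto
        then show "yy (\<Sum>j<length ?vs. t j * snd (snd (?vs ! j))) = y (\<Sum>j<length ?ws. t j * snd (snd (?ws ! j)))"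
          using simplex_average_bounds[of t "length ?vs" r "\<lambda>j. snd (snd (?vs ! j))" s, OF t _ e(2)] yv by simp
      qed auto
      also have "\<dots> = vertex_simplex E e (onob f x) (\<lambda>_::nat. cmp E K h) (onar f (\<Omega> x h)) y ?ws"
        using ht y_in f.base_onob[OF x]
        by (intro q'.vsimp_pullback[OF h onar_\<Omega>_autos[OF x h] \<Omega>_over[OF x h, symmetric], symmetric]) auto
      also have "\<dots> = vertex_simplex E e (onob f x) (lift_chart h (\<lambda>_. c)) (onar f (\<Omega> x h)) y ?ws"
        by (rule R.Y.vertex_simplex_cong) (auto simp: less_Suc_eq vertex_arrow_def lift_chart_def)
      finally show "c3 (q.vsimp ?vs) = down x h (\<lambda>_. c) y ?ws" by (simp only: down_def)
    qed
    moreover have "[prism_sum n (down x h (\<lambda>_. c) y) (0, r) (0, s)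
        = height x2 (cmp E h (onar f m2)) (cmp G c m2) z2 - height x1 (cmp E h (onar f m1)) (cmp G c m1) z1] (mod int n)"
      using height_step[where c = "\<lambda>_. c" and r = r and s = s and i = 0 and j = 0, OF x h c y one']
        height_at_point[where c = "\<lambda>_. c" and j = 0, OF x h c y m1(1) z1 m1(2)]
        height_at_point[where c = "\<lambda>_. c" and j = 0, OF x h c y m2(1) z2 m2(2)] by simp
    ultimately have "[path_prism r s = height xs hs cs zs - height xr hr cr zr] (mod int n)"
      using cong_trans[OF _ cong_diff[OF I2(2) cong_sym[OF I1(2)]]] by simp
    then show "auto_pow G xs (\<Omega> xs hs) n = ident G xs \<and> [path_prism r s = height xs hs cs zs - height xr hr cr zr] (mod int n)"
      using I2(1) by simp
  qed
  then show ?thesis using d by blast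
qed

lemma transported: "r \<le> s \<Longrightarrow> transported r s"
  by (rule Bolzano) (blast intro: transported_trans transported_local)+

text \<open>Both ends are lifted by the same object with the same chart of the gerbe and have equal
  images in \<open>E\<close>, so the correcting prisms in the two heights cancel.\<close>

lemma path_prism_lift_sum:
  assumes x0: "point_lift 0 x h0 c z" and x1: "point_lift 1 x h1 c z" and K01: "cmp E K h0 = cmp E K h1"
    and \<Omega>01: "onar f (\<Omega> x h0) = onar f (\<Omega> x h1)" and one: "auto_pow G x (\<Omega> x h0) n = ident G x"
  shows "auto_pow G x (\<Omega> x h1) n = ident G x"
    and "[path_prism 0 1 = lift_sum n x c (\<Omega> x h1) z - lift_sum n x c (\<Omega> x h0) z] (mod int n)"
proof -
  have *: "auto_pow G x (\<Omega> x h1) n = ident G x \<and> [path_prism 0 1 = height x h1 c z - height x h0 c z] (mod int n)"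
    using transported[of 0 1] x0 x1 one unfolding transported_def by simp
  then show "auto_pow G x (\<Omega> x h1) n = ident G x" by simp
  have c: "c \<in> arr G x a" using x0 by (simp add: point_lift_def)
  have "lift_chart h0 (\<lambda>_. c) = lift_chart h1 (\<lambda>_. c)"
    by (rule ext) (simp add: lift_chart_def K01 split: nat.split)
  then have "down x h0 (\<lambda>_. c) (\<lambda>_. z) = down x h1 (\<lambda>_. c) (\<lambda>_. z)" by (simp add: down_def[abs_def] \<Omega>01)
  moreover have "cyclic_sum n (up x h (\<lambda>_. c) (\<lambda>_. z)) (1, 0) = lift_sum n x c (\<Omega> x h) z" for h
    unfolding lift_sum_def
  proof (rule cyclic_sum_cong)
    show "up x h (\<lambda>_. c) (\<lambda>_. z) [(i, 1, 0), (j, 1, 0), (k, 1, 0)]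
        = l (vertex_simplex G a x (\<lambda>_. c) (\<Omega> x h) (\<lambda>_. z) [(i, (), 0), (j, (), 0), (k, (), 0)])" for i j k
      unfolding up_def by (intro arg_cong[of _ _ l] R.X.vertex_simplex_cong) (auto simp: less_Suc_eq vertex_arrow_def)
  qed
  ultimately show "[path_prism 0 1 = lift_sum n x c (\<Omega> x h1) z - lift_sum n x c (\<Omega> x h0) z] (mod int n)"
    using * by (simp add: height_def)
qed

end

section \<open>Evaluation of cohomology classes\<close>

lemma coboundary_diff: "coboundary n (\<lambda>s. a s - b s) s = coboundary n a s - coboundary n b s"
  by (simp add: coboundary_def algebra_simps sum_subtractf)

lemma cohomologyD:
  assumes d: "d \<in> cohomology n S" and a: "a \<in> d" and n: "n > 0"
  shows "cocycle n S a"
    and "b \<in> d \<Longrightarrow> \<exists>l. \<forall>s. singular_simplex n S s \<longrightarrow> a s - b s = coboundary (n - 1) l s"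
proof -
  obtain c where dc: "d = {c'. cocycle n S c' \<and> cohomologous n S c' c}" using d by (auto simp: cohomology_def)
  show "cocycle n S a" using a dc by simp
  assume b: "b \<in> d"
  obtain l1 where l1: "\<forall>s. singular_simplex n S s \<longrightarrow> a s - c s = coboundary (n - 1) l1 s"
    using a dc n by (auto simp: cohomologous_def)
  obtain l2 where l2: "\<forall>s. singular_simplex n S s \<longrightarrow> b s - c s = coboundary (n - 1) l2 s"
    using b dc n by (auto simp: cohomologous_def)
  have "a s - b s = coboundary (n - 1) (\<lambda>s. l1 s - l2 s) s" if "singular_simplex n S s" for s
    using l1[rule_format, OF that] l2[rule_format, OF that] by (simp add: coboundary_diff)
  then show "\<exists>l. \<forall>s. singular_simplex n S s \<longrightarrow> a s - b s = coboundary (n - 1) l s" by blast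
qed

lemma prism_sum_diff:
  "prism_sum n (\<lambda>vs. a vs - b vs) x y = prism_sum n a x y - prism_sum n b x y"
  by (simp add: prism_sum_def sum_subtractf[symmetric] algebra_simps)

lemma cyclic_cochain_map:
  assumes "cyclic_cochain n c"
  shows "cyclic_cochain n (\<lambda>vs. c (map (\<lambda>(i, x). (i, g x)) vs))"
proof -
  have 1: "map (\<lambda>(i, x). (i, g x)) (shift_vertices vs) = shift_vertices (map (\<lambda>(i, x). (i, g x)) vs)" for vs
    by (auto simp: shift_vertices_def)
  have 2: "congruent_vertices n (map (\<lambda>(i, x). (i, g x)) vs) (map (\<lambda>(i, x). (i, g x)) ws)"
    if "congruent_vertices n vs ws" for vs ws
    using that unfolding congruent_vertices_def list_all2_map1 list_all2_map2
    by (rule list_all2_mono) auto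
  show ?thesis using assms 2 unfolding cyclic_cochain_def 1 by simp
qed

section \<open>The Bockstein of a character, evaluated on a cyclic chain\<close>

context point_torsor
begin

interpretation G: group \<Gamma> by (rule \<Gamma>)

lemma torsor_auto_eq:
  "torsor_auto \<Gamma> P y0 g = \<lparr>bsrc = P, btgt = P, bfun = restrict id (topspace (bbase P)),
     tfun = restrict (\<lambda>x. act P y0 (g \<otimes>\<^bsub>\<Gamma>\<^esub> quot x)) (topspace (tot P))\<rparr>"
  by (simp add: torsor_auto_def quot_def[abs_def])

lemma torsor_auto_autos:
  assumes g: "g \<in> carrier \<Gamma>"
  shows "torsor_auto \<Gamma> P y0 g \<in> autos S P"
proof -
  note act = principal_bundle_act[OF P]
  have "continuous_map (bbase P) (bbase P) (restrict id (topspace (bbase P)))"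
    by (rule continuous_map_restrict) simp
  moreover have "continuous_map (tot P) (tot P) (restrict (\<lambda>x. act P y0 (g \<otimes>\<^bsub>\<Gamma>\<^esub> quot x)) (topspace (tot P)))"
    using act(2)[OF y0] quot(1) g by (intro continuous_from_tot_P) auto
  moreover have "act P y0 (g \<otimes>\<^bsub>\<Gamma>\<^esub> quot (act P y h)) = act P (act P y0 (g \<otimes>\<^bsub>\<Gamma>\<^esub> quot y)) h"
    if "y \<in> topspace (tot P)" "h \<in> carrier \<Gamma>" for y h
    using that g quot(1) act(4)[OF y0] by (simp add: quot_act G.m_assoc)
  moreover have "act P y0 (g \<otimes>\<^bsub>\<Gamma>\<^esub> quot y) \<in> topspace (tot P)" if "y \<in> topspace (tot P)" for y
    using that g quot(1) act(2)[OF y0] by simp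
  ultimately have "torsor_auto \<Gamma> P y0 g \<in> bundle_arrows \<Gamma> D"
    using P pt proj_P act(2) by (auto simp: bundle_arrows_def torsor_auto_eq)
  then show ?thesis by (auto simp: autos_def arr_def classifying_stack_def torsor_auto_eq)
qed

lemma torsor_auto_mult:
  assumes g: "g \<in> carrier \<Gamma>" and h: "h \<in> carrier \<Gamma>"
  shows "cmp S (torsor_auto \<Gamma> P y0 g) (torsor_auto \<Gamma> P y0 h) = torsor_auto \<Gamma> P y0 (g \<otimes>\<^bsub>\<Gamma>\<^esub> h)"
proof -
  note act = principal_bundle_act[OF P]
  have "quot (act P y0 k) = k" if "k \<in> carrier \<Gamma>" for k
    using quot(3)[OF act(2)[OF y0 that] that] by simp
  then have "compose (topspace (tot P)) (tfun (torsor_auto \<Gamma> P y0 g)) (tfun (torsor_auto \<Gamma> P y0 h))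
      = tfun (torsor_auto \<Gamma> P y0 (g \<otimes>\<^bsub>\<Gamma>\<^esub> h))"
    using g h quot(1) act(2)[OF y0] by (auto simp: compose_def torsor_auto_eq G.m_assoc restrict_def fun_eq_iff)
  moreover have "compose (topspace (bbase P)) (bfun (torsor_auto \<Gamma> P y0 g)) (bfun (torsor_auto \<Gamma> P y0 h))
      = bfun (torsor_auto \<Gamma> P y0 (g \<otimes>\<^bsub>\<Gamma>\<^esub> h))"
    by (auto simp: compose_def torsor_auto_eq restrict_def fun_eq_iff)
  ultimately show ?thesis by (simp add: classifying_stack_def) (simp add: torsor_auto_eq)
qed

lemma torsor_auto_one: "torsor_auto \<Gamma> P y0 \<one>\<^bsub>\<Gamma>\<^esub> = ident S P"
  using quot by (auto simp: torsor_auto_eq classifying_stack_def restrict_def fun_eq_iff)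

lemma torsor_auto_pow:
  "g \<in> carrier \<Gamma> \<Longrightarrow> auto_pow S P (torsor_auto \<Gamma> P y0 g) i = torsor_auto \<Gamma> P y0 (g [^]\<^bsub>\<Gamma>\<^esub> i)"
  by (induction i) (simp_all add: auto_pow_0 S.auto_pow_Suc_right[OF a_Ob torsor_auto_autos] torsor_auto_one torsor_auto_mult)

text \<open>The chain \<open>\<Sum> (0, i, i + 1)\<close> in \<open>B\<Gamma>\<close> has boundary \<open>n\<close> times the edge of \<open>\<gamma>\<close>.\<close>

lemma bockstein_value:
  fixes B :: "('o, 'm, 'u) fibcat"
  assumes F: "realization_morphism S B F P b kj"
    and \<gamma>: "\<gamma> \<in> carrier \<Gamma>" and n: "n > 0" and \<gamma>n: "\<gamma> [^]\<^bsub>\<Gamma>\<^esub> n = \<one>\<^bsub>\<Gamma>\<^esub>"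
    and c: "c \<in> cohomology 2 (realization B b)" and \<beta>: "\<beta> \<in> c"
    and bock: "is_bockstein \<Gamma> P y0 \<phi> (cohomology_pullback 2 (realization S P) (realization_map S P B b F kj) c)"
  shows "\<phi> \<gamma> = cis (2 * pi * (of_int (cyclic_sum n (\<lambda>vs. \<beta> (vertex_simplex B b (onob F P) (\<lambda>_::unit. kj)
      (onar F (torsor_auto \<Gamma> P y0 \<gamma>)) (\<lambda>_. pt) vs)) ((), 0)) / of_nat n))"
proof -
  interpret F: realization_morphism S B F P b kj by fact
  let ?\<gamma> = "torsor_auto \<Gamma> P y0 \<gamma>" and ?rm = "realization_map S P B b F kj"
  obtain l :: "('u rpoint, real) cochain" and \<kappa> where
    \<kappa>: "\<kappa> \<in> cohomology_pullback 2 (realization S P) ?rm c"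
    and l: "\<And>s. singular_simplex 2 (realization S P) s \<Longrightarrow> coboundary 1 l s = of_int (\<kappa> s)"
    and edge: "cis (2 * pi * l (restrict (\<lambda>t. edge_point S P ?\<gamma> pt (t 0) (t 1)) (standard_simplex 1))) = \<phi> \<gamma>"
    using bock \<gamma> pt by (auto simp: is_bockstein_def Let_def)
  obtain \<kappa>0 l1 where \<kappa>0: "\<kappa>0 \<in> c" and
    l1: "\<And>s. singular_simplex 2 (realization S P) s \<Longrightarrow> \<kappa> s - cochain_pullback 2 ?rm \<kappa>0 s = coboundary 1 l1 s"
    using \<kappa> by (auto simp: cohomology_pullback_def cohomologous_def)
  obtain l2 where l2: "\<And>s. singular_simplex 2 (realization B b) s \<Longrightarrow> \<kappa>0 s - \<beta> s = coboundary 1 l2 s"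
    using cohomologyD(2)[OF c \<kappa>0 _ \<beta>] by auto
  have PS: "P \<in> Ob S" by (rule a_Ob)
  interpret v: vertex_family S P P "\<lambda>_::unit. ident S P" ?\<gamma> "\<lambda>_. pt"
    using torsor_auto_autos[OF \<gamma>] S.ident_arr[OF PS] pt by unfold_locales (auto simp: classifying_stack_def)
  have gn: "auto_pow S P ?\<gamma> n = ident S P" using \<gamma> by (simp add: torsor_auto_pow \<gamma>n torsor_auto_one)
  note imf = F.vertex_family_image[OF v.vertex_family_axioms]
  have kid: "cmp B kj (onar F (ident S P)) = kj"
    using F.onar_ident[OF PS] F.Y.cmp_ident(1)[OF F.k] by simp
  interpret w: vertex_family B b "onob F P" "\<lambda>_::unit. kj" "onar F ?\<gamma>" "\<lambda>_. pt"
    using imf unfolding kid .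
  have wn: "auto_pow B (onob F P) (onar F ?\<gamma>) n = ident B (onob F P)"
    using F.onar_auto_pow[OF PS torsor_auto_autos[OF \<gamma>], of n] F.onar_ident[OF PS] gn by simp
  define x where "x = ((), 0 :: real)"
  let ?vs = "\<lambda>i. [(0, x), (i, x), (Suc i, x)]"
  have sv: "singular_simplex 2 (realization S P) (v.vsimp (?vs i))" for i
    using v.singular_vsimp[of "?vs i"] by (simp add: numeral_2_eq_2)
  have sw: "singular_simplex 2 (realization B b) (w.vsimp (?vs i))" for i
    using w.singular_vsimp[of "?vs i"] by (simp add: numeral_2_eq_2)
  have cv: "coboundary 1 h (v.vsimp (?vs i)) = list_coboundary (\<lambda>ws. h (v.vsimp ws)) (?vs i)" for h :: "('u rpoint, 'r::comm_ring_1) cochain" and i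
    by (rule v.coboundary_vsimp) simp
  have cw: "coboundary 1 h (w.vsimp (?vs i)) = list_coboundary (\<lambda>ws. h (w.vsimp ws)) (?vs i)" for h :: "('u rpoint, 'r::comm_ring_1) cochain" and i
    by (rule w.coboundary_vsimp) simp
  have map: "simplex_map 2 ?rm (v.vsimp (?vs i)) = w.vsimp (?vs i)" for i
    using F.simplex_map_vertex_simplex[OF v.vertex_family_axioms, of "?vs i"] by (simp add: numeral_2_eq_2 kid)
  have "real_of_int (cyclic_sum n (\<lambda>vs. \<kappa> (v.vsimp vs)) x) = of_nat n * l (v.vsimp [(0, x), (1, x)])"
  proof -
    have "real_of_int (cyclic_sum n (\<lambda>vs. \<kappa> (v.vsimp vs)) x) = cyclic_sum n (list_coboundary (\<lambda>ws. l (v.vsimp ws))) x"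
      unfolding cyclic_sum_def of_int_sum by (intro sum.cong refl) (simp only: l[OF sv, symmetric] cv)
    then show ?thesis using cyclic_sum_coboundary[OF v.cyclic_cochain_vsimp[OF gn], of l x] by simp
  qed
  \<comment> \<open>Changing the representative of the class adds coboundaries, which contribute
    multiples of \<open>n\<close>.\<close>
  moreover have "cyclic_sum n (\<lambda>vs. \<kappa> (v.vsimp vs)) x
      = cyclic_sum n (\<lambda>vs. \<beta> (w.vsimp vs)) x + int n * (l1 (v.vsimp [(0, x), (1, x)]) + l2 (w.vsimp [(0, x), (1, x)]))"
  proof -
    have "\<kappa> (v.vsimp (?vs i)) = \<beta> (w.vsimp (?vs i)) + (list_coboundary (\<lambda>ws. l1 (v.vsimp ws)) (?vs i)
        + list_coboundary (\<lambda>ws. l2 (w.vsimp ws)) (?vs i))" for i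
      using l1[OF sv[of i], unfolded cv] l2[OF sw[of i], unfolded cw] by (simp add: cochain_pullback_def map)
    then have "cyclic_sum n (\<lambda>vs. \<kappa> (v.vsimp vs)) x = cyclic_sum n (\<lambda>vs. \<beta> (w.vsimp vs)) x
        + (cyclic_sum n (list_coboundary (\<lambda>ws. l1 (v.vsimp ws))) x + cyclic_sum n (list_coboundary (\<lambda>ws. l2 (w.vsimp ws))) x)"
      unfolding cyclic_sum_def by (simp only: sum.distrib)
    then show ?thesis
      using cyclic_sum_coboundary[OF v.cyclic_cochain_vsimp[OF gn], of l1 x]
        cyclic_sum_coboundary[OF w.cyclic_cochain_vsimp[OF wn], of l2 x] by (simp add: algebra_simps)
  qed
  moreover have "v.vsimp [(0, x), (1, x)] = restrict (\<lambda>t. edge_point S P ?\<gamma> pt (t 0) (t 1)) (standard_simplex 1)"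
    unfolding vertex_simplex_def
  proof (simp, rule restrict_ext)
    fix t :: "nat \<Rightarrow> real" assume t: "t \<in> standard_simplex (Suc 0)"
    have tt: "(\<lambda>i. if i = 0 then t 0 else if i = 1 then t 1 else 0) = t"
      using t by (auto simp: standard_simplex_def fun_eq_iff)
    have "tuple_point S P 1 P (\<lambda>j. vertex_arrow S P (\<lambda>_. ident S P) ?\<gamma> ([(0, x), (1, x)] ! j)) pt t
        = tuple_point S P 1 P (\<lambda>i. if i = 0 then ident S P else ?\<gamma>) pt t"
      using S.cmp_ident(1)[OF S.ident_arr[OF PS]] S.cmp_ident(2)[OF S.autos_arr[OF torsor_auto_autos[OF \<gamma>]]]
        S.auto_pow_1[OF torsor_auto_autos[OF \<gamma>]]
      by (intro tuple_point_cong) (auto simp: le_Suc_eq vertex_arrow_def x_def auto_pow_0)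
    moreover have "edge_point S P ?\<gamma> pt (t 0) (t 1) = tuple_point S P 1 P (\<lambda>i. if i = 0 then ident S P else ?\<gamma>) pt t"
      unfolding edge_point_def tuple_point_def by (simp only: tt)
    ultimately show "tuple_point S P (Suc 0) P (\<lambda>j. vertex_arrow S P (\<lambda>_. ident S P) ?\<gamma> ([(0, x), (Suc 0, x)] ! j)) pt t
        = edge_point S P ?\<gamma> pt (t 0) (t (Suc 0))"
      by simp
  qed
  \<comment> \<open>Dividing by \<open>n\<close>, the value of \<open>l\<close> on the edge of
    \<open>\<gamma>\<close> is found up to an integer, which \<open>cis\<close> forgets.\<close>
  ultimately have e: "l (restrict (\<lambda>t. edge_point S P ?\<gamma> pt (t 0) (t 1)) (standard_simplex 1))
     = of_int (cyclic_sum n (\<lambda>vs. \<beta> (w.vsimp vs)) x) / of_nat n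
       + of_int (l1 (v.vsimp [(0, x), (1, x)]) + l2 (w.vsimp [(0, x), (1, x)]))" (is "_ = ?a + of_int ?k")
    using n by (simp add: field_simps)
  have "cis (2 * pi * (?a + of_int ?k)) = cis (2 * pi * ?a) * cis (2 * pi * of_int ?k)"
    by (simp add: cis_mult distrib_left)
  also have "cis (2 * pi * of_int ?k) = 1" by (rule cis_multiple_2pi) simp
  finally show ?thesis using edge unfolding e x_def by simp
qed

end

text \<open>The front edge in \<open>cup\<close> arises by deleting vertex 3 and then vertex 2, so
  the face formulas apply to it.\<close>

lemma singular_face_front: "singular_face 2 2 (singular_face 3 3 s) = restrict s (standard_simplex 1)"
proof
  fix t :: "nat \<Rightarrow> real"
  have "simplical_face k t = t" if "t \<in> standard_simplex 1" "k \<ge> 2" for k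
    using that by (auto simp: simplical_face_def standard_simplex_def fun_eq_iff)
  moreover have "t \<in> standard_simplex 2" if "t \<in> standard_simplex 1" using that standard_simplex_mono[of 1 2] by auto
  ultimately show "singular_face 2 2 (singular_face 3 3 s) t = restrict s (standard_simplex 1) t"
    by (cases "t \<in> standard_simplex 1") (simp_all add: singular_face_def)
qed

section \<open>Fibre integration on prisms\<close>

context circle_bundle_atlas
begin

text \<open>Replace \<open>\<kappa>\<close> by the representative in the definition of the integral.
  The coboundary between them drops out modulo \<open>n\<close>, because by \<open>ends\<close> the
  simplices at the two ends of the path coincide; on the representative only the fibre loop
  contributes, where \<open>\<eta>\<close> is 1.\<close>

lemma fibre_integral_value:
  assumes Bp: "powers B b" and Ep: "powers E e"
    and int: "is_fibre_integral B p b e m 2 d c"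
    and K: "K \<in> arr E x e" and \<Psi>: "\<Psi> \<in> autos E x" and \<Psi>n: "auto_pow E x \<Psi> n = ident E x"
    and yy: "continuous_map euclideanreal (base E x) yy"
    and kq: "kq \<in> arr B q b" and \<gamma>: "\<gamma> \<in> autos B q" and \<gamma>n: "auto_pow B q \<gamma> n = ident B q"
    and q: "topspace (base B q) = {t}" and \<nu>: "\<nu> \<in> arr B (fst x) q"
    and mK: "cmp B m (onar total_proj K) = cmp B kq \<nu>" and \<gamma>\<nu>: "cmp B \<gamma> \<nu> = cmp B \<nu> (onar total_proj \<Psi>)"
    and Y: "Y \<in> topspace (tot (onob p b))"
    and KY: "\<And>r. bmap E K (yy r) = act (onob p b) Y (cis (2 * pi * r))"
    and ends: "\<And>i j k. vertex_simplex E e x (\<lambda>_::unit. K) \<Psi> yy [(i, (), 0), (j, (), 0), (k, (), 0)]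
       = vertex_simplex E e x (\<lambda>_::unit. K) \<Psi> yy [(i, (), 1), (j, (), 1), (k, (), 1)]"
    and \<kappa>: "\<kappa> \<in> d"
  shows "\<exists>\<beta>\<in>c. [prism_sum n (\<lambda>vs. \<kappa> (vertex_simplex E e x (\<lambda>_::unit. K) \<Psi> yy vs)) ((), 0) ((), 1)
    = cyclic_sum n (\<lambda>vs. \<beta> (vertex_simplex B b q (\<lambda>_::unit. kq) \<gamma> (\<lambda>_. t) vs)) ((), 0)] (mod int n)"
proof -
  let ?\<pi> = "realization_map E e B b total_proj m"
  have num: "Suc 2 = (3 :: nat)" "2 + 1 = (3 :: nat)" by simp_all
  from int obtain \<epsilon> \<eta> \<beta> \<mu> where d: "d \<in> cohomology 3 (realization E e)" and c: "c \<in> cohomology 2 (realization B b)"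
    and \<eta>: "\<And>y. y \<in> topspace (tot (onob p b)) \<Longrightarrow>
       \<eta> (fibre_loop B p b e y) - \<eta> (constant_simplex 1 (vertex E e y)) = 1"
    and \<beta>: "\<beta> \<in> c"
    and D: "(\<lambda>s. cup 1 2 \<eta> (cochain_pullback 2 ?\<pi> \<beta>) s + cochain_pullback 3 ?\<pi> \<mu> s) \<in> d" (is "?D \<in> d")
    unfolding is_fibre_integral_def Let_def num by blast
  interpret pr: realization_morphism E B total_proj e b m
    using m Bp Ep total_proj.stack_morphism_axioms
    by (simp add: realization_morphism_def realization_morphism_axioms_def total_proj_def)
  interpret v: vertex_family E e x "\<lambda>_::unit. K" \<Psi> yy
    using K \<Psi> yy by unfold_locales auto
  interpret w: vertex_family B b q "\<lambda>_::unit. kq" \<gamma> "\<lambda>_. t"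
    using kq \<gamma> q by unfold_locales auto
  note imf = pr.vertex_family_image[OF v.vertex_family_axioms]
  have xB: "onob total_proj x = fst x" by (simp add: total_proj_def)
  have bx: "base B (fst x) = base E x" using total_proj.base_onob[OF v.x] by (simp add: xB)
  \<comment> \<open>Projected to \<open>B\<close>, the path is constant at the point
    \<open>t\<close> of \<open>q\<close>.\<close>
  have proj: "vertex_simplex B b (fst x) (\<lambda>_::unit. cmp B m (onar total_proj K)) (onar total_proj \<Psi>) yy vs = w.vsimp vs" for vs
  proof -
    have "onar total_proj \<Psi> \<in> autos B (fst x)" using total_proj.onar_autos[OF v.x \<Psi>] by (simp add: xB)
    then show ?thesis
      using v.y_in B.bmap_in[OF \<nu>] q
      by (intro w.vsimp_pullback[OF \<nu> _ \<gamma>\<nu>]) (auto simp: bx mK)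
  qed
  have down: "simplex_map (length vs - 1) ?\<pi> (v.vsimp vs) = w.vsimp (map (\<lambda>(i, _). (i, (), 0)) vs)" for vs
  proof (cases "vs = []")
    case False
    have "simplex_map (length vs - 1) ?\<pi> (v.vsimp vs) = w.vsimp vs"
      using pr.simplex_map_vertex_simplex[OF v.vertex_family_axioms, of vs] proj[of vs] by (simp add: xB)
    also have "\<dots> = w.vsimp (map (\<lambda>(i, _). (i, (), 0)) vs)"
      using False by (intro pr.Y.vertex_simplex_cong) (auto simp: vertex_arrow_def case_prod_beta)
    finally show ?thesis .
  next
    case True
    have "simplex_map (length vs - 1) ?\<pi> (v.vsimp vs) = w.vsimp vs"
      using pr.simplex_map_vertex_simplex[OF v.vertex_family_axioms, of vs] proj[of vs] by (simp add: xB)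
    then show ?thesis using True by simp
  qed
  define g :: "nat \<times> unit \<Rightarrow> nat \<times> unit \<times> real" where "g = (\<lambda>(i, _). (i, (), 0))"
  define bl where "bl vs = \<beta> (w.vsimp (map g vs))" for vs
  define ul where "ul vs = \<mu> (w.vsimp (map g vs))" for vs
  have cyb: "cyclic_cochain n bl"
    unfolding bl_def g_def
    using cyclic_cochain_map[OF w.cyclic_cochain_vsimp[OF \<gamma>n, of \<beta>], of "\<lambda>_. ((), 0)"] by (simp add: case_prod_beta)
  have cocb: "list_coboundary bl [(i, ()), (j, ()), (k, ()), (l, ())] = 0" for i j k l
  proof -
    let ?vs = "[(i, (), 0), (j, (), 0), (k, (), 0), (l, (), 0)]"
    have "coboundary 2 \<beta> (w.vsimp ?vs) = 0"
      using cohomologyD(1)[OF c \<beta>] w.singular_vsimp[of ?vs] by (simp add: cocycle_def eval_nat_numeral)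
    then show ?thesis
      using w.coboundary_vsimp[of ?vs 2 \<beta>] by (simp add: bl_def g_def list_coboundary_simps)
  qed
  have front: "restrict (v.vsimp [v0, v1, v2, v3]) (standard_simplex 1) = v.vsimp [v0, v1]" for v0 v1 v2 v3
  proof -
    have "singular_face 2 2 (singular_face 3 3 (v.vsimp [v0, v1, v2, v3])) = v.vsimp [v0, v1]"
      using v.face_vsimp[of "[v0, v1, v2, v3]" 2 3] v.face_vsimp[of "[v0, v1, v2]" 1 2] by (simp add: eval_nat_numeral)
    then show ?thesis by (simp only: singular_face_front)
  qed
  have rear: "restrict (\<lambda>t. v.vsimp [v0, v1, v2, v3] (\<lambda>i. if i < 1 then 0 else t (i - 1))) (standard_simplex 2) = v.vsimp [v1, v2, v3]"
    for v0 v1 v2 v3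
  proof -
    have "singular_face 3 0 (v.vsimp [v0, v1, v2, v3]) = v.vsimp [v1, v2, v3]"
      using v.face_vsimp[of "[v0, v1, v2, v3]" 2 0] by (simp add: eval_nat_numeral)
    moreover have "simplical_face 0 t = (\<lambda>i. if i < 1 then 0 else t (i - 1))" for t :: "nat \<Rightarrow> real"
      by (auto simp: simplical_face_def fun_eq_iff)
    ultimately show ?thesis by (simp add: singular_face_def o_def)
  qed
  have Dv: "?D (v.vsimp [(i, y1), (j, y2), (k, y3), (l, y4)])
      = \<eta> (v.vsimp [(i, y1), (j, y2)]) * bl [(j, ()), (k, ()), (l, ())] + ul [(i, ()), (j, ()), (k, ()), (l, ())]"
    for i j k l y1 y2 y3 y4
    using down[of "[(j, y2), (k, y3), (l, y4)]"] down[of "[(i, y1), (j, y2), (k, y3), (l, y4)]"]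
    unfolding cup_def front rear cochain_pullback_def bl_def ul_def g_def
    by (simp add: eval_nat_numeral)
  have loop: "v.vsimp [(0, (), 0), (0, (), 1)] = fibre_loop B p b e Y"
  proof
    fix t :: "nat \<Rightarrow> real"
    show "v.vsimp [(0, (), 0), (0, (), 1)] t = fibre_loop B p b e Y t"
      using v.vsimp_fibre_edge[of t "()" 0 1]
      by (cases "t \<in> standard_simplex 1") (simp_all add: fibre_loop_def KY vertex_simplex_def)
  qed
  have const: "v.vsimp [(0, (), 0), (0, (), 0)] = constant_simplex 1 (vertex E e Y)"
  proof
    fix t :: "nat \<Rightarrow> real"
    have "act (onob p b) Y 1 = Y"
      using principal_bundle_act(1)[OF principal[OF B.arr_Ob(2)[OF m]] Y] by (simp add: U1_def)
    then show "v.vsimp [(0, (), 0), (0, (), 0)] t = constant_simplex 1 (vertex E e Y) t"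
      using v.vsimp_fibre_edge[of t "()" 0 0] KY[of 0]
      by (cases "t \<in> standard_simplex 1") (simp_all add: constant_simplex_def vertex_simplex_def)
  qed
  have "prism_sum n (\<lambda>vs. ?D (v.vsimp vs)) ((), 0) ((), 1) - prism_sum n (\<lambda>vs. ?D (v.vsimp vs)) ((), 0) ((), 0)
      = (\<eta> (v.vsimp [(0, (), 0), (0, (), 1)]) - \<eta> (v.vsimp [(0, (), 0), (0, (), 0)])) * cyclic_sum n bl ()"
    by (rule prism_sum_cup[OF cyb cocb Dv])
  then have cup: "prism_sum n (\<lambda>vs. ?D (v.vsimp vs)) ((), 0) ((), 1) - prism_sum n (\<lambda>vs. ?D (v.vsimp vs)) ((), 0) ((), 0)
      = cyclic_sum n bl ()"
    using \<eta>[OF Y] unfolding loop const by simp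
  obtain l where l: "\<And>s. singular_simplex 3 (realization E e) s \<Longrightarrow> \<kappa> s - ?D s = coboundary 2 l s"
    using cohomologyD(2)[OF d \<kappa> _ D] by auto
  have cyl: "cyclic_cochain n (\<lambda>vs. l (v.vsimp vs))" by (rule v.cyclic_cochain_vsimp[OF \<Psi>n])
  have diff: "[prism_sum n (\<lambda>vs. \<kappa> (v.vsimp vs) - ?D (v.vsimp vs)) y1 y2
      = cyclic_sum n (\<lambda>vs. l (v.vsimp vs)) y2 - cyclic_sum n (\<lambda>vs. l (v.vsimp vs)) y1] (mod int n)" for y1 y2
  proof (rule prism_sum_coboundary[OF cyl])
    fix i j k r :: nat and u1 u2 u3 u4 :: "unit \<times> real"
    let ?vs = "[(i, u1), (j, u2), (k, u3), (r, u4)]"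
    have "\<kappa> (v.vsimp ?vs) - ?D (v.vsimp ?vs) = coboundary 2 l (v.vsimp ?vs)"
      using l v.singular_vsimp[of ?vs] by (simp add: eval_nat_numeral)
    also have "\<dots> = list_coboundary (\<lambda>vs. l (v.vsimp vs)) ?vs" by (rule v.coboundary_vsimp) simp
    finally show "\<kappa> (v.vsimp ?vs) - ?D (v.vsimp ?vs) = list_coboundary (\<lambda>vs. l (v.vsimp vs)) ?vs" .
  qed
  \<comment> \<open>As the end simplices coincide, the two boundary terms of \<open>l\<close>
    cancel.\<close>
  have "cyclic_sum n (\<lambda>vs. l (v.vsimp vs)) ((), 1) = cyclic_sum n (\<lambda>vs. l (v.vsimp vs)) ((), 0)"
    by (rule cyclic_sum_cong) (simp add: ends)
  then have 1: "[prism_sum n (\<lambda>vs. \<kappa> (v.vsimp vs)) ((), 0) ((), 1) = prism_sum n (\<lambda>vs. ?D (v.vsimp vs)) ((), 0) ((), 1)] (mod int n)"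
    using diff[of "((), 0)" "((), 1)"] by (simp add: prism_sum_diff cong_diff_iff_cong_0)
  \<comment> \<open>\<open>\<eta>\<close> is normalised only as a difference with a constant
    simplex, so the prism over the constant edge has to be carried along; it is zero modulo
    \<open>n\<close>.\<close>
  have 2: "[prism_sum n (\<lambda>vs. \<kappa> (v.vsimp vs)) ((), 0) ((), 0) = prism_sum n (\<lambda>vs. ?D (v.vsimp vs)) ((), 0) ((), 0)] (mod int n)"
    using diff[of "((), 0)" "((), 0)"] by (simp add: prism_sum_diff cong_diff_iff_cong_0)
  have 3: "[prism_sum n (\<lambda>vs. \<kappa> (v.vsimp vs)) ((), 0) ((), 0) = 0] (mod int n)"
  proof (rule prism_sum_refl[OF v.cyclic_cochain_vsimp[OF \<Psi>n]])
    fix i j k r s :: nat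
    let ?vs = "[(i, (), 0), (j, (), 0), (k, (), 0), (r, (), 0), (s, (), 0)]"
    have "coboundary 3 \<kappa> (v.vsimp ?vs) = 0"
      using cohomologyD(1)[OF d \<kappa>] v.singular_vsimp[of ?vs] by (simp add: cocycle_def eval_nat_numeral)
    then show "list_coboundary (\<lambda>vs. \<kappa> (v.vsimp vs)) ?vs = 0" using v.coboundary_vsimp[of ?vs 3 \<kappa>] by simp
  qed
  have "[prism_sum n (\<lambda>vs. \<kappa> (v.vsimp vs)) ((), 0) ((), 1) = cyclic_sum n bl ()] (mod int n)"
    using cong_diff[OF 1 cong_trans[OF cong_sym[OF 3] 2]] unfolding cup
    by simp
  moreover have "cyclic_sum n bl () = cyclic_sum n (\<lambda>vs. \<beta> (w.vsimp vs)) ((), 0)"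
    by (rule cyclic_sum_cong) (simp add: bl_def g_def)
  ultimately show ?thesis using \<beta> by auto
qed

end

section \<open>The value associated to a class at a point of the loop stack\<close>

text \<open>Exponents reduce modulo \<open>n\<close>; finiteness of the group is what
  \<open>point_torsor\<close> asks for.\<close>

lemma (in group) finite_generate_singleton:
  assumes a: "a \<in> carrier G" and n: "n > 0" and an: "a [^] (n :: nat) = \<one>"
  shows "finite (generate G {a})"
proof -
  have "a [^] (k :: int) \<in> (\<lambda>i. a [^] (i :: int)) ` {0..<int n}" for k
  proof -
    have "a [^] k = a [^] (int n * (k div int n) + k mod int n)" by simp
    also have "\<dots> = (a [^] int n) [^] (k div int n) \<otimes> a [^] (k mod int n)"
      unfolding int_pow_mult[OF a] int_pow_pow[OF a] ..
    also have "a [^] int n = \<one>" using an by (simp add: int_pow_int)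
    finally have "a [^] k = a [^] (k mod int n)" using a by simp
    then show ?thesis using n by (intro image_eqI[of _ _ "k mod int n"]) auto
  qed
  then have "generate G {a} \<subseteq> (\<lambda>i. a [^] (i :: int)) ` {0..<int n}" using generate_pow[OF a] by auto
  then show ?thesis by (rule finite_subset) simp
qed

context fibred_groupoids
begin

lemma right_inverse_point:
  assumes m: "m \<in> arr X x y" and x: "topspace (base X x) = {z}" and y: "topspace (base X y) = {t}"
  shows "\<exists>r\<in>arr X y x. cmp X m r = ident X y"
proof -
  note yO = arr_Ob(2)[OF m]
  obtain r where "r \<in> arr X y x" "cmp X m r = ident X y"
  proof (rule factor[OF m ident_arr[OF yO], of "\<lambda>_. z"])
    show "continuous_map (base X y) (base X x) (\<lambda>_. z)" using x by simp
    show "bmap X m z = bmap X (ident X y) s" if "s \<in> topspace (base X y)" for s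
      using bmap_in[OF m, of z] that x y bmap_ident[OF yO] by simp
  qed blast
  then show ?thesis by blast
qed

lemma group_aut_group:
  assumes x: "x \<in> Ob X"
  shows "group (aut_group X x)"
proof (rule groupI)
  fix \<phi> assume "\<phi> \<in> carrier (aut_group X x)"
  then have \<phi>: "\<phi> \<in> autos X x" by (simp add: aut_group_def)
  obtain \<psi> where \<psi>: "\<psi> \<in> arr X x x" "\<And>t. t \<in> topspace (base X x) \<Longrightarrow> bmap X \<psi> t = id t" "cmp X \<phi> \<psi> = ident X x"
  proof (rule factor[OF autos_arr[OF \<phi>] ident_arr[OF x], of id])
    show "bmap X \<phi> (id t) = bmap X (ident X x) t" if "t \<in> topspace (base X x)" for t
      using that bmap_autos[OF \<phi>] bmap_ident[OF x] by simp
  qed auto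
  have \<psi>a: "\<psi> \<in> autos X x" using \<psi> by (simp add: autos_def)
  have "cmp X \<psi> \<phi> = ident X x"
  proof (rule cancel_autos[OF autos_arr[OF \<phi>] cmp_autos[OF \<psi>a \<phi>] ident_autos[OF x]])
    show "cmp X \<phi> (cmp X \<psi> \<phi>) = cmp X \<phi> (ident X x)"
      using cmp_assoc[OF autos_arr[OF \<phi>] \<psi>(1) autos_arr[OF \<phi>]] \<psi>(3) cmp_ident[OF autos_arr[OF \<phi>]] by simp
  qed
  then show "\<exists>\<psi>\<in>carrier (aut_group X x). \<psi> \<otimes>\<^bsub>aut_group X x\<^esub> \<phi> = \<one>\<^bsub>aut_group X x\<^esub>"
    using \<psi>a by (auto simp: aut_group_def)
qed (auto simp: aut_group_def x ident_autos cmp_autos autos_arr intro: cmp_ident(2)[OF autos_arr] cmp_assoc[of _ x x _ x _ x])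

lemma aut_group_pow:
  assumes "x \<in> Ob X" "\<phi> \<in> autos X x"
  shows "\<phi> [^]\<^bsub>aut_group X x\<^esub> (n :: nat) = auto_pow X x \<phi> n"
proof (induction n)
  case (Suc n)
  then show ?case using auto_pow_Suc_right[OF assms, of n] by (simp add: aut_group_def)
qed (simp add: aut_group_def auto_pow_0)

text \<open>The isomorphism \<open>j\<close> carries the torsor automorphism of
  \<open>\<gamma>\<close> to \<open>\<gamma>\<close> itself, so the triangles coming from the
  classifying space are those of \<open>\<gamma>\<close> over \<open>q\<close>. The chart
  \<open>kq\<close> is part of the data of the value, whereas \<open>\<beta>\<close> is arbitrary in
  its class.\<close>

lemma associated_value:
  assumes b: "powers X b" and q: "q \<in> Ob X" and pt: "topspace (base X q) = {t}" and \<gamma>: "\<gamma> \<in> autos X q"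
    and n: "n > 0" and \<gamma>n: "auto_pow X q \<gamma> n = ident X q" and inf: "infinite (UNIV :: 'c set)"
    and c: "c \<in> cohomology 2 (realization X b)" and val: "is_associated_value X b c (q, \<gamma>) z"
  shows "\<exists>kq\<in>arr X q b. \<forall>\<beta>\<in>c. z = cis (2 * pi * (of_int (cyclic_sum n
      (\<lambda>vs. \<beta> (vertex_simplex X b q (\<lambda>_::unit. kq) \<gamma> (\<lambda>_. t) vs)) ((), 0)) / of_nat n))"
proof -
  let ?A = "aut_group X q"
  let ?\<Gamma> = "?A\<lparr>carrier := generate ?A {\<gamma>}\<rparr>"
  let ?S = "classifying_stack ?\<Gamma> (discrete_topology (carrier ?\<Gamma>))"
  interpret A: group ?A by (rule group_aut_group[OF q])
  have \<gamma>A: "\<gamma> \<in> carrier ?A" using \<gamma> by (simp add: aut_group_def)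
  have sub: "subgroup (generate ?A {\<gamma>}) ?A" by (rule A.generate_is_subgroup) (use \<gamma>A in simp)
  have \<gamma>pow: "\<gamma> [^]\<^bsub>?A\<^esub> n = \<one>\<^bsub>?A\<^esub>" using aut_group_pow[OF q \<gamma>, of n] \<gamma>n by (simp add: aut_group_def)
  have \<Gamma>: "group ?\<Gamma>" "finite (carrier ?\<Gamma>)"
    using A.subgroup_imp_group[OF sub] A.finite_generate_singleton[OF \<gamma>A n \<gamma>pow] by simp_all
  have \<gamma>\<Gamma>: "\<gamma> \<in> carrier ?\<Gamma>" by (simp add: generate.incl)
  have \<gamma>pow': "\<gamma> [^]\<^bsub>?\<Gamma>\<^esub> n = \<one>\<^bsub>?\<Gamma>\<^esub>" using \<gamma>pow by (simp add: nat_pow_def)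
  obtain F :: "(('c, 'b) pbundle, ('c, 'b) bundle_arrow, 'a, 'b) smap" and P y j k chi where
    F: "stack_map ?S X F" and P: "P \<in> Ob ?S" "bbase P = base X q" and y: "y \<in> topspace (tot P)"
    and j: "j \<in> arr X (onob F P) q" "\<And>t. t \<in> topspace (base X q) \<Longrightarrow> bmap X j t = t"
    and equiv: "\<And>\<delta>. \<delta> \<in> carrier ?\<Gamma> \<Longrightarrow> cmp X j (onar F (torsor_auto ?\<Gamma> P y \<delta>)) = cmp X \<delta> j"
    and k: "k \<in> arr X q b"
    and bock: "is_bockstein ?\<Gamma> P y chi
             (cohomology_pullback 2 (realization ?S P) (realization_map ?S P X b F (cmp X k j)) c)"
    and z: "z = chi \<gamma>"
    using val unfolding is_associated_value_def Let_def fst_conv snd_conv by blast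
  have Pb: "principal_bundle ?\<Gamma> (discrete_topology (carrier ?\<Gamma>)) P" using P by (simp add: classifying_stack_def)
  interpret T: point_torsor ?\<Gamma> P y t
    using \<Gamma> Pb y pt P(2) inf by (intro point_torsor.intro) simp_all
  have R: "realization_morphism ?S X F P b (cmp X k j)"
  proof -
    have "stack_morphism ?S X F" using F by unfold_locales
    then show ?thesis using T.powers_axioms b cmp_arr[OF k j(1)]
      by (simp add: realization_morphism_def realization_morphism_axioms_def)
  qed
  interpret R: realization_morphism ?S X F P b "cmp X k j" by (rule R)
  interpret v: vertex_family X b q "\<lambda>_::unit. k" \<gamma> "\<lambda>_. t"
    using b \<gamma> k pt by (simp add: vertex_family_def vertex_family_axioms_def)
  have FP: "base X (onob F P) = base X q" using R.base_onob[OF P(1)] P(2) by (simp add: classifying_stack_def)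
  have eq: "vertex_simplex X b (onob F P) (\<lambda>_::unit. cmp X k j) (onar F (torsor_auto ?\<Gamma> P y \<gamma>)) (\<lambda>_. t) vs = v.vsimp vs" for vs
    using R.onar_autos[OF P(1) T.torsor_auto_autos[OF \<gamma>\<Gamma>]] pt FP j(2)
    by (intro v.vsimp_pullback[OF j(1) _ equiv[OF \<gamma>\<Gamma>, symmetric]]) auto
  have "z = cis (2 * pi * (of_int (cyclic_sum n (\<lambda>vs. \<beta> (v.vsimp vs)) ((), 0)) / of_nat n))" if "\<beta> \<in> c" for \<beta>
    using T.bockstein_value[OF R \<gamma>\<Gamma> n \<gamma>pow' c that bock] unfolding z eq .
  then show ?thesis using k by blast
qed

end

section \<open>The line over a point of the loop stack\<close>

context circle_bundle
begin

lemma E_autos: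
  assumes "(v, \<tau>) \<in> Ob E" "\<psi> \<in> autos B v" "\<And>y. y \<in> topspace (base B v) \<Longrightarrow> tfun (onar p \<psi>) (\<tau> y) = \<tau> y"
  shows "((v, \<tau>), \<psi>, (v, \<tau>)) \<in> autos E (v, \<tau>)"
  using assms by (auto simp: autos_def E_arr E_bmap E_base E_Ob)

text \<open>The circle group is commutative, so the automorphism acts on the whole fibre by one
  scalar, and this scalar is the one singled out in \<open>h_fun\<close>.\<close>

lemma h_fun_one:
  assumes u: "u \<in> Ob B" and \<phi>: "\<phi> \<in> autos B u" and h: "h_fun p (u, \<phi>) t = 1"
    and y: "y \<in> topspace (tot (onob p u))" "proj (onob p u) y = t"
  shows "tfun (onar p \<phi>) y = y"
proof -
  note \<phi>' = B.autos_arr[OF \<phi>] and P = principal[OF u]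
  note act = principal_bundle_act[OF P] and torsor = principal_bundle_torsor[OF P group_U1 topspace_U1_space]
  let ?Q = "\<lambda>z. z \<in> carrier U1 \<and> (\<forall>y\<in>topspace (tot (onob p u)). proj (onob p u) y = t \<longrightarrow>
        tfun (onar p \<phi>) y = act (onob p u) y z)"
  have tb: "t \<in> topspace (base B u)" using proj_in[OF u y(1)] y(2) by simp
  have pr: "proj (onob p u) y = proj (onob p u) (tfun (onar p \<phi>) y)"
    using proj_tfun[OF \<phi>' y(1)] B.bmap_autos[OF \<phi>] tb y(2) by simp
  from torsor[OF y(1) tfun_in[OF \<phi>' y(1)] pr] obtain z where
    z: "z \<in> carrier U1" "act (onob p u) y z = tfun (onar p \<phi>) y" by blast
  have "?Q z"
  proof (intro conjI ballI impI)
    fix y' assume y': "y' \<in> topspace (tot (onob p u))" "proj (onob p u) y' = t"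
    obtain g where g: "g \<in> carrier U1" "act (onob p u) y g = y'" using torsor[OF y(1) y'(1)] y(2) y'(2) by metis
    have "tfun (onar p \<phi>) y' = act (onob p u) (act (onob p u) y z) g"
      using tfun_act[OF \<phi>' y(1) g(1)] g z by simp
    also have "\<dots> = act (onob p u) (act (onob p u) y g) z"
      using act(4)[OF y(1) z(1) g(1)] act(4)[OF y(1) g(1) z(1)] by (simp add: U1_def mult.commute)
    finally show "tfun (onar p \<phi>) y' = act (onob p u) y' z" using g by simp
  qed (rule z(1))
  moreover have "z' = z" if "?Q z'" for z'
  proof -
    have "z' \<in> carrier U1 \<and> act (onob p u) y z' = tfun (onar p \<phi>) y" using that y by simp
    then show ?thesis using torsor[OF y(1) tfun_in[OF \<phi>' y(1)] pr] z by blast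
  qed
  ultimately have "(THE z. ?Q z) = z" by (rule the_equality)
  then have "z = 1" using h by (simp add: h_fun_def)
  then show ?thesis using z(2) act(1)[OF y(1)] by (simp add: U1_def)
qed

text \<open>\<open>\<ll>\<close> is the restriction of \<open>(v, \<tau>)\<close> to the line over
  \<open>t\<close> in the product of \<open>U\<close> with the reals. It maps to \<open>q\<close> by
  \<open>\<nu>\<close>, and its section runs once around the circle fibre while the parameter grows
  by 1.\<close>

lemma fibre_line_ex:
  assumes a0: "a0 \<in> arr B q u" and bq: "base B q = subtopology (base B u) {t}" and a0t: "bmap B a0 t = t"
    and U: "t \<in> U" "t \<in> topspace (base B u)"
    and \<phi>: "\<phi> \<in> autos B u" and h1: "\<forall>t\<in>topspace (base B u). h_fun p (u, \<phi>) t = 1"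
    and \<gamma>: "\<gamma> \<in> autos B q" "cmp B a0 \<gamma> = cmp B \<phi> a0"
    and s: "continuous_map (subtopology (base B u) U) (tot (onob p u)) s"
    and mv: "mv \<in> arr B v u"
    and hom: "homeomorphic_map (base B v) (prod_topology (subtopology (base B u) U) euclideanreal)
         (\<lambda>y. (bmap B mv y, \<rho> y))"
    and v: "(v, \<tau>) \<in> Ob E"
    and \<tau>: "\<forall>y\<in>topspace (base B v).
        tfun (onar p mv) (\<tau> y) = act (onob p u) (s (bmap B mv y)) (cis (2 * pi * \<rho> y))"
    and \<psi>: "\<psi> \<in> autos B v" "cmp B mv \<psi> = cmp B \<phi> mv"
  shows "((v, \<tau>), \<psi>, (v, \<tau>)) \<in> autos E (v, \<tau>)"
    and "\<exists>\<ll> \<iota> \<nu> \<Psi> yy y0. \<iota> \<in> arr E \<ll> (v, \<tau>) \<and> \<nu> \<in> arr B (fst \<ll>) q \<and> \<Psi> \<in> autos E \<ll> \<and>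
      cmp E \<iota> \<Psi> = cmp E ((v, \<tau>), \<psi>, (v, \<tau>)) \<iota> \<and> cmp B \<gamma> \<nu> = cmp B \<nu> (onar total_proj \<Psi>) \<and>
      cmp B a0 \<nu> = cmp B mv (onar total_proj \<iota>) \<and>
      continuous_map euclideanreal (base E \<ll>) yy \<and>
      (\<forall>r. bmap B mv (bmap E \<iota> (yy r)) = t \<and> \<rho> (bmap E \<iota> (yy r)) = r) \<and>
      y0 \<in> topspace (tot (onob p q)) \<and>
      (\<forall>r. tfun (onar p \<nu>) (snd \<ll> (yy r)) = act (onob p q) y0 (cis (2 * pi * r)))"
proof -
  note h1 = h1[rule_format] and \<tau> = \<tau>[rule_format]
  note sv = section_props[OF v]
  have uO: "u \<in> Ob B" and qO: "q \<in> Ob B" using B.arr_Ob[OF a0] by auto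
  have bqt: "topspace (base B q) = {t}" using bq U(2) by auto
  \<comment> \<open>Since \<open>h\<close> is 1, \<open>\<phi>\<close> fixes the points of the total
    space; as the bundle map of \<open>mv\<close> is injective on fibres, \<open>\<psi>\<close>
    fixes the section.\<close>
  have psi_fix: "tfun (onar p \<psi>) (\<tau> y) = \<tau> y" if y: "y \<in> topspace (base B v)" for y
  proof (rule tfun_inj[OF mv tfun_in[OF B.autos_arr[OF \<psi>(1)] sv(2)[OF y]] sv(2)[OF y]])
    note my = tfun_in[OF mv sv(2)[OF y]]
    show "proj (onob p v) (tfun (onar p \<psi>) (\<tau> y)) = proj (onob p v) (\<tau> y)"
      using proj_tfun[OF B.autos_arr[OF \<psi>(1)] sv(2)[OF y]] B.bmap_autos[OF \<psi>(1) y] sv(3)[OF y] by simp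
    have "tfun (onar p mv) (tfun (onar p \<psi>) (\<tau> y)) = tfun (onar p \<phi>) (tfun (onar p mv) (\<tau> y))"
      using tfun_cmp[OF mv B.autos_arr[OF \<psi>(1)] sv(2)[OF y]] tfun_cmp[OF B.autos_arr[OF \<phi>] mv sv(2)[OF y]] \<psi>(2) by simp
    also have "\<dots> = tfun (onar p mv) (\<tau> y)"
      by (rule h_fun_one[OF uO \<phi> h1[OF proj_in[OF uO my]] my refl])
    finally show "tfun (onar p mv) (tfun (onar p \<psi>) (\<tau> y)) = tfun (onar p mv) (\<tau> y)" .
  qed
  show \<psi>E: "((v, \<tau>), \<psi>, (v, \<tau>)) \<in> autos E (v, \<tau>)" by (rule E_autos[OF v \<psi>(1) psi_fix])
  obtain k where k: "homeomorphic_maps (base B v) (prod_topology (subtopology (base B u) U) euclideanreal)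
       (\<lambda>y. (bmap B mv y, \<rho> y)) k"
    using hom by (auto simp: homeomorphic_map_maps)
  define yy where "yy r = k (t, r)" for r
  have tr: "(t, r) \<in> topspace (prod_topology (subtopology (base B u) U) euclideanreal)" for r using U by simp
  have yyv: "bmap B mv (yy r) = t" "\<rho> (yy r) = r" for r
    using k tr[of r] unfolding homeomorphic_maps_def yy_def by auto
  have "continuous_map euclideanreal (prod_topology (subtopology (base B u) U) euclideanreal) (\<lambda>r. (t, r))"
    using U by (intro continuous_map_pairedI) auto
  from continuous_map_compose[OF this, of "base B v" k] k
  have yyc: "continuous_map euclideanreal (base B v) yy" by (simp add: homeomorphic_maps_def o_def yy_def[abs_def])
  define Z where "Z = {y \<in> topspace (base B v). bmap B mv y = t}"
  have "continuous_map (subtopology (base B v) Z) (base E (v, \<tau>)) id" by (simp add: E_base continuous_map_from_subtopology)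
  from E.pullback[OF v this] obtain \<ll> \<iota> where \<iota>: "\<iota> \<in> arr E \<ll> (v, \<tau>)" and bl: "base E \<ll> = subtopology (base B v) Z"
    and \<iota>id: "\<And>y. y \<in> topspace (subtopology (base B v) Z) \<Longrightarrow> bmap E \<iota> y = id y" by blast
  have tl: "topspace (base E \<ll>) = Z" using bl by (auto simp: Z_def)
  obtain x \<xi> where \<ll>: "\<ll> = (x, \<xi>)" by (cases \<ll>)
  have xO: "(x, \<xi>) \<in> Ob E" using E.arr_Ob(1)[OF \<iota>] \<ll> by simp
  note sx = section_props[OF xO]
  obtain i where i: "\<iota> = ((x, \<xi>), i, (v, \<tau>))" "i \<in> arr B x v"
    and it: "\<And>y. y \<in> topspace (base B x) \<Longrightarrow> tfun (onar p i) (\<xi> y) = \<tau> (bmap B i y)"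
    using \<iota> by (auto simp: \<ll> E_arr)
  have bx: "base B x = base E \<ll>" by (simp add: \<ll> E_base)
  have i_id: "bmap B i y = y" if "y \<in> Z" for y
    using \<iota>id[of y] that by (auto simp: i(1) E_bmap Z_def)
  have yyZ: "yy r \<in> Z" for r using yyv yyc by (auto simp: Z_def continuous_map_def)
  have yyl: "continuous_map euclideanreal (base E \<ll>) yy"
    unfolding bl by (rule continuous_map_into_subtopology[OF yyc]) (use yyZ in auto)
  have ti: "onar total_proj \<iota> = i" by (simp add: i(1) total_proj_def)
  have mi: "cmp B mv i \<in> arr B x u" using B.cmp_arr[OF mv i(2)] .
  have mit: "bmap B (cmp B mv i) y = t" if "y \<in> topspace (base B x)" for y
    using that B.bmap_cmp[OF mv i(2)] i_id by (simp add: bx tl) (simp add: Z_def)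
  obtain \<nu> where \<nu>: "\<nu> \<in> arr B x q" "\<And>y. y \<in> topspace (base B x) \<Longrightarrow> bmap B \<nu> y = t" "cmp B a0 \<nu> = cmp B mv i"
  proof (rule B.factor[OF a0 mi, of "\<lambda>_. t"])
    show "continuous_map (base B x) (base B q) (\<lambda>_. t)" using bqt by simp
    show "bmap B a0 t = bmap B (cmp B mv i) y" if "y \<in> topspace (base B x)" for y
      using mit[OF that] a0t by simp
  qed blast
  obtain \<Psi> where \<Psi>: "\<Psi> \<in> autos E \<ll>" "cmp E \<iota> \<Psi> = cmp E ((v, \<tau>), \<psi>, (v, \<tau>)) \<iota>"
    using E.pullback_auto[OF \<iota> \<psi>E] by blast
  obtain \<Psi>b where \<Psi>b: "\<Psi> = ((x, \<xi>), \<Psi>b, (x, \<xi>))" "\<Psi>b \<in> arr B x x" using E.autos_arr[OF \<Psi>(1)] by (auto simp: \<ll> E_arr)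
  have tp: "onar total_proj \<Psi> = \<Psi>b" by (simp add: \<Psi>b(1) total_proj_def)
  have i\<Psi>: "cmp B i \<Psi>b = cmp B \<psi> i" using \<Psi>(2) by (simp add: i(1) \<Psi>b(1) E_cmp)
  \<comment> \<open>Checked after composing with \<open>a0\<close>, where both sides become
    \<open>\<phi>\<close> after the composite of \<open>mv\<close> and \<open>i\<close>.\<close>
  have \<gamma>\<nu>: "cmp B \<gamma> \<nu> = cmp B \<nu> \<Psi>b"
  proof (rule B.cancel[OF a0 B.cmp_arr[OF B.autos_arr[OF \<gamma>(1)] \<nu>(1)] B.cmp_arr[OF \<nu>(1) \<Psi>b(2)]])
    have "cmp B a0 (cmp B \<gamma> \<nu>) = cmp B (cmp B \<phi> a0) \<nu>"
      using B.cmp_assoc[OF a0 B.autos_arr[OF \<gamma>(1)] \<nu>(1)] \<gamma>(2) by simp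
    also have "\<dots> = cmp B \<phi> (cmp B mv i)" using B.cmp_assoc[OF B.autos_arr[OF \<phi>] a0 \<nu>(1)] \<nu>(3) by simp
    also have "\<dots> = cmp B mv (cmp B \<psi> i)"
      using B.cmp_assoc[OF B.autos_arr[OF \<phi>] mv i(2)] B.cmp_assoc[OF mv B.autos_arr[OF \<psi>(1)] i(2)] \<psi>(2) by simp
    also have "\<dots> = cmp B a0 (cmp B \<nu> \<Psi>b)"
      using B.cmp_assoc[OF mv i(2) \<Psi>b(2)] B.cmp_assoc[OF a0 \<nu>(1) \<Psi>b(2)] i\<Psi> \<nu>(3) by simp
    finally show "cmp B a0 (cmp B \<gamma> \<nu>) = cmp B a0 (cmp B \<nu> \<Psi>b)" .
    fix y assume y: "y \<in> topspace (base B x)"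
    have "bmap B (cmp B \<gamma> \<nu>) y \<in> topspace (base B q)" "bmap B (cmp B \<nu> \<Psi>b) y \<in> topspace (base B q)"
      using B.bmap_in[OF B.cmp_arr[OF B.autos_arr[OF \<gamma>(1)] \<nu>(1)] y] B.bmap_in[OF B.cmp_arr[OF \<nu>(1) \<Psi>b(2)] y] .
    then show "bmap B (cmp B \<gamma> \<nu>) y = bmap B (cmp B \<nu> \<Psi>b) y" by (simp add: bqt)
  qed
  have yx: "yy r \<in> topspace (base B x)" for r using yyZ by (simp add: bx tl)
  define y0 where "y0 = tfun (onar p \<nu>) (\<xi> (yy 0))"
  have y0: "y0 \<in> topspace (tot (onob p q))" unfolding y0_def by (rule tfun_in[OF \<nu>(1) sx(2)[OF yx]])
  have st: "s t \<in> topspace (tot (onob p u))" using s U by (auto simp: continuous_map_def)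
  have a\<nu>: "tfun (onar p a0) (tfun (onar p \<nu>) (\<xi> (yy r))) = act (onob p u) (s t) (cis (2 * pi * r))" for r
  proof -
    have "tfun (onar p a0) (tfun (onar p \<nu>) (\<xi> (yy r))) = tfun (onar p mv) (tfun (onar p i) (\<xi> (yy r)))"
      using tfun_cmp[OF a0 \<nu>(1) sx(2)[OF yx]] tfun_cmp[OF mv i(2) sx(2)[OF yx]] \<nu>(3) by simp
    then show ?thesis using it[OF yx] i_id[OF yyZ] \<tau>[of "yy r"] yyv[of r] yyZ[of r] by (simp add: Z_def)
  qed
  note Pu = principal[OF uO] and Pq = principal[OF qO]
  have sec: "tfun (onar p \<nu>) (\<xi> (yy r)) = act (onob p q) y0 (cis (2 * pi * r))" for r
  proof (rule tfun_inj[OF a0 tfun_in[OF \<nu>(1) sx(2)[OF yx]] principal_bundle_act(2)[OF Pq y0 cis_U1]])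
    have "tfun (onar p \<nu>) (\<xi> (yy r)) \<in> topspace (tot (onob p q))" by (rule tfun_in[OF \<nu>(1) sx(2)[OF yx]])
    then have "proj (onob p q) (tfun (onar p \<nu>) (\<xi> (yy r))) \<in> {t}" "proj (onob p q) y0 \<in> {t}"
      using proj_in[OF qO] y0 unfolding bqt[symmetric] by blast+
    then show "proj (onob p q) (tfun (onar p \<nu>) (\<xi> (yy r))) = proj (onob p q) (act (onob p q) y0 (cis (2 * pi * r)))"
      using principal_bundle_act(3)[OF Pq y0 cis_U1] by simp
    have "tfun (onar p a0) (act (onob p q) y0 (cis (2 * pi * r))) = act (onob p u) (act (onob p u) (s t) (cis 0)) (cis (2 * pi * r))"
      using tfun_act[OF a0 y0 cis_U1] a\<nu>[of 0] by (simp add: y0_def)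
    also have "\<dots> = act (onob p u) (s t) (cis (2 * pi * r))"
      using principal_bundle_act(1)[OF Pu st] by (simp add: U1_def)
    finally show "tfun (onar p a0) (tfun (onar p \<nu>) (\<xi> (yy r))) = tfun (onar p a0) (act (onob p q) y0 (cis (2 * pi * r)))"
      using a\<nu>[of r] by simp
  qed
  have \<iota>yy: "bmap E \<iota> (yy r) = yy r" for r using i_id[OF yyZ] by (simp add: i(1) E_bmap)
  have \<nu>': "\<nu> \<in> arr B (fst \<ll>) q" using \<nu>(1) by (simp add: \<ll>)
  have sec': "\<forall>r. tfun (onar p \<nu>) (snd \<ll> (yy r)) = act (onob p q) y0 (cis (2 * pi * r))" using sec by (simp add: \<ll>)
  have "\<forall>r. bmap B mv (bmap E \<iota> (yy r)) = t \<and> \<rho> (bmap E \<iota> (yy r)) = r" by (simp add: \<iota>yy yyv)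
  then show "\<exists>\<ll> \<iota> \<nu> \<Psi> yy y0. \<iota> \<in> arr E \<ll> (v, \<tau>) \<and> \<nu> \<in> arr B (fst \<ll>) q \<and> \<Psi> \<in> autos E \<ll> \<and>
      cmp E \<iota> \<Psi> = cmp E ((v, \<tau>), \<psi>, (v, \<tau>)) \<iota> \<and> cmp B \<gamma> \<nu> = cmp B \<nu> (onar total_proj \<Psi>) \<and>
      cmp B a0 \<nu> = cmp B mv (onar total_proj \<iota>) \<and>
      continuous_map euclideanreal (base E \<ll>) yy \<and>
      (\<forall>r. bmap B mv (bmap E \<iota> (yy r)) = t \<and> \<rho> (bmap E \<iota> (yy r)) = r) \<and>
      y0 \<in> topspace (tot (onob p q)) \<and>
      (\<forall>r. tfun (onar p \<nu>) (snd \<ll> (yy r)) = act (onob p q) y0 (cis (2 * pi * r)))"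
    using \<iota> \<nu>' \<Psi> \<gamma>\<nu>[folded tp] \<nu>(3)[folded ti] yyl y0 sec' by blast
qed

text \<open>As \<open>cis\<close> has period \<open>2 * pi\<close>, the section values at the
  parameters 0 and 1 agree over \<open>q\<close>, so one object of \<open>E\<close> over a point
  maps to both ends of the line.\<close>

lemma lift_to_line_end:
  assumes \<nu>: "\<nu> \<in> arr B x q" and q: "topspace (base B q) = {t}" and x: "(x, \<xi>) \<in> Ob E"
    and yy: "\<And>r. yy r \<in> topspace (base B x)"
    and y0: "y0 \<in> topspace (tot (onob p q))"
    and sec: "\<And>r. tfun (onar p \<nu>) (\<xi> (yy r)) = act (onob p q) y0 (cis (2 * pi * r))"
    and h0: "h0 \<in> arr E o' (x, \<xi>)" and o': "topspace (base E o') = {z}" and h0z: "bmap E h0 z = yy 0"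
  shows "\<exists>h1\<in>arr E o' (x, \<xi>). bmap E h1 z = yy 1 \<and>
    cmp B \<nu> (onar total_proj h0) = cmp B \<nu> (onar total_proj h1)"
proof -
  note sx = section_props[OF x]
  obtain w \<theta> where o'w: "o' = (w, \<theta>)" by (cases o')
  have w: "(w, \<theta>) \<in> Ob E" using E.arr_Ob(1)[OF h0] o'w by simp
  note sw = section_props[OF w]
  have bw: "topspace (base B w) = {z}" using o' by (simp add: o'w E_base)
  obtain i0 where i0: "h0 = ((w, \<theta>), i0, (x, \<xi>))" "i0 \<in> arr B w x"
    and i0s: "tfun (onar p i0) (\<theta> z) = \<xi> (bmap B i0 z)"
    using h0 bw by (auto simp: o'w E_arr)
  have i0z: "bmap B i0 z = yy 0" using h0z by (simp add: i0(1) E_bmap)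
  note \<nu>i = B.cmp_arr[OF \<nu> i0(2)]
  obtain i1 where i1: "i1 \<in> arr B w x" "\<And>r. r \<in> topspace (base B w) \<Longrightarrow> bmap B i1 r = yy 1" "cmp B \<nu> i1 = cmp B \<nu> i0"
  proof (rule B.factor[OF \<nu> \<nu>i, of "\<lambda>_. yy 1"])
    show "continuous_map (base B w) (base B x) (\<lambda>_. yy 1)" using yy by simp
    show "bmap B \<nu> (yy 1) = bmap B (cmp B \<nu> i0) r" if "r \<in> topspace (base B w)" for r
      using B.bmap_in[OF \<nu> yy[of 1]] B.bmap_in[OF \<nu>i that] q by simp
  qed blast
  have zw: "z \<in> topspace (base B w)" using bw by simp
  have i1z: "bmap B i1 z = yy 1" using i1(2)[OF zw] .
  have "tfun (onar p i1) (\<theta> z) = \<xi> (yy 1)"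
  proof (rule tfun_inj[OF \<nu> tfun_in[OF i1(1) sw(2)[OF zw]] sx(2)[OF yy]])
    show "proj (onob p x) (tfun (onar p i1) (\<theta> z)) = proj (onob p x) (\<xi> (yy 1))"
      using proj_tfun[OF i1(1) sw(2)[OF zw]] sw(3)[OF zw] sx(3)[OF yy] i1z by simp
    have "tfun (onar p \<nu>) (tfun (onar p i1) (\<theta> z)) = tfun (onar p \<nu>) (tfun (onar p i0) (\<theta> z))"
      using tfun_cmp[OF \<nu> i1(1) sw(2)[OF zw]] tfun_cmp[OF \<nu> i0(2) sw(2)[OF zw]] i1(3) by simp
    also have "\<dots> = tfun (onar p \<nu>) (\<xi> (yy 1))" using i0s i0z sec[of 0] sec[of 1] by simp
    finally show "tfun (onar p \<nu>) (tfun (onar p i1) (\<theta> z)) = tfun (onar p \<nu>) (\<xi> (yy 1))" .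
  qed
  then have "((w, \<theta>), i1, (x, \<xi>)) \<in> arr E o' (x, \<xi>)"
    using w x i1(1) bw i1z by (simp add: o'w E_arr E_Ob)
  then show ?thesis using i1z i1(3) by (intro bexI[of _ "((w, \<theta>), i1, (x, \<xi>))"]) (simp_all add: E_bmap total_proj_def i0(1))
qed

end

section \<open>Pulling back flat sections\<close>

text \<open>Surjectivity of the atlas yields a point of the fibre product over \<open>z\<close>,
  which is a section over the one-point base.\<close>

lemma (in fibred_groupoids) atlas_point_chart:
  assumes a: "atlas X a" and x: "x \<in> Ob X" and z: "topspace (base X x) = {z}"
  shows "\<exists>c. c \<in> arr X x a"
proof -
  obtain w m n where w: "is_product X x a w m n"
    and surj: "bmap X m ` topspace (base X w) = topspace (base X x)"
  proof -
    have "\<exists>w m n. is_product X x a w m n \<and> bmap X m ` topspace (base X w) = topspace (base X x)"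
      using a x by (simp add: atlas_def) fast
    then show ?thesis using that by blast
  qed
  have m: "m \<in> arr X w x" and n: "n \<in> arr X w a" using w by (auto simp: is_product_def)
  obtain y where y: "y \<in> topspace (base X w)" "bmap X m y = z" using surj z by (metis imageE singletonI)
  obtain s where "s \<in> arr X x w"
  proof (rule factor[OF m ident_arr[OF x], of "\<lambda>_. y"])
    show "continuous_map (base X x) (base X w) (\<lambda>_. y)" using y by simp
    show "bmap X m y = bmap X (ident X x) r" if "r \<in> topspace (base X x)" for r
      using that z y(2) bmap_ident[OF x] by simp
  qed blast
  then show ?thesis using cmp_arr[OF n] by blast
qed

context gerbe
begin

text \<open>Lifts exist near each point, and over a one-point base every neighbourhood of the point
  is the whole space.\<close>

lemma point_lift_ex:
  assumes l: "l \<in> Ob E" and y: "y \<in> topspace (base E l)"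
  shows "\<exists>x\<in>Ob G. \<exists>h\<in>arr E (onob f x) l. topspace (base G x) = {y} \<and> bmap E h y = y"
proof -
  have "continuous_map (subtopology (base E l) {y}) (base E l) id" by (simp add: continuous_map_from_subtopology)
  from E.pullback[OF l this] obtain l0 j where j: "j \<in> arr E l0 l" "base E l0 = subtopology (base E l) {y}"
    and jy: "\<And>t. t \<in> topspace (subtopology (base E l) {y}) \<Longrightarrow> bmap E j t = id t" by blast
  have t0: "topspace (base E l0) = {y}" using j(2) y by auto
  have l0: "l0 \<in> Ob E" using E.arr_Ob(1)[OF j(1)] .
  obtain x k V where x: "x \<in> Ob G" and V: "openin (base E l0) V" "y \<in> V" and k: "restriction_arrow E k V l0" "src E k = onob f x"
    by (rule local_lift[OF l0, of y]) (simp add: t0)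
  have k': "k \<in> arr E (onob f x) l0" using k by (auto simp: arr_def restriction_arrow_def)
  have tx: "topspace (base G x) = {y}"
    using k f.base_onob[OF x] t0 V(2) by (auto simp: restriction_arrow_def)
  have yx: "y \<in> topspace (base E (onob f x))" using tx f.base_onob[OF x] by simp
  have "bmap E k y = y" using k yx by (auto simp: restriction_arrow_def)
  then have "bmap E (cmp E j k) y = y" using E.bmap_cmp[OF j(1) k' yx] jy[of y] y by simp
  with tx E.cmp_arr[OF j(1) k'] show ?thesis by (intro bexI[OF _ x] bexI[of _ "cmp E j k"] conjI)
qed

text \<open>The constant \<open>c\<close> rescales the pulled-back lift; a suitable root will make
  its n-th power the identity.\<close>

definition pulled_section :: "('go \<Rightarrow> 'em \<Rightarrow> 'gm) \<Rightarrow> 'em \<Rightarrow> complex \<Rightarrow> 'go \<Rightarrow> 'em \<Rightarrow> 'gm" where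
  "pulled_section \<omega> \<iota> c x h = cmp G (\<omega> x (cmp E \<iota> h)) (sc x (\<lambda>_. c))"

context
  fixes \<omega> v \<psi> l \<iota> \<Psi> c
  assumes \<omega>: "gerbe_section G E f (v, \<psi>) \<omega>" and \<iota>: "\<iota> \<in> arr E l v"
    and \<Psi>: "\<Psi> \<in> autos E l" "cmp E \<iota> \<Psi> = cmp E \<psi> \<iota>" and \<psi>: "\<psi> \<in> autos E v" and c: "c \<in> carrier U1"
begin

lemma sectionD:
  assumes "x \<in> Ob G" "k \<in> arr E (onob f x) v"
  shows "\<omega> x k \<in> autos G x" "cmp E k (onar f (\<omega> x k)) = cmp E \<psi> k"
    "m \<in> arr G x' x \<Longrightarrow> cmp G (\<omega> x k) m = cmp G m (\<omega> x' (cmp E k (onar f m)))"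
  using \<omega> assms by (auto simp: gerbe_section_def)

lemma pulled_section_autos:
  assumes x: "x \<in> Ob G" and h: "h \<in> arr E (onob f x) l"
  shows "pulled_section \<omega> \<iota> c x h \<in> autos G x"
  unfolding pulled_section_def
  by (rule G.cmp_autos[OF sectionD(1)[OF x E.cmp_arr[OF \<iota> h]] sc_autos[OF x continuous_const_U1[OF c]]])

lemma onar_pulled_section:
  assumes x: "x \<in> Ob G" and h: "h \<in> arr E (onob f x) l"
  shows "onar f (pulled_section \<omega> \<iota> c x h) = onar f (\<omega> x (cmp E \<iota> h))"
proof -
  note w = sectionD(1)[OF x E.cmp_arr[OF \<iota> h]] and s = sc_autos[OF x continuous_const_U1[OF c]]
  show ?thesis
    using f.onar_cmp[OF G.autos_arr[OF w] G.autos_arr[OF s]] onar_sc[OF x continuous_const_U1[OF c]]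
      E.cmp_ident(1)[OF f.onar_arr[OF G.autos_arr[OF w]]] by (simp add: pulled_section_def)
qed

lemma gerbe_section_pulled: "gerbe_section G E f (l, \<Psi>) (pulled_section \<omega> \<iota> c)"
  unfolding gerbe_section_def fst_conv snd_conv
proof (intro ballI conjI allI)
  fix x h assume x: "x \<in> Ob G" and h: "h \<in> arr E (onob f x) l"
  let ?w = "\<omega> x (cmp E \<iota> h)"
  note \<iota>h = E.cmp_arr[OF \<iota> h]
  note w = sectionD[OF x \<iota>h]
  note fw = f.onar_arr[OF G.autos_arr[OF w(1)]]
  show "pulled_section \<omega> \<iota> c x h \<in> autos G x" by (rule pulled_section_autos[OF x h])
  have "cmp E h (onar f ?w) = cmp E \<Psi> h"
  proof (rule E.cancel[OF \<iota> E.cmp_arr[OF h fw] E.cmp_arr[OF E.autos_arr[OF \<Psi>(1)] h]])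
    show "cmp E \<iota> (cmp E h (onar f ?w)) = cmp E \<iota> (cmp E \<Psi> h)"
      using E.cmp_assoc[OF \<iota> h fw] E.cmp_assoc[OF \<iota> E.autos_arr[OF \<Psi>(1)] h]
        E.cmp_assoc[OF E.autos_arr[OF \<psi>] \<iota> h] w(2) \<Psi>(2) by simp
    fix t assume t: "t \<in> topspace (base E (onob f x))"
    have "t \<in> topspace (base G x)" using t f.base_onob[OF x] by simp
    then have "bmap E (onar f ?w) t = t"
      using f.bmap_onar[OF G.autos_arr[OF w(1)]] G.bmap_autos[OF w(1)] by simp
    then show "bmap E (cmp E h (onar f ?w)) t = bmap E (cmp E \<Psi> h) t"
      using E.bmap_cmp[OF h fw t] E.bmap_cmp[OF E.autos_arr[OF \<Psi>(1)] h t] E.bmap_autos[OF \<Psi>(1) E.bmap_in[OF h t]] by simp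
  qed
  then show "cmp E h (onar f (pulled_section \<omega> \<iota> c x h)) = cmp E \<Psi> h" by (simp add: onar_pulled_section[OF x h])
  fix x' m assume m: "m \<in> arr G x' x"
  note x' = G.arr_Ob(1)[OF m]
  note h' = E.cmp_arr[OF h f.onar_arr[OF m]]
  note w' = sectionD(1)[OF x' E.cmp_arr[OF \<iota> h']]
  note s = G.autos_arr[OF sc_autos[OF x continuous_const_U1[OF c]]]
    and s' = G.autos_arr[OF sc_autos[OF x' continuous_const_U1[OF c]]]
  have "cmp G (pulled_section \<omega> \<iota> c x h) m = cmp G ?w (cmp G m (sc x' (\<lambda>_. c)))"
    using G.cmp_assoc[OF G.autos_arr[OF w(1)] s m] sc_natural[OF m continuous_const_U1[OF c]] by (simp add: pulled_section_def)
  also have "\<dots> = cmp G (cmp G m (\<omega> x' (cmp E (cmp E \<iota> h) (onar f m)))) (sc x' (\<lambda>_. c))"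
    using G.cmp_assoc[OF G.autos_arr[OF w(1)] m s'] w(3)[OF m] by simp
  also have "\<dots> = cmp G m (pulled_section \<omega> \<iota> c x' (cmp E h (onar f m)))"
    using E.cmp_assoc[OF \<iota> h f.onar_arr[OF m]] G.cmp_assoc[OF m G.autos_arr[OF w'] s'] by (simp add: pulled_section_def)
  finally show "cmp G (pulled_section \<omega> \<iota> c x h) m = cmp G m (pulled_section \<omega> \<iota> c x' (cmp E h (onar f m)))" .
qed

lemma pulled_section_pow:
  assumes x: "x \<in> Ob G" and h: "h \<in> arr E (onob f x) l"
    and N: "auto_pow G x (\<omega> x (cmp E \<iota> h)) N = sc x (\<lambda>_. z)" and z: "z \<in> carrier U1"
  shows "auto_pow G x (pulled_section \<omega> \<iota> c x h) N = sc x (\<lambda>_. z * c ^ N)"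
proof -
  note w = sectionD(1)[OF x E.cmp_arr[OF \<iota> h]] and cc = continuous_const_U1[OF c]
  have cN: "c ^ N \<in> carrier U1" using c by (simp add: U1_def norm_power)
  have "auto_pow G x (pulled_section \<omega> \<iota> c x h) N = cmp G (auto_pow G x (\<omega> x (cmp E \<iota> h)) N) (auto_pow G x (sc x (\<lambda>_. c)) N)"
    unfolding pulled_section_def
    by (rule G.auto_pow_commuting_product[OF x w sc_autos[OF x cc] sc_commute[OF x cc w, symmetric]])
  also have "\<dots> = sc x (\<lambda>_. z * c ^ N)"
    using sc_mult[OF x continuous_const_U1[OF z] continuous_const_U1[OF cN]] auto_pow_sc[OF x cc] N by simp
  finally show ?thesis .
qed

text \<open>Rescaling by \<open>c\<close> turns the constant \<open>z\<close> of the flatness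
  condition into \<open>z * c ^ N\<close>, so flatness survives.\<close>

lemma flat_pulled:
  assumes flat: "flat_section G E f sc (v, \<psi>) \<omega>" and y: "y \<in> topspace (base E l)"
  shows "\<exists>V N z. openin (base E l) V \<and> y \<in> V \<and> 1 \<le> N \<and> z \<in> carrier U1 \<and>
        (\<forall>x\<in>Ob G. \<forall>h\<in>arr E (onob f x) l. bmap E h ` topspace (base G x) \<subseteq> V \<longrightarrow>
           auto_pow G x (pulled_section \<omega> \<iota> c x h) N = sc x (\<lambda>_. z))"
proof -
  have "bmap E \<iota> y \<in> topspace (base E v)" using E.bmap_in[OF \<iota> y] .
  then have "\<exists>V N z. openin (base E v) V \<and> bmap E \<iota> y \<in> V \<and> 1 \<le> N \<and> z \<in> carrier U1 \<and>
        (\<forall>x\<in>Ob G. \<forall>k\<in>arr E (onob f x) v. bmap E k ` topspace (base G x) \<subseteq> V \<longrightarrow>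
           auto_pow G x (\<omega> x k) N = sc x (\<lambda>_. z))"
    using flat by (simp add: flat_section_def auto_pow_def)
  then obtain V N z where V: "openin (base E v) V" "bmap E \<iota> y \<in> V" and N: "1 \<le> N" and z: "z \<in> carrier U1"
    and pw: "\<forall>x\<in>Ob G. \<forall>k\<in>arr E (onob f x) v. bmap E k ` topspace (base G x) \<subseteq> V \<longrightarrow>
           auto_pow G x (\<omega> x k) N = sc x (\<lambda>_. z)" by blast
  let ?V = "{y \<in> topspace (base E l). bmap E \<iota> y \<in> V}"
  have "openin (base E l) ?V" using openin_continuous_map_preimage[OF E.continuous_bmap[OF \<iota>] V(1)] .
  moreover have "auto_pow G x (pulled_section \<omega> \<iota> c x h) N = sc x (\<lambda>_. z * c ^ N)"
    if x: "x \<in> Ob G" and h: "h \<in> arr E (onob f x) l" and sub: "bmap E h ` topspace (base G x) \<subseteq> ?V" for x h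
  proof (rule pulled_section_pow[OF x h pw[rule_format, OF x E.cmp_arr[OF \<iota> h]] z])
    have "bmap E (cmp E \<iota> h) t \<in> V" if "t \<in> topspace (base G x)" for t
      using E.bmap_cmp[OF \<iota> h, of t] f.base_onob[OF x] sub that by auto
    then show "bmap E (cmp E \<iota> h) ` topspace (base G x) \<subseteq> V" by blast
  qed
  moreover have "z * c ^ N \<in> carrier U1" using z c by (simp add: U1_def norm_mult norm_power)
  ultimately show ?thesis using y V(2) N by (intro exI[of _ ?V] exI[of _ N] exI[of _ "z * c ^ N"]) blast
qed

end

end

lemma U1_root:
  assumes "z \<in> carrier U1" "n > 0"
  shows "\<exists>c\<in>carrier U1. z * c ^ n = 1"
proof -
  have z: "z = cis (Arg z)" using assms(1) rcis_cmod_Arg[of z] by (simp add: U1_def rcis_def)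
  have "cis (- Arg z / real n) ^ n = cis (- Arg z)" using assms(2) by (simp add: Complex.DeMoivre)
  then have "z * cis (- Arg z / real n) ^ n = cis (Arg z) * cis (- Arg z)" using z by simp
  then show ?thesis using cis_U1 by (intro bexI[of _ "cis (- Arg z / real n)"]) (simp_all add: cis_mult)
qed

section \<open>The holonomy along the fibre\<close>

text \<open>Provides room in the type of points for real 4-space, which parametrises tetrahedra with
  four rotation angles.\<close>

lemma lepoll_real_UNIV:
  assumes "(UNIV :: real set) \<lesssim> (UNIV :: 'u set)"
  shows "infinite (UNIV :: 'u set)" and "\<exists>j :: real \<times> real \<times> real \<times> real \<Rightarrow> 'u. inj j"
proof -
  obtain i :: "real \<Rightarrow> 'u" where i: "inj i" using assms by (auto simp: lepoll_def)
  show inf: "infinite (UNIV :: 'u set)" using finite_inverse_image[OF _ i] infinite_UNIV_char_0 i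
    by (metis finite_imageD finite_subset subset_UNIV)
  have "infinite (UNIV :: real set)" by (rule infinite_UNIV_char_0)
  from card_of_Times_same_infinite[OF this] obtain g :: "real \<times> real \<Rightarrow> real" where "bij_betw g (UNIV \<times> UNIV) UNIV"
    using card_of_ordIso by blast
  then have g: "inj g" by (simp add: bij_betw_def)
  have "inj (\<lambda>(a, b, c, d). i (g (a, g (b, g (c, d)))))"
    by (rule injI) (auto dest!: injD[OF i] injD[OF g])
  then show "\<exists>j :: real \<times> real \<times> real \<times> real \<Rightarrow> 'u. inj j" by blast
qed

locale circle_bundle_gerbe = circle_bundle_atlas B p b e m + gerbe_atlas G "total_stack B p" f sc a e k c3 l
  for B :: "('o, 'm, 'u) fibcat" and p :: "('o, 'm, 'u) ub_map" and b e m
    and G :: "('go, 'gm, 'u) fibcat" and f :: "('go, 'gm, ('o, 'u) eob, ('o, 'm, 'u) ear) smap"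
    and sc a k c3 l +
  assumes atlas_a: "atlas G a" and powers_b: "powers B b"
    and emb: "\<exists>j :: real \<times> real \<times> real \<times> real \<Rightarrow> 'u. inj j"
begin

text \<open>One object \<open>x\<close> over a point carries the lifts at both ends of the line, so
  \<open>g\<close> is a quotient of two automorphisms of \<open>x\<close> with the same image in
  \<open>E\<close>. Transport shows that \<open>g\<close> is an n-th root of unity and identifies
  its exponent modulo \<open>n\<close> with the path prism, which the fibre integral
  evaluates.\<close>

lemma holonomy_along_line:
  assumes int: "is_fibre_integral B p b e m 2 d c" and c3: "c3 \<in> d"
    and q: "topspace (base B q) = {t}" and \<gamma>: "\<gamma> \<in> autos B q"
    and \<iota>: "\<iota> \<in> arr E \<ll> V" and \<nu>: "\<nu> \<in> arr B (fst \<ll>) q" and \<Psi>: "\<Psi> \<in> autos E \<ll>" "cmp E \<iota> \<Psi> = cmp E \<psi> \<iota>"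
    and \<gamma>\<nu>: "cmp B \<gamma> \<nu> = cmp B \<nu> (onar total_proj \<Psi>)"
    and yy: "continuous_map euclideanreal (base E \<ll>) yy" and y0: "y0 \<in> topspace (tot (onob p q))"
    and sec: "\<forall>r. tfun (onar p \<nu>) (snd \<ll> (yy r)) = act (onob p q) y0 (cis (2 * pi * r))"
    and \<psi>: "\<psi> \<in> autos E V" and flat: "flat_section G E f sc (V, \<psi>) \<omega>" and g: "g \<in> carrier U1"
    and hol: "\<forall>x\<in>Ob G. \<forall>h0\<in>arr E (onob f x) \<ll>. \<forall>h1\<in>arr E (onob f x) \<ll>. \<forall>z.
       topspace (base G x) = {z} \<longrightarrow> bmap E h0 z = yy 0 \<longrightarrow> bmap E h1 z = yy 1 \<longrightarrow>
       cmp B \<nu> (onar total_proj h0) = cmp B \<nu> (onar total_proj h1) \<longrightarrow>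
       \<omega> x (cmp E \<iota> h0) = cmp G (\<omega> x (cmp E \<iota> h1)) (sc x (\<lambda>_. g))"
  shows "\<exists>n>0. auto_pow B q \<gamma> n = ident B q \<and> (\<forall>kq\<in>arr B q b. \<exists>\<beta>\<in>c.
    g = cis (2 * pi * (of_int (cyclic_sum n (\<lambda>vs. \<beta> (vertex_simplex B b q (\<lambda>_::unit. kq) \<gamma> (\<lambda>_. t) vs)) ((), 0)) / of_nat n)))"
proof -
  note sec = sec[rule_format] and hol = hol[rule_format]
  have qO: "q \<in> Ob B" using B.arr_Ob(2)[OF \<nu>] .
  have \<ll>: "\<ll> \<in> Ob E" using E.arr_Ob(1)[OF \<iota>] .
  then have \<ll>': "(fst \<ll>, snd \<ll>) \<in> Ob E" by simp
  have yyin: "yy r \<in> topspace (base E \<ll>)" for r using yy by (auto simp: continuous_map_def)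
  have bl: "base B (fst \<ll>) = base E \<ll>" using E_base[of "fst \<ll>" "snd \<ll>"] by simp
  obtain x h0 where x: "x \<in> Ob G" and h0: "h0 \<in> arr E (onob f x) \<ll>" and tx0: "topspace (base G x) = {yy 0}"
    and h00: "bmap E h0 (yy 0) = yy 0"
    using point_lift_ex[OF \<ll> yyin[of 0]] by blast
  define z where "z = yy 0"
  have tx: "topspace (base G x) = {z}" and h0zy: "bmap E h0 z = yy 0" using tx0 h00 by (simp_all add: z_def)
  have tfx: "topspace (base E (onob f x)) = {z}" using tx f.base_onob[OF x] by simp
  have h0': "h0 \<in> arr E (onob f x) (fst \<ll>, snd \<ll>)" using h0 by simp
  have yyB: "yy r \<in> topspace (base B (fst \<ll>))" for r using yyin by (simp add: bl)
  obtain h1 where h1: "h1 \<in> arr E (onob f x) \<ll>" and h1z: "bmap E h1 z = yy 1"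
    and h01: "cmp B \<nu> (onar total_proj h0) = cmp B \<nu> (onar total_proj h1)"
    using lift_to_line_end[OF \<nu> q \<ll>' yyB y0 sec h0' tfx h0zy] by auto
  obtain ch where ch: "ch \<in> arr G x a" using G.atlas_point_chart[OF atlas_a x tx] by blast
  have gsec: "gerbe_section G E f (V, \<psi>) \<omega>" using flat by (simp add: flat_section_def)
  note \<iota>h0 = E.cmp_arr[OF \<iota> h0] and \<iota>h1 = E.cmp_arr[OF \<iota> h1]
  \<comment> \<open>Flatness at the start of the line supplies the exponent
    \<open>n\<close>.\<close>
  have "\<exists>n z0. n > 0 \<and> z0 \<in> carrier U1 \<and> auto_pow G x (\<omega> x (cmp E \<iota> h0)) n = sc x (\<lambda>_. z0)"
  proof -
    have "bmap E \<iota> (yy 0) \<in> topspace (base E V)" using E.bmap_in[OF \<iota> yyin] .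
    then have "\<exists>W N z0. openin (base E V) W \<and> bmap E \<iota> (yy 0) \<in> W \<and> 1 \<le> N \<and> z0 \<in> carrier U1 \<and>
        (\<forall>x\<in>Ob G. \<forall>k\<in>arr E (onob f x) V. bmap E k ` topspace (base G x) \<subseteq> W \<longrightarrow>
           auto_pow G x (\<omega> x k) N = sc x (\<lambda>_. z0))"
      using flat by (simp add: flat_section_def auto_pow_def)
    then obtain W N z0 where W: "bmap E \<iota> (yy 0) \<in> W" "1 \<le> N" "z0 \<in> carrier U1"
      and pw: "\<forall>x\<in>Ob G. \<forall>k\<in>arr E (onob f x) V. bmap E k ` topspace (base G x) \<subseteq> W \<longrightarrow>
           auto_pow G x (\<omega> x k) N = sc x (\<lambda>_. z0)" by blast
    have "bmap E (cmp E \<iota> h0) z = bmap E \<iota> (yy 0)" using E.bmap_cmp[OF \<iota> h0, of z] tfx h0zy by simp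
    then have "bmap E (cmp E \<iota> h0) ` topspace (base G x) \<subseteq> W" using W(1) tx by simp
    then show ?thesis using pw[rule_format, OF x \<iota>h0] W by (intro exI[of _ N] exI[of _ z0]) simp
  qed
  then obtain n z0 where n: "n > 0" and z0: "z0 \<in> carrier U1" "auto_pow G x (\<omega> x (cmp E \<iota> h0)) n = sc x (\<lambda>_. z0)"
    by blast
  \<comment> \<open>An n-th root rescales the lift so that its n-th power is the identity at the
    start.\<close>
  obtain c0 where c0: "c0 \<in> carrier U1" "z0 * c0 ^ n = 1" using U1_root[OF z0(1) n] by blast
  let ?\<Omega> = "pulled_section \<omega> \<iota> c0"
  note ctx = gsec \<iota> \<Psi> \<psi> c0(1)
  note \<Omega>auto = pulled_section_autos[OF ctx x] and f\<Omega> = onar_pulled_section[OF ctx x]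
  note \<Omega>sec = gerbe_section_pulled[OF ctx]
  have \<Omega>n: "auto_pow G x (?\<Omega> x h0) n = ident G x"
    using pulled_section_pow[OF ctx x h0 z0(2,1)] c0(2) sc_one[OF x] by simp
  have f\<Omega>': "onar f (?\<Omega> x h) \<in> autos E (onob f x)" if "h \<in> arr E (onob f x) \<ll>" for h
    using f.onar_autos[OF x \<Omega>auto[OF that]] .
  have over: "cmp E h (onar f (?\<Omega> x h)) = cmp E \<Psi> h" if "h \<in> arr E (onob f x) \<ll>" for h
    using \<Omega>sec x that by (simp add: gerbe_section_def)
  have fx: "onob f x \<in> Ob E" by (rule f.onob_Ob[OF x])
  have tp: "onob total_proj w = fst w" for w :: "('o, 'u) eob" by (simp add: total_proj_def)
  have \<Psi>b: "onar total_proj \<Psi> \<in> autos B (fst \<ll>)" using total_proj.onar_autos[OF \<ll> \<Psi>(1)] by (simp add: tp)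
  have h0b: "onar total_proj h0 \<in> arr B (fst (onob f x)) (fst \<ll>)" using total_proj.onar_arr[OF h0] by (simp add: tp)
  let ?\<mu> = "cmp B \<nu> (onar total_proj h0)"
  have \<mu>: "?\<mu> \<in> arr B (fst (onob f x)) q" using B.cmp_arr[OF \<nu> h0b] .
  have tfxB: "topspace (base B (fst (onob f x))) = {z}" using tfx E_base[of "fst (onob f x)" "snd (onob f x)"] by simp
  \<comment> \<open>The identity for the lift is pushed down to \<open>B\<close> along
    \<open>?\<mu>\<close>, which has a right inverse as both its ends lie over points.\<close>
  have \<gamma>n: "auto_pow B q \<gamma> n = ident B q"
  proof -
    let ?F = "onar total_proj (onar f (?\<Omega> x h0))"
    have Fa: "?F \<in> autos B (fst (onob f x))" using total_proj.onar_autos[OF fx f\<Omega>'[OF h0]] by (simp add: tp)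
    have "cmp B \<gamma> ?\<mu> = cmp B (cmp B \<nu> (onar total_proj \<Psi>)) (onar total_proj h0)"
      using B.cmp_assoc[OF B.autos_arr[OF \<gamma>] \<nu> h0b] \<gamma>\<nu> by simp
    also have "\<dots> = cmp B \<nu> (onar total_proj (cmp E \<Psi> h0))"
      using B.cmp_assoc[OF \<nu> B.autos_arr[OF \<Psi>b] h0b] total_proj.onar_cmp[OF E.autos_arr[OF \<Psi>(1)] h0] by simp
    also have "\<dots> = cmp B ?\<mu> ?F"
      using B.cmp_assoc[OF \<nu> h0b B.autos_arr[OF Fa]] total_proj.onar_cmp[OF h0 E.autos_arr[OF f\<Omega>'[OF h0]]] over[OF h0] by simp
    finally have comm: "cmp B (auto_pow B q \<gamma> n) ?\<mu> = cmp B ?\<mu> (auto_pow B (fst (onob f x)) ?F n)"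
      by (rule B.auto_pow_commute[OF \<mu> Fa \<gamma>])
    have "auto_pow B (fst (onob f x)) ?F n = onar total_proj (onar f (auto_pow G x (?\<Omega> x h0) n))"
      using total_proj.onar_auto_pow[OF fx f\<Omega>'[OF h0], of n] f.onar_auto_pow[OF x \<Omega>auto[OF h0], of n] by (simp add: tp)
    also have "\<dots> = ident B (fst (onob f x))"
      using \<Omega>n f.onar_ident[OF x] total_proj.onar_ident[OF fx] by (simp add: tp)
    finally have \<mu>\<gamma>: "cmp B (auto_pow B q \<gamma> n) ?\<mu> = ?\<mu>" using comm B.cmp_ident(1)[OF \<mu>] by simp
    obtain r where r: "r \<in> arr B q (fst (onob f x))" "cmp B ?\<mu> r = ident B q"
      using B.right_inverse_point[OF \<mu> tfxB q] by blast
    have P: "auto_pow B q \<gamma> n \<in> arr B q q" using B.autos_arr[OF B.auto_pow_autos[OF qO \<gamma>]] .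
    show ?thesis using B.cmp_assoc[OF P \<mu> r(1)] r(2) \<mu>\<gamma> B.cmp_ident(1)[OF P] by simp
  qed
  \<comment> \<open>Under \<open>\<nu>\<close> the automorphism \<open>\<Psi>\<close> corresponds to
    \<open>\<gamma>\<close>, and an arrow of \<open>E\<close> with given ends is determined by its
    arrow in \<open>B\<close>.\<close>
  have \<Psi>n: "auto_pow E \<ll> \<Psi> n = ident E \<ll>"
  proof -
    have lB: "fst \<ll> \<in> Ob B" using B.arr_Ob(1)[OF \<nu>] .
    have "auto_pow B (fst \<ll>) (onar total_proj \<Psi>) n = ident B (fst \<ll>)"
      using B.auto_pow_commute[OF \<nu> \<Psi>b \<gamma> \<gamma>\<nu>, of n] \<gamma>n B.cmp_ident[OF \<nu>]
      by (intro B.cancel_autos[OF \<nu> B.auto_pow_autos[OF lB \<Psi>b] B.ident_autos[OF lB]]) simp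
    then have 1: "onar total_proj (auto_pow E \<ll> \<Psi> n) = onar total_proj (ident E \<ll>)"
      using total_proj.onar_auto_pow[OF \<ll> \<Psi>(1), of n] total_proj.onar_ident[OF \<ll>] by (simp add: tp)
    have "M = N" if "M \<in> arr E w w'" "N \<in> arr E w w'" "onar total_proj M = onar total_proj N" for M N w w'
      using that by (cases w, cases w') (auto simp: E_arr total_proj_def)
    from this[OF E.autos_arr[OF E.auto_pow_autos[OF \<ll> \<Psi>(1)]] E.ident_arr[OF \<ll>] 1] show ?thesis .
  qed
  have holo: "\<omega> x (cmp E \<iota> h0) = cmp G (\<omega> x (cmp E \<iota> h1)) (sc x (\<lambda>_. g))"
    by (rule hol[OF x h0 h1 tx h0zy h1z h01])
  note w1 = sectionD(1)[OF ctx x \<iota>h1]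
  note scg = sc_autos[OF x continuous_const_U1[OF g]] and scc = sc_autos[OF x continuous_const_U1[OF c0(1)]]
  \<comment> \<open>Scalars commute, so rescaling both lifts by the same constant does not change
    their quotient \<open>g\<close>.\<close>
  have \<Omega>01: "?\<Omega> x h0 = cmp G (?\<Omega> x h1) (sc x (\<lambda>_. g))"
  proof -
    have "?\<Omega> x h0 = cmp G (\<omega> x (cmp E \<iota> h1)) (cmp G (sc x (\<lambda>_. g)) (sc x (\<lambda>_. c0)))"
      using G.cmp_assoc[OF G.autos_arr[OF w1] G.autos_arr[OF scg] G.autos_arr[OF scc]] by (simp add: pulled_section_def holo)
    also have "cmp G (sc x (\<lambda>_. g)) (sc x (\<lambda>_. c0)) = cmp G (sc x (\<lambda>_. c0)) (sc x (\<lambda>_. g))"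
      by (rule sc_commute[OF x continuous_const_U1[OF g] scc])
    finally show ?thesis
      using G.cmp_assoc[OF G.autos_arr[OF w1] G.autos_arr[OF scc] G.autos_arr[OF scg]] by (simp add: pulled_section_def)
  qed
  have f01: "onar f (?\<Omega> x h0) = onar f (?\<Omega> x h1)"
    using f.onar_cmp[OF G.autos_arr[OF \<Omega>auto[OF h1]] G.autos_arr[OF scg]] onar_sc[OF x continuous_const_U1[OF g]]
      E.cmp_ident(1)[OF E.autos_arr[OF f\<Omega>'[OF h1]]] by (simp add: \<Omega>01)
  have main: "\<exists>\<beta>\<in>c. g = cis (2 * pi * (of_int (cyclic_sum n (\<lambda>vs. \<beta> (vertex_simplex B b q (\<lambda>_::unit. kq) \<gamma> (\<lambda>_. t) vs)) ((), 0)) / of_nat n))"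
    if kq: "kq \<in> arr B q b" for kq
  proof -
    have l: "cmp B kq \<nu> \<in> arr B (fst \<ll>) b" using B.cmp_arr[OF kq \<nu>] .
    obtain K where K: "K \<in> arr E \<ll> e" "cmp B m (onar total_proj K) = cmp B kq \<nu>"
      using ex1_implies_ex[OF arrow_to_e(1)[OF \<ll>' l]] unfolding prod.collapse by blast
    define Y where "Y = tfun (onar p kq) y0"
    have Y: "Y \<in> topspace (tot (onob p b))" unfolding Y_def by (rule tfun_in[OF kq y0])
    have KY: "bmap E K (yy r) = act (onob p b) Y (cis (2 * pi * r))" for r
    proof -
      have "bmap E K (yy r) = tfun (onar p (cmp B kq \<nu>)) (snd \<ll> (yy r))"
        using arrow_to_e(2)[OF \<ll>' l, of K "yy r"] K yyB by simp
      also have "\<dots> = tfun (onar p kq) (act (onob p q) y0 (cis (2 * pi * r)))"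
        using tfun_cmp[OF kq \<nu> section_props(2)[OF \<ll>' yyB]] sec by simp
      also have "\<dots> = act (onob p b) Y (cis (2 * pi * r))" unfolding Y_def by (rule tfun_act[OF kq y0 cis_U1])
      finally show ?thesis .
    qed
    have Kb: "onar total_proj K \<in> arr B (fst \<ll>) (fst e)" using total_proj.onar_arr[OF K(1)] by (simp add: tp)
    have Kh: "cmp B m (onar total_proj (cmp E K h)) = cmp B kq (cmp B \<nu> (onar total_proj h))"
      if h: "h \<in> arr E (onob f x) \<ll>" for h
    proof -
      have hb: "onar total_proj h \<in> arr B (fst (onob f x)) (fst \<ll>)" using total_proj.onar_arr[OF h] by (simp add: tp)
      show ?thesis
        using total_proj.onar_cmp[OF K(1) h] B.cmp_assoc[OF m Kb hb] B.cmp_assoc[OF kq \<nu> hb] K(2) by simp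
    qed
    \<comment> \<open>Both composites lie over the same arrow to \<open>b\<close>, which determines
      the arrow to \<open>e\<close>.\<close>
    have K01: "cmp E K h0 = cmp E K h1"
    proof -
      have fx': "(fst (onob f x), snd (onob f x)) \<in> Ob E" using fx by simp
      have u: "\<exists>!L. L \<in> arr E (fst (onob f x), snd (onob f x)) e \<and> cmp B m (onar total_proj L) = cmp B kq ?\<mu>"
        by (rule arrow_to_e(1)[OF fx' B.cmp_arr[OF kq \<mu>]])
      have "cmp E K h0 \<in> arr E (fst (onob f x), snd (onob f x)) e \<and> cmp B m (onar total_proj (cmp E K h0)) = cmp B kq ?\<mu>"
        "cmp E K h1 \<in> arr E (fst (onob f x), snd (onob f x)) e \<and> cmp B m (onar total_proj (cmp E K h1)) = cmp B kq ?\<mu>"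
        using E.cmp_arr[OF K(1) h0] E.cmp_arr[OF K(1) h1] Kh[OF h0] Kh[OF h1] h01 by simp_all
      then show ?thesis using the1_equality[OF u, of "cmp E K h0"] the1_equality[OF u, of "cmp E K h1"] by simp
    qed
    interpret path: gerbe_path G "total_stack B p" f sc a e k c3 l \<ll> \<Psi> K yy ?\<Omega> n
    proof unfold_locales
      show "\<exists>W N z. openin (base E \<ll>) W \<and> yy r \<in> W \<and> 1 \<le> N \<and> z \<in> carrier U1 \<and>
        (\<forall>x\<in>Ob G. \<forall>h\<in>arr E (onob f x) \<ll>. bmap E h ` topspace (base G x) \<subseteq> W \<longrightarrow>
           auto_pow G x (?\<Omega> x h) N = sc x (\<lambda>_. z))" for r
        by (rule flat_pulled[OF ctx flat yyin])
    qed (use atlas_a K \<Psi> yy \<Omega>sec n \<Psi>n in auto)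
    have pl0: "path.point_lift 0 x h0 ch z" and pl1: "path.point_lift 1 x h1 ch z"
      using x h0 h1 ch tx h0zy h1z by (simp_all add: path.point_lift_def)
    note lifts = path.path_prism_lift_sum[OF pl0 pl1 K01 f01 \<Omega>n]
    \<comment> \<open>The n-th powers of both lifts are the identity, at the far end by transport;
      the commuting scalar \<open>g\<close> between them inherits this.\<close>
    have gn: "g ^ n = 1"
    proof -
      have "auto_pow G x (?\<Omega> x h0) n = cmp G (auto_pow G x (?\<Omega> x h1) n) (auto_pow G x (sc x (\<lambda>_. g)) n)"
        unfolding \<Omega>01
        by (rule G.auto_pow_commuting_product[OF x \<Omega>auto[OF h1] scg
              sc_commute[OF x continuous_const_U1[OF g] \<Omega>auto[OF h1], symmetric]])
      then have "sc x (\<lambda>_. g ^ n) = sc x (\<lambda>_. 1)"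
        using \<Omega>n lifts(1) sc_one[OF x] auto_pow_sc[OF x continuous_const_U1[OF g], of n]
          G.cmp_ident(2)[OF G.autos_arr[OF G.auto_pow_autos[OF x scg, of n]]] by simp
      moreover have "g ^ n \<in> carrier U1" "1 \<in> carrier U1" using g by (simp_all add: U1_def norm_power)
      ultimately show ?thesis
        using sc_eq_iff[OF x continuous_const_U1 continuous_const_U1, of "g ^ n" 1] tx by simp
    qed
    then have "g \<in> (\<lambda>i. cis (2 * pi * real i / real n)) ` {..<n}"
      unfolding bij_betw_imp_surj_on[OF Complex.bij_betw_roots_unity[OF n]] by simp
    then obtain i where gi: "g = cis (2 * pi * real i / real n)" by blast
    let ?gi = "cis (- (2 * pi * real i / real n))"
    \<comment> \<open>Passing from the start to the end multiplies by the inverse of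
      \<open>g\<close>; this is why \<open>lift_sum_rotated\<close> is stated with a negative
      angle.\<close>
    have \<Omega>10: "cmp G (?\<Omega> x h0) (sc x (\<lambda>_. ?gi)) = ?\<Omega> x h1"
    proof -
      note sci = sc_autos[OF x continuous_const_U1[OF cis_U1[of "- (2 * pi * real i / real n)"]]]
      have "cmp G (sc x (\<lambda>_. g)) (sc x (\<lambda>_. ?gi)) = ident G x"
        using sc_mult[OF x continuous_const_U1[OF g] continuous_const_U1[OF cis_U1[of "- (2 * pi * real i / real n)"]]] sc_one[OF x]
        by (simp add: gi cis_mult)
      then show ?thesis
        using G.cmp_assoc[OF G.autos_arr[OF \<Omega>auto[OF h1]] G.autos_arr[OF scg] G.autos_arr[OF sci]]
          G.cmp_ident(1)[OF G.autos_arr[OF \<Omega>auto[OF h1]]] by (simp add: \<Omega>01)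
    qed
    obtain j :: "real \<times> real \<times> real \<times> real \<Rightarrow> 'u" where j: "inj j" using emb by blast
    have 1: "[path.path_prism 0 1 = int i] (mod int n)"
      using cong_trans[OF lifts(2) lift_sum_rotated[OF ch \<Omega>auto[OF h0] tx j n \<Omega>n, of i, unfolded \<Omega>10]] .
    interpret v: vertex_family "total_stack B p" e \<ll> "\<lambda>_::unit. K" \<Psi> yy by (rule path.family_path)
    have at: "vertex_simplex E e (onob f x) (\<lambda>_::unit. cmp E K h) (onar f (?\<Omega> x h)) (\<lambda>_. z) [(i1, (), 0), (i2, (), 0), (i3, (), 0)]
       = v.vsimp [(i1, (), s), (i2, (), s), (i3, (), s)]" if h: "h \<in> arr E (onob f x) \<ll>" "bmap E h z = yy s" for h s i1 i2 i3
      using h tfx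
      by (intro v.vsimp_at_point[OF h(1) f\<Omega>'[OF h(1)] over[OF h(1), symmetric]]) (auto simp: less_Suc_eq)
    have ends: "v.vsimp [(i1, (), 0), (i2, (), 0), (i3, (), 0)] = v.vsimp [(i1, (), 1), (i2, (), 1), (i3, (), 1)]" for i1 i2 i3
      using at[OF h0 h0zy] at[OF h1 h1z] by (simp add: K01 f01)
    have "\<exists>\<beta>\<in>c. [prism_sum n (\<lambda>vs. c3 (v.vsimp vs)) ((), 0) ((), 1)
        = cyclic_sum n (\<lambda>vs. \<beta> (vertex_simplex B b q (\<lambda>_::unit. kq) \<gamma> (\<lambda>_. t) vs)) ((), 0)] (mod int n)"
      by (rule fibre_integral_value[OF powers_b R.Y.powers_axioms int K(1) \<Psi>(1) \<Psi>n yy kq \<gamma> \<gamma>n q \<nu> K(2) \<gamma>\<nu> Y KY ends c3])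
    then obtain \<beta> where \<beta>: "\<beta> \<in> c" and 2: "[path.path_prism 0 1
        = cyclic_sum n (\<lambda>vs. \<beta> (vertex_simplex B b q (\<lambda>_::unit. kq) \<gamma> (\<lambda>_. t) vs)) ((), 0)] (mod int n)" (is "[_ = ?\<beta>] (mod _)")
      unfolding path.path_prism_def by blast
    \<comment> \<open>The two integers agree modulo \<open>n\<close>, so they define the same n-th
      root of unity.\<close>
    obtain r where "int i = ?\<beta> + int n * r"
      using cong_sym[OF cong_trans[OF cong_sym[OF 1] 2]] unfolding cong_iff_lin by blast
    then have "real i = of_int ?\<beta> + real n * of_int r" by (metis of_int_add of_int_mult of_int_of_nat_eq)
    then have "2 * pi * real i / real n = 2 * pi * (of_int ?\<beta> / real n) + 2 * pi * of_int r"
      using n by (simp add: field_simps)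
    then have "g = cis (2 * pi * (of_int ?\<beta> / real n)) * cis (2 * pi * of_int r)" unfolding gi by (simp only: cis_mult)
    also have "cis (2 * pi * of_int r) = 1" by (rule cis_multiple_2pi) simp
    finally show ?thesis using \<beta> by (intro bexI[of _ \<beta>]) simp_all
  qed
  show ?thesis using n \<gamma>n main by blast
qed

end

theorem proposition2p49:
  fixes B :: "('o, 'm, 'u) fibcat"
    and p :: "('o, 'm, 'u) ub_map"
    and G :: "('go, 'gm, 'u) fibcat"
    and f :: "('go, 'gm, ('o, 'u) eob, ('o, 'm, 'u) ear) smap"
    and sc :: "'go \<Rightarrow> ('u \<Rightarrow> complex) \<Rightarrow> 'gm"
    and g chi :: "'o \<times> 'm \<Rightarrow> 'u \<Rightarrow> complex"
  assumes "(UNIV :: real set) \<lesssim> (UNIV :: 'u set)"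
    and "orbispace B"
    and "stack_map B (classifying_stack U1 U1_space) p"
    and "U1_gerbe G (total_stack B p) f sc"
    and "orbispace_atlas B b"
    and "induced_atlas B p b e m"
    and "is_DD_class G (total_stack B p) f sc e d"
    and "is_fibre_integral B p b e m 2 d c"
    and "is_holonomy_function B p G f sc g"
    and "is_associated_function B b c chi"
  shows "\<forall>w\<in>Ob (loop_stack_1 B p). \<forall>t\<in>topspace (base B (fst w)). g w t = chi w t"
proof (intro ballI)
  fix w t assume w: "w \<in> Ob (loop_stack_1 B p)" and t: "t \<in> topspace (base B (fst w))"
  obtain u \<phi> where u\<phi>: "w = (u, \<phi>)" by (cases w)
  have w': "fst w = u" "snd w = \<phi>" by (simp_all add: u\<phi>)
  let ?E = "total_stack B p"
  have stB: "stack B" and atb: "atlas B b" using assms(2,5)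
    by (simp_all add: orbispace_def topological_stack_def orbispace_atlas_def etale_separated_atlas_def)
  have stG: "stack G" and stE: "stack ?E" and f: "stack_map G ?E f"
    using assms(4) by (simp_all add: U1_gerbe_def topological_stack_def)
  interpret circle_bundle B p
    using fibred_groupoidsI[OF stB] fibred_groupoidsI[OF stE] assms(3)
    by (simp add: circle_bundle_def circle_bundle_axioms_def)
  interpret circle_bundle_atlas B p b e m by unfold_locales (rule assms(6))
  interpret gerbe G ?E f sc
  proof -
    interpret fibred_groupoids G by (rule fibred_groupoidsI[OF stG])
    show "gerbe G ?E f sc" using f assms(4) by unfold_locales
  qed
  have powers_b: "powers B b" by (rule atlas_powers[OF stB atb])
  have powers_e: "powers ?E e"
  proof (rule powers_e)
    show "\<exists>w m n. is_product B u b w m n" if "u \<in> Ob B" for u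
      using atb that by (simp add: atlas_def) fast
  qed
  obtain a k c3 l where d: "d \<in> cohomology 3 (realization ?E e)" and a: "atlas G a"
    and k: "k \<in> arr ?E (onob f a) e" and c3: "c3 \<in> d"
    and l: "\<forall>\<sigma>. singular_simplex 3 (realization G a) \<sigma> \<longrightarrow>
           coboundary 2 l \<sigma> = cochain_pullback 3 (realization_map G a ?E e f k) c3 \<sigma>"
    and sphere: "\<forall>x\<in>topspace (base G a). l (gerbe_sphere G sc a x) - l (constant_simplex 2 (vertex G a x)) = 1"
    using assms(7) unfolding is_DD_class_def by blast
  interpret circle_bundle_gerbe B p b e m G f sc a k c3 l
  proof -
    have "realization_morphism G ?E f a e k"
      using f.stack_morphism_axioms atlas_powers[OF stG a] powers_e k
      by (simp add: realization_morphism_def realization_morphism_axioms_def)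
    moreover have "cocycle 3 (realization ?E e) c3" using cohomologyD(1)[OF d c3] by simp
    ultimately have "gerbe_atlas G ?E f sc a e k c3 l"
      using gerbe_axioms l sphere by (simp add: gerbe_atlas_def gerbe_atlas_axioms_def)
    then show "circle_bundle_gerbe B p b e m G f sc a k c3 l"
      using circle_bundle_atlas_axioms a powers_b lepoll_real_UNIV(2)[OF assms(1)]
      by (simp add: circle_bundle_gerbe_def circle_bundle_gerbe_axioms_def)
  qed
  have int: "is_fibre_integral B p b e m 2 d c" by (rule assms(8))
  have u: "u \<in> Ob B" and \<phi>: "\<phi> \<in> autos B u" and h1: "\<forall>t\<in>topspace (base B u). h_fun p (u, \<phi>) t = 1"
    using w by (auto simp: u\<phi> loop_stack_1_def loop_stack_def Let_def)
  have tu: "t \<in> topspace (base B u)" using t by (simp add: u\<phi>)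
  \<comment> \<open>The object \<open>(u, \<phi>)\<close> is restricted to the point
    \<open>t\<close>, where both values can be computed.\<close>
  have "continuous_map (subtopology (base B u) {t}) (base B u) id" by (simp add: continuous_map_from_subtopology)
  from B.pullback[OF u this] obtain q a0 where a0: "a0 \<in> arr B q u" and bq: "base B q = subtopology (base B u) {t}"
    and a0id: "\<And>s. s \<in> topspace (subtopology (base B u) {t}) \<Longrightarrow> bmap B a0 s = id s" by blast
  have q: "topspace (base B q) = {t}" using bq tu by auto
  have a0t: "bmap B a0 t = t" using a0id[of t] tu by simp
  have qO: "q \<in> Ob B" using B.arr_Ob(1)[OF a0] .
  obtain \<gamma> where \<gamma>: "\<gamma> \<in> autos B q" "cmp B a0 \<gamma> = cmp B \<phi> a0" using B.pullback_auto[OF a0 \<phi>] by blast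
  have val: "is_associated_value B b c (q, \<gamma>) (chi w t)"
  proof -
    let ?k = "((q, \<gamma>), a0, (u, \<phi>))"
    have "(u, \<phi>) \<in> Ob (loop_stack B)" "(q, \<gamma>) \<in> Ob (loop_stack B)" "?k \<in> arr (loop_stack B) (q, \<gamma>) (u, \<phi>)"
      using u \<phi> qO \<gamma> a0 by (auto simp: loop_stack_def arr_def)
    then have "is_associated_value B b c (q, \<gamma>) (chi (u, \<phi>) (bmap (loop_stack B) ?k t))"
      using assms(10) q unfolding is_associated_function_def by simp
    then show ?thesis by (simp add: u\<phi> loop_stack_def a0t)
  qed
  obtain C where C: "open_cover (base B u) C"
    and CU: "\<forall>U\<in>C. \<exists>s v m \<rho> \<tau> \<psi> \<omega>.
       continuous_map (subtopology (base B u) U) (tot (onob p u)) s \<and>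
       (\<forall>t\<in>U. proj (onob p u) (s t) = t) \<and>
       m \<in> arr B v u \<and>
       homeomorphic_map (base B v) (prod_topology (subtopology (base B u) U) euclideanreal)
         (\<lambda>y. (bmap B m y, \<rho> y)) \<and>
       (v, \<tau>) \<in> Ob ?E \<and>
       (\<forall>y\<in>topspace (base B v). tfun (onar p m) (\<tau> y) = act (onob p u) (s (bmap B m y)) (cis (2 * pi * \<rho> y))) \<and>
       \<psi> \<in> autos B v \<and> cmp B m \<psi> = cmp B \<phi> m \<and>
       flat_section G ?E f sc ((v, \<tau>), ((v, \<tau>), \<psi>, (v, \<tau>))) \<omega> \<and>
       (\<forall>t\<in>U. g w t \<in> carrier U1 \<and>
          (\<forall>x\<in>Ob G. \<forall>k0\<in>arr ?E (onob f x) (v, \<tau>). \<forall>k1\<in>arr ?E (onob f x) (v, \<tau>). \<forall>pt y0 y1.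
             topspace (base G x) = {pt} \<longrightarrow>
             bmap ?E k0 pt = y0 \<longrightarrow> bmap B m y0 = t \<longrightarrow> \<rho> y0 = 0 \<longrightarrow>
             bmap ?E k1 pt = y1 \<longrightarrow> bmap B m y1 = t \<longrightarrow> \<rho> y1 = 1 \<longrightarrow>
             cmp B m (onar total_proj k0) = cmp B m (onar total_proj k1) \<longrightarrow>
             \<omega> x k0 = cmp G (\<omega> x k1) (sc x (\<lambda>_. g w t))))"
    using assms(9)[unfolded is_holonomy_function_def, rule_format, OF w]
    unfolding is_fibre_holonomy_def w' by (elim exE conjE) (rule that)
  obtain U where U: "U \<in> C" "t \<in> U" using C tu by (auto simp: open_cover_def)
  from CU[rule_format, OF U(1)] obtain s v mv \<rho> \<tau> \<psi> \<omega> where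
    s: "continuous_map (subtopology (base B u) U) (tot (onob p u)) s" and mv: "mv \<in> arr B v u"
    and hom: "homeomorphic_map (base B v) (prod_topology (subtopology (base B u) U) euclideanreal) (\<lambda>y. (bmap B mv y, \<rho> y))"
    and v: "(v, \<tau>) \<in> Ob ?E"
    and \<tau>: "\<forall>y\<in>topspace (base B v). tfun (onar p mv) (\<tau> y) = act (onob p u) (s (bmap B mv y)) (cis (2 * pi * \<rho> y))"
    and \<psi>: "\<psi> \<in> autos B v" "cmp B mv \<psi> = cmp B \<phi> mv"
    and flat: "flat_section G ?E f sc ((v, \<tau>), ((v, \<tau>), \<psi>, (v, \<tau>))) \<omega>"
    and hol: "\<forall>t\<in>U. g w t \<in> carrier U1 \<and>
          (\<forall>x\<in>Ob G. \<forall>k0\<in>arr ?E (onob f x) (v, \<tau>). \<forall>k1\<in>arr ?E (onob f x) (v, \<tau>). \<forall>pt y0 y1.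
             topspace (base G x) = {pt} \<longrightarrow>
             bmap ?E k0 pt = y0 \<longrightarrow> bmap B mv y0 = t \<longrightarrow> \<rho> y0 = 0 \<longrightarrow>
             bmap ?E k1 pt = y1 \<longrightarrow> bmap B mv y1 = t \<longrightarrow> \<rho> y1 = 1 \<longrightarrow>
             cmp B mv (onar total_proj k0) = cmp B mv (onar total_proj k1) \<longrightarrow>
             \<omega> x k0 = cmp G (\<omega> x k1) (sc x (\<lambda>_. g w t)))"
    by (elim exE conjE) (rule that)
  note line = fibre_line_ex[OF a0 bq a0t U(2) tu \<phi> h1 \<gamma> s mv hom v \<tau> \<psi>]
  obtain \<ll> \<iota> \<nu> \<Psi> yy y0 where \<iota>: "\<iota> \<in> arr ?E \<ll> (v, \<tau>)" and \<nu>: "\<nu> \<in> arr B (fst \<ll>) q" and \<Psi>: "\<Psi> \<in> autos ?E \<ll>"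
      "cmp ?E \<iota> \<Psi> = cmp ?E ((v, \<tau>), \<psi>, (v, \<tau>)) \<iota>" and \<gamma>\<nu>: "cmp B \<gamma> \<nu> = cmp B \<nu> (onar total_proj \<Psi>)"
    and a0\<nu>: "cmp B a0 \<nu> = cmp B mv (onar total_proj \<iota>)"
    and yy: "continuous_map euclideanreal (base ?E \<ll>) yy"
    and yyt: "\<forall>r. bmap B mv (bmap ?E \<iota> (yy r)) = t \<and> \<rho> (bmap ?E \<iota> (yy r)) = r"
    and y0: "y0 \<in> topspace (tot (onob p q))"
    and sec: "\<forall>r. tfun (onar p \<nu>) (snd \<ll> (yy r)) = act (onob p q) y0 (cis (2 * pi * r))"
    using line(2) by (elim exE conjE) (rule that)
  have gU: "g w t \<in> carrier U1" using hol U(2) by blast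
  \<comment> \<open>The ends of the line are the points \<open>y0\<close> and \<open>y1\<close> in
    the definition of the holonomy. Agreement over \<open>q\<close> gives agreement over
    \<open>u\<close> by composing with \<open>a0\<close>.\<close>
  have hol': "\<omega> x (cmp ?E \<iota> h0) = cmp G (\<omega> x (cmp ?E \<iota> h1)) (sc x (\<lambda>_. g w t))"
    if x: "x \<in> Ob G" and h0: "h0 \<in> arr ?E (onob f x) \<ll>" and h1: "h1 \<in> arr ?E (onob f x) \<ll>"
      and z: "topspace (base G x) = {z}" and ends: "bmap ?E h0 z = yy 0" "bmap ?E h1 z = yy 1"
      and \<nu>h: "cmp B \<nu> (onar total_proj h0) = cmp B \<nu> (onar total_proj h1)" for x h0 h1 z
  proof -
    have zE: "z \<in> topspace (base ?E (onob f x))" using z f.base_onob[OF x] by simp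
    have "bmap ?E (cmp ?E \<iota> h0) z = bmap ?E \<iota> (yy 0)" "bmap ?E (cmp ?E \<iota> h1) z = bmap ?E \<iota> (yy 1)"
      using E.bmap_cmp[OF \<iota> h0 zE] E.bmap_cmp[OF \<iota> h1 zE] ends by simp_all
    moreover have mh: "cmp B mv (onar total_proj (cmp ?E \<iota> h)) = cmp B a0 (cmp B \<nu> (onar total_proj h))"
      if h: "h \<in> arr ?E (onob f x) \<ll>" for h
    proof -
      have \<iota>b: "onar total_proj \<iota> \<in> arr B (fst \<ll>) v" and hb: "onar total_proj h \<in> arr B (fst (onob f x)) (fst \<ll>)"
        using total_proj.onar_arr[OF \<iota>] total_proj.onar_arr[OF h] by (simp_all add: total_proj_def)
      show ?thesis
        using total_proj.onar_cmp[OF \<iota> h] B.cmp_assoc[OF mv \<iota>b hb] B.cmp_assoc[OF a0 \<nu> hb] a0\<nu> by simp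
    qed
    ultimately show ?thesis
      using hol[rule_format, OF U(2), THEN conjunct2, rule_format, OF x E.cmp_arr[OF \<iota> h0] E.cmp_arr[OF \<iota> h1] z refl _ _ refl]
        yyt mh[OF h0] mh[OF h1] \<nu>h by simp
  qed
  obtain n where n: "n > 0" and \<gamma>n: "auto_pow B q \<gamma> n = ident B q"
    and gval: "\<forall>kq\<in>arr B q b. \<exists>\<beta>\<in>c. g w t = cis (2 * pi * (of_int (cyclic_sum n
        (\<lambda>vs. \<beta> (vertex_simplex B b q (\<lambda>_::unit. kq) \<gamma> (\<lambda>_. t) vs)) ((), 0)) / of_nat n))"
    using holonomy_along_line[OF int c3 q \<gamma>(1) \<iota> \<nu> \<Psi> \<gamma>\<nu> yy y0 sec line(1) flat gU] hol' by blast
  have c: "c \<in> cohomology 2 (realization B b)" using int by (simp add: is_fibre_integral_def Let_def)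
  \<comment> \<open>The associated value dictates the chart \<open>kq\<close>, the holonomy the
    cocycle \<open>\<beta>\<close>; each side holds for every choice made by the other.\<close>
  obtain kq where kq: "kq \<in> arr B q b" and cval: "\<forall>\<beta>\<in>c. chi w t = cis (2 * pi * (of_int (cyclic_sum n
      (\<lambda>vs. \<beta> (vertex_simplex B b q (\<lambda>_::unit. kq) \<gamma> (\<lambda>_. t) vs)) ((), 0)) / of_nat n))"
    using B.associated_value[OF powers_b qO q \<gamma>(1) n \<gamma>n lepoll_real_UNIV(1)[OF assms(1)] c val] by blast
  obtain \<beta> where \<beta>: "\<beta> \<in> c" and gv: "g w t = cis (2 * pi * (of_int (cyclic_sum n
      (\<lambda>vs. \<beta> (vertex_simplex B b q (\<lambda>_::unit. kq) \<gamma> (\<lambda>_. t) vs)) ((), 0)) / of_nat n))"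
    using gval kq by blast
  show "g w t = chi w t" unfolding gv using cval \<beta> by simp
qed

end
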